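(* Let $R>0$ and let $u_0\in\dot H^1(R)$ (radial). Let $u_L$ be the solution of the linear wave equation $\partial_t^2u_L-\Delta u_L=0$ with initial data $(u_0,0)$ in the region $\{(t,x)\in[0,\infty)\times\mathbb{R}^4:\ |x|>R+|t|\}$. Then $$\lim_{t\to\infty}\|\nabla u_L(t)\|^2_{L^2(|x|>t+R)}=\lim_{t\to\infty}\|\partial_tu_L(t)\|^2_{L^2(|x|>t+R)}\geq\frac{3}{20}\|\nabla\pi_R^\perp u_0\|^2_{L^2(|x|>R)}.$$
   Context: Everything is radial on $\mathbb{R}^4$, $r=|x|$. $\dot H^1(R)$ is the space of restrictions to $\{r>R\}$ of radial elements of $\dot H^1(\mathbb{R}^4)$, with norm $\|\varphi\|_{\dot H^1(R)}^2=\int_R^\infty|\varphi'(r)|^2r^3\,dr$. For $f\in\dot H^1(R)$, $$\pi_R^\perp(f)(r)=f(r)-\frac{R^2f(R)}{r^2},\quad r>R,$$ which is the orthogonal projection in $\dot H^1(R)$ onto the orthogonal complement of $\mathrm{span}(1/r^2)$. The solution on $\{|x|>R+|t|\}$ is the restriction to this set of the solution of the free wave equation on $\mathbb{R}\times\mathbb{R}^4$ with initial data any radial extension of $(u_0,0)$ in $\dot H^1(\mathbb{R}^4)\times L^2(\mathbb{R}^4)$ (independent of the extension by finite speed of propagation). *)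

theory Defs
  imports "HOL-Analysis.Analysis"
begin

text \<open>
  Elements of \<open>L\<^sup>2\<close> and \<open>\<dot>H\<^sup>1\<close> are represented by functions, and identified only up to null sets.
  The measure is always \<open>lebesgue\<close>, the completion of \<open>lborel\<close>, so that changing a function on a null
  set affects neither measurability nor integrals. All functions are real valued.
\<close>

section \<open>Test functions and weak gradients\<close>

definition partial_deriv :: "'a::euclidean_space \<Rightarrow> ('a \<Rightarrow> real) \<Rightarrow> 'a \<Rightarrow> real" where
  "partial_deriv b f x = frechet_derivative f (at x) b"

definition laplacian :: "('a::euclidean_space \<Rightarrow> real) \<Rightarrow> 'a \<Rightarrow> real" where
  "laplacian f x = (\<Sum>b\<in>Basis. partial_deriv b (partial_deriv b f) x)"

primrec times_cont_diff :: "nat \<Rightarrow> ('a::euclidean_space \<Rightarrow> real) \<Rightarrow> bool" where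
  "times_cont_diff 0 f \<longleftrightarrow> continuous_on UNIV f"
| "times_cont_diff (Suc k) f \<longleftrightarrow>
     (\<forall>x. f differentiable at x) \<and> (\<forall>b\<in>Basis. times_cont_diff k (partial_deriv b f))"

definition test_functions :: "'a::euclidean_space set \<Rightarrow> ('a \<Rightarrow> real) set" where
  "test_functions \<Omega> = {\<phi>. (\<forall>k. times_cont_diff k \<phi>) \<and>
     (\<exists>K. compact K \<and> K \<subseteq> \<Omega> \<and> (\<forall>x. x \<notin> K \<longrightarrow> \<phi> x = 0))}"

definition locally_integrable ::
    "'a::euclidean_space set \<Rightarrow> ('a \<Rightarrow> 'b::{banach,second_countable_topology}) \<Rightarrow> bool" where
  "locally_integrable \<Omega> f \<longleftrightarrow> (\<forall>K. compact K \<and> K \<subseteq> \<Omega> \<longrightarrow> set_integrable lebesgue K f)"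

definition has_weak_gradient ::
    "'a::euclidean_space set \<Rightarrow> ('a \<Rightarrow> real) \<Rightarrow> ('a \<Rightarrow> 'a) \<Rightarrow> bool" where
  "has_weak_gradient \<Omega> f g \<longleftrightarrow>
     locally_integrable \<Omega> f \<and> locally_integrable \<Omega> g \<and>
     (\<forall>\<phi>\<in>test_functions \<Omega>. \<forall>b\<in>Basis.
        (LINT x:\<Omega>|lebesgue. f x * partial_deriv b \<phi> x) = - (LINT x:\<Omega>|lebesgue. (g x \<bullet> b) * \<phi> x))"

text \<open>The weak gradient is unique up to null subsets of the open set \<open>\<Omega>\<close>; a representative is chosen.\<close>

definition weak_gradient :: "'a::euclidean_space set \<Rightarrow> ('a \<Rightarrow> real) \<Rightarrow> 'a \<Rightarrow> 'a" where
  "weak_gradient \<Omega> f = (SOME g. has_weak_gradient \<Omega> f g)"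

section \<open>Function spaces\<close>

definition square_integrable :: "('a::euclidean_space \<Rightarrow> 'b::euclidean_space) \<Rightarrow> bool" where
  "square_integrable f \<longleftrightarrow>
     f \<in> borel_measurable lebesgue \<and> integrable lebesgue (\<lambda>x. (norm (f x))\<^sup>2)"

definition L2_norm :: "'a::euclidean_space set \<Rightarrow> ('a \<Rightarrow> 'b::euclidean_space) \<Rightarrow> real" where
  "L2_norm \<Omega> f = sqrt (LINT x:\<Omega>|lebesgue. (norm (f x))\<^sup>2)"

text \<open>
  \<open>\<dot>H\<^sup>1(\<real>\<^sup>4)\<close>, realised as a space of functions through the Sobolev embedding into \<open>L\<^sup>4\<close>
  (\<open>4 = 2d/(d-2)\<close> for \<open>d = 4\<close>). The condition \<open>f \<in> L\<^sup>4\<close> excludes the nonzero constants.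
\<close>

definition Hdot1 :: "(real^4 \<Rightarrow> real) set" where
  "Hdot1 = {f. f \<in> borel_measurable lebesgue \<and> integrable lebesgue (\<lambda>x. (f x) ^ 4) \<and>
     (\<exists>g. has_weak_gradient UNIV f g \<and> square_integrable g)}"

definition radial :: "(real^4 \<Rightarrow> real) \<Rightarrow> bool" where
  "radial f \<longleftrightarrow> (\<exists>h. AE x in lebesgue. f x = h (norm x))"

definition radial_extension :: "real \<Rightarrow> (real \<Rightarrow> real) \<Rightarrow> (real^4 \<Rightarrow> real) \<Rightarrow> bool" where
  "radial_extension R f w \<longleftrightarrow>
     w \<in> Hdot1 \<and> radial w \<and> (AE x in lebesgue. norm x > R \<longrightarrow> w x = f (norm x))"

text \<open>
  An element of \<open>\<dot>H\<^sup>1(R)\<close> is written as a function of \<open>r = |x|\<close>, and only its values for \<open>r \<ge> R\<close> matter.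
  A radial element of \<open>\<dot>H\<^sup>1(\<real>\<^sup>4)\<close> has a unique representative that is continuous away from the origin.
  This representative is the one used, so the boundary value \<open>f R\<close> is meaningful.
\<close>

definition Hdot1_ext :: "real \<Rightarrow> (real \<Rightarrow> real) set" where
  "Hdot1_ext R = {f. continuous_on {R..} f \<and> (\<exists>w. radial_extension R f w)}"

definition proj_perp :: "real \<Rightarrow> (real \<Rightarrow> real) \<Rightarrow> real \<Rightarrow> real" where
  "proj_perp R f r = f r - R\<^sup>2 * f R / r\<^sup>2"

section \<open>Finite energy solutions of the wave equation\<close>

text \<open>
  \<open>u \<in> C(\<real>, \<dot>H\<^sup>1)\<close> with \<open>\<partial>\<^sub>t u = v \<in> C(\<real>, L\<^sup>2)\<close> and \<open>\<partial>\<^sub>t v = \<Delta> u\<close>, where both time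
  derivatives are taken in the sense of distributions on \<open>\<real>\<^sup>4\<close>.
\<close>

definition free_wave_solution ::
    "(real^4 \<Rightarrow> real) \<Rightarrow> (real^4 \<Rightarrow> real) \<Rightarrow>
     (real \<Rightarrow> real^4 \<Rightarrow> real) \<Rightarrow> (real \<Rightarrow> real^4 \<Rightarrow> real) \<Rightarrow> bool" where
  "free_wave_solution w\<^sub>0 w\<^sub>1 u v \<longleftrightarrow>
     (\<forall>t. u t \<in> Hdot1 \<and> square_integrable (v t)) \<and>
     (\<forall>t. ((\<lambda>s. L2_norm UNIV (weak_gradient UNIV (\<lambda>x. u s x - u t x))) \<longlongrightarrow> 0) (at t)) \<and>
     (\<forall>t. ((\<lambda>s. L2_norm UNIV (\<lambda>x. v s x - v t x)) \<longlongrightarrow> 0) (at t)) \<and>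
     (\<forall>\<phi>\<in>test_functions UNIV. \<forall>t.
        ((\<lambda>s. LINT x|lebesgue. u s x * \<phi> x) has_real_derivative
           (LINT x|lebesgue. v t x * \<phi> x)) (at t) \<and>
        ((\<lambda>s. LINT x|lebesgue. v s x * \<phi> x) has_real_derivative
           (LINT x|lebesgue. u t x * laplacian \<phi> x)) (at t)) \<and>
     (AE x in lebesgue. u 0 x = w\<^sub>0 x) \<and> (AE x in lebesgue. v 0 x = w\<^sub>1 x)"

text \<open>
  \<open>u\<close> is the solution in \<open>{(t,x). t \<ge> 0, |x| > R + t}\<close> with data \<open>(u\<^sub>0, 0)\<close>, and \<open>dtu\<close> is its time
  derivative: they are restrictions to this region of a solution on \<open>\<real> \<times> \<real>\<^sup>4\<close> whose data extend
  \<open>(u\<^sub>0, 0)\<close>. The values of \<open>u\<close> and \<open>dtu\<close> outside the region are irrelevant.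
\<close>

definition exterior_wave_solution ::
    "real \<Rightarrow> (real \<Rightarrow> real) \<Rightarrow>
     (real \<Rightarrow> real^4 \<Rightarrow> real) \<Rightarrow> (real \<Rightarrow> real^4 \<Rightarrow> real) \<Rightarrow> bool" where
  "exterior_wave_solution R u\<^sub>0 u dtu \<longleftrightarrow>
     (\<exists>w U V. radial_extension R u\<^sub>0 w \<and> free_wave_solution w (\<lambda>_. 0) U V \<and>
        (\<forall>t\<ge>0. AE x in lebesgue. norm x > R + \<bar>t\<bar> \<longrightarrow> u t x = U t x \<and> dtu t x = V t x))"

end

theory Submission
  imports Defs "HOL-Computational_Algebra.Polynomial"
begin

text \<open>The solution is compared with its mollifications in space, which are classical solutions. Convolution with
  a radial test function commutes with the wave operator, so the error is again a solution and its energy at time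
  \<open>t\<close> is controlled by the error of the data, uniformly in \<open>t\<close> (\<open>err_uniform\<close>). Hence it suffices to treat the
  mollified solution and to pass to the limit in both sides (\<open>uniform_approximation_limit\<close>). A mollified solution
  is radial, because its difference from a rotated copy solves the equation with vanishing data (\<open>S_radial\<close>).

  For a radial classical solution put \<open>a = r^(3/2) u_t\<close> and \<open>b = r^(3/2) u_r + 2 r^(1/2) u = r^(-1/2) (r^2 u)_r\<close>.
  The incoming part \<open>P = a + b\<close> and the outgoing part \<open>Q = a - b\<close>, written in \<open>s = r - t\<close>, satisfy a first order system
  whose only coupling has size \<open>1 / (s + t)\<close> (locale \<open>radial_system\<close>). Along incoming rays \<open>P\<close> decays, so that
  \<open>P(t)\<close> tends to \<open>0\<close> in \<open>L^2\<close> while \<open>Q(t)\<close> converges; this is the asymptotic equipartition of energy, because the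
  exterior kinetic and potential energies are the integrals of \<open>((P + Q) / 2)^2\<close> and \<open>((P - Q) / 2)^2\<close> up to a vanishing
  boundary term.

  The limit of \<open>Q\<close> is computed exactly. Pairing \<open>(P, Q)\<close> with the self-similar solution of the same system built from
  the Legendre function of degree \<open>-1/2\<close> gives \<open>Q(t, s) --> - b(0, s) - (K b)(s)\<close>, where
  \<open>(K b)(s) = integral of b(0, y) k(s / y) / y over y > s\<close> and \<open>k\<close> is minus the derivative of that Legendre function,
  so that \<open>1/8 <= k <= 3/10\<close>. Now \<open>(b + K b)^2 >= b^2 + 2 b (K b)\<close>. The constant part \<open>1/5\<close> of \<open>k\<close> contributes a nonnegative
  quadratic form and the rest, of size at most \<open>1/10\<close>, at most \<open>2/5\<close> of the norm by the Hardy inequality. Therefore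
  the limit of \<open>Q\<close> carries at least \<open>3/5\<close> of the integral of \<open>b(0)^2\<close> (\<open>radial_limits\<close>), and a quarter of it goes to either
  energy: \<open>3/20\<close>. Finally \<open>b\<close> vanishes exactly on multiples of \<open>1 / r^2\<close>, and the integral of \<open>b(0)^2\<close> is the norm of the
  projected data (\<open>projection_energy\<close>).\<close>

abbreviation (input) "pd \<equiv> partial_deriv"
abbreviation (input) "lmeas \<equiv> borel_measurable lebesgue"
abbreviation (input) "linteg \<equiv> integrable lebesgue"
abbreviation (input) "testfuns \<equiv> test_functions UNIV"
abbreviation (input) has_deriv (infix "has'_deriv" 50) where "f has_deriv D \<equiv> (f has_real_derivative D)"
notation (input) tendsto (infixr "--->" 55)
abbreviation (input) lebesgue_int :: "('a::euclidean_space \<Rightarrow> 'b::{banach,second_countable_topology}) \<Rightarrow> 'b" (binder "LI " 60)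
  where "lebesgue_int f \<equiv> integral\<^sup>L lebesgue f"

section \<open>Smooth functions and test functions\<close>

abbreviation "smooth f \<equiv> (\<forall>k. times_cont_diff k f)"

lemma partial_deriv_eq:
 "(f has_derivative f') (at x) ==> pd b f x = f' b"
 by (simp add: partial_deriv_def frechet_derivative_at[symmetric])

lemma times_cont_diff_Suc_D: "times_cont_diff (Suc k) f ==> times_cont_diff k f"
proof (induction k arbitrary: f)
 case 0
 then show ?case
  by (auto intro!: continuous_at_imp_continuous_on differentiable_imp_continuous_within)
next
 case (Suc k)
 then show ?case by (metis times_cont_diff.simps(2))
qed

lemma smooth_differentiable: "smooth f ==> f differentiable at x"
 using times_cont_diff.simps(2)[of 0 f] by blast

lemma smooth_continuous: "smooth f ==> continuous_on UNIV f"
 using times_cont_diff.simps(1) by blast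

lemma partial_deriv_Basis_sum:
 fixes f :: "'a::euclidean_space => real"
 assumes "f differentiable at x"
 shows "pd h f x = (\<Sum>b\<in>Basis. (h \<bullet> b) * pd b f x)"
proof -
 have "linear (frechet_derivative f (at x))"
  using assms by (rule linear_frechet_derivative)
 then have "frechet_derivative f (at x) (\<Sum>b\<in>Basis. (h \<bullet> b) *\<^sub>R b) =
   (\<Sum>b\<in>Basis. (h \<bullet> b) *\<^sub>R frechet_derivative f (at x) b)"
  by (simp add: linear_sum linear_scale)
 then show ?thesis
  by (simp add: partial_deriv_def euclidean_representation)
qed

lemma times_cont_diff_const: "times_cont_diff k (%x::'a::euclidean_space. c)"
proof (induction k arbitrary: c)
 case (Suc k)
 have "pd b (%x. c) = (%x::'a. 0)" for b
  by (rule ext, subst partial_deriv_eq[where f' = "%_. 0"]) (auto intro: derivative_eq_intros)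
 with Suc show ?case by simp
qed simp

lemma times_cont_diff_add:
 "times_cont_diff k f ==> times_cont_diff k g ==> times_cont_diff k (%x. f x + g x)"
proof (induction k arbitrary: f g)
 case (Suc k)
 have "pd b (%x. f x + g x) = (%x. pd b f x + pd b g x)" for b
 proof
  fix x
  have "f differentiable at x" "g differentiable at x" using Suc.prems by auto
  then have "(f has_derivative frechet_derivative f (at x)) (at x)"
   "(g has_derivative frechet_derivative g (at x)) (at x)"
   using frechet_derivative_works by blast+
  then show "pd b (%x. f x + g x) x = pd b f x + pd b g x"
   by (subst partial_deriv_eq[OF has_derivative_add]) (auto simp: partial_deriv_def)
 qed
 with Suc show ?case by (auto intro!: differentiable_add)
qed (auto intro!: continuous_intros)

lemma times_cont_diff_mult:
 "times_cont_diff k f ==> times_cont_diff k g ==> times_cont_diff k (%x. f x * g x)"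
proof (induction k arbitrary: f g)
 case (Suc k)
 have "pd b (%x. f x * g x) = (%x. f x * pd b g x + pd b f x * g x)" for b
 proof
  fix x
  have "f differentiable at x" "g differentiable at x" using Suc.prems by auto
  then have "(f has_derivative frechet_derivative f (at x)) (at x)"
   "(g has_derivative frechet_derivative g (at x)) (at x)"
   using frechet_derivative_works by blast+
  then show "pd b (%x. f x * g x) x = f x * pd b g x + pd b f x * g x"
   by (subst partial_deriv_eq[OF has_derivative_mult]) (auto simp: partial_deriv_def)
 qed
 with Suc show ?case
  using times_cont_diff_Suc_D[OF Suc.prems(1)] times_cont_diff_Suc_D[OF Suc.prems(2)]
  by (simp add: times_cont_diff_add)
qed (auto intro!: continuous_intros)

lemma times_cont_diff_sum:
 "finite I ==> (!!i. i \<in> I ==> times_cont_diff k (f i)) ==> times_cont_diff k (%x. \<Sum>i\<in>I. f i x)"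
 by (induction I rule: finite_induct) (auto intro: times_cont_diff_const times_cont_diff_add)

lemma times_cont_diff_inner:
 fixes c :: "'a::euclidean_space"
 shows "times_cont_diff k (%x. x \<bullet> c)"
proof (cases k)
 case (Suc j)
 have "pd b (%x. x \<bullet> c) = (%x. b \<bullet> c)" for b
  by (rule ext, rule partial_deriv_eq) (auto intro!: derivative_eq_intros)
 then show ?thesis unfolding Suc
  by (auto intro!: times_cont_diff_const simp: differentiable_def intro!: derivative_eq_intros exI)
qed (auto intro!: continuous_intros)

lemma times_cont_diff_compose_real:
 fixes D :: "nat => real => real"
 assumes D: "!!j y. (D j has_deriv D (Suc j) y) (at y)"
  and f: "smooth f"
 shows "times_cont_diff k (%x. D j (f x))"
proof (induction k arbitrary: j)
 case 0
 have "continuous_on UNIV (D j)"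
  using D by (meson DERIV_isCont continuous_at_imp_continuous_on)
 then show ?case using smooth_continuous[OF f]
  by (simp add: continuous_on_compose2)
next
 case (Suc k)
 have der: "((%x. D j (f x)) has_derivative (%h. D (Suc j) (f x) * frechet_derivative f (at x) h)) (at x)" for x
 proof -
  have "(f has_derivative frechet_derivative f (at x)) (at x)"
   using smooth_differentiable[OF f] frechet_derivative_works by blast
  from has_derivative_compose[OF this D[of j "f x", unfolded has_field_derivative_def]]
  show ?thesis .
 qed
 have "pd b (%x. D j (f x)) = (%x. D (Suc j) (f x) * pd b f x)" for b
  by (rule ext, subst partial_deriv_eq[OF der]) (simp add: partial_deriv_def)
 moreover have "times_cont_diff k (pd b f)" if "b \<in> Basis" for b
  using f that times_cont_diff.simps(2)[of k f] by blast
 ultimately show ?case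
  using der by (auto simp: differentiable_def intro!: times_cont_diff_mult Suc.IH)
qed

lemma smooth_norm_square: "smooth (%x::'a::euclidean_space. (norm x)^2)"
proof
 fix k
 have "(%x::'a. (norm x)^2) = (%x. \<Sum>b\<in>Basis. (x \<bullet> b) * (x \<bullet> b))"
  by (auto simp: power2_norm_eq_inner euclidean_inner[of x x for x::'a])
 then show "times_cont_diff k (%x::'a::euclidean_space. (norm x)^2)"
  by (auto intro!: times_cont_diff_sum times_cont_diff_mult times_cont_diff_inner)
qed

lemma test_functionsI:
 assumes "smooth \<phi>" "compact K" "K \<subseteq> \<Omega>" "!!x. x \<notin> K ==> \<phi> x = 0"
 shows "\<phi> \<in> test_functions \<Omega>"
 using assms unfolding test_functions_def by blast

lemma test_smooth: "\<phi> \<in> test_functions \<Omega> ==> smooth \<phi>"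
 by (simp add: test_functions_def)

lemma test_mono: "\<phi> \<in> test_functions A ==> A \<subseteq> B ==> \<phi> \<in> test_functions B"
 by (auto simp: test_functions_def)

lemma test_has_derivative:
 "\<phi> \<in> test_functions \<Omega> ==> (\<phi> has_derivative (%h. pd h \<phi> x)) (at x)"
 using smooth_differentiable[OF test_smooth, of \<phi> \<Omega> x]
 unfolding partial_deriv_def using frechet_derivative_works by fastforce

lemma test_continuous: "\<phi> \<in> test_functions \<Omega> ==> continuous_on A \<phi>"
 using smooth_continuous[OF test_smooth] continuous_on_subset by blast

lemma test_partial_deriv:
 fixes \<phi> :: "'a::euclidean_space => real"
 assumes "\<phi> \<in> test_functions \<Omega>"
 shows "pd h \<phi> \<in> test_functions \<Omega>"
proof -
 from assms obtain K where K: "compact K" "K \<subseteq> \<Omega>" "!!x. x \<notin> K ==> \<phi> x = 0"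
  unfolding test_functions_def by blast
 have diff: "\<phi> differentiable at x" for x
  using smooth_differentiable[OF test_smooth[OF assms]] .
 have eq: "pd h \<phi> = (%x. \<Sum>b\<in>Basis. (h \<bullet> b) * pd b \<phi> x)"
  by (rule ext) (rule partial_deriv_Basis_sum[OF diff])
 have "times_cont_diff k (pd b \<phi>)" if "b \<in> Basis" for b k
  using test_smooth[OF assms] that times_cont_diff.simps(2)[of k \<phi>] by blast
 then have sm: "smooth (pd h \<phi>)"
  unfolding eq by (auto intro!: times_cont_diff_sum times_cont_diff_mult times_cont_diff_const)
 have "pd h \<phi> x = 0" if "x \<notin> K" for x
 proof -
  have "open (- K)" using K(1) by (simp add: compact_imp_closed open_Compl)
  have "(\<phi> has_derivative (%_. 0)) (at x)"
   by (rule has_derivative_transform_within_open[OF has_derivative_const[of 0] \<open>open (-K)\<close>])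
     (use that K(3) in auto)
  then show ?thesis by (simp add: partial_deriv_eq)
 qed
 then show ?thesis using sm K by (intro test_functionsI[of _ K]) auto
qed

lemma test_sum:
 assumes "finite I" "!!i. i \<in> I ==> f i \<in> test_functions \<Omega>"
 shows "(%x. \<Sum>i\<in>I. c i * f i x) \<in> test_functions \<Omega>"
proof -
 have "\<forall>i\<in>I. \<exists>K. compact K \<and> K \<subseteq> \<Omega> \<and> (\<forall>x. x \<notin> K --> f i x = 0)"
  using assms(2) unfolding test_functions_def by blast
 then obtain K where K: "\<forall>i\<in>I. compact (K i) \<and> K i \<subseteq> \<Omega> \<and> (\<forall>x. x \<notin> K i --> f i x = 0)"
  by metis
 show ?thesis
 proof (rule test_functionsI[of _ "\<Union>i\<in>I. K i"])
  show "compact (\<Union>i\<in>I. K i)" using K assms(1) by (intro compact_UN) auto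
  show "smooth (%x. \<Sum>i\<in>I. c i * f i x)"
   using assms test_smooth
   by (auto intro!: times_cont_diff_sum times_cont_diff_mult times_cont_diff_const)
  show "(\<Sum>i\<in>I. c i * f i x) = 0" if "x \<notin> (\<Union>i\<in>I. K i)" for x
   using that K by (intro sum.neutral) auto
 qed (use K in auto)
qed

lemma test_diff:
 assumes "f \<in> test_functions \<Omega>" "g \<in> test_functions \<Omega>"
 shows "(%x. f x - g x) \<in> test_functions \<Omega>"
 using test_sum[of "UNIV::bool set" "%b. if b then f else g" \<Omega> "%b. if b then 1 else -1"] assms
 by (simp add: UNIV_bool)

lemma test_laplacian: "\<phi> \<in> test_functions \<Omega> ==> laplacian \<phi> \<in> test_functions \<Omega>"
 using test_sum[of "Basis" "%b. pd b (pd b \<phi>)" \<Omega> "%b. 1"]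
 unfolding laplacian_def[abs_def] by (simp add: test_partial_deriv)

lemma differentiable_reflect:
 assumes "f differentiable at (x - y)"
 shows "(%y. f (x - y)) differentiable at y"
proof -
 have "(%y. x - y) differentiable at y"
  by (simp add: differentiable_diff)
 then show ?thesis
  using differentiable_chain_at[of "%y. x - y" y f] assms by (simp add: o_def)
qed

lemma partial_deriv_reflect:
 assumes "f differentiable at (x - y)"
 shows "pd b (%y. f (x - y)) y = - pd b f (x - y)"
proof -
 have f: "(f has_derivative frechet_derivative f (at (x - y))) (at (x - y))"
  using assms frechet_derivative_works by blast
 have "((%y. x - y) has_derivative (%h. - h)) (at y)"
  by (auto intro!: derivative_eq_intros)
 from has_derivative_compose[OF this f]
 have "((%y. f (x - y)) has_derivative (%h. frechet_derivative f (at (x - y)) (- h))) (at y)" .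
 then have "pd b (%y. f (x - y)) y = frechet_derivative f (at (x - y)) (- b)"
  by (rule partial_deriv_eq)
 also have "... = - pd b f (x - y)"
  using linear_frechet_derivative[OF assms] by (simp add: partial_deriv_def linear_neg)
 finally show ?thesis .
qed

lemma times_cont_diff_reflect: "times_cont_diff k f ==> times_cont_diff k (%y. f (x - y))"
proof (induction k arbitrary: f)
 case 0
 then show ?case by (auto intro!: continuous_on_compose2[of UNIV f] continuous_intros)
next
 case (Suc k)
 have "(%y. f (x - y)) differentiable at y" for y
  using Suc.prems by (intro differentiable_reflect) simp
 moreover have "times_cont_diff k (pd b (%y. f (x - y)))" if "b \<in> Basis" for b
 proof -
  have "pd b (%y. f (x - y)) = (%y. (-1) * pd b f (x - y))"
   using partial_deriv_reflect[of f x _ b] Suc.prems by (intro ext) simp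
  moreover have "times_cont_diff k (%y. (-1) * pd b f (x - y))"
   using Suc that by (intro times_cont_diff_mult times_cont_diff_const) simp
  ultimately show ?thesis by simp
 qed
 ultimately show ?case by simp
qed

lemma test_reflect:
 assumes "\<phi> \<in> testfuns"
 shows "(%y. \<phi> (x - y)) \<in> testfuns"
proof -
 from assms obtain K where K: "compact K" "!!x. x \<notin> K ==> \<phi> x = 0"
  unfolding test_functions_def by blast
 show ?thesis
 proof (rule test_functionsI[of _ "(%y. x - y) ` K"])
  show "compact ((%y. x - y) ` K)"
   using K(1) by (intro compact_continuous_image continuous_intros)
  show "\<phi> (x - y) = 0" if "y \<notin> (%y. x - y) ` K" for y
  proof -
   have "x - y \<notin> K"
   proof
    assume "x - y \<in> K"
    then have "x - (x - y) \<in> (%y. x - y) ` K" by (rule imageI)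
    then show False using that by simp
   qed
   then show ?thesis using K by simp
  qed
 qed (use times_cont_diff_reflect test_smooth[OF assms] in auto)
qed

lemma laplacian_reflect:
 assumes "\<phi> \<in> testfuns"
 shows "laplacian (%y. \<phi> (x - y)) y = laplacian \<phi> (x - y)"
proof -
 have d: "\<phi> differentiable at z" "pd b \<phi> differentiable at z" for z b
  using assms test_partial_deriv[OF assms] smooth_differentiable[OF test_smooth] by blast+
 have "pd b (pd b (%y. \<phi> (x - y))) y = pd b (pd b \<phi>) (x - y)" for b
 proof -
  have "pd b (%y. \<phi> (x - y)) = (%y. (-1) * pd b \<phi> (x - y))"
   using partial_deriv_reflect[OF d(1)] by (intro ext) simp
  moreover have "pd b (%y. (-1) * pd b \<phi> (x - y)) y
    = (-1) * pd b (%y. pd b \<phi> (x - y)) y"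
  proof -
   have "(%y. pd b \<phi> (x - y)) differentiable at y"
    by (intro differentiable_reflect d)
   then have "((%y. pd b \<phi> (x - y)) has_derivative
     frechet_derivative (%y. pd b \<phi> (x - y)) (at y)) (at y)"
    using frechet_derivative_works by blast
   from partial_deriv_eq[OF has_derivative_mult_right[OF this, of "-1"], of b] show ?thesis
    by (simp only: partial_deriv_def[of b "%y. pd b \<phi> (x - y)"])
  qed
  ultimately show ?thesis
   using partial_deriv_reflect[of "pd b \<phi>" x y b] d by simp
 qed
 then show ?thesis by (simp add: laplacian_def)
qed

text \<open>The Laplacian is the trace of the Hessian, so every orthonormal frame computes it.\<close>

lemma laplacian_orthogonal_frame:
 fixes \<phi> :: "'a::euclidean_space => real" and T :: "'a => 'a"
 assumes \<phi>: "\<phi> \<in> test_functions \<Omega>" and T: "orthogonal_transformation T"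
 shows "(\<Sum>b\<in>Basis. pd (T b) (pd (T b) \<phi>) x) = laplacian \<phi> x"
proof -
 have d: "\<phi> differentiable at z" "pd b \<phi> differentiable at z" for z b
  using \<phi> test_partial_deriv[OF \<phi>] smooth_differentiable[OF test_smooth] by blast+
 have 1: "pd h (pd h \<phi>) x =
   (\<Sum>c\<in>Basis. \<Sum>d\<in>Basis. (h \<bullet> c) * (h \<bullet> d) * pd c (pd d \<phi>) x)" for h
 proof -
  have e: "pd h \<phi> = (%x. \<Sum>d\<in>Basis. (h \<bullet> d) * pd d \<phi> x)"
   by (rule ext) (rule partial_deriv_Basis_sum[OF d(1)])
  have "((%x. \<Sum>d\<in>Basis. (h \<bullet> d) * pd d \<phi> x) has_derivative
    (%k. \<Sum>d\<in>Basis. (h \<bullet> d) * pd k (pd d \<phi>) x)) (at x)"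
   by (intro has_derivative_sum has_derivative_mult_right
     test_has_derivative[OF test_partial_deriv[OF \<phi>]])
  then have "pd c (pd h \<phi>) x = (\<Sum>d\<in>Basis. (h \<bullet> d) * pd c (pd d \<phi>) x)" for c
   unfolding e by (rule partial_deriv_eq)
  then show ?thesis
   by (subst partial_deriv_Basis_sum[OF d(2)]) (simp add: sum_distrib_left mult.assoc)
 qed
 have lin: "linear T" using T by (simp add: orthogonal_transformation_def)
 have 2: "(\<Sum>b\<in>Basis. (T b \<bullet> c) * (T b \<bullet> d)) = c \<bullet> d" for c d
 proof -
  define T' where "T' = inv T"
  have TT: "T (T' x) = x" for x 
   unfolding T'_def by (rule surj_f_inv_f[OF orthogonal_transformation_surj[OF T]])
  have inner: "T x \<bullet> T y = x \<bullet> y" for x y using T by (simp add: orthogonal_transformation_def)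
  have adj: "T b \<bullet> c = T' c \<bullet> b" for b c
   using inner[of b "T' c"] by (simp add: TT inner_commute)
  have "(\<Sum>b\<in>Basis. (T b \<bullet> c) * (T b \<bullet> d)) = T' c \<bullet> T' d"
   unfolding adj by (rule euclidean_inner[symmetric])
  also have "... = c \<bullet> d" using inner[of "T' c" "T' d"] by (simp add: TT)
  finally show ?thesis .
 qed
 have "(\<Sum>b\<in>Basis. pd (T b) (pd (T b) \<phi>) x) =
   (\<Sum>c\<in>Basis. \<Sum>d\<in>Basis. \<Sum>b\<in>Basis. (T b \<bullet> c) * (T b \<bullet> d) * pd c (pd d \<phi>) x)"
  unfolding 1 by (subst sum.swap, rule sum.cong[OF refl], subst sum.swap, rule refl)
 also have "... = (\<Sum>c\<in>Basis. \<Sum>d\<in>Basis. (c \<bullet> d) * pd c (pd d \<phi>) x)"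
  by (simp add: 2 sum_distrib_right[symmetric])
 also have "... = (\<Sum>c\<in>Basis. pd c (pd c \<phi>) x)"
 proof (rule sum.cong[OF refl])
  fix c :: 'a assume c: "c \<in> Basis"
  have "(\<Sum>d\<in>Basis. (c \<bullet> d) * pd c (pd d \<phi>) x) =
   (\<Sum>d\<in>Basis. if d = c then pd c (pd c \<phi>) x else 0)"
   using c by (intro sum.cong) (auto simp: inner_Basis)
  then show "(\<Sum>d\<in>Basis. (c \<bullet> d) * pd c (pd d \<phi>) x)
    = pd c (pd c \<phi>) x"
   using c by (simp add: sum.delta)
 qed
 finally show ?thesis by (simp add: laplacian_def)
qed

text \<open>Every derivative of \<open>exp (- 1 / x)\<close> is a polynomial in \<open>1 / x\<close> times the same exponential, and the exponential wins at the origin.\<close>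

lemma exp_recip_smooth:
 obtains D :: "nat => real => real" where
  "!!j y. (D j has_deriv D (Suc j) y) (at y)"
  "!!j y. y <= 0 ==> D j y = 0" "!!y. y > 0 ==> D 0 y = exp (- 1 / y)"
proof -
 define p :: "nat => real poly" where
  "p = rec_nat 1 (%_ q. [:0,0,1:] * (q - pderiv q))"
 have p: "p 0 = 1" "p (Suc j) = [:0,0,1:] * (p j - pderiv (p j))" for j
  by (simp_all add: p_def)
 define D where "D j y = (if y <= 0 then 0 else poly (p j) (1 / y) * exp (- 1 / y))" for j and y :: real
 have lim: "((%y. poly q (1 / y) * exp (- 1 / y)) ---> 0) (at_right (0::real))" for q :: "real poly"
 proof -
  have "((%x. poly q x * exp (- x)) ---> 0) at_top"
  proof (induction q)
   case (pCons a q)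
   have "((%x. poly r x * exp (- x)) ---> 0) at_top" for r :: "real poly"
   proof -
    have "((%x. \<Sum>i\<le>degree r. coeff r i * (x ^ i / exp x)) ---> (\<Sum>i\<le>degree r. coeff r i * 0)) at_top"
     by (intro tendsto_intros tendsto_power_div_exp_0)
    then show ?thesis
     by (simp add: poly_altdef exp_minus sum_distrib_right divide_inverse mult.assoc)
   qed
   then show ?case .
  qed simp
  from filterlim_compose[OF this filterlim_inverse_at_top_right]
  show ?thesis by (simp add: inverse_eq_divide)
 qed
 have der: "(D j has_deriv D (Suc j) y) (at y)" for j y
 proof -
  consider "y < 0" | "y > 0" | "y = 0" by linarith
  then show ?thesis
  proof cases
   case 1
   have "((%_. 0) has_deriv 0) (at y)" by simp
   then have "(D j has_deriv 0) (at y)"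
    by (rule has_field_derivative_transform_within_open[of _ _ _ "{..<0}"])
      (use 1 in \<open>auto simp: D_def\<close>)
   then show ?thesis using 1 by (simp add: D_def)
  next
   case 2
   have "((%y. poly (p j) (1 / y) * exp (- 1 / y)) has_deriv
     (poly (pderiv (p j)) (1/y) * (- 1 / y^2)) * exp (- 1 / y) +
     poly (p j) (1/y) * (exp (-1 / y) * (1 / y^2))) (at y)"
    using 2 by (auto intro!: derivative_eq_intros DERIV_chain2[OF poly_DERIV]
      simp: power2_eq_square)
   moreover have "(poly (pderiv (p j)) (1/y) * (- 1 / y^2)) * exp (- 1 / y) +
     poly (p j) (1/y) * (exp (-1 / y) * (1 / y^2)) = D (Suc j) y"
    using 2 by (simp add: D_def p power2_eq_square field_simps)
   ultimately have "((%y. poly (p j) (1 / y) * exp (- 1 / y)) has_deriv D (Suc j) y) (at y)"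
    by simp
   then show ?thesis
    by (rule has_field_derivative_transform_within_open[of _ _ _ "{0<..}"])
      (use 2 in \<open>auto simp: D_def\<close>)
  next
   case 3
   have "((%h. (D j (0 + h) - D j 0) / h) ---> 0) (at 0)"
   proof (rule filterlim_split_at)
    show "((%h. (D j (0 + h) - D j 0) / h) ---> 0) (at_left 0)"
     by (rule tendsto_eventually) (auto simp: D_def eventually_at_filter)
    have "((%h. poly (pCons 0 (p j)) (1 / h) * exp (- 1 / h)) ---> 0) (at_right (0::real))"
     by (rule lim)
    then show "((%h. (D j (0 + h) - D j 0) / h) ---> 0) (at_right 0)"
     by (rule Lim_transform_eventually)
       (auto simp: D_def eventually_at_filter)
   qed
   then show ?thesis using 3 by (simp add: DERIV_def D_def)
  qed
 qed
 show ?thesis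
  by (rule that[of D]) (use der in \<open>auto simp: D_def p\<close>)
qed

lemma radial_bump_exists:
 obtains g :: "real => real" where
  "!!s. g s >= 0" "!!s. s < 1 ==> g s > 0" "!!s. s >= 1 ==> g s = 0"
  "!!\<epsilon>. \<epsilon> > 0 ==> (%y::'a::euclidean_space. g ((norm y / \<epsilon>)^2)) \<in> testfuns"
proof -
 obtain D :: "nat => real => real" where D:
  "!!j y. (D j has_deriv D (Suc j) y) (at y)"
  "!!j y. y <= 0 ==> D j y = 0" "!!y. y > 0 ==> D 0 y = exp (- 1 / y)"
  using exp_recip_smooth by blast
 define g where "g s = D 0 (1 - s)" for s
 show ?thesis
 proof (rule that[of g])
  show "g s >= 0" for s using D(2)[of "1-s" 0] D(3)[of "1-s"]
   by (cases "s < 1") (auto simp: g_def)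
  show "g s > 0" if "s < 1" for s using that by (auto simp: g_def D(3))
  show "g s = 0" if "s >= 1" for s using that by (auto simp: g_def D(2))
  fix \<epsilon> :: real assume "\<epsilon> > 0"
  have sm: "smooth (%y::'a. 1 + (- (1 / \<epsilon>^2)) * (norm y)^2)"
   by (intro allI times_cont_diff_add times_cont_diff_mult times_cont_diff_const
     smooth_norm_square[rule_format])
  have eq: "(%y::'a. g ((norm y / \<epsilon>)^2)) = (%y. D 0 (1 + (- (1 / \<epsilon>^2)) * (norm y)^2))"
   by (auto simp: g_def power_divide)
  show "(%y::'a. g ((norm y / \<epsilon>)^2)) \<in> testfuns"
  proof (rule test_functionsI[of _ "cball 0 \<epsilon>"])
   show "smooth (%y::'a. g ((norm y / \<epsilon>)^2))"
    unfolding eq by (intro allI times_cont_diff_compose_real[where D = D] D(1) sm)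
   show "g ((norm y / \<epsilon>)^2) = 0" if "y \<notin> cball 0 \<epsilon>" for y :: 'a
   proof -
    have "1 <= norm y / \<epsilon>" using that \<open>\<epsilon> > 0\<close> by (auto simp: field_simps)
    then have "1 <= (norm y / \<epsilon>)^2" by simp
    then show ?thesis by (simp add: g_def D(2))
   qed
  qed auto
 qed
qed

section \<open>Lebesgue integration\<close>

text \<open>Invariance refers to the completed measure, so that functions which are merely Lebesgue measurable can be transported.\<close>

definition lebesgue_preserving :: "('a::euclidean_space => 'a) => bool" where
 "lebesgue_preserving T \<longleftrightarrow> T \<in> lebesgue \<rightarrow>\<^sub>M lebesgue \<and> distr lebesgue lebesgue T = lebesgue"

lemma lebesgue_preserving_affine:
 fixes a :: "'a::euclidean_space"
 assumes "c = 1 \<or> c = -1"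
 shows "lebesgue_preserving (%x. a + c *\<^sub>R x)"
proof -
 have eq: "(%x. a + (\<Sum>j\<in>Basis. (c * (x \<bullet> j)) *\<^sub>R j)) = (%x::'a. a + c *\<^sub>R x)"
  by (simp add: scaleR_scaleR[symmetric] scaleR_sum_right[symmetric] euclidean_representation
    del: scaleR_scaleR)
 have c: "!!j. j \<in> (Basis::'a set) ==> (%_. c) j ~= 0" using assms by auto
 have "(\<Prod>j\<in>(Basis::'a set). \<bar>c\<bar>) = 1" using assms by auto
 then show ?thesis
  using lebesgue_affine_euclidean[of "%_::'a. c" a] lebesgue_affine_measurable[of "%_::'a. c" a]
   assms unfolding lebesgue_preserving_def eq
  by (auto simp: density_1)
qed

lemma lebesgue_preserving_translation: "lebesgue_preserving (%x. x - a)"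
 using lebesgue_preserving_affine[of 1 "- a"] by simp

lemma lebesgue_preserving_reflection: "lebesgue_preserving (%x. a - x)"
 using lebesgue_preserving_affine[of "-1" a] by simp

lemma lebesgue_preserving_lborelI:
 assumes T[measurable]: "T \<in> borel_measurable borel" and d: "distr lborel borel T = lborel"
 shows "lebesgue_preserving T"
proof -
 have null: "T -` N \<in> null_sets lborel" if "N \<in> null_sets lborel" for N
 proof -
  have "emeasure (distr lborel borel T) N = 0" using d that by auto
  moreover have "N \<in> sets borel" using that by auto
  ultimately show ?thesis using measurable_sets[OF T, of N] by (intro null_setsI) (auto simp: emeasure_distr)
 qed
 have m: "T \<in> lebesgue \<rightarrow>\<^sub>M lebesgue"
 proof (rule completion.measurable_completion2)
  show "T \<in> lebesgue \<rightarrow>\<^sub>M lborel" using T by (intro measurable_completion) simp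
  note m = this
  show "null_sets lborel \<subseteq> null_sets (distr lebesgue lborel T)"
  proof
   fix N :: "'a set" assume N: "N \<in> null_sets lborel"
   then have "emeasure lborel (T -` N) = 0" "N \<in> sets borel" "T -` N \<in> sets borel"
    using null[OF N] by auto
   then show "N \<in> null_sets (distr lebesgue lborel T)"
    using m by (intro null_setsI) (simp_all add: emeasure_distr)
  qed
 qed
 have "distr lebesgue lebesgue T = lebesgue"
 proof (rule measure_eqI)
  fix A assume "A \<in> sets (distr lebesgue lebesgue T)"
  then have A: "A \<in> sets lebesgue" by simp
  let ?B = "main_part lborel A"
  have B: "?B \<in> sets borel" using A main_part_sets by force
  have ae: "AE x in lborel. x \<in> ?B \<longleftrightarrow> x \<in> A" using A by (rule AE_in_main_part)
  then have "AE x in distr lborel borel T. x \<in> ?B \<longleftrightarrow> x \<in> A" unfolding d .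
  then have ae': "AE x in lborel. T x \<in> ?B \<longleftrightarrow> T x \<in> A"
   by (rule AE_distrD[rotated]) simp
  have "emeasure (distr lebesgue lebesgue T) A = emeasure lebesgue (T -` A)"
   using m A by (simp add: emeasure_distr)
  also have "... = emeasure lebesgue (T -` ?B)"
  proof (rule emeasure_eq_AE)
   show "AE x in lebesgue. x \<in> T -` A \<longleftrightarrow> x \<in> T -` ?B"
    using AE_completion[OF ae'] by auto
   show "T -` A \<in> sets lebesgue" using measurable_sets[OF m A] by simp
   show "T -` ?B \<in> sets lebesgue" using measurable_sets[OF m, of ?B] B by simp
  qed
  also have "... = emeasure (distr lborel borel T) ?B"
   using B measurable_sets[OF T B] by (simp add: emeasure_distr)
  also have "... = emeasure lebesgue A"
   unfolding d using emeasure_eq_AE[of A ?B lebesgue] AE_completion[OF ae] A B by auto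
  finally show "emeasure (distr lebesgue lebesgue T) A = emeasure lebesgue A" .
 qed simp
 with m show ?thesis by (simp add: lebesgue_preserving_def)
qed

lemma lebesgue_preserving_orthogonal:
 fixes T :: "real^'n::{finite,wellorder} => real^'n::_"
 assumes T: "orthogonal_transformation T"
 shows "lebesgue_preserving T"
proof (rule lebesgue_preserving_lborelI)
 have "continuous_on UNIV T"
  using T by (simp add: orthogonal_transformation_def linear_continuous_on linear_conv_bounded_linear)
 then show m[measurable]: "T \<in> borel_measurable borel" by (rule borel_measurable_continuous_onI)
 show "distr lborel borel T = lborel"
 proof (rule lborel_eqI[symmetric])
  fix l u :: "real^'n::_" assume le: "!!b. b \<in> Basis ==> l \<bullet> b <= u \<bullet> b"
  have inv: "orthogonal_transformation (inv T)" using T by (rule orthogonal_transformation_inv)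
  have vi: "T -` box l u = inv T ` box l u"
   using orthogonal_transformation_bij[OF T] bij_vimage_eq_inv_image by blast
  have "emeasure (distr lborel borel T) (box l u) = emeasure lborel (T -` box l u)"
   by (simp add: emeasure_distr)
  also have "... = emeasure lebesgue (inv T ` box l u)"
   unfolding vi[symmetric] using measurable_sets[OF m, of "box l u"] by simp
  also have "... = ennreal (measure lebesgue (inv T ` box l u))"
   using measurable_orthogonal_image[OF inv, of "box l u"] by (simp add: emeasure_eq_measure2)
  also have "... = emeasure lebesgue (box l u)"
   using measure_orthogonal_image[OF inv, of "box l u"] by (simp add: emeasure_eq_measure2)
  finally show "emeasure (distr lborel borel T) (box l u) = (\<Prod>b\<in>Basis. (u - l) \<bullet> b)"
   using le by (simp add: emeasure_lborel_box_eq)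
 qed simp
qed

lemma lebesgue_preserving_integral:
 fixes f :: "'a::euclidean_space => 'b::{banach,second_countable_topology}"
 assumes T: "lebesgue_preserving T" and f: "f \<in> lmeas"
 shows "(LI x. f (T x)) = (LI x. f x)"
  and "linteg (%x. f (T x)) \<longleftrightarrow> linteg f"
  and "(%x. f (T x)) \<in> lmeas"
proof -
 have m: "T \<in> lebesgue \<rightarrow>\<^sub>M lebesgue" and d: "distr lebesgue lebesgue T = lebesgue"
  using T by (auto simp: lebesgue_preserving_def)
 show "(LI x. f (T x)) = (LI x. f x)"
  using integral_distr[OF m, of f] f d by simp
 show "linteg (%x. f (T x)) \<longleftrightarrow> linteg f"
  using integrable_distr_eq[OF m, of f] f d by simp
 show "(%x. f (T x)) \<in> lmeas"
  using measurable_compose[OF m f] .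
qed

lemma lebesgue_preserving_AE:
 assumes T: "lebesgue_preserving T" and P: "AE x in lebesgue. P x"
 shows "AE x in lebesgue. P (T x)"
proof (rule AE_distrD[of T lebesgue lebesgue P])
 show "T \<in> lebesgue \<rightarrow>\<^sub>M lebesgue" using T by (simp add: lebesgue_preserving_def)
 have "distr lebesgue lebesgue T = lebesgue" using T by (simp add: lebesgue_preserving_def)
 then show "AE x in distr lebesgue lebesgue T. P x" using P by (simp only:)
qed

lemma borel_measurable_lebesgue_AE_cong:
 fixes f g :: "'a::euclidean_space => 'b::{second_countable_topology,metric_space}"
 assumes g: "g \<in> lmeas" and ae: "AE x in lebesgue. f x = g x"
 shows "f \<in> lmeas"
proof (rule borel_measurableI)
 fix S :: "'b set" assume "open S"
 have 1: "g -` S \<in> sets lebesgue"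
  using measurable_sets[OF g, of S] \<open>open S\<close> by simp
 have "AE x in lebesgue. x \<in> g -` S \<longleftrightarrow> x \<in> f -` S" using ae by auto
 from completion.in_sets_AE[OF this 1] have "f -` S \<in> sets lebesgue" by simp
 then show "f -` S \<inter> space lebesgue \<in> sets lebesgue"
  by (simp only: space_completion space_lborel space_borel Int_UNIV_right)
qed

lemma square_integrable_mult:
 fixes f g :: "'a => real"
 assumes "f \<in> borel_measurable M" "g \<in> borel_measurable M"
  and "integrable M (%x. (f x)^2)" "integrable M (%x. (g x)^2)"
 shows "integrable M (%x. f x * g x)"
proof (rule Bochner_Integration.integrable_bound)
 show "integrable M (%x. (f x)^2 + (g x)^2)" using assms by auto
 have "norm (a * b) <= norm (a^2 + b^2)" for a b :: real
 proof -
  have "0 <= (\<bar>a\<bar> - \<bar>b\<bar>)^2" by simp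
  then have "2 * (\<bar>a\<bar> * \<bar>b\<bar>) <= a^2 + b^2" by (simp add: power2_diff)
  moreover have "0 <= \<bar>a\<bar> * \<bar>b\<bar>" by simp
  ultimately have "\<bar>a\<bar> * \<bar>b\<bar> <= a^2 + b^2" by linarith
  then show ?thesis by (simp add: abs_mult)
 qed
 then show "AE x in M. norm (f x * g x) <= norm ((f x)^2 + (g x)^2)" by auto
qed (use assms in auto)

lemma le_add_smallI: "(!!e. e > 0 ==> a <= (b + e) * (c + e)) ==> a <= b * (c::real)"
proof -
 assume *: "!!e. e > 0 ==> a <= (b + e) * (c + e)"
 have "((%e. (b + e) * (c + e)) ---> (b + 0) * (c + 0)) (at_right 0)"
  by (intro tendsto_intros)
 then have "a <= (b + 0) * (c + 0)"
  by (rule tendsto_lowerbound) (auto simp: eventually_at_filter *)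
 then show ?thesis by simp
qed

text \<open>Young's inequality with the optimal weight; enlarging both norms by \<open>e\<close> keeps the weight defined when a norm vanishes.\<close>

lemma integral_Cauchy_Schwarz:
 fixes f g :: "'a => real"
 assumes "f \<in> borel_measurable M" "g \<in> borel_measurable M"
  and i: "integrable M (%x. (f x)^2)" "integrable M (%x. (g x)^2)"
 shows "(LINT x|M. \<bar>f x * g x\<bar>) <= sqrt (LINT x|M. (f x)^2) * sqrt (LINT x|M. (g x)^2)"
proof (rule le_add_smallI)
 fix e :: real assume "e > 0"
 define a where "a = sqrt (LINT x|M. (f x)^2)"
 define b where "b = sqrt (LINT x|M. (g x)^2)"
 have a: "a >= 0" "(LINT x|M. (f x)^2) = a^2" and b: "b >= 0" "(LINT x|M. (g x)^2) = b^2"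
  by (auto simp: a_def b_def)
 define l where "l = (b + e) / (a + e)"
 have l: "l > 0" using a b \<open>e > 0\<close> by (simp add: l_def)
 have pt: "\<bar>u * v\<bar> <= (l * u^2 + v^2 / l) / 2" for u v :: real
 proof -
  have "0 <= (l * \<bar>u\<bar> - \<bar>v\<bar>)^2" by simp
  then have "2 * l * (\<bar>u\<bar> * \<bar>v\<bar>) <= l^2 * u^2 + v^2"
   by (simp add: power2_diff power_mult_distrib algebra_simps)
  then show ?thesis using l by (simp add: abs_mult field_simps power2_eq_square)
 qed
 have "(LINT x|M. \<bar>f x * g x\<bar>) <= (LINT x|M. (l * (f x)^2 + (g x)^2 / l) / 2)"
  using assms pt by (intro integral_mono integrable_abs square_integrable_mult) auto
 also have "... = (l * a^2 + b^2 / l) / 2" using i by (simp add: a b)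
 also have "... <= (l * (a + e)^2 + (b + e)^2 / l) / 2"
  using a b l \<open>e > 0\<close> by (intro divide_right_mono add_mono mult_left_mono power_mono) auto
 also have "... = (a + e) * (b + e)"
  using a b \<open>e > 0\<close> by (simp add: l_def power2_eq_square)
 finally show "(LINT x|M. \<bar>f x * g x\<bar>) <= (sqrt (LINT x|M. (f x)^2) + e) * (sqrt (LINT x|M. (g x)^2) + e)"
  by (simp add: a_def b_def)
qed

lemma square_norm_add_le:
 fixes u v :: "'b::real_inner"
 assumes "l > 0"
 shows "(norm (u + v))^2 <= (1 + l) * (norm u)^2 + (1 + 1 / l) * (norm v)^2"
proof -
 have "0 <= (l * norm u - norm v)^2" by simp
 then have "2 * (norm u * norm v) <= l * (norm u)^2 + (norm v)^2 / l"
  using assms by (simp add: power2_diff power_mult_distrib field_simps power2_eq_square)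
 moreover have "(norm (u + v))^2 <= (norm u + norm v)^2"
  by (intro power_mono norm_triangle_ineq) auto
 ultimately show ?thesis by (simp add: power2_sum algebra_simps)
qed

lemma square_integrable_add:
 fixes f g :: "'a => 'b::euclidean_space"
 assumes "f \<in> borel_measurable M" "g \<in> borel_measurable M"
  and i: "integrable M (%x. (norm (f x))^2)" "integrable M (%x. (norm (g x))^2)"
 shows "integrable M (%x. (norm (f x + g x))^2)"
proof (rule Bochner_Integration.integrable_bound)
 show "integrable M (%x. 2 * (norm (f x))^2 + 2 * (norm (g x))^2)" using i by auto
 show "AE x in M. norm ((norm (f x + g x))^2) <= norm (2 * (norm (f x))^2 + 2 * (norm (g x))^2)"
  using square_norm_add_le[of 1] by auto
qed (use assms in auto)

lemma L2_triangle:
 fixes f g :: "'a => 'b::euclidean_space"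
 assumes m: "f \<in> borel_measurable M" "g \<in> borel_measurable M"
  and i: "integrable M (%x. (norm (f x))^2)" "integrable M (%x. (norm (g x))^2)"
 shows "sqrt (LINT x|M. (norm (f x + g x))^2) <=
  sqrt (LINT x|M. (norm (f x))^2) + sqrt (LINT x|M. (norm (g x))^2)"
proof -
 define a where "a = sqrt (LINT x|M. (norm (f x))^2)"
 define b where "b = sqrt (LINT x|M. (norm (g x))^2)"
 have a: "a >= 0" "(LINT x|M. (norm (f x))^2) = a^2" and b: "b >= 0" "(LINT x|M. (norm (g x))^2) = b^2"
  by (auto simp: a_def b_def)
 have "(LINT x|M. (norm (f x + g x))^2) <= (a + b) * (a + b)"
 proof (rule le_add_smallI)
  fix d :: real assume "d > 0"
  define e where "e = d / 2"
  have "e > 0" using \<open>d > 0\<close> by (simp add: e_def)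
  define l where "l = (b + e) / (a + e)"
  have l: "l > 0" using a b \<open>e > 0\<close> by (simp add: l_def)
  have "(LINT x|M. (norm (f x + g x))^2) <= (LINT x|M. (1 + l) * (norm (f x))^2 + (1 + 1/l) * (norm (g x))^2)"
   using assms square_norm_add_le[OF l] by (intro integral_mono square_integrable_add) auto
  also have "... = (1 + l) * a^2 + (1 + 1 / l) * b^2" using i by (simp add: a b)
  also have "... <= (1 + l) * (a + e)^2 + (1 + 1 / l) * (b + e)^2"
   using a b l \<open>e > 0\<close> by (intro add_mono mult_left_mono power_mono) auto
  also have "... = (a + e + (b + e)) * (a + e + (b + e))"
  proof -
   define A where "A = a + e"
   define B where "B = b + e"
   have "A > 0" "B > 0" using a b \<open>e > 0\<close> by (auto simp: A_def B_def)
   then show ?thesis unfolding l_def A_def[symmetric] B_def[symmetric]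
    by (simp add: power2_eq_square field_simps)
  qed
  also have "... = (a + b + d) * (a + b + d)" by (simp add: e_def algebra_simps)
  finally show "(LINT x|M. (norm (f x + g x))^2) <= (a + b + d) * (a + b + d)" .
 qed
 moreover have e: "sqrt ((a + b) * (a + b)) = a + b"
  using a(1) b(1) by (metis abs_of_nonneg add_nonneg_nonneg real_sqrt_abs2)
 ultimately have "sqrt (LINT x|M. (norm (f x + g x))^2) <= a + b"
  using real_sqrt_le_mono by metis
 then show ?thesis unfolding a_def b_def .
qed

lemma integrable_indicator_cball: "linteg (indicator (cball a r) :: 'a::euclidean_space => real)"
proof (rule integrable_real_indicator)
 show "emeasure lebesgue (cball a r) < \<infinity>" using fmeasurableD2[OF lmeasurable_cball[of a r]] by (simp add: top.not_eq_extremum)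
qed simp

text \<open>Translation invariance of the integral, in differentiated form.\<close>

lemma integral_directional_derivative_eq_0:
 fixes f f' :: "'a::euclidean_space => real"
 assumes cf: "continuous_on UNIV f" and cf': "continuous_on UNIV f'"
  and supp: "!!x. norm x > M ==> f x = 0"
  and der: "!!x. ((%s. f (x + s *\<^sub>R b)) has_deriv f' x) (at 0)"
 shows "(LI x. f' x) = 0"
proof -
 have der': "((%s. f (x + s *\<^sub>R b)) has_deriv f' (x + s *\<^sub>R b)) (at s)" for x s
  using der[of "x + s *\<^sub>R b"] DERIV_shift[of "%s. f (x + s *\<^sub>R b)" "f' (x + s *\<^sub>R b)" 0 s]
  by (simp add: scaleR_add_left add.assoc add.left_commute add.commute)
 have supp': "f' x = 0" if "norm x > M" for x
 proof -
  have op: "open {s. norm (x + s *\<^sub>R b) > M}"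
   by (intro open_Collect_less continuous_intros)
  have "((%s. 0) has_deriv 0) (at 0)" by simp
  then have "((%s. f (x + s *\<^sub>R b)) has_deriv 0) (at 0)"
   by (rule has_field_derivative_transform_within_open[OF _ op]) (use that supp in auto)
  then show ?thesis using der DERIV_unique by blast
 qed
 have "compact (f' ` cball 0 M)" using cf' by (intro compact_continuous_image) (auto intro: continuous_on_subset)
 then obtain C0 where C0: "!!x. x \<in> cball 0 M ==> \<bar>f' x\<bar> <= C0"
  by (meson bounded_real compact_imp_bounded imageI)
 define C where "C = max C0 0"
 have C: "\<bar>f' x\<bar> <= C" for x
  using C0[of x] supp'[of x] by (cases "norm x <= M") (auto simp: C_def)
 let ?h = "%n::nat. 1 / (real n + 1)"
 define F where "F n x = (f (x + ?h n *\<^sub>R b) - f x) / ?h n" for n x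
 have bf: "f \<in> borel_measurable borel" "f' \<in> borel_measurable borel"
  using cf cf' by (auto intro: borel_measurable_continuous_onI)
 have mf: "f \<in> lmeas" using bf by (simp add: measurable_completion)
 have lim: "(%n. F n x) \<longlonglongrightarrow> f' x" for x
 proof -
  have "((%h. (f (x + h *\<^sub>R b) - f x) / h) ---> f' x) (at 0)"
   using der[of x] by (simp add: DERIV_def)
  moreover have "filterlim ?h (at 0) sequentially"
   unfolding filterlim_at using LIMSEQ_inverse_real_of_nat by (auto simp: inverse_eq_divide add.commute)
  ultimately show ?thesis unfolding F_def by (rule filterlim_compose)
 qed
 have bnd: "norm (F n x) <= C * indicator (cball 0 (M + norm b)) x" for n x
 proof (cases "norm x <= M + norm b")
  case True
  obtain z where z: "0 < z" "z < ?h n" "f (x + ?h n *\<^sub>R b) - f (x + 0 *\<^sub>R b) = (?h n - 0) * f' (x + z *\<^sub>R b)"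
   using MVT2[of 0 "?h n" "%s. f (x + s *\<^sub>R b)" "%s. f' (x + s *\<^sub>R b)"] der' by auto
  then have "F n x = f' (x + z *\<^sub>R b)" by (simp add: F_def)
  then show ?thesis using C True by simp
 next
  case False
  have "norm (?h n *\<^sub>R b) <= norm b" by (simp add: divide_le_eq algebra_simps)
  then have "norm (x + ?h n *\<^sub>R b) > M" "norm x > M"
   using False norm_triangle_ineq4[of "x + ?h n *\<^sub>R b" "?h n *\<^sub>R b"] norm_ge_zero[of b]
   by (simp_all only: mem_cball not_le add_diff_cancel_right')
  then show ?thesis using supp by (simp add: F_def False)
 qed
 have ii: "linteg (%x. C * indicator (cball 0 (M + norm b)) x :: real)"
  by (rule integrable_mult_right) (rule integrable_indicator_cball)
 have fint: "linteg f"
 proof -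
  have "integrable lborel (%x. indicator (cball 0 M) x *\<^sub>R f x)"
  proof (rule borel_integrable_compact)
   show "continuous_on (cball 0 M) f" using cf by (rule continuous_on_subset) simp
  qed simp
  moreover have "(%x. indicator (cball 0 M) x *\<^sub>R f x) = f"
  proof
   show "indicator (cball 0 M) x *\<^sub>R f x = f x" for x
    using supp[of x] by (cases "norm x <= M") auto
  qed
  ultimately show ?thesis by (simp add: integrable_completion bf)
 qed
 have tr: "lebesgue_preserving (%x. x + a)" for a :: 'a
  using lebesgue_preserving_affine[of 1 a] by (simp add: add.commute)
 have "(LI x. F n x) = 0" for n
  unfolding F_def using lebesgue_preserving_integral[OF tr mf] fint by simp
 moreover have "(%n. LI x. F n x) \<longlonglongrightarrow> (LI x. f' x)"
 proof (rule integral_dominated_convergence[OF _ _ ii])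
  show "f' \<in> lmeas" using bf by (simp add: measurable_completion)
  show "F n \<in> lmeas" for n
   unfolding F_def[abs_def] using lebesgue_preserving_integral(3)[OF tr mf] mf by auto
 qed (use lim bnd in auto)
 ultimately have "(%n::nat. 0::real) \<longlonglongrightarrow> (LI x. f' x)" by simp
 from LIMSEQ_unique[OF this tendsto_const] show ?thesis .
qed

section \<open>Translations and mollification in mean\<close>

text \<open>Translation is continuous in mean for indicators by regularity of the measure, hence for integrable functions by approximation; truncation then reduces the square integrable case to the integrable one.\<close>

lemma translation_continuous_indicator:
 fixes A :: "'a::euclidean_space set"
 assumes A: "A \<in> sets lebesgue" "emeasure lebesgue A < \<infinity>" and e: "e > 0"
 shows "\<exists>d>0. \<forall>y. norm y < d -->
  (LI x. \<bar>indicator A (x - y) - indicator A x\<bar> :: real) <= e"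
proof -
 have fm: "A \<in> lmeasurable" using A by (simp add: fmeasurable_def)
 obtain U where U: "open U" "A \<subseteq> U" "U - A \<in> lmeasurable" "emeasure lebesgue (U - A) < ennreal (e / 4)"
  using sets_lebesgue_outer_open[OF A(1), of "e / 4"] e by auto
 obtain T where T: "closed T" "T \<subseteq> A" "A - T \<in> lmeasurable" "emeasure lebesgue (A - T) < ennreal (e / 8)"
  using sets_lebesgue_inner_closed[OF A(1), of "e / 8"] e by auto
 have Tl: "T \<in> lmeasurable"
  using T fm by (metis fmeasurableI2 borel_closed sets_completionI_sets sets_lborel)
 have "(%n. measure lebesgue (T \<inter> cball 0 (real n))) \<longlonglongrightarrow> measure lebesgue (\<Union>n. T \<inter> cball 0 (real n))"
 proof (rule Lim_measure_incseq)
  show "range (%n. T \<inter> cball 0 (real n)) \<subseteq> sets lebesgue" using Tl by auto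
  show "incseq (%n. T \<inter> cball 0 (real n))" by (auto simp: incseq_def)
  have "(\<Union>n. T \<inter> cball 0 (real n)) = T" using real_arch_simple by auto
  then show "emeasure lebesgue (\<Union>n. T \<inter> cball 0 (real n)) ~= \<infinity>"
   using fmeasurableD2[OF Tl] by (simp only: infinity_ennreal_def not_False_eq_True)
 qed
 moreover have "(\<Union>n. T \<inter> cball 0 (real n)) = T" using real_arch_simple by auto
 ultimately have "(%n. measure lebesgue (T \<inter> cball 0 (real n))) \<longlonglongrightarrow> measure lebesgue T" by simp
 from LIMSEQ_D[OF this, of "e / 8"] e obtain n where n: "\<bar>measure lebesgue (T \<inter> cball 0 (real n)) - measure lebesgue T\<bar> < e / 8"
  by auto
 define K where "K = T \<inter> cball 0 (real n)"
 have K: "compact K" "K \<subseteq> T" "K \<in> lmeasurable" unfolding K_def using T Tl by (auto intro: closed_Int_compact)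
 have mU: "measure lebesgue (U - A) <= e / 4"
  using U e by (simp add: emeasure_eq_measure2 ennreal_less_iff)
 have m1: "measure lebesgue (A - T) <= e / 8"
  using T e by (simp add: emeasure_eq_measure2 ennreal_less_iff)
 have m2: "measure lebesgue (T - K) <= e / 8"
  using measurable_measure_Diff[OF Tl fmeasurableD[OF K(3)] K(2)] n unfolding K_def abs_less_iff by linarith
 have AK: "A - K \<in> lmeasurable" using fm K by (simp add: fmeasurable.Diff)
 have "measure lebesgue (A - K) <= measure lebesgue (A - T) + measure lebesgue (T - K)"
 proof -
  have "A - K = (A - T) \<union> (T - K)" using T K by auto
  then show ?thesis using measure_Un_le[of "A - T" lebesgue "T - K"] T Tl K by auto
 qed
 with m1 m2 have mK: "measure lebesgue (A - K) <= e / 4" by simp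
 have "K \<subseteq> U" using K T U by auto
 then obtain d where d: "d > 0" "(\<Union>x\<in>K. ball x d) \<subseteq> U"
  using compact_subset_open_imp_ball_epsilon_subset[OF K(1) U(1)] by blast
 show ?thesis
 proof (intro exI[of _ d] conjI allI impI d)
  fix y :: 'a assume y: "norm y < d"
  have sh: "x + z \<in> U" if "x \<in> K" "norm z < d" for x z
   using d that by (force simp: dist_norm)
  have tr: "lebesgue_preserving (%x. x - y)" by (rule lebesgue_preserving_translation)
  let ?g = "%x. indicator (A - K) x + indicator (U - A) x :: real"
  have gi: "linteg ?g" using AK U
   by (intro Bochner_Integration.integrable_add integrable_real_indicator) (auto simp: fmeasurable_def)
  have gi': "linteg (%x. ?g (x - y))"
   using lebesgue_preserving_integral(2)[OF tr, of ?g] gi by auto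
  have pt: "\<bar>indicator A (x - y) - indicator A x\<bar> <= ?g (x - y) + ?g x" for x
   using sh[of "x - y" y] sh[of x "- y"] y U(2) \<open>K \<subseteq> U\<close> by (auto simp: indicator_def)
  have "(LI x. \<bar>indicator A (x - y) - indicator A x\<bar>) <= (LI x. ?g (x - y) + ?g x)"
  proof (rule integral_mono')
   show "linteg (%x. ?g (x - y) + ?g x)" by (rule Bochner_Integration.integrable_add[OF gi' gi])
  qed (use pt in auto)
  also have "... = 2 * (LI x. ?g x)"
   using Bochner_Integration.integral_add[OF gi' gi] lebesgue_preserving_integral(1)[OF tr, of ?g] gi by auto
  also have "(LI x. ?g x) = measure lebesgue (A - K) + measure lebesgue (U - A)"
  proof -
   have "linteg (indicator (A - K) :: 'a => real)" "linteg (indicator (U - A) :: 'a => real)"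
    using AK U by (auto intro!: integrable_real_indicator simp: fmeasurable_def)
   from Bochner_Integration.integral_add[OF this] show ?thesis
    by simp
  qed
  finally show "(LI x. \<bar>indicator A (x - y) - indicator A x\<bar> :: real) <= e" using mK mU by simp
 qed
qed

lemma translation_continuous_L1:
 fixes f :: "'a::euclidean_space => real"
 assumes "linteg f"
 shows "\<forall>e>0. \<exists>d>0. \<forall>y. norm y < d --> (LI x. \<bar>f (x - y) - f x\<bar>) <= e"
 using assms
proof (induction rule: integrable_induct)
 case (base A c)
 show ?case
 proof (intro allI impI)
  fix e :: real assume e: "e > 0"
  obtain d where d: "d > 0" "!!y. norm y < d ==>
    (LI x. \<bar>indicator A (x - y) - indicator A x\<bar> :: real) <= e / (\<bar>c\<bar> + 1)"
   using translation_continuous_indicator[OF base, of "e / (\<bar>c\<bar> + 1)"] e by auto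
  show "\<exists>d>0. \<forall>y. norm y < d --> (LI x. \<bar>indicator A (x - y) *\<^sub>R c - indicator A x *\<^sub>R c\<bar>) <= e"
  proof (intro exI[of _ d] conjI allI impI d)
   fix y :: 'a assume y: "norm y < d"
   have "(LI x. \<bar>indicator A (x - y) *\<^sub>R c - indicator A x *\<^sub>R c\<bar>) =
     (LI x. \<bar>indicator A (x - y) - indicator A x :: real\<bar> * \<bar>c\<bar>)"
    by (intro Bochner_Integration.integral_cong) (auto simp: indicator_def)
   also have "... = (LI x. \<bar>indicator A (x - y) - indicator A x :: real\<bar>) * \<bar>c\<bar>"
    by simp
   also have "... <= e / (\<bar>c\<bar> + 1) * \<bar>c\<bar>" using d(2)[OF y] by (intro mult_right_mono) auto
   also have "... <= e" using e by (simp add: field_simps)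
   finally show "(LI x. \<bar>indicator A (x - y) *\<^sub>R c - indicator A x *\<^sub>R c\<bar>) <= e" .
  qed
 qed
next
 case (add f g)
 show ?case
 proof (intro allI impI)
  fix e :: real assume e: "e > 0"
  have e2: "e / 2 > 0" using e by simp
  obtain d1 where d1: "d1 > 0" "!!y. norm y < d1 ==> (LI x. \<bar>f (x - y) - f x\<bar>) <= e / 2"
   using add.IH(1)[rule_format, OF e2] by blast
  obtain d2 where d2: "d2 > 0" "!!y. norm y < d2 ==> (LI x. \<bar>g (x - y) - g x\<bar>) <= e / 2"
   using add.IH(2)[rule_format, OF e2] by blast
  note d = d1 d2
  show "\<exists>d>0. \<forall>y. norm y < d --> (LI x. \<bar>f (x - y) + g (x - y) - (f x + g x)\<bar>) <= e"
  proof (intro exI[of _ "min d1 d2"] conjI allI impI)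
   fix y :: 'a assume y: "norm y < min d1 d2"
   have i: "linteg (%x. \<bar>f (x - y) - f x\<bar>)" "linteg (%x. \<bar>g (x - y) - g x\<bar>)"
    using add.hyps lebesgue_preserving_integral(2)[OF lebesgue_preserving_translation, of f y]
     lebesgue_preserving_integral(2)[OF lebesgue_preserving_translation, of g y] by auto
   have "(LI x. \<bar>f (x - y) + g (x - y) - (f x + g x)\<bar>) <=
    (LI x. \<bar>f (x - y) - f x\<bar> + \<bar>g (x - y) - g x\<bar>)"
    by (rule integral_mono') (use i in auto)
   also have "... <= e" using i d(2)[of y] d(4)[of y] y by simp
   finally show "(LI x. \<bar>f (x - y) + g (x - y) - (f x + g x)\<bar>) <= e" .
  qed (use d in auto)
 qed
next
 case (lim f s)
 have conv: "(%i. LI x. \<bar>s i x - f x\<bar>) \<longlonglongrightarrow> (LINT x|(lebesgue::'a measure). 0)"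
 proof (rule integral_dominated_convergence[where w = "%x. 3 * \<bar>f x\<bar>"])
  show "AE x in lebesgue. (%i. \<bar>s i x - f x\<bar>) \<longlonglongrightarrow> 0"
  proof (rule AE_I2)
   fix x :: 'a assume "x \<in> space lebesgue"
   then have "(%i. \<bar>s i x - f x\<bar>) \<longlonglongrightarrow> \<bar>f x - f x\<bar>" by (intro tendsto_intros lim)
   then show "(%i. \<bar>s i x - f x\<bar>) \<longlonglongrightarrow> 0" by simp
  qed
  show "AE x in lebesgue. norm \<bar>s i x - f x\<bar> <= 3 * \<bar>f x\<bar>" for i
  proof (rule AE_I2)
   fix x :: 'a assume "x \<in> space lebesgue"
   then have "norm (s i x) <= 2 * norm (f x)" by (rule lim.hyps(3))
   then show "norm \<bar>s i x - f x\<bar> <= 3 * \<bar>f x\<bar>" unfolding real_norm_def by linarith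
  qed
 qed (use lim.hyps in auto)
 show ?case
 proof (intro allI impI)
  fix e :: real assume e: "e > 0"
  obtain i where "\<bar>(LI x. \<bar>s i x - f x\<bar>)\<bar> < e / 3"
   using LIMSEQ_D[OF conv, of "e / 3"] e by auto
  then have i: "(LI x. \<bar>s i x - f x\<bar>) <= e / 3" by simp
  obtain d where d: "d > 0" "!!y. norm y < d ==> (LI x. \<bar>s i (x - y) - s i x\<bar>) <= e / 3"
   using lim.IH[of i, rule_format, of "e / 3"] e by auto
  show "\<exists>d>0. \<forall>y. norm y < d --> (LI x. \<bar>f (x - y) - f x\<bar>) <= e"
  proof (intro exI[of _ d] conjI allI impI d)
   fix y :: 'a assume y: "norm y < d"
   note tr = lebesgue_preserving_integral[OF lebesgue_preserving_translation, where a1 = y]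
   have I: "linteg (%x. \<bar>s i x - f x\<bar>)" using lim.hyps by auto
   have i1: "linteg (%x. \<bar>s i (x - y) - f (x - y)\<bar>)"
    using tr(2)[of "%x. \<bar>s i x - f x\<bar>"] I by auto
   have i2: "linteg (%x. \<bar>s i (x - y) - s i x\<bar>)"
    using tr(2)[of "s i"] lim.hyps by auto
   have "(LI x. \<bar>f (x - y) - f x\<bar>) <=
    (LI x. \<bar>s i (x - y) - f (x - y)\<bar> + \<bar>s i (x - y) - s i x\<bar> + \<bar>s i x - f x\<bar>)"
    by (rule integral_mono') (use i1 i2 I in auto)
   also have "... = (LI x. \<bar>s i x - f x\<bar>) + (LI x. \<bar>s i (x - y) - s i x\<bar>) + (LI x. \<bar>s i x - f x\<bar>)"
    using tr(1)[of "%x. \<bar>s i x - f x\<bar>"] I i1 i2 by auto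
   also have "... <= e" using i d(2)[OF y] by simp
   finally show "(LI x. \<bar>f (x - y) - f x\<bar>) <= e" .
  qed
 qed
qed

lemma translation_continuous_L2:
 fixes f :: "'a::euclidean_space => real"
 assumes m: "f \<in> lmeas" and i: "linteg (%x. (f x)^2)" and e: "e > 0"
 shows "\<exists>d>0. \<forall>y. norm y < d --> linteg (%x. (f (x - y) - f x)^2) \<and>
   (LI x. (f (x - y) - f x)^2) <= e"
proof -
 define s where "s k x = (if norm x <= real k \<and> \<bar>f x\<bar> <= real k then f x else 0)" for k x
 have sm: "(%x. s k x) \<in> lmeas" for k
 proof -
  have "f -` {- real k..real k} \<in> sets lebesgue" using measurable_sets[OF m, of "{- real k..real k}"] by simp
  moreover have "{x \<in> space lebesgue. norm x <= real k \<and> \<bar>f x\<bar> <= real k} = cball 0 (real k) \<inter> f -` {- real k..real k}"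
   by (auto simp: abs_le_iff)
  ultimately have P: "{x \<in> space lebesgue. norm x <= real k \<and> \<bar>f x\<bar> <= real k} \<in> sets lebesgue" by auto
  show ?thesis unfolding s_def[abs_def] by (rule measurable_If[OF m borel_measurable_const P])
 qed
 have conv: "(%k. LI x. (s k x - f x)^2) \<longlonglongrightarrow> (LINT x|(lebesgue::'a measure). 0)"
 proof (rule integral_dominated_convergence[where w = "%x. (f x)^2"])
  show "AE x in lebesgue. (%k. (s k x - f x)^2) \<longlonglongrightarrow> 0"
  proof (rule AE_I2)
   fix x
   obtain K where K: "max (norm x) \<bar>f x\<bar> <= real K" using real_arch_simple by blast
   have "\<forall>\<^sub>F k in sequentially. (s k x - f x)^2 = 0"
    using eventually_ge_at_top[of K]
   proof eventually_elim
    case (elim k)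
    then have "real K <= real k" by simp
    then show ?case using K by (auto simp: s_def)
   qed
   then show "(%k. (s k x - f x)^2) \<longlonglongrightarrow> 0" by (rule tendsto_eventually)
  qed
  show "(%x. (s k x - f x)^2) \<in> lmeas" for k
   using sm m by (intro borel_measurable_power borel_measurable_diff)
  show "AE x in lebesgue. norm ((s k x - f x)^2) <= (f x)^2" for k by (auto simp: s_def)
 qed (use i in auto)
 obtain k where "\<bar>LI x. (s k x - f x)^2\<bar> < e / 9"
  using LIMSEQ_D[OF conv, of "e / 9"] e by auto
 then have k: "(LI x. (s k x - f x)^2) <= e / 9" by simp
 have I: "linteg (%x. (s k x - f x)^2)"
 proof (rule Bochner_Integration.integrable_bound[OF i])
  show "(%x. (s k x - f x)^2) \<in> lmeas"
   using sm m by (intro borel_measurable_power borel_measurable_diff)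
  show "AE x in lebesgue. norm ((s k x - f x)^2) <= norm ((f x)^2)" by (auto simp: s_def)
 qed
 have sb: "\<bar>s k x\<bar> <= real k" for x by (auto simp: s_def)
 have si: "linteg (s k)"
 proof (rule Bochner_Integration.integrable_bound)
  show "linteg (%x. real k * indicator (cball 0 (real k)) x :: real)"
   by (rule integrable_mult_right) (rule integrable_indicator_cball)
  show "s k \<in> lmeas" by (rule sm)
  show "AE x in lebesgue. norm (s k x) <= norm (real k * indicator (cball 0 (real k)) x :: real)"
   by (auto simp: s_def)
 qed
 have e9: "e / (9 * (2 * real k + 1)) > 0" using e by simp
 obtain d where d: "d > 0" "!!y. norm y < d ==> (LI x. \<bar>s k (x - y) - s k x\<bar>) <= e / (9 * (2 * real k + 1))"
  using translation_continuous_L1[OF si, rule_format, OF e9] by blast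
 show ?thesis
 proof (intro exI[of _ d] conjI allI impI d)
  fix y :: 'a assume y: "norm y < d"
  note tr = lebesgue_preserving_integral[OF lebesgue_preserving_translation, where a1 = y]
  have i1: "linteg (%x. (s k (x - y) - f (x - y))^2)"
   using tr(2)[of "%x. (s k x - f x)^2"] I by auto
  have i2: "linteg (%x. \<bar>s k (x - y) - s k x\<bar>)"
   using tr(2)[of "s k"] si by auto
  let ?w = "%x. 3 * (s k (x - y) - f (x - y))^2 + 3 * (2 * real k * \<bar>s k (x - y) - s k x\<bar>) + 3 * (s k x - f x)^2"
  have wi: "linteg ?w" using i1 i2 I by auto
  have pt: "(f (x - y) - f x)^2 <= ?w x" for x
  proof -
   define a b c where "a = f (x - y) - s k (x - y)" and "b = s k (x - y) - s k x" and "c = s k x - f x"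
   have F1: "f (x - y) - f x = a + b + c" by (simp add: a_def b_def c_def)
   have F2: "(a + b + c)^2 <= 3 * a^2 + 3 * b^2 + 3 * c^2"
   proof -
    have "0 <= (a - b)^2 + (b - c)^2 + (a - c)^2" by simp
    then show ?thesis by (simp add: power2_eq_square algebra_simps)
   qed
   have F3: "b\<^sup>2 <= 2 * real k * \<bar>b\<bar>"
   proof -
    have "\<bar>b\<bar> <= 2 * real k" using sb[of x] sb[of "x - y"] by (simp add: b_def)
    then have "\<bar>b\<bar> * \<bar>b\<bar> <= 2 * real k * \<bar>b\<bar>" by (intro mult_right_mono) auto
    then show ?thesis by (simp add: power2_eq_square)
   qed
   have F4: "a\<^sup>2 = (s k (x - y) - f (x - y))^2" by (simp add: a_def power2_commute)
   have "(a + b + c)^2 <= 3 * a^2 + 3 * (2 * real k * \<bar>b\<bar>) + 3 * c^2" using F2 F3 by linarith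
   then show ?thesis unfolding F1[symmetric] F4 unfolding b_def c_def .
  qed
  have mf: "(%x. (f (x - y) - f x)^2) \<in> lmeas"
   using tr(3)[OF m] m by auto
  show ii: "linteg (%x. (f (x - y) - f x)^2)"
  proof (rule Bochner_Integration.integrable_bound[OF wi mf])
   show "AE x in lebesgue. norm ((f (x - y) - f x)^2) <= norm (?w x)"
   proof (rule AE_I2)
    fix x
    show "norm ((f (x - y) - f x)^2) <= norm (?w x)"
     using order_trans[OF pt[of x] abs_ge_self] unfolding real_norm_def abs_power2 .
   qed
  qed
  have "(LI x. (f (x - y) - f x)^2) <= (LI x. ?w x)"
   using ii wi pt by (rule integral_mono)
  also have "... = 3 * (LI x. (s k (x - y) - f (x - y))^2) +
    3 * (2 * real k * (LI x. \<bar>s k (x - y) - s k x\<bar>)) + 3 * (LI x. (s k x - f x)^2)"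
   using i1 i2 I by simp
  also have "... = 6 * (LI x. (s k x - f x)^2) +
    3 * (2 * real k * (LI x. \<bar>s k (x - y) - s k x\<bar>))"
   using tr(1)[of "%x. (s k x - f x)^2"] I by auto
  also have "... <= 6 * (e / 9) + 3 * (e / 9)"
  proof -
   have "2 * real k * (LI x. \<bar>s k (x - y) - s k x\<bar>) <= 2 * real k * (e / (9 * (2 * real k + 1)))"
    using d(2)[OF y] by (intro mult_left_mono) auto
   also have "... <= e / 9" using e by (simp add: field_simps)
   finally show ?thesis using k by linarith
  qed
  finally show "(LI x. (f (x - y) - f x)^2) <= e" by simp
 qed
qed

definition convol :: "('a::euclidean_space => real) => ('a => real) => 'a => real" where
 "convol f \<phi> x = (LI y. f y * \<phi> (x - y))"

definition mollifier :: "real => ('a::euclidean_space => real) => bool" where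
 "mollifier \<epsilon> \<eta> \<longleftrightarrow> \<eta> \<in> testfuns \<and> (\<forall>y. \<eta> y >= 0) \<and>
   (\<forall>y. norm y >= \<epsilon> --> \<eta> y = 0) \<and> (LI y. \<eta> y) = 1"

lemma test_borel: "\<phi> \<in> test_functions \<Omega> ==> \<phi> \<in> borel_measurable borel"
 using test_continuous[of \<phi> \<Omega> UNIV] by (rule borel_measurable_continuous_onI)

lemma test_integrable:
 fixes \<phi> :: "'a::euclidean_space => real"
 assumes "\<phi> \<in> test_functions \<Omega>"
 shows "linteg \<phi>"
proof -
 from assms obtain K where K: "compact K" "!!x. x \<notin> K ==> \<phi> x = 0"
  unfolding test_functions_def by blast
 have "integrable lborel (%x. indicator K x *\<^sub>R \<phi> x)"
  using K test_continuous[OF assms] by (intro borel_integrable_compact)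
 moreover have "(%x. indicator K x *\<^sub>R \<phi> x) = \<phi>"
 proof
  show "indicator K x *\<^sub>R \<phi> x = \<phi> x" for x using K(2)[of x] by (cases "x \<in> K") auto
 qed
 ultimately show ?thesis using test_borel[OF assms] by (simp add: integrable_completion)
qed

lemma test_bounded:
 fixes \<phi> :: "'a::euclidean_space => real"
 assumes "\<phi> \<in> test_functions \<Omega>"
 obtains C where "C >= 0" "!!x. \<bar>\<phi> x\<bar> <= C"
proof -
 from assms obtain K where K: "compact K" "!!x. x \<notin> K ==> \<phi> x = 0"
  unfolding test_functions_def by blast
 have "compact (\<phi> ` K)" using K test_continuous[OF assms] by (intro compact_continuous_image)
 then obtain C where "!!x. x \<in> K ==> \<bar>\<phi> x\<bar> <= C"
  by (meson bounded_real compact_imp_bounded imageI)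
 then have "\<bar>\<phi> x\<bar> <= max C 0" for x using K(2)[of x] by (cases "x \<in> K") (auto simp: max.coboundedI1)
 then show ?thesis using that[of "max C 0"] by auto
qed

lemma test_square_integrable:
 fixes \<phi> :: "'a::euclidean_space => real"
 assumes "\<phi> \<in> test_functions \<Omega>"
 shows "linteg (%x. (\<phi> x)^2)"
proof -
 obtain C where C: "C >= 0" "!!x. \<bar>\<phi> x\<bar> <= C" using test_bounded[OF assms] by blast
 show ?thesis
 proof (rule Bochner_Integration.integrable_bound)
  show "linteg (%x. C * \<bar>\<phi> x\<bar>)" using test_integrable[OF assms] by auto
  show "(%x. (\<phi> x)^2) \<in> lmeas"
   using test_borel[OF assms] by (simp add: measurable_completion)
  have "(\<phi> x)^2 <= C * \<bar>\<phi> x\<bar>" for x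
   using mult_right_mono[OF C(2)[of x], of "\<bar>\<phi> x\<bar>"] by (simp add: power2_eq_square)
  then show "AE x in lebesgue. norm ((\<phi> x)^2) <= norm (C * \<bar>\<phi> x\<bar>)"
   using C by (auto intro!: AE_I2 simp: abs_mult)
 qed
qed

lemma convol_commute:
 assumes "f \<in> lmeas" "\<phi> \<in> borel_measurable borel"
 shows "convol f \<phi> x = (LI y. f (x - y) * \<phi> y)"
proof -
 have "\<phi> \<in> lmeas" using assms(2) by (simp add: measurable_completion)
 then have m: "(%y. f y * \<phi> (x - y)) \<in> lmeas"
  using assms lebesgue_preserving_integral(3)[OF lebesgue_preserving_reflection, of \<phi> x] by auto
 show ?thesis
  using lebesgue_preserving_integral(1)[OF lebesgue_preserving_reflection m, of x]
  by (simp add: convol_def)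
qed

lemma convol_AE_cong:
 assumes "AE x in lebesgue. f x = g x" "g \<in> lmeas" "\<phi> \<in> borel_measurable borel"
 shows "convol f \<phi> x = convol g \<phi> x"
proof -
 have "\<phi> \<in> lmeas" using assms(3) by (simp add: measurable_completion)
 then have m: "(%y. \<phi> (x - y)) \<in> lmeas"
  using lebesgue_preserving_integral(3)[OF lebesgue_preserving_reflection, of \<phi> x] by auto
 have "f \<in> lmeas" using borel_measurable_lebesgue_AE_cong[OF assms(2,1)] .
 then show ?thesis unfolding convol_def
  by (intro integral_cong_AE) (use assms m in auto)
qed

text \<open>The error is an average of translation errors. The fundamental lemma needs this in \<open>L^1\<close> and the energy estimates need it in \<open>L^2\<close>, hence the exponent \<open>n\<close>.\<close>

lemma mollify_error_le:
 fixes f \<eta> :: "'a::euclidean_space => real"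
 assumes n: "n = 1 \<or> n = 2" and f[measurable]: "f \<in> borel_measurable borel" and \<eta>: "mollifier \<epsilon> \<eta>"
  and loc: "!!x. linteg (%y. f (x - y) * \<eta> y)"
  and tr: "!!y. norm y < \<epsilon> ==> (\<integral>\<^sup>+x. ennreal (\<bar>f (x - y) - f x\<bar> ^ n) \<partial>lborel) <= B"
 shows "(\<integral>\<^sup>+x. ennreal (\<bar>convol f \<eta> x - f x\<bar> ^ n) \<partial>lborel) <= B"
proof -
 have \<eta>t: "\<eta> \<in> testfuns" and \<eta>0: "!!y. \<eta> y >= 0" and \<eta>s: "!!y. norm y >= \<epsilon> ==> \<eta> y = 0"
  and \<eta>1: "(LI y. \<eta> y) = 1" using \<eta> by (auto simp: mollifier_def)
 have \<eta>b[measurable]: "\<eta> \<in> borel_measurable borel" by (rule test_borel[OF \<eta>t])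
 have \<eta>i: "integrable lborel \<eta>" using test_integrable[OF \<eta>t] \<eta>b by (simp add: integrable_completion)
 have \<eta>n: "(\<integral>\<^sup>+y. ennreal (\<eta> y) \<partial>lborel) = 1"
  using \<eta>1 \<eta>i \<eta>0 \<eta>b by (simp add: nn_integral_eq_integral integral_completion)
 have pt: "ennreal (\<bar>convol f \<eta> x - f x\<bar> ^ n) <= (\<integral>\<^sup>+y. ennreal (\<eta> y * \<bar>f (x - y) - f x\<bar> ^ n) \<partial>lborel)" for x
 proof -
  have l: "integrable lborel (%y. f (x - y) * \<eta> y)" using loc[of x] by (simp add: integrable_completion)
  have "convol f \<eta> x = (LINT y|lborel. f (x - y) * \<eta> y)"
   by (subst convol_commute) (auto simp: integral_completion measurable_completion)
  moreover have "f x = (LINT y|lborel. f x * \<eta> y)" using \<eta>1 by (simp add: integral_completion)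
  ultimately have "convol f \<eta> x - f x = (LINT y|lborel. f (x - y) * \<eta> y) - (LINT y|lborel. f x * \<eta> y)"
   by simp
  also have "... = (LINT y|lborel. \<eta> y * (f (x - y) - f x))"
   using l \<eta>i by (subst Bochner_Integration.integral_diff[symmetric]) (auto simp: algebra_simps)
  finally have eq: "convol f \<eta> x - f x = (LINT y|lborel. \<eta> y * (f (x - y) - f x))" .
  have "ennreal \<bar>convol f \<eta> x - f x\<bar> <= (\<integral>\<^sup>+y. ennreal \<bar>\<eta> y * (f (x - y) - f x)\<bar> \<partial>lborel)"
   unfolding eq using integral_norm_bound_ennreal[of lborel "%y. \<eta> y * (f (x - y) - f x)"] l \<eta>i
   by (simp add: algebra_simps)
  also have "... = (\<integral>\<^sup>+y. ennreal (\<eta> y * \<bar>f (x - y) - f x\<bar>) \<partial>lborel)"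
   by (simp add: abs_mult \<eta>0)
  finally have 1: "ennreal \<bar>convol f \<eta> x - f x\<bar> <= (\<integral>\<^sup>+y. ennreal (\<eta> y * \<bar>f (x - y) - f x\<bar>) \<partial>lborel)" .
  show ?thesis
  proof (cases "n = 1")
   case True
   then show ?thesis using 1 by simp
  next
   case False
   then have n2: "n = 2" using n by simp
   have "(ennreal \<bar>convol f \<eta> x - f x\<bar>)^2 <= (\<integral>\<^sup>+y. ennreal (\<eta> y * \<bar>f (x - y) - f x\<bar>) \<partial>lborel)^2"
    using 1 by (rule power_mono) simp
   also have "... = (\<integral>\<^sup>+y. ennreal (sqrt (\<eta> y)) * ennreal (sqrt (\<eta> y) * \<bar>f (x - y) - f x\<bar>) \<partial>lborel)^2"
    by (simp add: ennreal_mult[symmetric] \<eta>0 mult.assoc[symmetric])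
   also have "... <= (\<integral>\<^sup>+y. (ennreal (sqrt (\<eta> y)))^2 \<partial>lborel) * (\<integral>\<^sup>+y. (ennreal (sqrt (\<eta> y) * \<bar>f (x - y) - f x\<bar>))^2 \<partial>lborel)"
    by (rule Cauchy_Schwarz_nn_integral) auto
   also have "... = (\<integral>\<^sup>+y. ennreal (\<eta> y * \<bar>f (x - y) - f x\<bar>\<^sup>2) \<partial>lborel)"
    using \<eta>n by (simp add: ennreal_power \<eta>0 power_mult_distrib)
   finally show ?thesis using n2 by (simp add: ennreal_power)
  qed
 qed
 have "(\<integral>\<^sup>+x. ennreal (\<bar>convol f \<eta> x - f x\<bar> ^ n) \<partial>lborel) <=
   (\<integral>\<^sup>+x. (\<integral>\<^sup>+y. ennreal (\<eta> y * \<bar>f (x - y) - f x\<bar> ^ n) \<partial>lborel) \<partial>lborel)"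
  by (rule nn_integral_mono) (rule pt)
 also have "... = (\<integral>\<^sup>+y. (\<integral>\<^sup>+x. ennreal (\<eta> y * \<bar>f (x - y) - f x\<bar> ^ n) \<partial>lborel) \<partial>lborel)"
  by (rule lborel_pair.Fubini') measurable
 also have "... = (\<integral>\<^sup>+y. ennreal (\<eta> y) * (\<integral>\<^sup>+x. ennreal (\<bar>f (x - y) - f x\<bar> ^ n) \<partial>lborel) \<partial>lborel)"
  by (simp add: ennreal_mult \<eta>0 nn_integral_cmult)
 also have "... <= (\<integral>\<^sup>+y. ennreal (\<eta> y) * B \<partial>lborel)"
 proof (rule nn_integral_mono)
  fix y :: 'a
  show "ennreal (\<eta> y) * (\<integral>\<^sup>+x. ennreal (\<bar>f (x - y) - f x\<bar> ^ n) \<partial>lborel) <= ennreal (\<eta> y) * B"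
   using tr[of y] \<eta>s[of y] by (cases "norm y < \<epsilon>") (auto intro: mult_left_mono)
 qed
 also have "... = B" by (simp add: nn_integral_multc \<eta>n)
 finally show ?thesis .
qed

section \<open>Convolution with test functions\<close>

lemma radial_mollifier_exists:
 assumes "\<epsilon> > 0"
 obtains \<eta> :: "'a::euclidean_space => real" where "mollifier \<epsilon> \<eta>" "!!x y. norm x = norm y ==> \<eta> x = \<eta> y"
proof -
 obtain g :: "real => real" where g: "!!s. g s >= 0" "!!s. s < 1 ==> g s > 0" "!!s. s >= 1 ==> g s = 0"
  "!!\<epsilon>. \<epsilon> > 0 ==> (%y::'a. g ((norm y / \<epsilon>)^2)) \<in> testfuns"
  using radial_bump_exists[where 'a = 'a] by blast
 define \<eta>0 where "\<eta>0 y = g ((norm y / \<epsilon>)^2)" for y :: 'a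
 have t: "\<eta>0 \<in> testfuns" unfolding \<eta>0_def[abs_def] by (rule g(4)[OF assms])
 define c where "c = (LI y. \<eta>0 y)"
 have "c ~= 0"
 proof
  assume "c = 0"
  then have ae: "AE y in lebesgue. \<eta>0 y = 0"
   unfolding c_def using integral_nonneg_eq_0_iff_AE[OF test_integrable[OF t]] g(1) by (simp add: \<eta>0_def)
  have "ball (0::'a) \<epsilon> \<subseteq> {y. \<eta>0 y ~= 0}"
  proof
   fix y :: 'a assume "y \<in> ball 0 \<epsilon>"
   then have "norm y / \<epsilon> < 1" using assms by simp
   then have "(norm y / \<epsilon>)^2 < 1" using assms by (simp add: abs_square_less_1)
   then show "y \<in> {y. \<eta>0 y ~= 0}" using g(2) by (force simp: \<eta>0_def)
  qed
  moreover have "negligible {y. \<eta>0 y ~= 0}"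
   using ae by (simp add: negligible_iff_null_sets completion.AE_iff_null_sets)
  ultimately have "negligible (ball (0::'a) \<epsilon>)" using negligible_subset by blast
  then show False using assms open_not_negligible[of "ball (0::'a) \<epsilon>"] by simp
 qed
 moreover have "c >= 0" unfolding c_def by (rule integral_nonneg_AE) (auto intro!: AE_I2 simp: \<eta>0_def g)
 ultimately have c: "c > 0" by simp
 have t1: "(%x. \<Sum>i\<in>{()}. (1 / c) * \<eta>0 x) \<in> testfuns" by (rule test_sum) (use t in auto)
 show ?thesis
 proof (rule that[of "%y. (1 / c) * \<eta>0 y"])
  show "mollifier \<epsilon> (%y. (1 / c) * \<eta>0 y)"
   unfolding mollifier_def
  proof (intro conjI allI impI)
   show "(%y. (1 / c) * \<eta>0 y) \<in> testfuns" using t1 by simp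
   show "0 <= (1 / c) * \<eta>0 y" for y using c g by (simp add: \<eta>0_def)
   show "(1 / c) * \<eta>0 y = 0" if "norm y >= \<epsilon>" for y
   proof -
    have "1 <= norm y / \<epsilon>" using that assms by simp
    then have "1 <= (norm y / \<epsilon>)^2" by simp
    then show ?thesis using g(3) by (simp add: \<eta>0_def)
   qed
   show "(LI y. (1 / c) * \<eta>0 y) = 1" using c by (simp add: c_def[symmetric])
  qed
  show "(1 / c) * \<eta>0 x = (1 / c) * \<eta>0 y" if "norm x = norm y" for x y using that by (simp add: \<eta>0_def)
 qed
qed

lemma test_support:
 fixes \<phi> :: "'a::euclidean_space => real"
 assumes "\<phi> \<in> test_functions \<Omega>"
 obtains M where "M > 0" "!!x. norm x > M ==> \<phi> x = 0"
proof -
 from assms obtain K where K: "compact K" "!!x. x \<notin> K ==> \<phi> x = 0"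
  unfolding test_functions_def by blast
 obtain M where M: "!!x. x \<in> K ==> norm x <= M" using compact_imp_bounded[OF K(1)] by (auto simp: bounded_iff)
 show ?thesis
 proof (rule that[of "max M 1"])
  show "\<phi> x = 0" if "norm x > max M 1" for x using K(2)[of x] M[of x] that by auto
 qed simp
qed

lemma test_dir_deriv:
 assumes "\<phi> \<in> test_functions \<Omega>"
 shows "((%s. \<phi> (x + s *\<^sub>R h)) has_deriv pd h \<phi> (x + s *\<^sub>R h)) (at s)"
proof -
 have "((%s. x + s *\<^sub>R h) has_derivative (%k. k *\<^sub>R h)) (at s)" by (auto intro!: derivative_eq_intros)
 from has_derivative_compose[OF this test_has_derivative[OF assms]]
 have 1: "((%s. \<phi> (x + s *\<^sub>R h)) has_derivative (%k. pd (k *\<^sub>R h) \<phi> (x + s *\<^sub>R h))) (at s)" .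
 have d: "\<phi> differentiable at y" for y using smooth_differentiable[OF test_smooth[OF assms]] .
 have "pd (k *\<^sub>R h) \<phi> y = k * pd h \<phi> y" for k y
  unfolding partial_deriv_def using linear_scale[OF linear_frechet_derivative[OF d]] by simp
 then show ?thesis using 1 unfolding has_field_derivative_def by (simp add: mult_commute_abs)
qed

lemma test_lipschitz:
 fixes \<phi> :: "'a::euclidean_space => real"
 assumes "\<phi> \<in> test_functions \<Omega>"
 obtains L where "L >= 0" "!!x h. \<bar>\<phi> (x + h) - \<phi> x\<bar> <= L * norm h"
proof -
 have "\<forall>b\<in>Basis. \<exists>C\<ge>0. \<forall>x. \<bar>pd b \<phi> x\<bar> <= C"
  using test_bounded[OF test_partial_deriv[OF assms]] by metis
 then obtain C where C: "\<forall>b\<in>Basis. C b >= 0 \<and> (\<forall>x. \<bar>pd b \<phi> x\<bar> <= C b)" by metis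
 define L where "L = (\<Sum>b\<in>Basis. C b)"
 show ?thesis
 proof (rule that[of L])
  show "L >= 0" unfolding L_def using C by (intro sum_nonneg) auto
  fix x h :: 'a
  obtain z where z: "\<phi> (x + 1 *\<^sub>R h) - \<phi> (x + 0 *\<^sub>R h) = (1 - 0) * pd h \<phi> (x + z *\<^sub>R h)"
   using MVT2[of 0 1 "%s. \<phi> (x + s *\<^sub>R h)" "%s. pd h \<phi> (x + s *\<^sub>R h)"] test_dir_deriv[OF assms] by auto
  have "\<bar>pd h \<phi> y\<bar> <= L * norm h" for y
  proof -
   have "pd h \<phi> y = (\<Sum>b\<in>Basis. (h \<bullet> b) * pd b \<phi> y)"
    by (rule partial_deriv_Basis_sum) (rule smooth_differentiable[OF test_smooth[OF assms]])
   also have "\<bar>...\<bar> <= (\<Sum>b\<in>Basis. \<bar>(h \<bullet> b) * pd b \<phi> y\<bar>)" by (rule sum_abs)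
   also have "... <= (\<Sum>b\<in>Basis. norm h * C b)"
    unfolding abs_mult using C by (intro sum_mono mult_mono Basis_le_norm) auto
   finally show ?thesis by (simp add: L_def sum_distrib_left mult.commute)
  qed
  then show "\<bar>\<phi> (x + h) - \<phi> x\<bar> <= L * norm h" using z by simp
 qed
qed

context
 fixes f :: "'a::euclidean_space => real"
 assumes li: "locally_integrable UNIV f"
begin

lemma cball_integrable: "linteg (%y. indicator (cball a r) y * \<bar>f y\<bar>)"
proof -
 have "set_integrable lebesgue (cball a r) f" using li by (simp add: locally_integrable_def)
 then have "linteg (%y. \<bar>indicator (cball a r) y *\<^sub>R f y\<bar>)" unfolding set_integrable_def by (rule integrable_abs)
 then show ?thesis by (simp add: abs_mult)
qed

lemma locally_integrable_measurable: "f \<in> lmeas"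
proof (rule borel_measurable_LIMSEQ_real)
 have "set_integrable lebesgue (cball 0 (real n)) f" for n using li by (simp add: locally_integrable_def)
 then show "(%x. indicator (cball 0 (real n)) x *\<^sub>R f x) \<in> lmeas" for n
  unfolding set_integrable_def by (rule borel_measurable_integrable)
 fix x :: 'a
 obtain k where k: "norm x <= real k" using real_arch_simple by blast
 have "\<forall>\<^sub>F n in sequentially. indicator (cball 0 (real n)) x *\<^sub>R f x = f x"
  using eventually_ge_at_top[of k]
 proof eventually_elim
  case (elim n)
  then have "norm x <= real n" using k by linarith
  then show ?case by simp
 qed
 then show "(%n. indicator (cball 0 (real n)) x *\<^sub>R f x) \<longlonglongrightarrow> f x" by (rule tendsto_eventually)
qed

lemma bounded_kernel_integral:
 assumes k: "k \<in> lmeas" and b: "!!y. \<bar>k y\<bar> <= C * indicator (cball a r) y"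
 shows "linteg (%y. f y * k y)"
  and "\<bar>LI y. f y * k y\<bar> <= C * (LI y. indicator (cball a r) y * \<bar>f y\<bar>)"
proof -
 have pt: "\<bar>f y * k y\<bar> <= C * (indicator (cball a r) y * \<bar>f y\<bar>)" for y
  using mult_left_mono[OF b[of y], of "\<bar>f y\<bar>"] by (simp add: abs_mult mult_ac)
 have ii: "linteg (%y. C * (indicator (cball a r) y * \<bar>f y\<bar>))"
  by (rule integrable_mult_right) (rule cball_integrable)
 show i: "linteg (%y. f y * k y)"
 proof (rule Bochner_Integration.integrable_bound[OF ii])
  show "(%y. f y * k y) \<in> lmeas"
   by (rule borel_measurable_times[OF locally_integrable_measurable k])
  show "AE y in lebesgue. norm (f y * k y) <= norm (C * (indicator (cball a r) y * \<bar>f y\<bar>))"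
  proof (rule AE_I2)
   fix y show "norm (f y * k y) <= norm (C * (indicator (cball a r) y * \<bar>f y\<bar>))"
    using order_trans[OF pt[of y] abs_ge_self] unfolding real_norm_def .
  qed
 qed
 have "\<bar>LI y. f y * k y\<bar> <= (LI y. \<bar>f y * k y\<bar>)" by (rule integral_abs_bound)
 also have "... <= (LI y. C * (indicator (cball a r) y * \<bar>f y\<bar>))"
  by (rule integral_mono[OF integrable_abs[OF i] ii]) (rule pt)
 finally show "\<bar>LI y. f y * k y\<bar> <= C * (LI y. indicator (cball a r) y * \<bar>f y\<bar>)" by simp
qed

lemma reflect_measurable:
 "\<phi> \<in> test_functions \<Omega> ==> (%y. \<phi> (x - y)) \<in> lmeas"
 using lebesgue_preserving_integral(3)[OF lebesgue_preserving_reflection, of \<phi> x] test_borel[of \<phi> \<Omega>]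
 by (simp add: measurable_completion)

lemma convol_integrable:
 assumes \<phi>: "\<phi> \<in> test_functions \<Omega>"
 shows "linteg (%y. f y * \<phi> (x - y))"
proof -
 obtain C where C: "C >= 0" "!!x. \<bar>\<phi> x\<bar> <= C" using test_bounded[OF \<phi>] by blast
 obtain M where M: "M > 0" "!!x. norm x > M ==> \<phi> x = 0" using test_support[OF \<phi>] by blast
 show ?thesis
 proof (rule bounded_kernel_integral(1)[OF reflect_measurable[OF \<phi>], where C = C and a = x and r = M])
  show "\<bar>\<phi> (x - y)\<bar> <= C * indicator (cball x M) y" for y
   using C M(2)[of "x - y"] by (cases "y \<in> cball x M") (auto simp: dist_norm)
 qed
qed

lemma convol_continuous:
 assumes \<phi>: "\<phi> \<in> test_functions \<Omega>"
 shows "continuous_on UNIV (convol f \<phi>)"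
proof -
 obtain L where L: "L >= 0" "!!x h. \<bar>\<phi> (x + h) - \<phi> x\<bar> <= L * norm h" using test_lipschitz[OF \<phi>] by blast
 obtain M where M: "M > 0" "!!x. norm x > M ==> \<phi> x = 0" using test_support[OF \<phi>] by blast
 have "isCont (convol f \<phi>) x" for x
 proof -
  define I where "I = (LI y. indicator (cball x (M + 1)) y * \<bar>f y\<bar>)"
  have bd: "\<bar>convol f \<phi> x' - convol f \<phi> x\<bar> <= L * norm (x' - x) * I" if x': "norm (x' - x) < 1" for x'
  proof -
   have "convol f \<phi> x' - convol f \<phi> x = (LI y. f y * (\<phi> (x' - y) - \<phi> (x - y)))"
    unfolding convol_def using Bochner_Integration.integral_diff[OF convol_integrable[OF \<phi>, of x'] convol_integrable[OF \<phi>, of x]]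
    by (simp add: right_diff_distrib)
   also have "\<bar>...\<bar> <= (L * norm (x' - x)) * (LI y. indicator (cball x (M + 1)) y * \<bar>f y\<bar>)"
   proof (rule bounded_kernel_integral(2))
    show "(%y. \<phi> (x' - y) - \<phi> (x - y)) \<in> lmeas"
     by (intro borel_measurable_diff reflect_measurable[OF \<phi>])
    fix y
    show "\<bar>\<phi> (x' - y) - \<phi> (x - y)\<bar> <= L * norm (x' - x) * indicator (cball x (M + 1)) y"
    proof (cases "y \<in> cball x (M + 1)")
     case True
     then show ?thesis using L(2)[of "x - y" "x' - x"] by (simp add: algebra_simps)
    next
     case False
     then have "norm (x - y) > M + 1" by (simp add: dist_norm)
     moreover have "norm (x - y) <= norm (x' - y) + norm (x' - x)"
      using norm_triangle_ineq4[of "x' - y" "x' - x"] by simp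
     ultimately have "norm (x' - y) > M" "norm (x - y) > M" using x' by linarith+
     then show ?thesis using M(2) False by simp
    qed
   qed
   finally show ?thesis by (simp add: I_def)
  qed
  have "((%x'. L * norm (x' - x) * I) ---> L * norm (x - x) * I) (at x)" by (intro tendsto_intros)
  then have lim: "((%x'. L * norm (x' - x) * I) ---> 0) (at x)" by simp
  have ev: "\<forall>\<^sub>F x' in at x. norm (convol f \<phi> x' - convol f \<phi> x) <= L * norm (x' - x) * I"
  proof -
   have "\<forall>\<^sub>F x' in at x. dist x' x < 1" using eventually_at[of _ x UNIV] by (auto intro!: exI[of _ 1])
   then show ?thesis by eventually_elim (use bd in \<open>auto simp: dist_norm\<close>)
  qed
  have "((%x'. convol f \<phi> x' - convol f \<phi> x) ---> 0) (at x)"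
   by (rule Lim_null_comparison[OF ev lim])
  then show ?thesis unfolding isCont_def by (simp add: Lim_null[symmetric])
 qed
 then show ?thesis by (simp add: continuous_on_eq_continuous_at)
qed

lemma convol_dir_deriv_0:
 assumes \<phi>: "\<phi> \<in> test_functions \<Omega>"
 shows "((%s. convol f \<phi> (x + s *\<^sub>R h)) has_deriv convol f (pd h \<phi>) x) (at 0)"
proof -
 have p1: "pd h \<phi> \<in> test_functions \<Omega>" by (rule test_partial_deriv[OF \<phi>])
 obtain L where L: "L >= 0" "!!x k. \<bar>pd h \<phi> (x + k) - pd h \<phi> x\<bar> <= L * norm k"
  using test_lipschitz[OF p1] by blast
 obtain M where M: "M > 0" "!!x. norm x > M ==> \<phi> x = 0" using test_support[OF \<phi>] by blast
 obtain M' where M': "M' > 0" "!!x. norm x > M' ==> pd h \<phi> x = 0" using test_support[OF p1] by blast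
 define r where "r = max M M' + norm h"
 define I where "I = (LI y. indicator (cball x r) y * \<bar>f y\<bar>)"
 have taylor: "\<bar>(\<phi> (z + s *\<^sub>R h) - \<phi> z) / s - pd h \<phi> z\<bar> <= L * norm h * \<bar>s\<bar>" if "s ~= 0" for z s
 proof -
  have "\<exists>q. \<bar>q\<bar> <= \<bar>s\<bar> \<and> \<phi> (z + s *\<^sub>R h) - \<phi> z = s * pd h \<phi> (z + q *\<^sub>R h)"
  proof (cases "s > 0")
   case True
   obtain q where "0 < q" "q < s" "\<phi> (z + s *\<^sub>R h) - \<phi> (z + 0 *\<^sub>R h) = (s - 0) * pd h \<phi> (z + q *\<^sub>R h)"
    using MVT2[OF True, of "%s. \<phi> (z + s *\<^sub>R h)" "%s. pd h \<phi> (z + s *\<^sub>R h)"] test_dir_deriv[OF \<phi>] by auto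
   then show ?thesis by (intro exI[of _ q]) auto
  next
   case False
   then have "s < 0" using that by simp
   obtain q where "s < q" "q < 0" "\<phi> (z + 0 *\<^sub>R h) - \<phi> (z + s *\<^sub>R h) = (0 - s) * pd h \<phi> (z + q *\<^sub>R h)"
    using MVT2[OF \<open>s < 0\<close>, of "%s. \<phi> (z + s *\<^sub>R h)" "%s. pd h \<phi> (z + s *\<^sub>R h)"] test_dir_deriv[OF \<phi>] by auto
   then show ?thesis by (intro exI[of _ q]) auto
  qed
  then obtain q where q: "\<bar>q\<bar> <= \<bar>s\<bar>" "\<phi> (z + s *\<^sub>R h) - \<phi> z = s * pd h \<phi> (z + q *\<^sub>R h)" by blast
  then have "(\<phi> (z + s *\<^sub>R h) - \<phi> z) / s - pd h \<phi> z = pd h \<phi> (z + q *\<^sub>R h) - pd h \<phi> z"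
   using that by simp
  also have "\<bar>...\<bar> <= L * norm (q *\<^sub>R h)" by (rule L(2))
  also have "... <= L * (\<bar>s\<bar> * norm h)" using q L(1) by (intro mult_left_mono) (auto intro: mult_right_mono)
  finally show ?thesis by (simp add: mult_ac)
 qed
 have bd: "\<bar>(convol f \<phi> (x + s *\<^sub>R h) - convol f \<phi> x) / s - convol f (pd h \<phi>) x\<bar> <= L * norm h * \<bar>s\<bar> * I"
  if s: "s ~= 0" "\<bar>s\<bar> <= 1" for s
 proof -
  let ?k = "%y. (\<phi> ((x - y) + s *\<^sub>R h) - \<phi> (x - y)) / s - pd h \<phi> (x - y)"
  have e: "x + s *\<^sub>R h - y = (x - y) + s *\<^sub>R h" for y by simp
  have i1: "linteg (%y. f y * \<phi> ((x - y) + s *\<^sub>R h))" using convol_integrable[OF \<phi>, of "x + s *\<^sub>R h"] unfolding e .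
  note i2 = convol_integrable[OF \<phi>, of x] and i3 = convol_integrable[OF p1, of x]
  have "(LI y. f y * ?k y) = (LI y. (f y * \<phi> ((x - y) + s *\<^sub>R h) - f y * \<phi> (x - y)) / s - f y * pd h \<phi> (x - y))"
   by (rule Bochner_Integration.integral_cong) (simp_all add: algebra_simps diff_divide_distrib)
  also have "... = (convol f \<phi> (x + s *\<^sub>R h) - convol f \<phi> x) / s - convol f (pd h \<phi>) x"
   unfolding convol_def e using i1 i2 i3 by simp
  finally have "(convol f \<phi> (x + s *\<^sub>R h) - convol f \<phi> x) / s - convol f (pd h \<phi>) x = (LI y. f y * ?k y)" by simp
  also have "\<bar>...\<bar> <= (L * norm h * \<bar>s\<bar>) * (LI y. indicator (cball x r) y * \<bar>f y\<bar>)"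
  proof (rule bounded_kernel_integral(2))
   have "(%y. \<phi> ((x - y) + s *\<^sub>R h)) \<in> lmeas" using reflect_measurable[OF \<phi>, of "x + s *\<^sub>R h"] unfolding e .
   then show "?k \<in> lmeas"
    using reflect_measurable[OF \<phi>, of x] reflect_measurable[OF p1, of x]
    by (intro borel_measurable_diff borel_measurable_divide borel_measurable_const)
   fix y
   show "\<bar>?k y\<bar> <= L * norm h * \<bar>s\<bar> * indicator (cball x r) y"
   proof (cases "y \<in> cball x r")
    case True
    then show ?thesis using taylor[OF s(1), of "x - y"] by simp
   next
    case False
    then have n: "norm (x - y) > r" by (simp add: dist_norm)
    have "norm (x - y) <= norm ((x - y) + s *\<^sub>R h) + \<bar>s\<bar> * norm h"
     using norm_triangle_ineq4[of "(x - y) + s *\<^sub>R h" "s *\<^sub>R h"] by simp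
    moreover have "\<bar>s\<bar> * norm h <= norm h" using s(2) by (simp add: mult_left_le_one_le)
    ultimately have "norm ((x - y) + s *\<^sub>R h) > M" "norm (x - y) > M" "norm (x - y) > M'"
     using n norm_ge_zero[of h] unfolding r_def by linarith+
    then show ?thesis using M(2) M'(2) False by simp
   qed
  qed
  finally show ?thesis by (simp add: I_def)
 qed
 have "((%s. L * norm h * \<bar>s\<bar> * I) ---> L * norm h * \<bar>0\<bar> * I) (at 0)" by (intro tendsto_intros)
 then have lim: "((%s. L * norm h * \<bar>s\<bar> * I) ---> 0) (at 0)" by simp
 have ev: "\<forall>\<^sub>F s in at 0. norm ((convol f \<phi> (x + s *\<^sub>R h) - convol f \<phi> x) / s - convol f (pd h \<phi>) x) <= L * norm h * \<bar>s\<bar> * I"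
 proof -
  have "\<forall>\<^sub>F s in at (0::real). s ~= 0 \<and> \<bar>s\<bar> <= 1" unfolding eventually_at by (auto intro!: exI[of _ 1])
  then show ?thesis by eventually_elim (use bd in auto)
 qed
 have "((%s. (convol f \<phi> (x + s *\<^sub>R h) - convol f \<phi> x) / s) ---> convol f (pd h \<phi>) x) (at 0)"
  using Lim_null_comparison[OF ev lim] by (simp add: Lim_null[symmetric])
 then show ?thesis unfolding DERIV_def by simp
qed

lemma convol_dir_deriv:
 assumes \<phi>: "\<phi> \<in> test_functions \<Omega>"
 shows "((%s. convol f \<phi> (x + s *\<^sub>R h)) has_deriv convol f (pd h \<phi>) (x + s *\<^sub>R h)) (at s)"
 using convol_dir_deriv_0[OF \<phi>, of "x + s *\<^sub>R h" h]
  DERIV_shift[of "%s. convol f \<phi> (x + s *\<^sub>R h)" "convol f (pd h \<phi>) (x + s *\<^sub>R h)" 0 s]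
 by (simp add: scaleR_add_left add.assoc add.left_commute add.commute)

end

section \<open>Uniqueness of weak gradients\<close>

lemma real_le_all_pos_ennreal: "(!!e. e > 0 ==> x <= ennreal e) ==> x = 0"
proof (rule ccontr)
 assume *: "!!e. e > 0 ==> x <= ennreal e" and "x ~= 0"
 have "x < top" using *[of 1] by (simp add: le_less_trans)
 then obtain r where r: "r >= 0" "x = ennreal r" by (cases x) auto
 then have "r > 0" using \<open>x ~= 0\<close> by (cases "r = 0") auto
 then have "ennreal r <= ennreal (r / 2)" using *[of "r / 2"] r by simp
 then show False using \<open>r > 0\<close> by (simp add: ennreal_le_iff)
qed

lemma mollify_L1:
 fixes f :: "'a::euclidean_space => real"
 assumes f: "linteg f" and e: "e > 0"
 shows "\<exists>d>0. \<forall>\<epsilon> \<eta>. \<epsilon> <= d --> mollifier \<epsilon> \<eta> --> (\<integral>\<^sup>+x. ennreal \<bar>convol f \<eta> x - f x\<bar> \<partial>lebesgue) <= ennreal e"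
proof -
 obtain g where g: "g \<in> borel_measurable lborel" "AE x in lborel. f x = g x"
  using completion_ex_borel_measurable_real[OF borel_measurable_integrable[OF f]] by auto
 have gb: "g \<in> borel_measurable borel" using g(1) by simp
 have gl: "g \<in> lmeas" using g(1) by (rule measurable_completion)
 have ae: "AE x in lebesgue. f x = g x" using AE_completion[OF g(2)] .
 have gi: "linteg g" using integrable_cong_AE[OF borel_measurable_integrable[OF f] gl ae] f by simp
 from translation_continuous_L1[OF gi, rule_format, OF e]
 obtain d where d: "d > 0" "\<forall>y. norm y < d --> (LI x. \<bar>g (x - y) - g x\<bar>) <= e"
  by (elim exE conjE)
 show ?thesis
 proof (intro exI[of _ d] conjI allI impI d)
  fix \<epsilon> and \<eta> :: "'a => real" assume le: "\<epsilon> <= d" and m: "mollifier \<epsilon> \<eta>"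
  have t: "\<eta> \<in> testfuns" using m by (simp add: mollifier_def)
  obtain C where C: "C >= 0" "!!x. \<bar>\<eta> x\<bar> <= C" using test_bounded[OF t] by blast
  have trg: "linteg (%x. g (x - y))" for y
   using lebesgue_preserving_integral(2)[OF lebesgue_preserving_translation gl, of y] gi by simp
  have rfl: "linteg (%y. g (x - y))" for x
   using lebesgue_preserving_integral(2)[OF lebesgue_preserving_reflection gl, of x] gi by simp
  have "(\<integral>\<^sup>+x. ennreal (\<bar>convol g \<eta> x - g x\<bar> ^ 1) \<partial>lborel) <= ennreal e"
  proof (rule mollify_error_le[OF _ gb m])
   show "linteg (%y. g (x - y) * \<eta> y)" for x
   proof (rule Bochner_Integration.integrable_bound)
    show "linteg (%y. C * g (x - y))" by (rule integrable_mult_right) (rule rfl)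
    show "(%y. g (x - y) * \<eta> y) \<in> lmeas"
     by (rule borel_measurable_times[OF borel_measurable_integrable[OF rfl] borel_measurable_integrable[OF test_integrable[OF t]]])
    show "AE y in lebesgue. norm (g (x - y) * \<eta> y) <= norm (C * g (x - y))"
     using C by (intro AE_I2) (simp add: abs_mult mult.commute mult_right_mono)
   qed
   fix y :: 'a assume y: "norm y < \<epsilon>"
   have i: "linteg (%x. \<bar>g (x - y) - g x\<bar>)" using trg gi by auto
   have "(\<integral>\<^sup>+x. ennreal (\<bar>g (x - y) - g x\<bar> ^ 1) \<partial>lborel) = (\<integral>\<^sup>+x. ennreal \<bar>g (x - y) - g x\<bar> \<partial>lebesgue)"
    by (simp add: nn_integral_completion)
   also have "... = ennreal (LI x. \<bar>g (x - y) - g x\<bar>)"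
    by (rule nn_integral_eq_integral[OF i]) auto
   also have "... <= ennreal e" using d(2)[rule_format, of y] y le by (intro ennreal_leI) auto
   finally show "(\<integral>\<^sup>+x. ennreal (\<bar>g (x - y) - g x\<bar> ^ 1) \<partial>lborel) <= ennreal e" .
  qed simp
  moreover have "(\<integral>\<^sup>+x. ennreal \<bar>convol f \<eta> x - f x\<bar> \<partial>lebesgue) = (\<integral>\<^sup>+x. ennreal \<bar>convol g \<eta> x - g x\<bar> \<partial>lebesgue)"
   by (rule nn_integral_cong_AE) (use ae convol_AE_cong[OF ae gl test_borel[OF t]] in auto)
  ultimately show "(\<integral>\<^sup>+x. ennreal \<bar>convol f \<eta> x - f x\<bar> \<partial>lebesgue) <= ennreal e"
   by (simp add: nn_integral_completion)
 qed
qed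

lemma square_integrable_locally:
 fixes f :: "'a::euclidean_space => real"
 assumes m: "f \<in> lmeas" and i: "linteg (%x. (f x)^2)"
 shows "locally_integrable UNIV f"
 unfolding locally_integrable_def
proof (intro allI impI)
 fix K :: "'a set" assume K: "compact K \<and> K \<subseteq> UNIV"
 have Km: "K \<in> lmeasurable" using K by (simp add: lmeasurable_compact)
 have iK: "linteg (indicator K :: 'a => real)"
  using fmeasurableD2[OF Km] fmeasurableD[OF Km] by (intro integrable_real_indicator) (auto simp: top.not_eq_extremum)
 have "linteg (%x. indicator K x * f x)"
 proof (rule square_integrable_mult)
  have "(%x. (indicator K x :: real)^2) = indicator K" by (auto simp: indicator_def fun_eq_iff)
  then show "linteg (%x. (indicator K x :: real)^2)" using iK by simp
 qed (use iK m i in auto)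
 then show "set_integrable lebesgue K f" by (simp add: set_integrable_def)
qed

lemma mollify_L2:
 fixes f :: "'a::euclidean_space => real"
 assumes fm: "f \<in> lmeas" and f: "linteg (%x. (f x)^2)" and e: "e > 0"
 shows "\<exists>d>0. \<forall>\<epsilon> \<eta>. \<epsilon> <= d --> mollifier \<epsilon> \<eta> -->
   linteg (%x. (convol f \<eta> x - f x)^2) \<and> (LI x. (convol f \<eta> x - f x)^2) <= e"
proof -
 obtain g where g: "g \<in> borel_measurable lborel" "AE x in lborel. f x = g x"
  using completion_ex_borel_measurable_real[OF fm] by auto
 have gb: "g \<in> borel_measurable borel" using g(1) by simp
 have gl: "g \<in> lmeas" using g(1) by (rule measurable_completion)
 have ae: "AE x in lebesgue. f x = g x" using AE_completion[OF g(2)] .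
 have ae2: "AE x in lebesgue. (f x)^2 = (g x)^2" using ae by auto
 have gi: "linteg (%x. (g x)^2)"
  using integrable_cong_AE[OF borel_measurable_integrable[OF f] _ ae2] f gl by auto
 from translation_continuous_L2[OF gl gi e]
 obtain d where d: "d > 0" "\<forall>y. norm y < d --> linteg (%x. (g (x - y) - g x)^2) \<and> (LI x. (g (x - y) - g x)^2) <= e"
  by (elim exE conjE)
 show ?thesis
 proof (intro exI[of _ d] conjI allI impI d)
  fix \<epsilon> and \<eta> :: "'a => real" assume le: "\<epsilon> <= d" and m: "mollifier \<epsilon> \<eta>"
  have t: "\<eta> \<in> testfuns" using m by (simp add: mollifier_def)
  have rm: "(%y. g (x - y)) \<in> lmeas" for x
   by (rule lebesgue_preserving_integral(3)[OF lebesgue_preserving_reflection gl])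
  have rfl: "linteg (%y. (g (x - y))^2)" for x
   using lebesgue_preserving_integral(2)[OF lebesgue_preserving_reflection, of "%x. (g x)^2" x] gi by simp
  have "(\<integral>\<^sup>+x. ennreal (\<bar>convol g \<eta> x - g x\<bar> ^ 2) \<partial>lborel) <= ennreal e"
  proof (rule mollify_error_le[OF _ gb m])
   show "linteg (%y. g (x - y) * \<eta> y)" for x
    by (rule square_integrable_mult[OF rm borel_measurable_integrable[OF test_integrable[OF t]] rfl test_square_integrable[OF t]])
   fix y :: 'a assume y: "norm y < \<epsilon>"
   then have dy: "linteg (%x. (g (x - y) - g x)^2)" "(LI x. (g (x - y) - g x)^2) <= e" using d(2)[rule_format, of y] le by auto
   have "(\<integral>\<^sup>+x. ennreal (\<bar>g (x - y) - g x\<bar> ^ 2) \<partial>lborel) = (\<integral>\<^sup>+x. ennreal ((g (x - y) - g x)^2) \<partial>lebesgue)"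
    by (simp add: nn_integral_completion)
   also have "... = ennreal (LI x. (g (x - y) - g x)^2)"
    by (rule nn_integral_eq_integral[OF dy(1)]) auto
   also have "... <= ennreal e" using dy(2) by (intro ennreal_leI) auto
   finally show "(\<integral>\<^sup>+x. ennreal (\<bar>g (x - y) - g x\<bar> ^ 2) \<partial>lborel) <= ennreal e" .
  qed simp
  moreover have "(\<integral>\<^sup>+x. ennreal ((convol f \<eta> x - f x)^2) \<partial>lebesgue) = (\<integral>\<^sup>+x. ennreal ((convol g \<eta> x - g x)^2) \<partial>lebesgue)"
   by (rule nn_integral_cong_AE) (use ae convol_AE_cong[OF ae gl test_borel[OF t]] in auto)
  ultimately have n: "(\<integral>\<^sup>+x. ennreal ((convol f \<eta> x - f x)^2) \<partial>lebesgue) <= ennreal e"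
   by (simp add: nn_integral_completion)
  have cm: "(%x. (convol f \<eta> x - f x)^2) \<in> lmeas"
  proof -
   have "convol f \<eta> \<in> borel_measurable borel"
    by (rule borel_measurable_continuous_onI[OF convol_continuous[OF square_integrable_locally[OF fm f] t]])
   then have "convol f \<eta> \<in> lmeas" by (simp add: measurable_completion)
   then show ?thesis using fm by (intro borel_measurable_power borel_measurable_diff)
  qed
  show i: "linteg (%x. (convol f \<eta> x - f x)^2)"
   using cm n by (intro integrableI_bounded) (auto simp: le_less_trans)
  have "ennreal (LI x. (convol f \<eta> x - f x)^2) <= ennreal e"
   using n nn_integral_eq_integral[OF i] by simp
  then show "(LI x. (convol f \<eta> x - f x)^2) <= e" using e by (simp add: ennreal_le_iff)
 qed
qed

text \<open>On a small ball the mollifications of \<open>f\<close>, cut off to a larger ball, are integrals against test functions and vanish; they converge to \<open>f\<close> in mean.\<close>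

lemma fundamental_lemma_calculus_of_variations:
 fixes f :: "'a::euclidean_space => real"
 assumes op: "open \<Omega>" and li: "locally_integrable \<Omega> f"
  and z: "!!\<phi>. \<phi> \<in> test_functions \<Omega> ==> (LINT x:\<Omega>|lebesgue. f x * \<phi> x) = 0"
 shows "AE x in lebesgue. x \<in> \<Omega> --> f x = 0"
proof -
 have local: "AE x in lebesgue. x \<in> ball a r --> f x = 0" if r: "r > 0" "cball a (2 * r) \<subseteq> \<Omega>" for a r
 proof -
  define g where "g x = indicator (cball a (2 * r)) x * f x" for x
  have "set_integrable lebesgue (cball a (2 * r)) f" using li r by (simp add: locally_integrable_def)
  then have gi: "linteg g" unfolding g_def[abs_def] by (simp add: set_integrable_def)
  have small: "(\<integral>\<^sup>+x. ennreal (indicator (ball a r) x * \<bar>g x\<bar>) \<partial>lebesgue) <= ennreal e" if e: "e > 0" for e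
  proof -
   from mollify_L1[OF gi e]
   obtain d where d: "d > 0" "\<forall>\<epsilon> \<eta>. \<epsilon> <= d --> mollifier \<epsilon> \<eta> --> (\<integral>\<^sup>+x. ennreal \<bar>convol g \<eta> x - g x\<bar> \<partial>lebesgue) <= ennreal e"
    by (elim exE conjE)
   define \<epsilon> where "\<epsilon> = min d (r / 2)"
   have "\<epsilon> > 0" using d r by (simp add: \<epsilon>_def)
   then obtain \<eta> :: "'a => real" where m: "mollifier \<epsilon> \<eta>" by (rule radial_mollifier_exists)
   have t: "\<eta> \<in> testfuns" and s: "!!y. norm y >= \<epsilon> ==> \<eta> y = 0" using m by (auto simp: mollifier_def)
   have zero: "convol g \<eta> x = 0" if x: "x \<in> ball a r" for x
   proof -
    have sub: "cball x \<epsilon> \<subseteq> cball a (2 * r)"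
    proof
     fix y assume "y \<in> cball x \<epsilon>"
     then have "dist a y <= dist a x + \<epsilon>" using dist_triangle[of a y x] by simp
     also have "... <= r + r" using x r unfolding \<epsilon>_def by (intro add_mono) auto
     finally show "y \<in> cball a (2 * r)" by simp
    qed
    have sup: "\<eta> (x - y) = 0" if "y \<notin> cball x \<epsilon>" for y using s[of "x - y"] that by (simp add: dist_norm)
    have "(%y. \<eta> (x - y)) \<in> test_functions \<Omega>"
    proof (rule test_functionsI[of _ "cball x \<epsilon>"])
     show "smooth (%y. \<eta> (x - y))" using test_smooth[OF test_reflect[OF t]] .
    qed (use sub r sup in auto)
    from z[OF this] have "(LI y. indicator \<Omega> y *\<^sub>R (f y * \<eta> (x - y))) = 0" by (simp add: set_lebesgue_integral_def)
    moreover have "(%y. indicator \<Omega> y *\<^sub>R (f y * \<eta> (x - y))) = (%y. g y * \<eta> (x - y))"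
    proof
     fix y
     show "indicator \<Omega> y *\<^sub>R (f y * \<eta> (x - y)) = g y * \<eta> (x - y)"
     proof (cases "y \<in> cball x \<epsilon>")
      case True
      then have "y \<in> cball a (2 * r)" "y \<in> \<Omega>" using sub r by auto
      then show ?thesis by (simp add: g_def)
     qed (simp add: sup)
    qed
    ultimately show ?thesis by (simp only: convol_def)
   qed
   have "(\<integral>\<^sup>+x. ennreal (indicator (ball a r) x * \<bar>g x\<bar>) \<partial>lebesgue) <= (\<integral>\<^sup>+x. ennreal \<bar>convol g \<eta> x - g x\<bar> \<partial>lebesgue)"
    by (rule nn_integral_mono) (use zero in \<open>auto simp: indicator_def\<close>)
   also have "... <= ennreal e" by (rule d(2)[rule_format, OF _ m]) (simp add: \<epsilon>_def)
   finally show ?thesis .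
  qed
  have "(\<integral>\<^sup>+x. ennreal (indicator (ball a r) x * \<bar>g x\<bar>) \<partial>lebesgue) = 0"
   by (rule real_le_all_pos_ennreal) (rule small)
  then have "AE x in lebesgue. ennreal (indicator (ball a r) x * \<bar>g x\<bar>) = 0"
  proof (subst (asm) nn_integral_0_iff_AE)
   have "(%x. indicator (ball a r) x * \<bar>g x\<bar>) \<in> lmeas"
    using borel_measurable_integrable[OF gi]
    by (intro borel_measurable_times borel_measurable_indicator borel_measurable_abs) auto
   then show "(%x. ennreal (indicator (ball a r) x * \<bar>g x\<bar>)) \<in> lmeas"
    by (rule measurable_compose[OF _ measurable_ennreal])
  qed
  then show ?thesis
  proof (rule AE_mp, intro AE_I2 impI)
   fix x assume "ennreal (indicator (ball a r) x * \<bar>g x\<bar>) = 0" "x \<in> ball a r"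
   then have "\<bar>g x\<bar> <= 0" by (simp add: ennreal_eq_0_iff)
   then have "g x = 0" by simp
   moreover have "x \<in> cball a (2 * r)" using \<open>x \<in> ball a r\<close> r by auto
   ultimately show "f x = 0" by (simp add: g_def)
  qed
 qed
 define F where "F = {ball a r |a r. r > 0 \<and> cball a (2 * r) \<subseteq> \<Omega>}"
 obtain F' where F': "F' \<subseteq> F" "countable F'" "\<Union>F' = \<Union>F" using Lindelof[of F] by (auto simp: F_def)
 have cov: "\<Omega> \<subseteq> \<Union>F"
 proof
  fix x assume "x \<in> \<Omega>"
  then obtain r where r: "r > 0" "cball x r \<subseteq> \<Omega>" using op open_contains_cball by blast
  then have "ball x (r / 2) \<in> F" unfolding F_def by (intro CollectI exI[of _ x] exI[of _ "r / 2"]) auto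
  then show "x \<in> \<Union>F" using r(1) by (intro UnionI[of "ball x (r / 2)"]) auto
 qed
 have "AE x in lebesgue. \<forall>B\<in>F'. x \<in> B --> f x = 0"
  unfolding AE_ball_countable[OF F'(2)] using F'(1) local unfolding F_def by blast
 then show ?thesis
 proof eventually_elim
  case (elim x)
  show ?case
  proof
   assume "x \<in> \<Omega>"
   then have "x \<in> \<Union>F'" using cov F'(3) by auto
   then obtain B where "B \<in> F'" "x \<in> B" by (rule UnionE)
   then show "f x = 0" using bspec[OF elim, of B] by simp
  qed
 qed
qed

lemma locally_integrable_times_test:
 fixes f \<phi> :: "'a::euclidean_space => real"
 assumes li: "locally_integrable \<Omega> f" and \<phi>: "\<phi> \<in> test_functions \<Omega>"
 shows "set_integrable lebesgue \<Omega> (%x. f x * \<phi> x)"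
proof -
 from \<phi> obtain K where K: "compact K" "K \<subseteq> \<Omega>" "!!x. x \<notin> K ==> \<phi> x = 0"
  unfolding test_functions_def by blast
 obtain C where C: "C >= 0" "!!x. \<bar>\<phi> x\<bar> <= C" using test_bounded[OF \<phi>] by blast
 have i: "linteg (%x. indicator K x *\<^sub>R f x)"
  using li K by (simp add: locally_integrable_def set_integrable_def)
 have "linteg (%x. (indicator K x *\<^sub>R f x) * \<phi> x)"
 proof (rule Bochner_Integration.integrable_bound)
  show "linteg (%x. C * (indicator K x *\<^sub>R f x))" by (rule integrable_mult_right) (rule i)
  show "(%x. (indicator K x *\<^sub>R f x) * \<phi> x) \<in> lmeas"
   by (rule borel_measurable_times[OF borel_measurable_integrable[OF i] borel_measurable_integrable[OF test_integrable[OF \<phi>]]])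
  show "AE x in lebesgue. norm ((indicator K x *\<^sub>R f x) * \<phi> x) <= norm (C * (indicator K x *\<^sub>R f x))"
  proof (rule AE_I2)
   fix x
   have "\<bar>indicator K x * f x\<bar> * \<bar>\<phi> x\<bar> <= \<bar>indicator K x * f x\<bar> * C" using C by (intro mult_left_mono) auto
   then show "norm ((indicator K x *\<^sub>R f x) * \<phi> x) <= norm (C * (indicator K x *\<^sub>R f x))"
    using C by (simp add: abs_mult mult_ac)
  qed
 qed
 moreover have "(%x. (indicator K x *\<^sub>R f x) * \<phi> x) = (%x. indicator \<Omega> x *\<^sub>R (f x * \<phi> x))"
 proof
  show "(indicator K x *\<^sub>R f x) * \<phi> x = indicator \<Omega> x *\<^sub>R (f x * \<phi> x)" for x
   using K(2) K(3)[of x] by (cases "x \<in> K") (auto simp: indicator_def)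
 qed
 ultimately show ?thesis by (simp only: set_integrable_def)
qed

lemma locally_integrable_inner:
 assumes "locally_integrable \<Omega> (g :: 'a::euclidean_space => 'a)"
 shows "locally_integrable \<Omega> (%x. g x \<bullet> b)"
 unfolding locally_integrable_def set_integrable_def
proof (intro allI impI)
 fix K assume "compact K \<and> K \<subseteq> \<Omega>"
 then have "linteg (%x. indicator K x *\<^sub>R g x)"
  using assms by (simp add: locally_integrable_def set_integrable_def)
 then have "linteg (%x. (indicator K x *\<^sub>R g x) \<bullet> b)" by (rule integrable_inner_left)
 then show "linteg (%x. indicator K x *\<^sub>R (g x \<bullet> b))" by simp
qed

lemma weak_gradient_unique:
 fixes f f' :: "'a::euclidean_space => real"
 assumes op: "open \<Omega>" and g: "has_weak_gradient \<Omega> f g" and g': "has_weak_gradient \<Omega> f' g'"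
  and ae: "AE x in lebesgue. x \<in> \<Omega> --> f x = f' x"
 shows "AE x in lebesgue. x \<in> \<Omega> --> g x = g' x"
proof -
 have comp: "AE x in lebesgue. x \<in> \<Omega> --> g x \<bullet> b - g' x \<bullet> b = 0" if b: "b \<in> Basis" for b
 proof (rule fundamental_lemma_calculus_of_variations[OF op])
  have l: "locally_integrable \<Omega> (%x. g x \<bullet> b)" "locally_integrable \<Omega> (%x. g' x \<bullet> b)"
   using g g' by (auto simp: has_weak_gradient_def intro: locally_integrable_inner)
  then show "locally_integrable \<Omega> (%x. g x \<bullet> b - g' x \<bullet> b)"
   unfolding locally_integrable_def by (auto intro: set_integral_diff(1))
  fix \<phi> assume \<phi>: "\<phi> \<in> test_functions \<Omega>"
  have "(LINT x:\<Omega>|lebesgue. (g x \<bullet> b - g' x \<bullet> b) * \<phi> x) =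
    (LINT x:\<Omega>|lebesgue. (g x \<bullet> b) * \<phi> x) - (LINT x:\<Omega>|lebesgue. (g' x \<bullet> b) * \<phi> x)"
   using set_integral_diff(2)[OF locally_integrable_times_test[OF l(1) \<phi>] locally_integrable_times_test[OF l(2) \<phi>]]
   by (simp add: left_diff_distrib)
  also have "... = (LINT x:\<Omega>|lebesgue. f' x * pd b \<phi> x) - (LINT x:\<Omega>|lebesgue. f x * pd b \<phi> x)"
   using g g' \<phi> b by (simp add: has_weak_gradient_def)
  also have "(LINT x:\<Omega>|lebesgue. f x * pd b \<phi> x) = (LINT x:\<Omega>|lebesgue. f' x * pd b \<phi> x)"
  proof -
   have l: "locally_integrable \<Omega> f" "locally_integrable \<Omega> f'" using g g' by (auto simp: has_weak_gradient_def)
   note i = locally_integrable_times_test[OF l(1) test_partial_deriv[OF \<phi>, of b]]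
    locally_integrable_times_test[OF l(2) test_partial_deriv[OF \<phi>, of b]]
   show ?thesis unfolding set_lebesgue_integral_def
   proof (rule integral_cong_AE)
    show "AE x in lebesgue. indicator \<Omega> x *\<^sub>R (f x * pd b \<phi> x) = indicator \<Omega> x *\<^sub>R (f' x * pd b \<phi> x)"
     using ae by eventually_elim (auto simp: indicator_def)
   qed (use i in \<open>auto simp: set_integrable_def\<close>)
  qed
  finally show "(LINT x:\<Omega>|lebesgue. (g x \<bullet> b - g' x \<bullet> b) * \<phi> x) = 0" by simp
 qed
 have "AE x in lebesgue. \<forall>b\<in>Basis. x \<in> \<Omega> --> g x \<bullet> b - g' x \<bullet> b = 0"
  using comp by (subst AE_ball_countable) (auto intro: countable_finite)
 then show ?thesis
 proof eventually_elim
  case (elim x)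
  show ?case
  proof
   assume "x \<in> \<Omega>"
   then have z: "g x \<bullet> b - g' x \<bullet> b = 0" if "b \<in> Basis" for b using elim that by blast
   show "g x = g' x" by (rule euclidean_eqI) (use z in force)
  qed
 qed
qed

lemma weak_gradient_AE:
 assumes op: "open \<Omega>" and g: "has_weak_gradient \<Omega> f g"
 shows "AE x in lebesgue. x \<in> \<Omega> --> weak_gradient \<Omega> f x = g x"
  and "has_weak_gradient \<Omega> f (weak_gradient \<Omega> f)"
proof -
 show h: "has_weak_gradient \<Omega> f (weak_gradient \<Omega> f)"
  unfolding weak_gradient_def by (rule someI[of "has_weak_gradient \<Omega> f", OF g])
 show "AE x in lebesgue. x \<in> \<Omega> --> weak_gradient \<Omega> f x = g x"
  by (rule weak_gradient_unique[OF op h g]) simp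
qed

lemma weak_gradient_cong_AE:
 assumes ae: "AE x in lebesgue. x \<in> \<Omega> --> f x = f' x" and g: "has_weak_gradient \<Omega> f' g"
 shows "has_weak_gradient \<Omega> f g"
proof -
 have l': "locally_integrable \<Omega> f'" using g by (simp add: has_weak_gradient_def)
 have "locally_integrable \<Omega> f"
  unfolding locally_integrable_def set_integrable_def
 proof (intro allI impI)
  fix K assume K: "compact K \<and> K \<subseteq> \<Omega>"
  have i: "linteg (%x. indicator K x *\<^sub>R f' x)"
   using l' K by (simp add: locally_integrable_def set_integrable_def)
  have e: "AE x in lebesgue. indicator K x *\<^sub>R f x = indicator K x *\<^sub>R f' x"
   using ae by eventually_elim (use K in \<open>auto simp: indicator_def\<close>)
  have m: "(%x. indicator K x *\<^sub>R f x) \<in> lmeas"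
   by (rule borel_measurable_lebesgue_AE_cong[OF borel_measurable_integrable[OF i] e])
  show "linteg (%x. indicator K x *\<^sub>R f x)"
   using integrable_cong_AE[OF m borel_measurable_integrable[OF i] e] i by simp
 qed
 moreover have "(LINT x:\<Omega>|lebesgue. f x * pd b \<phi> x) = (LINT x:\<Omega>|lebesgue. f' x * pd b \<phi> x)"
  if \<phi>: "\<phi> \<in> test_functions \<Omega>" for \<phi> b
 proof -
  have i: "linteg (%x. indicator \<Omega> x *\<^sub>R (f' x * pd b \<phi> x))"
   using locally_integrable_times_test[OF l' test_partial_deriv[OF \<phi>, of b]] by (simp add: set_integrable_def)
  have e: "AE x in lebesgue. indicator \<Omega> x *\<^sub>R (f x * pd b \<phi> x) = indicator \<Omega> x *\<^sub>R (f' x * pd b \<phi> x)"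
   using ae by eventually_elim (auto simp: indicator_def)
  have m: "(%x. indicator \<Omega> x *\<^sub>R (f x * pd b \<phi> x)) \<in> lmeas"
   by (rule borel_measurable_lebesgue_AE_cong[OF borel_measurable_integrable[OF i] e])
  show ?thesis unfolding set_lebesgue_integral_def by (rule integral_cong_AE[OF m borel_measurable_integrable[OF i] e])
 qed
 ultimately show ?thesis using g by (simp add: has_weak_gradient_def)
qed

section \<open>Energy inequalities outside light cones\<close>

lemma continuous_compact_integrals:
 fixes F :: "'a::euclidean_space => real"
 assumes c: "continuous_on UNIV F" and s: "!!x. x \<notin> cbox a b ==> F x = 0"
 shows "linteg F" "(LI x. F x) = integral (cbox a b) F"
proof -
 have cb: "continuous_on (cbox a b) F" using c by (rule continuous_on_subset) simp
 have Fb: "F \<in> borel_measurable lborel" using borel_measurable_continuous_onI[OF c] by simp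
 have i: "integrable lborel (%x. indicator (cbox a b) x *\<^sub>R F x)" by (rule borel_integrable_compact[OF compact_cbox cb])
 have e: "(%x. indicator (cbox a b) x *\<^sub>R F x) = F"
 proof
  fix x show "indicator (cbox a b) x *\<^sub>R F x = F x" using s[of x] by (cases "x \<in> cbox a b") auto
 qed
 show "linteg F" using i unfolding e by (simp add: integrable_completion[OF Fb])
 have "set_integrable lborel (cbox a b) F" using i by (simp add: set_integrable_def)
 from set_borel_integral_eq_integral(2)[OF this] show "(LI x. F x) = integral (cbox a b) F"
  unfolding set_lebesgue_integral_def e by (simp add: integral_completion[OF Fb])
qed

text \<open>A smooth substitute for the norm. Its gradient has length at most \<open>1\<close>, which is what finite speed of propagation uses.\<close>

definition japanese :: "'a::euclidean_space => real" where "japanese x = sqrt (1 + (norm x)^2)"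

lemma japanese_pos: "japanese x > 0"
 unfolding japanese_def using zero_le_power2[of "norm x"] by (intro real_sqrt_gt_zero) linarith

lemma japanese_ge: "norm x <= japanese x"
 unfolding japanese_def by (rule real_le_rsqrt) simp

lemma japanese_le: "japanese x <= norm x + 1"
 unfolding japanese_def by (rule real_le_lsqrt) (auto simp: power2_eq_square algebra_simps)

lemma japanese_continuous: "continuous_on A japanese"
 unfolding japanese_def[abs_def] by (intro continuous_intros)

lemma japanese_dir_deriv:
 "((%s. japanese (x + s *\<^sub>R b)) has_deriv (x \<bullet> b) / japanese x) (at 0)"
proof -
 have e: "(%s. japanese (x + s *\<^sub>R b)) = (%s. sqrt (1 + (x \<bullet> x + 2 * s * (x \<bullet> b) + s^2 * (b \<bullet> b))))"
  unfolding japanese_def power2_norm_eq_inner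
  by (auto simp: inner_add_left inner_add_right inner_commute power2_eq_square algebra_simps)
 have pos: "0 < 1 + (x \<bullet> x + 2 * 0 * (x \<bullet> b) + 0^2 * (b \<bullet> b))" using inner_ge_zero[of x] by (simp add: add_pos_nonneg)
 have "((%s. 1 + (x \<bullet> x + 2 * s * (x \<bullet> b) + s^2 * (b \<bullet> b))) has_deriv 2 * (x \<bullet> b)) (at 0)"
  by (auto intro!: derivative_eq_intros)
 note D = DERIV_chain2[where f = sqrt and g = "%s. 1 + (x \<bullet> x + 2 * s * (x \<bullet> b) + s^2 * (b \<bullet> b))" and x = 0, OF DERIV_real_sqrt[OF pos] this]
 have e1: "1 + (x \<bullet> x + 2 * 0 * (x \<bullet> b) + 0^2 * (b \<bullet> b)) = 1 + (norm x)^2"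
  by (simp add: dot_square_norm)
 have e2: "inverse r / 2 * (2 * y) = y / r" for r y :: real
  by (cases "r = 0") (simp_all add: field_simps)
 show ?thesis using D unfolding e e1 e2 japanese_def[symmetric] .
qed

lemma positive_part_square_deriv:
 "((%s. (max 0 s)^2) has_deriv 2 * max 0 s) (at (s::real))"
proof -
 consider "s < 0" | "s > 0" | "s = 0" by linarith
 then show ?thesis
 proof cases
  case 1
  have "((%_. 0) has_deriv 0) (at s)" by simp
  then have "((%s. (max 0 s)^2) has_deriv 0) (at s)"
   by (rule has_field_derivative_transform_within_open[of _ _ _ "{..<0}"]) (use 1 in auto)
  then show ?thesis using 1 by simp
 next
  case 2
  have "((%s. s\<^sup>2) has_deriv 2 * s) (at s)" by (auto intro!: derivative_eq_intros)
  then have "((%s. (max 0 s)^2) has_deriv 2 * s) (at s)"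
   by (rule has_field_derivative_transform_within_open[of _ _ _ "{0<..}"]) (use 2 in auto)
  then show ?thesis using 2 by simp
 next
  case 3
  have "((%h. ((max 0 (0 + h))^2 - (max 0 0)\<^sup>2) / h) ---> 0) (at (0::real))"
  proof (rule Lim_null_comparison[where g = "%h. \<bar>h\<bar>"])
   show "\<forall>\<^sub>F h in at (0::real). norm (((max 0 (0 + h))^2 - (max 0 0)\<^sup>2) / h) <= \<bar>h\<bar>"
    by (rule always_eventually) (auto simp: max_def power2_eq_square abs_mult)
   have "((%h::real. \<bar>h\<bar>) ---> \<bar>0\<bar>) (at 0)" by (intro tendsto_intros)
   then show "((%h::real. \<bar>h\<bar>) ---> 0) (at 0)" by simp
  qed
  then show ?thesis using 3 by (simp add: DERIV_def)
 qed
qed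

text \<open>The first order system for \<open>Z = u_t\<close> and \<open>G b = u_b\<close>, with \<open>DZ b\<close> and \<open>DG b\<close> the derivatives in direction \<open>b\<close>. It is stated abstractly because it is applied to mollified solutions, to differences of two mollifications and to the difference of a solution and its rotation.\<close>

locale wave_system =
 fixes Z :: "real => 'a::euclidean_space => real" and G DZ DG :: "'a => real => 'a => real"
 assumes cZ: "continuous_on UNIV (%p. Z (fst p) (snd p))"
  and cG: "!!b. b \<in> Basis ==> continuous_on UNIV (%p. G b (fst p) (snd p))"
  and cDZ: "!!b. b \<in> Basis ==> continuous_on UNIV (%p. DZ b (fst p) (snd p))"
  and cDG: "!!b. b \<in> Basis ==> continuous_on UNIV (%p. DG b (fst p) (snd p))"
  and Zt: "!!t x. ((%t. Z t x) has_deriv (\<Sum>b\<in>Basis. DG b t x)) (at t)"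
  and Gt: "!!b t x. b \<in> Basis ==> ((%t. G b t x) has_deriv DZ b t x) (at t)"
  and Zx: "!!b t x. b \<in> Basis ==> ((%s. Z t (x + s *\<^sub>R b)) has_deriv DZ b t x) (at 0)"
  and Gx: "!!b t x. b \<in> Basis ==> ((%s. G b t (x + s *\<^sub>R b)) has_deriv DG b t x) (at 0)"
begin

definition en :: "real => 'a => real" where "en t x = (Z t x)^2 + (\<Sum>b\<in>Basis. (G b t x)^2)"

lemma en_nonneg: "en t x >= 0" unfolding en_def by (intro add_nonneg_nonneg sum_nonneg) auto

lemma slice:
 fixes f :: "real => 'a => real"
 assumes "continuous_on UNIV (%p. f (fst p) (snd p))"
 shows "continuous_on UNIV (f t)"
proof -
 have "continuous_on UNIV (%x::'a. (t, x))" by (intro continuous_intros)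
 from continuous_on_compose2[OF assms this] show ?thesis by simp
qed

lemma en_continuous: "continuous_on UNIV (%p. en (fst p) (snd p))"
 unfolding en_def by (intro continuous_on_add continuous_on_sum continuous_on_power cZ cG)

text \<open>The weight is a decreasing function of time whose time derivative dominates its space gradient, so the boundary flux cannot create energy. The factor \<open>g\<close> makes the integrals compactly supported.\<close>

lemma weighted_energy:
 fixes f f' g g' :: "real => real"
 assumes f: "!!s. (f has_deriv f' s) (at s)" "continuous_on UNIV f'" "!!s. f s >= 0" "!!s. f' s >= 0"
  and g: "!!s. (g has_deriv g' s) (at s)" "continuous_on UNIV g'" "!!s. g s >= 0" "!!s. g' s <= 0"
  and gN: "!!s. s >= N ==> g s = 0" and T: "T >= 0"
 shows "(LI x. f (japanese x - T) * g (japanese x + T) * en T x)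
  <= (LI x. f (japanese x) * g (japanese x) * en 0 x)"
proof -
 define \<zeta> where "\<zeta> t x = f (japanese x - t) * g (japanese x + t)" for t and x :: 'a
 define \<zeta>t where "\<zeta>t t x = - f' (japanese x - t) * g (japanese x + t) + f (japanese x - t) * g' (japanese x + t)" for t and x :: 'a
 define \<zeta>x where "\<zeta>x t x = f' (japanese x - t) * g (japanese x + t) + f (japanese x - t) * g' (japanese x + t)" for t and x :: 'a
 define ent where "ent t x = 2 * Z t x * (\<Sum>b\<in>Basis. DG b t x) + (\<Sum>b\<in>Basis. 2 * G b t x * DZ b t x)" for t x
 have cf: "continuous_on UNIV f" "continuous_on UNIV g"
  using f(1) g(1) by (meson DERIV_isCont continuous_at_imp_continuous_on)+
 have cj: "continuous_on UNIV (%p::real \<times> 'a. japanese (snd p) - fst p)" "continuous_on UNIV (%p::real \<times> 'a. japanese (snd p) + fst p)"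
  by (intro continuous_intros continuous_on_compose2[OF japanese_continuous[of UNIV]]; simp)+
 note cc = continuous_on_compose2[OF cf(1) cj(1)] continuous_on_compose2[OF cf(2) cj(2)]
  continuous_on_compose2[OF f(2) cj(1)] continuous_on_compose2[OF g(2) cj(2)]
 have c\<zeta>: "continuous_on UNIV (%p. \<zeta> (fst p) (snd p))" "continuous_on UNIV (%p. \<zeta>t (fst p) (snd p))" "continuous_on UNIV (%p. \<zeta>x (fst p) (snd p))"
  unfolding \<zeta>_def \<zeta>t_def \<zeta>x_def
  by (intro continuous_on_add continuous_on_mult continuous_on_minus cc; simp)+
 have cent: "continuous_on UNIV (%p. ent (fst p) (snd p))"
  unfolding ent_def by (intro continuous_on_add continuous_on_mult continuous_on_sum continuous_on_const cZ cG cDZ cDG)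
 have \<zeta>_t: "((%t. \<zeta> t x) has_deriv \<zeta>t t x) (at t)" for t x
 proof -
  have a: "((%t. f (japanese x - t)) has_deriv f' (japanese x - t) * (-1)) (at t)"
   by (rule DERIV_chain2[where f = f and g = "%t. japanese x - t", OF f(1)]) (auto intro!: derivative_eq_intros)
  have b: "((%t. g (japanese x + t)) has_deriv g' (japanese x + t) * 1) (at t)"
   by (rule DERIV_chain2[where f = g and g = "%t. japanese x + t", OF g(1)]) (auto intro!: derivative_eq_intros)
  from DERIV_mult[OF a b] show ?thesis unfolding \<zeta>_def \<zeta>t_def by (simp add: mult.commute)
 qed
 have \<zeta>_x: "((%s. \<zeta> t (x + s *\<^sub>R b)) has_deriv \<zeta>x t x * ((x \<bullet> b) / japanese x)) (at 0)" for t x b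
 proof -
  note j = japanese_dir_deriv[of x b]
  have j1: "((%s. japanese (x + s *\<^sub>R b) - t) has_deriv (x \<bullet> b) / japanese x - 0) (at 0)"
   "((%s. japanese (x + s *\<^sub>R b) + t) has_deriv (x \<bullet> b) / japanese x + 0) (at 0)"
   by (intro DERIV_diff DERIV_add j DERIV_const)+
  have a: "((%s. f (japanese (x + s *\<^sub>R b) - t)) has_deriv f' (japanese (x + 0 *\<^sub>R b) - t) * ((x \<bullet> b) / japanese x - 0)) (at 0)"
   by (rule DERIV_chain2[where f = f and g = "%s. japanese (x + s *\<^sub>R b) - t", OF f(1) j1(1)])
  have c: "((%s. g (japanese (x + s *\<^sub>R b) + t)) has_deriv g' (japanese (x + 0 *\<^sub>R b) + t) * ((x \<bullet> b) / japanese x + 0)) (at 0)"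
   by (rule DERIV_chain2[where f = g and g = "%s. japanese (x + s *\<^sub>R b) + t", OF g(1) j1(2)])
  from DERIV_mult[OF a c] show ?thesis unfolding \<zeta>_def \<zeta>x_def by (simp add: algebra_simps)
 qed
 have en_t: "((%t. en t x) has_deriv ent t x) (at t)" for t x
 proof -
  have "((%t. (Z t x)^2 + (\<Sum>b\<in>Basis. (G b t x)^2)) has_deriv
    (of_nat 2 * ((\<Sum>b\<in>Basis. DG b t x) * Z t x ^ (2 - Suc 0))) + (\<Sum>b\<in>Basis. of_nat 2 * (DZ b t x * G b t x ^ (2 - Suc 0)))) (at t)"
   by (intro DERIV_add DERIV_sum DERIV_power Zt Gt)
  moreover have "(of_nat 2 * ((\<Sum>b\<in>Basis. DG b t x) * Z t x ^ (2 - Suc 0))) + (\<Sum>b\<in>Basis. of_nat 2 * (DZ b t x * G b t x ^ (2 - Suc 0))) = ent t x"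
   unfolding ent_def by (simp add: mult_ac)
  ultimately show ?thesis unfolding en_def by (simp only:)
 qed
 obtain a where a: "cball (0::'a) \<bar>N\<bar> \<subseteq> cbox (-a) a" using bounded_subset_cbox_symmetric[OF bounded_cball] by metis
 have supp: "\<zeta> t x = 0" if "t >= 0" "norm x > \<bar>N\<bar>" for t x
  using gN[of "japanese x + t"] japanese_ge[of x] that unfolding \<zeta>_def by simp
 have supp2: "\<zeta> t x * y = 0" if "t >= 0" "x \<notin> cbox (-a) a" for t x y
 proof -
  have "x \<notin> cball 0 \<bar>N\<bar>" using that(2) a by blast
  then show ?thesis using supp[OF that(1), of x] by simp
 qed
 define h where "h t = integral (cbox (-a) a) (%x. \<zeta> t x * en t x)" for t
 have cse: "continuous_on UNIV (%x. \<zeta> t x * en t x)" for t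
  using slice[OF continuous_on_mult[OF c\<zeta>(1) en_continuous]] .
 have cd: "continuous_on UNIV (%p. \<zeta>t (fst p) (snd p) * en (fst p) (snd p) + ent (fst p) (snd p) * \<zeta> (fst p) (snd p))"
  by (intro continuous_on_add continuous_on_mult c\<zeta> en_continuous cent)
 have hd: "(h has_deriv integral (cbox (-a) a) (%x. \<zeta>t t x * en t x + ent t x * \<zeta> t x)) (at t)" for t
  unfolding h_def
 proof (rule leibniz_rule_field_derivative[where U = UNIV and f = "%t x. \<zeta> t x * en t x" and fx = "%t x. \<zeta>t t x * en t x + ent t x * \<zeta> t x"])
  show "((%t. \<zeta> t x * en t x) has_field_derivative \<zeta>t t x * en t x + ent t x * \<zeta> t x) (at t)" for t x
   by (rule DERIV_mult[OF \<zeta>_t en_t])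
  show "(%x. \<zeta> t x * en t x) integrable_on cbox (-a) a" for t
   by (rule integrable_continuous[OF continuous_on_subset[OF cse]]) simp
  show "continuous_on (UNIV \<times> cbox (-a) a) (%(t, x). \<zeta>t t x * en t x + ent t x * \<zeta> t x)"
   unfolding split_beta by (rule continuous_on_subset[OF cd]) simp
 qed auto
 have neg: "integral (cbox (-a) a) (%x. \<zeta>t t x * en t x + ent t x * \<zeta> t x) <= 0" if t: "t >= 0" for t
 proof -
  define W where "W b x = \<zeta> t x * (2 * Z t x * G b t x)" for b x
  define W' where "W' b x = \<zeta>x t x * ((x \<bullet> b) / japanese x) * (2 * Z t x * G b t x) + (2 * DZ b t x * G b t x + DG b t x * (2 * Z t x)) * \<zeta> t x" for b x
  have cjs: "continuous_on UNIV (%x::'a. (x \<bullet> b) / japanese x)" for b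
  proof (intro continuous_on_divide continuous_on_inner continuous_on_id continuous_on_const japanese_continuous ballI)
   show "japanese x ~= 0" for x :: 'a using japanese_pos[of x] by simp
  qed
  have sl: "continuous_on UNIV (Z t)" "!!b. b \<in> Basis ==> continuous_on UNIV (G b t)" "!!b. b \<in> Basis ==> continuous_on UNIV (DZ b t)"
   "!!b. b \<in> Basis ==> continuous_on UNIV (DG b t)" "continuous_on UNIV (\<zeta> t)" "continuous_on UNIV (\<zeta>x t)" "continuous_on UNIV (\<zeta>t t)"
   "continuous_on UNIV (en t)" "continuous_on UNIV (ent t)"
   using slice[OF cZ] slice[OF cG] slice[OF cDZ] slice[OF cDG] slice[OF c\<zeta>(1)] slice[OF c\<zeta>(2)] slice[OF c\<zeta>(3)] slice[OF en_continuous] slice[OF cent]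
   by auto
  have cW: "continuous_on UNIV (W b)" "continuous_on UNIV (W' b)" if "b \<in> Basis" for b
   unfolding W_def[abs_def] W'_def[abs_def] using that
   by (intro continuous_on_add continuous_on_mult continuous_on_const sl cjs; assumption)+
  have W0: "(LI x. W' b x) = 0" if b: "b \<in> Basis" for b
  proof (rule integral_directional_derivative_eq_0[OF cW[OF b], where M = "\<bar>N\<bar>"])
   show "W b x = 0" if "norm x > \<bar>N\<bar>" for x using supp[OF t that] by (simp add: W_def)
   show "((%s. W b (x + s *\<^sub>R b)) has_deriv W' b x) (at 0)" for x
   proof -
    have "((%s. \<zeta> t (x + s *\<^sub>R b) * ((2 * Z t (x + s *\<^sub>R b)) * G b t (x + s *\<^sub>R b))) has_deriv
      \<zeta>x t x * ((x \<bullet> b) / japanese x) * ((2 * Z t (x + 0 *\<^sub>R b)) * G b t (x + 0 *\<^sub>R b)) +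
      ((2 * DZ b t x) * G b t (x + 0 *\<^sub>R b) + DG b t x * (2 * Z t (x + 0 *\<^sub>R b))) * \<zeta> t (x + 0 *\<^sub>R b)) (at 0)"
     by (intro DERIV_mult[OF \<zeta>_x DERIV_mult[OF DERIV_cmult[OF Zx[OF b]] Gx[OF b]]])
    then show ?thesis unfolding W_def W'_def by simp
   qed
  qed
  have supW': "W' b x = 0" if "b \<in> Basis" "x \<notin> cbox (-a) a" for b x
  proof -
   have n: "norm x > \<bar>N\<bar>" using that(2) a by (auto simp: subset_iff not_le)
   have "((%s. \<zeta> t (x + s *\<^sub>R b)) has_deriv 0) (at 0)"
   proof (rule has_field_derivative_transform_within_open[OF DERIV_const[of 0]])
    show "open {s. norm (x + s *\<^sub>R b) > \<bar>N\<bar>}" by (intro open_Collect_less continuous_intros)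
   qed (use n supp[OF t] in auto)
   from DERIV_unique[OF this \<zeta>_x] have "\<zeta>x t x * ((x \<bullet> b) / japanese x) = 0" by simp
   then show ?thesis using supp[OF t n] by (simp only: W'_def mult_zero_left mult_zero_right add_0)
  qed
  have iW: "integral (cbox (-a) a) (W' b) = 0" "W' b integrable_on cbox (-a) a" if b: "b \<in> Basis" for b
   using continuous_compact_integrals(2)[OF cW(2)[OF b] supW'[OF b]] W0[OF b]
   by (auto intro!: integrable_continuous continuous_on_subset[OF cW(2)[OF b]])
  define r where "r x = \<zeta>t t x * en t x - \<zeta>x t x * (2 * Z t x) * (\<Sum>b\<in>Basis. ((x \<bullet> b) / japanese x) * G b t x)" for x
  have split: "\<zeta>t t x * en t x + ent t x * \<zeta> t x = r x + (\<Sum>b\<in>Basis. W' b x)" for x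
  proof -
   have "(\<Sum>b\<in>Basis. W' b x) = \<zeta>x t x * (2 * Z t x) * (\<Sum>b\<in>Basis. ((x \<bullet> b) / japanese x) * G b t x) + ent t x * \<zeta> t x"
    unfolding W'_def ent_def by (simp add: sum.distrib sum_distrib_left sum_distrib_right algebra_simps)
   then show ?thesis by (simp add: r_def)
  qed
  have r0: "r x <= 0" for x
  proof -
   define Gv where "Gv = (\<Sum>b\<in>Basis. G b t x *\<^sub>R b)"
   have Gb: "Gv \<bullet> b = G b t x" if "b \<in> Basis" for b unfolding Gv_def using that by (rule inner_sum_left_Basis)
   have nG: "(norm Gv)^2 = (\<Sum>b\<in>Basis. (G b t x)^2)"
    unfolding power2_norm_eq_inner euclidean_inner[of Gv Gv] by (rule sum.cong) (simp_all add: Gb power2_eq_square)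
   have sx: "(\<Sum>b\<in>Basis. ((x \<bullet> b) / japanese x) * G b t x) = (x \<bullet> Gv) / japanese x"
    unfolding euclidean_inner[of x Gv] sum_divide_distrib by (rule sum.cong) (simp_all add: Gb)
   have "\<bar>x \<bullet> Gv\<bar> <= norm x * norm Gv" by (rule Cauchy_Schwarz_ineq2)
   also have "... <= japanese x * norm Gv" using japanese_ge by (intro mult_right_mono) auto
   finally have s: "\<bar>(x \<bullet> Gv) / japanese x\<bar> <= norm Gv"
    using japanese_pos[of x] by (simp add: abs_divide divide_le_eq mult.commute)
   have zx: "\<bar>\<zeta>x t x\<bar> <= - \<zeta>t t x"
   proof -
    have "0 <= f' (japanese x - t) * g (japanese x + t)" using f g by simp
    moreover have "f (japanese x - t) * g' (japanese x + t) <= 0" using f g by (simp add: mult_nonneg_nonpos)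
    ultimately show ?thesis unfolding \<zeta>x_def \<zeta>t_def by (simp add: abs_le_iff)
   qed
   have "2 * \<bar>Z t x\<bar> * norm Gv <= en t x"
    using sum_squares_bound[of "\<bar>Z t x\<bar>" "norm Gv"] unfolding en_def nG[symmetric] by simp
   have "\<bar>\<zeta>x t x * (2 * Z t x) * ((x \<bullet> Gv) / japanese x)\<bar> = \<bar>\<zeta>x t x\<bar> * (2 * \<bar>Z t x\<bar> * \<bar>(x \<bullet> Gv) / japanese x\<bar>)"
    by (simp add: abs_mult)
   also have "... <= (- \<zeta>t t x) * en t x"
   proof (rule mult_mono[OF zx])
    have "2 * \<bar>Z t x\<bar> * \<bar>(x \<bullet> Gv) / japanese x\<bar> <= 2 * \<bar>Z t x\<bar> * norm Gv" using s by (intro mult_left_mono) auto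
    then show "2 * \<bar>Z t x\<bar> * \<bar>(x \<bullet> Gv) / japanese x\<bar> <= en t x" using \<open>2 * \<bar>Z t x\<bar> * norm Gv <= en t x\<close> by linarith
    show "0 <= - \<zeta>t t x" using zx abs_ge_zero[of "\<zeta>x t x"] by linarith
   qed simp
   finally have "- (\<zeta>x t x * (2 * Z t x) * ((x \<bullet> Gv) / japanese x)) <= (- \<zeta>t t x) * en t x"
    by (rule order_trans[OF abs_ge_minus_self])
   then show ?thesis unfolding r_def sx by simp
  qed
  have cr: "continuous_on UNIV r"
   unfolding r_def[abs_def] by (intro continuous_on_diff continuous_on_mult continuous_on_sum continuous_on_const sl cjs)
  have ir: "r integrable_on cbox (-a) a" by (rule integrable_continuous[OF continuous_on_subset[OF cr]]) simp
  have "integral (cbox (-a) a) (%x. \<zeta>t t x * en t x + ent t x * \<zeta> t x) = integral (cbox (-a) a) r + (\<Sum>b\<in>Basis. integral (cbox (-a) a) (W' b))"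
   unfolding split using integral_add[OF ir integrable_sum[of Basis W' "cbox (-a) a"]] integral_sum[of Basis W' "cbox (-a) a"] iW(2) by simp
  also have "... = integral (cbox (-a) a) r" using iW(1) by simp
  also have "... <= 0" using integral_le[OF ir integrable_0] r0 by simp
  finally show ?thesis .
 qed
 have "h T <= h 0"
  by (rule DERIV_nonpos_imp_nonincreasing[OF T]) (use hd neg in blast)
 moreover have "h t = (LI x. \<zeta> t x * en t x)" if "t >= 0" for t
  unfolding h_def using continuous_compact_integrals(2)[OF cse supp2[OF that]] by simp
 ultimately show ?thesis using T unfolding \<zeta>_def by simp
qed

text \<open>The outer cutoff \<open>g\<close> of the previous inequality increases to \<open>1\<close>.\<close>

lemma exterior_energy:
 fixes f f' :: "real => real"
 assumes f: "!!s. (f has_deriv f' s) (at s)" "continuous_on UNIV f'" "!!s. f s >= 0" "!!s. f' s >= 0"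
  and T: "T >= 0" and i: "linteg (%x. f (japanese x) * en 0 x)"
 shows "linteg (%x. f (japanese x - T) * en T x)"
  and "(LI x. f (japanese x - T) * en T x) <= (LI x. f (japanese x) * en 0 x)"
proof -
 define g where "g N s = (max 0 (1 - s / real (Suc N)))^2" for N :: nat and s :: real
 have fm: "f \<in> borel_measurable borel" using f(1) by (intro borel_measurable_continuous_onI) (meson DERIV_isCont continuous_at_imp_continuous_on)
 have jm: "japanese \<in> borel_measurable (borel :: 'a measure)" by (rule borel_measurable_continuous_onI[OF japanese_continuous])
 have em: "en t \<in> borel_measurable borel" for t by (rule borel_measurable_continuous_onI[OF slice[OF en_continuous]])
 have gm: "g N \<in> borel_measurable borel" for N unfolding g_def[abs_def] by measurable
 have m: "(%x. f (japanese x - t) * en t x) \<in> lmeas" "(%x. f (japanese x - t) * g N (japanese x + t) * en t x) \<in> lmeas" for t N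
  using fm jm em gm by (simp_all add: measurable_completion)
 have g1: "0 <= g N s" "s >= 0 ==> g N s <= 1" for N s
  unfolding g_def by (auto intro!: power_le_one)
 have bnd: "(LI x. f (japanese x - T) * g N (japanese x + T) * en T x) <= (LI x. f (japanese x) * en 0 x)"
  and int: "linteg (%x. f (japanese x - T) * g N (japanese x + T) * en T x)" for N
 proof -
  define g' where "g' s = 2 * max 0 (1 - s / real (Suc N)) * (- (1 / real (Suc N)))" for s
  have gd: "(g N has_deriv g' s) (at s)" for s
   unfolding g_def g'_def
   by (rule DERIV_chain2[where f = "%s. (max 0 s)^2" and g = "%s. 1 - s / real (Suc N)", OF positive_part_square_deriv])
     (auto intro!: derivative_eq_intros)
  have g'c: "continuous_on UNIV g'" unfolding g'_def[abs_def] by (intro continuous_intros) auto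
  have g'n: "g' s <= 0" for s unfolding g'_def by (intro mult_nonneg_nonpos) auto
  have gN: "g N s = 0" if "s >= real (Suc N)" for s using that by (simp add: g_def max_def field_simps)
  have "(LI x. f (japanese x - T) * g N (japanese x + T) * en T x) <= (LI x. f (japanese x) * g N (japanese x) * en 0 x)"
   by (rule weighted_energy[OF f gd g'c g1(1) g'n gN T])
  also have "... <= (LI x. f (japanese x) * en 0 x)"
  proof (rule integral_mono'[OF i])
   fix x :: 'a
   have "f (japanese x) * g N (japanese x) <= f (japanese x) * 1" using f(3) g1(2)[of "japanese x" N] japanese_pos[of x] by (intro mult_left_mono) auto
   then show "f (japanese x) * g N (japanese x) * en 0 x <= f (japanese x) * en 0 x" using en_nonneg by (intro mult_right_mono) auto
   show "0 <= f (japanese x) * en 0 x" using f(3) en_nonneg by simp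
  qed
  finally show "(LI x. f (japanese x - T) * g N (japanese x + T) * en T x) <= (LI x. f (japanese x) * en 0 x)" .
  obtain a where a: "cball (0::'a) (real (Suc N)) \<subseteq> cbox (-a) a" using bounded_subset_cbox_symmetric[OF bounded_cball] by metis
  show "linteg (%x. f (japanese x - T) * g N (japanese x + T) * en T x)"
  proof (rule continuous_compact_integrals(1))
   have cf: "continuous_on UNIV f" "continuous_on UNIV (g N)"
    using f(1) gd by (meson DERIV_isCont continuous_at_imp_continuous_on)+
   have cj: "continuous_on UNIV (%x::'a. japanese x - T)" "continuous_on UNIV (%x::'a. japanese x + T)"
    by (intro continuous_intros japanese_continuous)+
   show "continuous_on UNIV (%x. f (japanese x - T) * g N (japanese x + T) * en T x)"
    by (intro continuous_on_mult continuous_on_compose2[OF cf(1) cj(1)] continuous_on_compose2[OF cf(2) cj(2)] slice[OF en_continuous]; simp)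
   fix x assume "x \<notin> cbox (-a) a"
   then have "x \<notin> cball 0 (real (Suc N))" using a by blast
   then have "japanese x + T >= real (Suc N)" using japanese_ge[of x] T by simp
   then show "f (japanese x - T) * g N (japanese x + T) * en T x = 0" using gN by simp
  qed
 qed
 let ?F = "%N x. f (japanese x - T) * g N (japanese x + T) * en T x" and ?G = "%x. f (japanese x - T) * en T x"
 have F0: "0 <= ?F N x" for N and x :: 'a using f(3) g1(1) en_nonneg by simp
 have "(%N. \<integral>\<^sup>+x. ennreal (?F N x) \<partial>lebesgue) \<longlonglongrightarrow> (\<integral>\<^sup>+x. ennreal (?G x) \<partial>lebesgue)"
 proof (rule nn_integral_LIMSEQ)
  show "incseq (%N x. ennreal (?F N x))"
  proof (rule incseq_SucI, rule le_funI)
   fix N :: nat and x :: 'a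
   have s: "japanese x + T >= 0" using japanese_pos[of x] T by simp
   have "g N (japanese x + T) <= g (Suc N) (japanese x + T)"
    unfolding g_def using s by (intro power_mono max.mono diff_mono divide_left_mono) auto
   then show "ennreal (?F N x) <= ennreal (?F (Suc N) x)"
    using f(3) en_nonneg by (intro ennreal_leI mult_right_mono mult_left_mono) auto
  qed
  show "(%x. ennreal (?F N x)) \<in> lmeas" for N using m(2) by simp
  fix x :: 'a
  have "(%N. (japanese x + T) / real (Suc N)) \<longlonglongrightarrow> 0" using lim_const_over_n LIMSEQ_Suc by blast
  then have "(%N. g N (japanese x + T)) \<longlonglongrightarrow> (max 0 (1 - 0))^2" unfolding g_def by (intro tendsto_intros)
  then have "(%N. ?F N x) \<longlonglongrightarrow> f (japanese x - T) * (max 0 (1 - 0))^2 * en T x" by (intro tendsto_intros)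
  then show "(%N. ennreal (?F N x)) \<longlonglongrightarrow> ennreal (?G x)" by (intro tendsto_ennrealI) simp
 qed
 moreover have "(\<integral>\<^sup>+x. ennreal (?F N x) \<partial>lebesgue) <= ennreal (LI x. f (japanese x) * en 0 x)" for N
  using nn_integral_eq_integral[OF int[of N]] F0 bnd[of N] by (simp add: ennreal_leI)
 ultimately have n: "(\<integral>\<^sup>+x. ennreal (?G x) \<partial>lebesgue) <= ennreal (LI x. f (japanese x) * en 0 x)"
  by (intro LIMSEQ_le_const2) auto
 have G0: "0 <= ?G x" for x :: 'a using f(3) en_nonneg by simp
 show ii: "linteg ?G"
 proof (rule integrableI_bounded)
  show "?G \<in> lmeas" using m(1) .
  show "(\<integral>\<^sup>+x. ennreal (norm (?G x)) \<partial>lebesgue) < \<infinity>"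
   using n G0 by (simp add: le_less_trans)
 qed
 have "0 <= (LI x. f (japanese x) * en 0 x)" using f(3) en_nonneg by (intro integral_nonneg_AE) auto
 then show "(LI x. ?G x) <= (LI x. f (japanese x) * en 0 x)"
  using n nn_integral_eq_integral[OF ii] G0 by simp
qed

end

section \<open>Mollified finite energy solutions\<close>

lemma convol_Basis_sum:
 fixes f :: "'a::euclidean_space => real"
 assumes li: "locally_integrable UNIV f" and fin: "finite I" and \<phi>: "!!i. i \<in> I ==> \<phi> i \<in> testfuns"
 shows "convol f (%y. \<Sum>i\<in>I. c i * \<phi> i y) x = (\<Sum>i\<in>I. c i * convol f (\<phi> i) x)"
proof -
 have "convol f (%y. \<Sum>i\<in>I. c i * \<phi> i y) x = (LI y. (\<Sum>i\<in>I. c i * (f y * \<phi> i (x - y))))"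
  unfolding convol_def by (simp add: sum_distrib_left mult_ac)
 also have "... = (\<Sum>i\<in>I. LI y. c i * (f y * \<phi> i (x - y)))"
  by (rule Bochner_Integration.integral_sum) (rule integrable_mult_right, rule convol_integrable[OF li \<phi>])
 finally show ?thesis by (simp add: convol_def)
qed

lemma convol_partial_deriv_sum:
 fixes f :: "'a::euclidean_space => real"
 assumes li: "locally_integrable UNIV f" and \<phi>: "\<phi> \<in> testfuns"
 shows "convol f (pd h \<phi>) x = (\<Sum>b\<in>Basis. (h \<bullet> b) * convol f (pd b \<phi>) x)"
proof -
 have "pd h \<phi> = (%y. \<Sum>b\<in>Basis. (h \<bullet> b) * pd b \<phi> y)"
  by (rule ext) (rule partial_deriv_Basis_sum[OF smooth_differentiable[OF test_smooth[OF \<phi>]]])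
 then show ?thesis
  using convol_Basis_sum[OF li finite_Basis test_partial_deriv[OF \<phi>]] by simp
qed

lemma convol_L2_bound:
 fixes f :: "'a::euclidean_space => real"
 assumes f: "f \<in> lmeas" "linteg (%x. (f x)^2)" and \<phi>: "\<phi> \<in> testfuns"
 shows "\<bar>convol f \<phi> x\<bar> <= sqrt (LI y. (f y)^2) * sqrt (LI y. (\<phi> y)^2)"
proof -
 have pm: "\<phi> \<in> lmeas" using test_borel[OF \<phi>] by (simp add: measurable_completion)
 have rm: "(%y. \<phi> (x - y)) \<in> lmeas"
  by (rule lebesgue_preserving_integral(3)[OF lebesgue_preserving_reflection pm])
 have pm2: "(%y. (\<phi> y)^2) \<in> lmeas" using pm by (rule borel_measurable_power)
 have ri: "linteg (%y. (\<phi> (x - y))^2)" "(LI y. (\<phi> (x - y))^2) = (LI y. (\<phi> y)^2)"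
  using lebesgue_preserving_integral(2)[OF lebesgue_preserving_reflection pm2, of x]
   lebesgue_preserving_integral(1)[OF lebesgue_preserving_reflection pm2, of x] test_square_integrable[OF \<phi>] by auto
 have "\<bar>convol f \<phi> x\<bar> <= (LI y. \<bar>f y * \<phi> (x - y)\<bar>)" unfolding convol_def by (rule integral_abs_bound)
 also have "... <= sqrt (LI y. (f y)^2) * sqrt (LI y. (\<phi> (x - y))^2)"
  by (rule integral_Cauchy_Schwarz[OF f(1) rm f(2) ri(1)])
 finally show ?thesis by (simp add: ri(2))
qed

text \<open>Lipschitz continuity in \<open>x\<close>, uniform for nearby times, together with continuity in \<open>t\<close> at each point.\<close>

lemma joint_continuity:
 fixes F :: "real => 'a::euclidean_space => real" and D :: "'a => real => 'a => real"
 assumes der: "!!t x h s. ((%s. F t (x + s *\<^sub>R h)) has_deriv (\<Sum>b\<in>Basis. (h \<bullet> b) * D b t (x + s *\<^sub>R h))) (at s)"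
  and bnd: "!!t0. \<exists>C. \<forall>\<^sub>F t in at t0. \<forall>b\<in>Basis. \<forall>x. \<bar>D b t x\<bar> <= C"
  and bnd0: "!!t0. \<exists>C. \<forall>b\<in>Basis. \<forall>x. \<bar>D b t0 x\<bar> <= C"
  and ct: "!!t x. isCont (%t. F t x) t"
 shows "continuous_on UNIV (%p. F (fst p) (snd p))"
proof -
 have "isCont (%p. F (fst p) (snd p)) (t0, x0)" for t0 x0
 proof -
  have lfst: "filterlim fst (nhds t0) (nhds (t0, x0))" and lsnd: "filterlim snd (nhds x0) (nhds (t0, x0))"
   using tendsto_fst[OF filterlim_ident, of "(t0, x0)"] tendsto_snd[OF filterlim_ident, of "(t0, x0)"] by simp_all
  obtain C1 C2 where C1: "\<forall>\<^sub>F t in at t0. \<forall>b\<in>Basis. \<forall>x. \<bar>D b t x\<bar> <= C1" and C2: "\<forall>b\<in>Basis. \<forall>x. \<bar>D b t0 x\<bar> <= C2"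
   using bnd bnd0 by blast
  define C where "C = max 0 (max C1 C2)"
  have CC: "C1 <= C" "C2 <= C" by (auto simp: C_def)
  have "\<forall>\<^sub>F t in nhds t0. \<forall>b\<in>Basis. \<forall>x. \<bar>D b t x\<bar> <= C"
   unfolding eventually_nhds_conv_at
  proof
   show "\<forall>\<^sub>F t in at t0. \<forall>b\<in>Basis. \<forall>x. \<bar>D b t x\<bar> <= C"
    using C1 by (rule eventually_mono) (meson CC(1) order_trans)
   show "\<forall>b\<in>Basis. \<forall>x. \<bar>D b t0 x\<bar> <= C" using C2 CC(2) by (meson order_trans)
  qed
  then have evC: "\<forall>\<^sub>F p in nhds (t0, x0). \<forall>b\<in>Basis. \<forall>x. \<bar>D b (fst p) x\<bar> <= C"
   by (rule eventually_compose_filterlim) (rule lfst)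
  have lip: "\<bar>F t x - F t x0\<bar> <= real DIM('a) * C * norm (x - x0)" if D: "\<forall>b\<in>Basis. \<forall>x. \<bar>D b t x\<bar> <= C" for t x
  proof -
   obtain z where z: "F t (x0 + 1 *\<^sub>R (x - x0)) - F t (x0 + 0 *\<^sub>R (x - x0)) = (1 - 0) * (\<Sum>b\<in>Basis. ((x - x0) \<bullet> b) * D b t (x0 + z *\<^sub>R (x - x0)))"
    using MVT2[of 0 1 "%s. F t (x0 + s *\<^sub>R (x - x0))" "%s. (\<Sum>b\<in>Basis. ((x - x0) \<bullet> b) * D b t (x0 + s *\<^sub>R (x - x0)))"] der by auto
   have B: "\<bar>\<Sum>b\<in>Basis. ((x - x0) \<bullet> b) * D b t y\<bar> <= (\<Sum>b\<in>(Basis::'a set). norm (x - x0) * C)" for y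
   proof (rule order_trans[OF sum_abs sum_mono])
    fix b :: 'a assume b: "b \<in> Basis"
    show "\<bar>((x - x0) \<bullet> b) * D b t y\<bar> <= norm (x - x0) * C"
     unfolding abs_mult using D b by (intro mult_mono Basis_le_norm) auto
   qed
   from B[where y = "x0 + z *\<^sub>R (x - x0)"] show ?thesis using z by (simp add: mult_ac)
  qed
  have l1: "((%p. F (fst p) x0) ---> F t0 x0) (nhds (t0, x0))"
  proof -
   have "filterlim (%t. F t x0) (nhds (F t0 x0)) (nhds t0)"
    using ct[where x=x0 and t=t0] unfolding isCont_def by (rule tendsto_at_iff_tendsto_nhds[THEN iffD1])
   then show ?thesis by (rule filterlim_compose) (rule lfst)
  qed
  have l2: "((%p. F (fst p) (snd p) - F (fst p) x0) ---> 0) (nhds (t0, x0))"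
  proof (rule Lim_null_comparison)
   show "\<forall>\<^sub>F p in nhds (t0, x0). norm (F (fst p) (snd p) - F (fst p) x0) <= real DIM('a) * C * norm (snd p - x0)"
    using evC by eventually_elim (use lip in auto)
   have "((%p. snd p) ---> x0) (nhds (t0, x0))" by (rule lsnd)
   then have "((%p. real DIM('a) * C * norm (snd p - x0)) ---> real DIM('a) * C * norm (x0 - x0)) (nhds (t0, x0))"
    by (intro tendsto_intros)
   then show "((%p. real DIM('a) * C * norm (snd p - x0)) ---> 0) (nhds (t0, x0))" by simp
  qed
  have "((%p. F (fst p) x0 + (F (fst p) (snd p) - F (fst p) x0)) ---> F t0 x0 + 0) (nhds (t0, x0))"
   by (intro tendsto_add l1 l2)
  then show ?thesis unfolding isCont_def by (intro tendsto_at_iff_tendsto_nhds[THEN iffD2]) simp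
 qed
 then show ?thesis by (auto simp: continuous_on_eq_continuous_at)
qed

text \<open>A finite energy solution after a choice \<open>g t\<close> of the weak gradient of \<open>u t\<close>. Below, \<open>S\<close> and \<open>V\<close> are the convolutions of \<open>u\<close> and of its time derivative \<open>v\<close> with a test function.\<close>

locale weak_wave =
 fixes u v :: "real => real^4 => real" and g :: "real => real^4 => real^4"
 assumes grad: "!!t. has_weak_gradient UNIV (u t) (g t)"
  and g2: "!!t. square_integrable (g t)" and v2: "!!t. square_integrable (v t)"
  and cg: "!!t. ((%s. LI x. (norm (g s x - g t x))^2) ---> 0) (at t)"
  and cv: "!!t. ((%s. LI x. (norm (v s x - v t x))^2) ---> 0) (at t)"
  and ut: "!!\<phi> t. \<phi> \<in> testfuns ==>
    ((%s. LI x. u s x * \<phi> x) has_deriv (LI x. v t x * \<phi> x)) (at t)"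
  and vt: "!!\<phi> t. \<phi> \<in> testfuns ==>
    ((%s. LI x. v s x * \<phi> x) has_deriv (LI x. u t x * laplacian \<phi> x)) (at t)"
begin

definition S :: "(real^4 => real) => real => real^4 => real" where "S \<phi> t x = convol (u t) \<phi> x"
definition V :: "(real^4 => real) => real => real^4 => real" where "V \<phi> t x = convol (v t) \<phi> x"

lemma u_li: "locally_integrable UNIV (u t)" using grad by (simp add: has_weak_gradient_def)

lemma v_sq: "v t \<in> lmeas" "linteg (%x. (v t x)^2)"
 using v2[of t] by (auto simp: square_integrable_def)

lemma v_li: "locally_integrable UNIV (v t)" by (rule square_integrable_locally[OF v_sq])

lemma g_sq:
 shows "(%x. g t x \<bullet> b) \<in> lmeas" "b \<in> Basis ==> linteg (%x. (g t x \<bullet> b)^2)"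
  "b \<in> Basis ==> (LI x. (g t x \<bullet> b)^2) <= (LI x. (norm (g t x))^2)"
proof -
 have gm: "g t \<in> lmeas" and gi: "linteg (%x. (norm (g t x))^2)" using g2[of t] by (auto simp: square_integrable_def)
 show m: "(%x. g t x \<bullet> b) \<in> lmeas" using gm by (rule borel_measurable_inner) simp
 assume b: "b \<in> Basis"
 have le: "(g t x \<bullet> b)^2 <= (norm (g t x))^2" for x using Basis_le_norm[OF b, of "g t x"] by (metis abs_ge_zero power2_abs power_mono)
 show i: "linteg (%x. (g t x \<bullet> b)^2)"
  by (rule Bochner_Integration.integrable_bound[OF gi borel_measurable_power[OF m]]) (use le in auto)
 show "(LI x. (g t x \<bullet> b)^2) <= (LI x. (norm (g t x))^2)" by (rule integral_mono[OF i gi le])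
qed

lemma S_gradient:
 assumes b: "b \<in> Basis" and \<phi>: "\<phi> \<in> testfuns"
 shows "S (pd b \<phi>) t x = convol (%y. g t y \<bullet> b) \<phi> x"
proof -
 have d: "\<phi> differentiable at z" for z using smooth_differentiable[OF test_smooth[OF \<phi>]] .
 have "(LINT y:UNIV|lebesgue. u t y * pd b (%y. \<phi> (x - y)) y) = - (LINT y:UNIV|lebesgue. (g t y \<bullet> b) * \<phi> (x - y))"
  using grad[of t] test_reflect[OF \<phi>, of x] b unfolding has_weak_gradient_def by blast
 then show ?thesis
  unfolding partial_deriv_reflect[OF d] by (simp add: S_def convol_def set_lebesgue_integral_def)
qed

lemma S_t:
 assumes "\<phi> \<in> testfuns" shows "((%t. S \<phi> t x) has_deriv V \<phi> t x) (at t)"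
 unfolding S_def V_def convol_def by (rule ut[OF test_reflect[OF assms]])

lemma V_t:
 assumes "\<phi> \<in> testfuns" shows "((%t. V \<phi> t x) has_deriv S (laplacian \<phi>) t x) (at t)"
 using vt[OF test_reflect[OF assms], of x t] unfolding S_def V_def convol_def laplacian_reflect[OF assms] .

lemma S_x:
 assumes "\<phi> \<in> testfuns"
 shows "((%s. S \<phi> t (x + s *\<^sub>R h)) has_deriv S (pd h \<phi>) t (x + s *\<^sub>R h)) (at s)"
 unfolding S_def by (rule convol_dir_deriv[OF u_li assms])

lemma V_x:
 assumes "\<phi> \<in> testfuns"
 shows "((%s. V \<phi> t (x + s *\<^sub>R h)) has_deriv V (pd h \<phi>) t (x + s *\<^sub>R h)) (at s)"
 unfolding V_def by (rule convol_dir_deriv[OF v_li assms])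

lemma S_x0:
 assumes "\<phi> \<in> testfuns"
 shows "((%s. S \<phi> t (x + s *\<^sub>R h)) has_deriv S (pd h \<phi>) t x) (at 0)"
 using S_x[OF assms, of t x h 0] by simp

lemma V_x0:
 assumes "\<phi> \<in> testfuns"
 shows "((%s. V \<phi> t (x + s *\<^sub>R h)) has_deriv V (pd h \<phi>) t x) (at 0)"
 using V_x[OF assms, of t x h 0] by simp

lemma S_laplacian:
 assumes "\<phi> \<in> testfuns"
 shows "S (laplacian \<phi>) t x = (\<Sum>b\<in>Basis. S (pd b (pd b \<phi>)) t x)"
proof -
 have "laplacian \<phi> = (%y. \<Sum>b\<in>Basis. 1 * pd b (pd b \<phi>) y)" by (simp add: laplacian_def[abs_def])
 then show ?thesis
  using convol_Basis_sum[where \<phi> = "%b. pd b (pd b \<phi>)" and c = "%_. 1" and x = x,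
   OF u_li finite_Basis test_partial_deriv[OF test_partial_deriv[OF assms]], of t]
  by (simp add: S_def)
qed

lemma S_laplacian_frame:
 fixes T :: "real^4 => real^4"
 assumes \<phi>: "\<phi> \<in> testfuns" and T: "orthogonal_transformation T"
 shows "S (laplacian \<phi>) t x = (\<Sum>b\<in>Basis. S (pd (T b) (pd (T b) \<phi>)) t x)"
proof -
 have "laplacian \<phi> = (%y. \<Sum>b\<in>Basis. 1 * pd (T b) (pd (T b) \<phi>) y)"
  using laplacian_orthogonal_frame[OF \<phi> T] by (simp add: fun_eq_iff)
 then show ?thesis
  using convol_Basis_sum[where \<phi> = "%b. pd (T b) (pd (T b) \<phi>)" and c = "%_. 1" and x = x,
   OF u_li finite_Basis test_partial_deriv[OF test_partial_deriv[OF \<phi>]], of t]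
  by (simp add: S_def)
qed

lemma norm_locally_bounded:
 fixes w :: "real => real^4 => 'b::euclidean_space"
 assumes sq: "!!t. square_integrable (w t)" and c: "((%s. LI x. (norm (w s x - w t x))^2) ---> 0) (at t)"
 shows "\<forall>\<^sub>F s in at t. (LI x. (norm (w s x))^2) <= 2 * (LI x. (norm (w t x))^2) + 2"
proof -
 have "\<forall>\<^sub>F s in at t. (LI x. (norm (w s x - w t x))^2) < 1" using order_tendstoD(2)[OF c, of 1] by simp
 then show ?thesis
 proof eventually_elim
  case (elim s)
  have m: "w s \<in> lmeas" "w t \<in> lmeas"
   and i: "linteg (%x. (norm (w s x))^2)" "linteg (%x. (norm (w t x))^2)"
   using sq by (auto simp: square_integrable_def)
  have i3: "linteg (%x. (norm (w s x - w t x))^2)"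
   using square_integrable_add[OF m(1) borel_measurable_uminus[OF m(2)] i(1)] i(2) by simp
  have "(LI x. (norm (w s x))^2) <= (LI x. 2 * (norm (w t x))^2 + 2 * (norm (w s x - w t x))^2)"
  proof (rule integral_mono)
   show "linteg (%x. 2 * (norm (w t x))^2 + 2 * (norm (w s x - w t x))^2)" using i i3 by simp
   show "(norm (w s x))^2 <= 2 * (norm (w t x))^2 + 2 * (norm (w s x - w t x))^2" for x
    using square_norm_add_le[of 1 "w t x" "w s x - w t x"] by simp
  qed (rule i(1))
  also have "... = 2 * (LI x. (norm (w t x))^2) + 2 * (LI x. (norm (w s x - w t x))^2)" using i i3 by simp
  finally show ?case using elim by linarith
 qed
qed

lemma S_continuous:
 assumes \<phi>: "\<phi> \<in> testfuns"
 shows "continuous_on UNIV (%p. S \<phi> (fst p) (snd p))"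
proof (rule joint_continuity[where D = "%b. S (pd b \<phi>)"])
 show "((%s. S \<phi> t (x + s *\<^sub>R h)) has_deriv (\<Sum>b\<in>Basis. (h \<bullet> b) * S (pd b \<phi>) t (x + s *\<^sub>R h))) (at s)" for t x h s
  using S_x[OF \<phi>, of t x h s] unfolding S_def convol_partial_deriv_sum[OF u_li \<phi>, of t h] .
 have b: "\<bar>S (pd b \<phi>) t x\<bar> <= sqrt (LI y. (norm (g t y))^2) * sqrt (LI y. (\<phi> y)^2)" if b: "b \<in> Basis" for b t x
 proof -
  have "\<bar>S (pd b \<phi>) t x\<bar> <= sqrt (LI y. (g t y \<bullet> b)^2) * sqrt (LI y. (\<phi> y)^2)"
   unfolding S_gradient[OF b \<phi>] by (rule convol_L2_bound[OF g_sq(1) g_sq(2)[OF b] \<phi>])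
  also have "... <= sqrt (LI y. (norm (g t y))^2) * sqrt (LI y. (\<phi> y)^2)"
   by (rule mult_right_mono[OF real_sqrt_le_mono[OF g_sq(3)[OF b]]]) simp
  finally show ?thesis .
 qed
 then show "\<exists>C. \<forall>b\<in>Basis. \<forall>x. \<bar>S (pd b \<phi>) t0 x\<bar> <= C" for t0 by blast
 show "\<exists>C. \<forall>\<^sub>F t in at t0. \<forall>b\<in>Basis. \<forall>x. \<bar>S (pd b \<phi>) t x\<bar> <= C" for t0
 proof (rule exI, rule eventually_mono[OF norm_locally_bounded[OF g2 cg, of t0]], intro ballI allI)
  fix t b x assume le: "(LI x. (norm (g t x))^2) <= 2 * (LI x. (norm (g t0 x))^2) + 2" and bb: "b \<in> (Basis :: (real^4) set)"
  show "\<bar>S (pd b \<phi>) t x\<bar> <= sqrt (2 * (LI x. (norm (g t0 x))^2) + 2) * sqrt (LI y. (\<phi> y)^2)"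
   by (rule order_trans[OF b[OF bb] mult_right_mono[OF real_sqrt_le_mono[OF le]]]) simp
 qed
 show "isCont (%t. S \<phi> t x) t" for t x using S_t[OF \<phi>] DERIV_isCont by blast
qed

lemma V_continuous:
 assumes \<phi>: "\<phi> \<in> testfuns"
 shows "continuous_on UNIV (%p. V \<phi> (fst p) (snd p))"
proof (rule joint_continuity[where D = "%b. V (pd b \<phi>)"])
 show "((%s. V \<phi> t (x + s *\<^sub>R h)) has_deriv (\<Sum>b\<in>Basis. (h \<bullet> b) * V (pd b \<phi>) t (x + s *\<^sub>R h))) (at s)" for t x h s
  using V_x[OF \<phi>, of t x h s] unfolding V_def convol_partial_deriv_sum[OF v_li \<phi>, of t h] .
 define L where "L = (\<Sum>b\<in>(Basis :: (real^4) set). sqrt (LI y. (pd b \<phi> y)^2))"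
 have b: "\<bar>V (pd b \<phi>) t x\<bar> <= sqrt (LI y. (norm (v t y))^2) * L" if b: "b \<in> Basis" for b t x
 proof -
  have "\<bar>V (pd b \<phi>) t x\<bar> <= sqrt (LI y. (v t y)^2) * sqrt (LI y. (pd b \<phi> y)^2)"
   unfolding V_def by (rule convol_L2_bound[OF v_sq test_partial_deriv[OF \<phi>]])
  also have "... <= sqrt (LI y. (v t y)^2) * L"
   unfolding L_def using b by (intro mult_left_mono member_le_sum) auto
  finally show ?thesis by simp
 qed
 then show "\<exists>C. \<forall>b\<in>Basis. \<forall>x. \<bar>V (pd b \<phi>) t0 x\<bar> <= C" for t0 by blast
 have L0: "L >= 0" unfolding L_def by (intro sum_nonneg) auto
 show "\<exists>C. \<forall>\<^sub>F t in at t0. \<forall>b\<in>Basis. \<forall>x. \<bar>V (pd b \<phi>) t x\<bar> <= C" for t0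
 proof (rule exI, rule eventually_mono[OF norm_locally_bounded[OF v2 cv, of t0]], intro ballI allI)
  fix t b x assume le: "(LI x. (norm (v t x))^2) <= 2 * (LI x. (norm (v t0 x))^2) + 2" and bb: "b \<in> (Basis :: (real^4) set)"
  show "\<bar>V (pd b \<phi>) t x\<bar> <= sqrt (2 * (LI x. (norm (v t0 x))^2) + 2) * L"
   by (rule order_trans[OF b[OF bb] mult_right_mono[OF real_sqrt_le_mono[OF le] L0]])
 qed
 show "isCont (%t. V \<phi> t x) t" for t x using V_t[OF \<phi>] DERIV_isCont by blast
qed

lemma mollified_wave_system:
 assumes \<phi>: "\<phi> \<in> testfuns"
 shows "wave_system (V \<phi>) (%b. S (pd b \<phi>)) (%b. V (pd b \<phi>)) (%b. S (pd b (pd b \<phi>)))"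
proof
 note p = test_partial_deriv[OF \<phi>] and pp = test_partial_deriv[OF test_partial_deriv[OF \<phi>]]
 show "((%t. V \<phi> t x) has_deriv (\<Sum>b\<in>Basis. S (pd b (pd b \<phi>)) t x)) (at t)" for t x
  using V_t[OF \<phi>, of x t] unfolding S_laplacian[OF \<phi>] .
qed (rule V_continuous[OF \<phi>] S_continuous[OF test_partial_deriv[OF \<phi>]] V_continuous[OF test_partial_deriv[OF \<phi>]]
  S_continuous[OF test_partial_deriv[OF test_partial_deriv[OF \<phi>]]] S_t[OF test_partial_deriv[OF \<phi>]]
  V_x0[OF \<phi>] S_x0[OF test_partial_deriv[OF \<phi>]])+

text \<open>The frame \<open>T b\<close> at the point \<open>T x\<close> is the image of the frame \<open>b\<close> at \<open>x\<close>, and the Laplacian does not depend on the frame.\<close>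

lemma rotation_difference_wave_system:
 fixes T :: "real^4 => real^4"
 assumes \<phi>: "\<phi> \<in> testfuns" and T: "orthogonal_transformation T"
 shows "wave_system (%t x. V \<phi> t x - V \<phi> t (T x)) (%b t x. S (pd b \<phi>) t x - S (pd (T b) \<phi>) t (T x))
   (%b t x. V (pd b \<phi>) t x - V (pd (T b) \<phi>) t (T x))
   (%b t x. S (pd b (pd b \<phi>)) t x - S (pd (T b) (pd (T b) \<phi>)) t (T x))"
proof
 have lin: "linear T" using T by (simp add: orthogonal_transformation_def)
 have Tc: "continuous_on UNIV (%p::real \<times> (real^4). (fst p, T (snd p)))"
  by (intro continuous_on_Pair continuous_on_fst[OF continuous_on_id]
    continuous_on_compose2[OF linear_continuous_on[OF lin[unfolded linear_conv_bounded_linear]] continuous_on_snd[OF continuous_on_id] subset_UNIV])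
 have cS: "continuous_on UNIV (%p. S \<psi> (fst p) (T (snd p)))" if "\<psi> \<in> testfuns" for \<psi>
  using continuous_on_compose2[OF S_continuous[OF that] Tc] by simp
 have cV: "continuous_on UNIV (%p. V \<psi> (fst p) (T (snd p)))" if "\<psi> \<in> testfuns" for \<psi>
  using continuous_on_compose2[OF V_continuous[OF that] Tc] by simp
 have Tx: "T (x + s *\<^sub>R b) = T x + s *\<^sub>R T b" for x b s using lin by (simp add: linear_add linear_scale)
 note p = test_partial_deriv[OF \<phi>] and pp = test_partial_deriv[OF test_partial_deriv[OF \<phi>]]
 show "continuous_on UNIV (%p. V \<phi> (fst p) (snd p) - V \<phi> (fst p) (T (snd p)))"
  by (intro continuous_on_diff V_continuous cV \<phi>)
 show "continuous_on UNIV (%p. S (pd b \<phi>) (fst p) (snd p) - S (pd (T b) \<phi>) (fst p) (T (snd p)))" for b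
  by (intro continuous_on_diff S_continuous cS p)
 show "continuous_on UNIV (%p. V (pd b \<phi>) (fst p) (snd p) - V (pd (T b) \<phi>) (fst p) (T (snd p)))" for b
  by (intro continuous_on_diff V_continuous cV p)
 show "continuous_on UNIV (%p. S (pd b (pd b \<phi>)) (fst p) (snd p) - S (pd (T b) (pd (T b) \<phi>)) (fst p) (T (snd p)))" for b
  by (intro continuous_on_diff S_continuous cS pp)
 show "((%t. V \<phi> t x - V \<phi> t (T x)) has_deriv (\<Sum>b\<in>Basis. S (pd b (pd b \<phi>)) t x - S (pd (T b) (pd (T b) \<phi>)) t (T x))) (at t)" for t x
  unfolding sum_subtractf S_laplacian[OF \<phi>, symmetric] S_laplacian_frame[OF \<phi> T, symmetric]
  by (intro DERIV_diff V_t[OF \<phi>])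
 show "((%t. S (pd b \<phi>) t x - S (pd (T b) \<phi>) t (T x)) has_deriv V (pd b \<phi>) t x - V (pd (T b) \<phi>) t (T x)) (at t)" for b t x
  by (intro DERIV_diff S_t p)
 show "((%s. V \<phi> t (x + s *\<^sub>R b) - V \<phi> t (T (x + s *\<^sub>R b))) has_deriv V (pd b \<phi>) t x - V (pd (T b) \<phi>) t (T x)) (at 0)" for b t x
  unfolding Tx by (intro DERIV_diff V_x0 \<phi>)
 show "((%s. S (pd b \<phi>) t (x + s *\<^sub>R b) - S (pd (T b) \<phi>) t (T (x + s *\<^sub>R b))) has_deriv
   S (pd b (pd b \<phi>)) t x - S (pd (T b) (pd (T b) \<phi>)) t (T x)) (at 0)" for b t x
  unfolding Tx by (intro DERIV_diff S_x0 p)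
qed

end

section \<open>Radial symmetry, decay and the mollification error\<close>

lemma continuous_nonneg_integral_zero:
 fixes f :: "'a::euclidean_space => real"
 assumes c: "continuous_on UNIV f" and nn: "!!x. f x >= 0" and i: "linteg f" and z: "(LI x. f x) <= 0"
 shows "f x = 0"
proof -
 have "(LI x. f x) >= 0" using nn by simp
 then have "(LI x. f x) = 0" using z by linarith
 then have ae: "AE x in lebesgue. f x = 0" using integral_nonneg_eq_0_iff_AE[OF i] nn by simp
 define A where "A = {x. f x ~= 0}"
 have op: "open A" unfolding A_def using c by (intro open_Collect_neq) auto
 have "A \<in> null_sets lebesgue"
  using ae AE_iff_null_sets[of A lebesgue] op by (simp add: A_def)
 then have "negligible A" by (simp add: negligible_iff_null_sets)
 then have "A = {}" using op open_not_negligible by blast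
 then show ?thesis by (auto simp: A_def)
qed

locale radial_weak_wave = weak_wave +
 fixes h :: "real => real"
 assumes u4: "!!t. linteg (%x. (u t x) ^ 4)"
  and u0: "AE x in lebesgue. u 0 x = h (norm x)" and v0: "AE x in lebesgue. v 0 x = 0"
begin

lemma V_zero:
 assumes "\<phi> \<in> testfuns" shows "V \<phi> 0 x = 0"
proof -
 have "convol (v 0) \<phi> x = convol (%_. 0) \<phi> x" by (rule convol_AE_cong[OF v0 _ test_borel[OF assms]]) simp
 then show ?thesis by (simp add: V_def convol_def)
qed

text \<open>Only the data are assumed radial; a change of variables moves the rotation from the kernel to them.\<close>

lemma S_radial_0:
 fixes T :: "real^4 => real^4"
 assumes \<phi>: "\<phi> \<in> testfuns" and sym: "!!x y. norm x = norm y ==> \<phi> x = \<phi> y"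
  and T: "orthogonal_transformation T"
 shows "S \<phi> 0 (T x) = S \<phi> 0 x"
proof -
 note p = lebesgue_preserving_orthogonal[OF T]
 have nT: "norm (T y) = norm y" for y using T by (rule orthogonal_transformation_norm)
 have Td: "T x - T y = T (x - y)" for y using T by (simp add: orthogonal_transformation_def linear_diff)
 have m: "(%y. u 0 y * \<phi> (T x - y)) \<in> lmeas"
  using convol_integrable[OF u_li \<phi>, of 0 "T x"] by simp
 have m2: "(%y. u 0 y * \<phi> (x - y)) \<in> lmeas"
  using convol_integrable[OF u_li \<phi>, of 0 "x"] by simp
 have mT: "(%y. u 0 (T y) * \<phi> (T x - T y)) \<in> lmeas"
  using lebesgue_preserving_integral(3)[OF p m] by simp
 have "S \<phi> 0 (T x) = (LI y. u 0 (T y) * \<phi> (T x - T y))"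
  unfolding S_def convol_def by (rule lebesgue_preserving_integral(1)[OF p m, symmetric])
 also have "... = (LI y. u 0 y * \<phi> (x - y))"
 proof (rule integral_cong_AE[OF mT m2])
  show "AE y in lebesgue. u 0 (T y) * \<phi> (T x - T y) = u 0 y * \<phi> (x - y)"
   using u0 lebesgue_preserving_AE[OF p u0]
  proof eventually_elim
   case (elim y)
   have "\<phi> (T (x - y)) = \<phi> (x - y)" by (rule sym) (rule nT)
   then show ?case using elim unfolding nT Td by simp
  qed
 qed
 finally show ?thesis by (simp add: S_def convol_def)
qed

text \<open>The energy inequality applies to the difference of the solution and its rotation, whose data vanish.\<close>

lemma S_radial:
 fixes x y :: "real^4"
 assumes \<phi>: "\<phi> \<in> testfuns" and sym: "!!x y. norm x = norm y ==> \<phi> x = \<phi> y"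
  and t: "t >= 0" and xy: "norm x = norm y"
 shows "S \<phi> t x = S \<phi> t y" "V \<phi> t x = V \<phi> t y"
proof -
 obtain T :: "real^4 => real^4" where T: "orthogonal_transformation T" and Tx: "T x = y"
  using orthogonal_transformation_exists[OF xy] by blast
 interpret D: wave_system "%t x. V \<phi> t x - V \<phi> t (T x)" "%b t x. S (pd b \<phi>) t x - S (pd (T b) \<phi>) t (T x)"
   "%b t x. V (pd b \<phi>) t x - V (pd (T b) \<phi>) t (T x)"
   "%b t x. S (pd b (pd b \<phi>)) t x - S (pd (T b) (pd (T b) \<phi>)) t (T x)"
  by (rule rotation_difference_wave_system[OF \<phi> T])
 have S0: "S (pd b \<phi>) 0 z = S (pd (T b) \<phi>) 0 (T z)" for b z
 proof -
  have "((%s. S \<phi> 0 (T z + s *\<^sub>R T b)) has_deriv S (pd (T b) \<phi>) 0 (T z)) (at 0)"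
   by (rule S_x0[OF \<phi>])
  moreover have "(%s. S \<phi> 0 (T z + s *\<^sub>R T b)) = (%s. S \<phi> 0 (z + s *\<^sub>R b))"
  proof
   have "T z + s *\<^sub>R T b = T (z + s *\<^sub>R b)" for s
    using T by (simp add: orthogonal_transformation_def linear_add linear_scale)
   then show "S \<phi> 0 (T z + s *\<^sub>R T b) = S \<phi> 0 (z + s *\<^sub>R b)" for s using S_radial_0[OF \<phi> sym T] by simp
  qed
  ultimately show ?thesis using S_x0[OF \<phi>, of 0 z b] DERIV_unique by metis
 qed
 have "D.en 0 z = 0" for z
 proof -
  have d: "S (pd b \<phi>) 0 z - S (pd (T b) \<phi>) 0 (T z) = 0" for b using S0[of b z] by simp
  show ?thesis unfolding D.en_def V_zero[OF \<phi>] d by simp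
 qed
 then have en0: "(%z. (%_. 1) (japanese z) * D.en 0 z) = (%z. 0)" by simp
 have Z: "V \<phi> \<tau> z - V \<phi> \<tau> (T z) = 0" if "\<tau> >= 0" for \<tau> z
 proof -
  have i0: "linteg (%z. (%_. 1::real) (japanese z) * D.en 0 z)" unfolding en0 by simp
  have f: "((%_. 1::real) has_deriv (%_. 0) s) (at s)" for s :: real by simp
  note ee = D.exterior_energy[where f = "%_. 1" and f' = "%_. 0", OF f continuous_on_const _ _ that i0]
  have e1: "linteg (D.en \<tau>)" using ee(1) by simp
  have "(LI z. D.en \<tau> z) <= (LI z. (%_. 1) (japanese z) * D.en 0 z)" using ee(2) by simp
  then have e2: "(LI z. D.en \<tau> z) <= 0" unfolding en0 by simp
  have "D.en \<tau> z = 0"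
   by (rule continuous_nonneg_integral_zero[OF D.slice[OF D.en_continuous] D.en_nonneg e1 e2])
  moreover have "0 <= (\<Sum>b\<in>Basis. (S (pd b \<phi>) \<tau> z - S (pd (T b) \<phi>) \<tau> (T z))^2)"
   by (intro sum_nonneg) simp
  ultimately have "(V \<phi> \<tau> z - V \<phi> \<tau> (T z))^2 <= 0" unfolding D.en_def by linarith
  then show ?thesis by simp
 qed
 have d: "((%t. S \<phi> t x - S \<phi> t (T x)) has_deriv V \<phi> \<tau> x - V \<phi> \<tau> (T x)) (at \<tau>)" for \<tau>
  by (intro DERIV_diff S_t[OF \<phi>])
 have "S \<phi> t x - S \<phi> t (T x) = S \<phi> 0 x - S \<phi> 0 (T x)"
 proof (cases "t = 0")
  case False
  then have "0 < t" using t by simp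
  from MVT2[OF this, of "%t. S \<phi> t x - S \<phi> t (T x)" "%\<tau>. V \<phi> \<tau> x - V \<phi> \<tau> (T x)", OF d]
  obtain z where "0 < z" "S \<phi> t x - S \<phi> t (T x) - (S \<phi> 0 x - S \<phi> 0 (T x)) = (t - 0) * (V \<phi> z x - V \<phi> z (T x))" by blast
  then show ?thesis using Z[of z x] by simp
 qed simp
 then show "S \<phi> t x = S \<phi> t y" using S_radial_0[OF \<phi> sym T, of x] Tx by simp
 show "V \<phi> t x = V \<phi> t y" using Z[OF t, of x] Tx by simp
qed

text \<open>From \<open>u t \<in> L^4\<close>, using \<open>\<bar>u\<bar> <= l + u^4 / l^3\<close>: the first term is small with \<open>l\<close>, the second is small far out.\<close>

lemma S_decay:
 assumes \<phi>: "\<phi> \<in> testfuns" and e: "e > 0"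
 shows "\<exists>N. \<forall>x. norm x >= N --> \<bar>S \<phi> t x\<bar> <= e"
proof -
 obtain C where C: "C >= 0" "!!x. \<bar>\<phi> x\<bar> <= C" using test_bounded[OF \<phi>] by blast
 obtain M where M: "M > 0" "!!x. norm x > M ==> \<phi> x = 0" using test_support[OF \<phi>] by blast
 define I where "I = (LI y. \<bar>\<phi> y\<bar>)"
 have I0: "I >= 0" unfolding I_def by simp
 define l where "l = e / (2 * (I + 1))"
 have l: "l > 0" "l * I <= e / 2" using e I0 by (auto simp: l_def field_simps)
 define W where "W k = (LI y. indicator {y. norm y >= real k} y * (u t y) ^ 4)" for k :: nat
 have um: "(%y. (u t y) ^ 4) \<in> lmeas" using u4 by (rule borel_measurable_integrable)
 have cs: "{y::real^4. norm y >= k} \<in> sets lebesgue" for k :: real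
 proof -
  have "closed {y::real^4. norm y >= k}" by (intro closed_Collect_le continuous_intros)
  then have "{y::real^4. norm y >= k} \<in> sets lborel" by simp
  then show ?thesis by (rule sets_completionI_sets)
 qed
 have im: "(%y. indicator {y. norm y >= k} y * (u t y) ^ 4) \<in> lmeas" for k :: real
  by (intro borel_measurable_times borel_measurable_indicator cs um)
 have "W \<longlonglongrightarrow> (LINT y|(lebesgue :: (real^4) measure). 0)"
  unfolding W_def
 proof (rule integral_dominated_convergence[where w = "%y. (u t y) ^ 4"])
  show "AE y in lebesgue. (%k. indicator {y. norm y >= real k} y * (u t y) ^ 4) \<longlonglongrightarrow> 0"
  proof (rule AE_I2)
   fix y :: "real^4"
   obtain K :: nat where K: "norm y < real K" using reals_Archimedean2 by blast
   have "\<forall>\<^sub>F k in sequentially. indicator {y. norm y >= real k} y * (u t y) ^ 4 = 0"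
    using eventually_ge_at_top[of K] by eventually_elim (use K in \<open>auto simp: indicator_def\<close>)
   then show "(%k. indicator {y. norm y >= real k} y * (u t y) ^ 4) \<longlonglongrightarrow> 0" by (rule tendsto_eventually)
  qed
  show "AE y in lebesgue. norm (indicator {y. norm y >= real k} y * (u t y) ^ 4) <= (u t y) ^ 4" for k
   by (rule AE_I2) (auto simp: indicator_def)
 qed (use im u4 in auto)
 then have W0: "W \<longlonglongrightarrow> 0" by simp
 define d where "d = e * l ^ 3 / (2 * (C + 1))"
 have l3: "l ^ 3 > 0" using l by simp
 have d: "d > 0" unfolding d_def using e l3 C(1) by simp
 have "C * d / l ^ 3 = e / 2 * (C / (C + 1))" unfolding d_def using l3 by simp
 also have "... <= e / 2 * 1" using e C(1) by (intro mult_left_mono) auto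
 finally have d2: "C * d / l ^ 3 <= e / 2" by simp
 have "\<forall>\<^sub>F k in sequentially. W k < d" using order_tendstoD(2)[OF W0 d] .
 then obtain k where k: "W k < d" using eventually_happens'[OF sequentially_bot] by blast
 have "\<bar>S \<phi> t x\<bar> <= e" if x: "norm x >= real k + M" for x
 proof -
  have pt: "\<bar>u t y * \<phi> (x - y)\<bar> <= l * \<bar>\<phi> (x - y)\<bar> + C / l ^ 3 * (indicator {y. norm y >= real k} y * (u t y) ^ 4)" for y
  proof (cases "norm (x - y) > M")
   case True then show ?thesis using M(2) l C(1) by (simp add: indicator_def)
  next
   case False
   have ny: "norm y >= real k" using x False norm_triangle_ineq2[of x y] by linarith
   have "\<bar>u t y\<bar> <= l + (u t y) ^ 4 / l ^ 3"
   proof (cases "\<bar>u t y\<bar> <= l")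
    case True then show ?thesis using l zero_le_even_power[of 4 "u t y"] by (simp add: add_increasing2)
   next
    case False
    have "\<bar>u t y\<bar> * l ^ 3 <= \<bar>u t y\<bar> * \<bar>u t y\<bar> ^ 3" using False l by (intro mult_left_mono power_mono) auto
    also have "... = (u t y) ^ 4" by (simp add: power_abs[symmetric] abs_mult[symmetric] eval_nat_numeral)
    finally show ?thesis using l by (simp add: pos_le_divide_eq add_increasing)
   qed
   then have "\<bar>u t y\<bar> * \<bar>\<phi> (x - y)\<bar> <= l * \<bar>\<phi> (x - y)\<bar> + (u t y) ^ 4 / l ^ 3 * \<bar>\<phi> (x - y)\<bar>"
    using mult_right_mono[OF _ abs_ge_zero] by (metis distrib_right)
   moreover have "(u t y) ^ 4 / l ^ 3 * \<bar>\<phi> (x - y)\<bar> <= (u t y) ^ 4 / l ^ 3 * C" using l C(2) by (intro mult_left_mono) auto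
   ultimately show ?thesis using ny by (simp add: abs_mult mult_ac)
  qed
  note pp = lebesgue_preserving_reflection[of x]
  have am: "(%y. \<bar>\<phi> y\<bar>) \<in> lmeas" using test_borel[OF \<phi>] by (simp add: measurable_completion)
  have ai: "linteg (%y. \<bar>\<phi> (x - y)\<bar>)" "(LI y. \<bar>\<phi> (x - y)\<bar>) = I"
   using lebesgue_preserving_integral(2)[OF pp am] lebesgue_preserving_integral(1)[OF pp am] test_integrable[OF \<phi>] by (auto simp: I_def)
  have wi: "linteg (%y. indicator {y. norm y >= real k} y * (u t y) ^ 4)"
   by (rule Bochner_Integration.integrable_bound[OF u4[of t] im]) (auto simp: indicator_def)
  note i1 = integrable_mult_right[of l, OF ai(1)] and i2 = integrable_mult_right[of "C / l ^ 3", OF wi]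
  have "\<bar>S \<phi> t x\<bar> <= (LI y. \<bar>u t y * \<phi> (x - y)\<bar>)" unfolding S_def convol_def by (rule integral_abs_bound)
  also have "... <= (LI y. l * \<bar>\<phi> (x - y)\<bar> + C / l ^ 3 * (indicator {y. norm y >= real k} y * (u t y) ^ 4))"
   by (rule integral_mono[OF integrable_abs[OF convol_integrable[OF u_li \<phi>]] Bochner_Integration.integrable_add[OF i1 i2] pt])
  also have "... = l * I + C / l ^ 3 * W k"
   unfolding Bochner_Integration.integral_add[OF i1 i2] by (simp only: integral_mult_right_zero ai(2) W_def)
  also have "... <= e / 2 + C / l ^ 3 * d" using l k C(1) by (intro add_mono mult_left_mono) auto
  also have "C / l ^ 3 * d = C * d / l ^ 3" by simp
  finally show ?thesis using d2 by linarith
 qed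
 then show ?thesis by blast
qed

definition err :: "(real^4 => real) => real => real^4 => real" where
 "err \<phi> t x = (V \<phi> t x - v t x)^2 + (\<Sum>b\<in>Basis. (S (pd b \<phi>) t x - g t x \<bullet> b)^2)"

lemma err_small:
 assumes e: "e > 0"
 shows "\<exists>d>0. \<forall>\<epsilon> \<eta>. \<epsilon> <= d --> mollifier \<epsilon> \<eta> --> linteg (err \<eta> t) \<and> (LI x. err \<eta> t x) <= e"
proof -
 have e5: "e / 5 > 0" using e by simp
 obtain d0 where d0: "d0 > 0" "!!\<epsilon> \<eta>. \<epsilon> <= d0 ==> mollifier \<epsilon> \<eta> ==>
   linteg (%x. (convol (v t) \<eta> x - v t x)^2) \<and> (LI x. (convol (v t) \<eta> x - v t x)^2) <= e / 5"
  using mollify_L2[OF v_sq e5, of t] by blast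
 define Q where "Q b d \<longleftrightarrow> d > 0 \<and> (\<forall>\<epsilon> \<eta>. \<epsilon> <= d --> mollifier \<epsilon> \<eta> -->
   linteg (%x. (convol (%y. g t y \<bullet> b) \<eta> x - g t x \<bullet> b)^2) \<and> (LI x. (convol (%y. g t y \<bullet> b) \<eta> x - g t x \<bullet> b)^2) <= e / 5)" for b d
 have "\<forall>b\<in>Basis. \<exists>d. Q b d"
  unfolding Q_def by (intro ballI mollify_L2[OF g_sq(1) g_sq(2) e5])
 from bchoice[OF this] obtain D where D: "\<forall>b\<in>Basis. Q b (D b)" by (elim exE)
 have D1: "D b > 0" if "b \<in> Basis" for b using D that by (simp add: Q_def)
 define d where "d = Min (insert d0 (D ` Basis))"
 have "d > 0" unfolding d_def using d0(1) D1 by (subst Min_gr_iff) auto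
 moreover have "linteg (err \<eta> t) \<and> (LI x. err \<eta> t x) <= e" if le: "\<epsilon> <= d" and \<eta>: "mollifier \<epsilon> \<eta>" for \<epsilon> \<eta>
 proof -
  have te: "\<eta> \<in> testfuns" using \<eta> by (simp add: mollifier_def)
  have le0: "\<epsilon> <= d0" and leb: "!!b. b \<in> Basis ==> \<epsilon> <= D b" using le by (auto simp: d_def)
  have A: "linteg (%x. (V \<eta> t x - v t x)^2)" "(LI x. (V \<eta> t x - v t x)^2) <= e / 5"
   using d0(2)[OF le0 \<eta>] unfolding V_def by (rule conjunct1, rule conjunct2)
  have B: "linteg (%x. (S (pd b \<eta>) t x - g t x \<bullet> b)^2)"
   "(LI x. (S (pd b \<eta>) t x - g t x \<bullet> b)^2) <= e / 5" if b: "b \<in> Basis" for b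
  proof -
   have "linteg (%x. (convol (%y. g t y \<bullet> b) \<eta> x - g t x \<bullet> b)^2) \<and> (LI x. (convol (%y. g t y \<bullet> b) \<eta> x - g t x \<bullet> b)^2) <= e / 5"
    using D[rule_format, OF b, unfolded Q_def, THEN conjunct2, rule_format, OF leb[OF b] \<eta>] .
   then show "linteg (%x. (S (pd b \<eta>) t x - g t x \<bullet> b)^2)"
    "(LI x. (S (pd b \<eta>) t x - g t x \<bullet> b)^2) <= e / 5"
    unfolding S_gradient[OF b te] by (rule conjunct1, rule conjunct2)
  qed
  have Bs: "linteg (%x. \<Sum>b\<in>Basis. (S (pd b \<eta>) t x - g t x \<bullet> b)^2)"
   by (rule Bochner_Integration.integrable_sum[OF B(1)])
  have "(LI x. err \<eta> t x) = (LI x. (V \<eta> t x - v t x)^2) + (\<Sum>b\<in>Basis. LI x. (S (pd b \<eta>) t x - g t x \<bullet> b)^2)"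
   unfolding err_def Bochner_Integration.integral_add[OF A(1) Bs]
   by (rule arg_cong2[where f = "(+)", OF refl]) (rule Bochner_Integration.integral_sum[OF B(1)])
  also have "... <= e / 5 + (\<Sum>b\<in>(Basis :: (real^4) set). e / 5)" by (intro add_mono sum_mono A B)
  also have "... = e" by simp
  finally have "(LI x. err \<eta> t x) <= e" .
  moreover have "linteg (err \<eta> t)" unfolding err_def[abs_def] by (rule Bochner_Integration.integrable_add[OF A(1) Bs])
  ultimately show ?thesis by blast
 qed
 ultimately show ?thesis by blast
qed

text \<open>The difference \<open>\<phi>\<close> of two mollifiers gives a solution without error terms, so its energy is bounded by that of the data. The second mollifier is then shrunk until its own errors, at the two times in question, are negligible.\<close>

lemma err_uniform:
 assumes m: "mollifier \<epsilon> \<eta>" and i0: "linteg (err \<eta> 0)" and t: "t >= 0"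
 shows "linteg (err \<eta> t)" "(LI x. err \<eta> t x) <= 4 * (LI x. err \<eta> 0 x)"
proof -
 have te: "\<eta> \<in> testfuns" using m by (simp add: mollifier_def)
 have sq: "(a - c)^2 <= 2 * (a - b)^2 + 2 * (b - c)^2" "(a - b)^2 <= 2 * (a - c)^2 + 2 * (b - c)^2" for a b c :: real
  using square_norm_add_le[of 1 "a - b" "b - c"] square_norm_add_le[of 1 "a - c" "c - b"] by (auto simp: power2_commute)
 have key: "linteg (err \<eta> t) \<and> (LI x. err \<eta> t x) <= 4 * (LI x. err \<eta> 0 x) + e" if e: "e > 0" for e
 proof -
  have e6: "e / 6 > 0" using e by simp
  obtain d1 where d1: "d1 > 0" "!!\<epsilon> \<eta>. \<epsilon> <= d1 ==> mollifier \<epsilon> \<eta> ==> linteg (err \<eta> 0) \<and> (LI x. err \<eta> 0 x) <= e / 6"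
   using err_small[OF e6, of 0] by blast
  obtain d2 where d2: "d2 > 0" "!!\<epsilon> \<eta>. \<epsilon> <= d2 ==> mollifier \<epsilon> \<eta> ==> linteg (err \<eta> t) \<and> (LI x. err \<eta> t x) <= e / 6"
   using err_small[OF e6, of t] by blast
  \<comment> \<open>A second mollifier so fine that its errors at the times \<open>0\<close> and \<open>t\<close> do not matter.\<close>
  have "min d1 d2 > 0" using d1 d2 by simp
  then obtain \<psi> :: "real^4 => real" where \<psi>: "mollifier (min d1 d2) \<psi>" using radial_mollifier_exists by blast
  have te': "\<psi> \<in> testfuns" using \<psi> by (simp add: mollifier_def)
  have A: "linteg (err \<psi> 0)" "(LI x. err \<psi> 0 x) <= e / 6"
   and B: "linteg (err \<psi> t)" "(LI x. err \<psi> t x) <= e / 6"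
   using d1(2)[OF _ \<psi>] d2(2)[OF _ \<psi>] by auto
  define \<phi> where "\<phi> = (%x. \<eta> x - \<psi> x)"
  have \<phi>: "\<phi> \<in> testfuns" unfolding \<phi>_def by (rule test_diff[OF te te'])
  have pd: "pd b \<phi> = (%x. pd b \<eta> x - pd b \<psi> x)" for b
  proof
   fix x
   have "((%s. \<eta> (x + s *\<^sub>R b) - \<psi> (x + s *\<^sub>R b)) has_deriv pd b \<eta> x - pd b \<psi> x) (at 0)"
    using DERIV_diff[OF test_dir_deriv[OF te, of x b 0] test_dir_deriv[OF te', of x b 0]] by simp
   then show "pd b \<phi> x = pd b \<eta> x - pd b \<psi> x"
    using test_dir_deriv[OF \<phi>, of x b 0] DERIV_unique unfolding \<phi>_def by fastforce
  qed
  have cd: "convol f (%x. \<alpha> x - \<beta> x) x = convol f \<alpha> x - convol f \<beta> x"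
   if "locally_integrable UNIV f" "\<alpha> \<in> testfuns" "\<beta> \<in> testfuns" for f \<alpha> \<beta> and x :: "real^4"
   unfolding convol_def right_diff_distrib
   by (rule Bochner_Integration.integral_diff[OF convol_integrable[OF that(1,2)] convol_integrable[OF that(1,3)]])
  have Vd: "V \<phi> s x = V \<eta> s x - V \<psi> s x" for s x unfolding V_def \<phi>_def by (rule cd[OF v_li te te'])
  have Sd: "S (pd b \<phi>) s x = S (pd b \<eta>) s x - S (pd b \<psi>) s x" for b s x
   unfolding S_def pd by (rule cd[OF u_li test_partial_deriv[OF te] test_partial_deriv[OF te']])
  interpret D: wave_system "V \<phi>" "%b. S (pd b \<phi>)" "%b. V (pd b \<phi>)" "%b. S (pd b (pd b \<phi>))"
   by (rule mollified_wave_system[OF \<phi>])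
  have le0: "D.en 0 x <= 2 * err \<eta> 0 x + 2 * err \<psi> 0 x" for x
  proof -
   have "D.en 0 x <= (2 * (V \<eta> 0 x - v 0 x)^2 + 2 * (V \<psi> 0 x - v 0 x)^2) + (\<Sum>b\<in>Basis.
     2 * (S (pd b \<eta>) 0 x - g 0 x \<bullet> b)^2 + 2 * (S (pd b \<psi>) 0 x - g 0 x \<bullet> b)^2)"
    unfolding D.en_def Vd Sd by (intro add_mono sum_mono sq)
   also have "... = 2 * err \<eta> 0 x + 2 * err \<psi> 0 x"
    unfolding err_def sum.distrib sum_distrib_left[symmetric] by (simp add: algebra_simps)
   finally show ?thesis .
  qed
  have let_le: "err \<eta> t x <= 2 * D.en t x + 2 * err \<psi> t x" for x
  proof -
   have "err \<eta> t x <= (2 * (V \<eta> t x - V \<psi> t x)^2 + 2 * (V \<psi> t x - v t x)^2) + (\<Sum>b\<in>Basis.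
     2 * (S (pd b \<eta>) t x - S (pd b \<psi>) t x)^2 + 2 * (S (pd b \<psi>) t x - g t x \<bullet> b)^2)"
    unfolding err_def by (intro add_mono sum_mono sq)
   also have "... = 2 * D.en t x + 2 * err \<psi> t x"
    unfolding err_def D.en_def Vd Sd sum.distrib sum_distrib_left[symmetric] by (simp add: algebra_simps)
   finally show ?thesis .
  qed
  have nn: "err \<alpha> s x >= 0" for \<alpha> s x unfolding err_def by (intro add_nonneg_nonneg sum_nonneg) auto
  have dm: "D.en s \<in> lmeas" for s
   using borel_measurable_continuous_onI[OF D.slice[OF D.en_continuous]] by (simp add: measurable_completion)
  note ii = Bochner_Integration.integrable_add[OF integrable_mult_right[of 2, OF i0] integrable_mult_right[of 2, OF A(1)]]
  have ie0: "linteg (D.en 0)"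
   by (rule Bochner_Integration.integrable_bound[OF ii dm]) (use le0 D.en_nonneg nn in \<open>auto simp: abs_of_nonneg\<close>)
  have f: "((%_. 1::real) has_deriv (%_. 0) s) (at s)" for s :: real by simp
  have ie0': "linteg (%z. (%_. 1::real) (japanese z) * D.en 0 z)" using ie0 by simp
  note ee = D.exterior_energy[where f = "%_. 1" and f' = "%_. 0", OF f continuous_on_const _ _ t ie0']
  have iet: "linteg (D.en t)" using ee(1) by simp
  have "(LI x. D.en t x) <= (LI x. D.en 0 x)" using ee(2) by simp
  also have "... <= (LI x. 2 * err \<eta> 0 x + 2 * err \<psi> 0 x)" by (rule integral_mono[OF ie0 ii le0])
  also have "... = 2 * (LI x. err \<eta> 0 x) + 2 * (LI x. err \<psi> 0 x)"
   using i0 A(1) by simp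
  finally have E: "(LI x. D.en t x) <= 2 * (LI x. err \<eta> 0 x) + e / 3" using A(2) by linarith
  note it = Bochner_Integration.integrable_add[OF integrable_mult_right[of 2, OF iet] integrable_mult_right[of 2, OF B(1)]]
  have vm: "V \<eta> t \<in> lmeas" "S (pd b \<eta>) t \<in> lmeas" for b
   using borel_measurable_continuous_onI[OF convol_continuous[OF v_li te]] borel_measurable_continuous_onI[OF convol_continuous[OF u_li test_partial_deriv[OF te]]]
   by (simp_all add: V_def[abs_def] S_def[abs_def] measurable_completion)
  have em: "err \<eta> t \<in> lmeas" unfolding err_def[abs_def]
   by (intro borel_measurable_add borel_measurable_sum borel_measurable_power borel_measurable_diff vm v_sq(1) g_sq(1))
  have iet': "linteg (err \<eta> t)"
   by (rule Bochner_Integration.integrable_bound[OF it em]) (use let_le nn D.en_nonneg in \<open>auto simp: abs_of_nonneg\<close>)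
  have "(LI x. err \<eta> t x) <= (LI x. 2 * D.en t x + 2 * err \<psi> t x)" by (rule integral_mono[OF iet' it let_le])
  also have "... = 2 * (LI x. D.en t x) + 2 * (LI x. err \<psi> t x)" using iet B(1) by simp
  finally show ?thesis using E B(2) iet' by auto
 qed
 show "linteg (err \<eta> t)" using key[of 1] by simp
 show "(LI x. err \<eta> t x) <= 4 * (LI x. err \<eta> 0 x)" by (rule field_le_epsilon) (use key in blast)
qed

end

section \<open>Polar coordinates for radial functions\<close>

definition sphere_area :: real where "sphere_area = 4 * unit_ball_vol 4"

lemma sphere_area_pos: "sphere_area > 0" by (simp add: sphere_area_def)

text \<open>The distribution of the norm is determined by the volumes of balls, which grow like the fourth power of the radius.\<close>

lemma norm_distribution:
 "distr (lborel :: (real^4) measure) borel norm = density lborel (%r. ennreal (indicator {0..} r * (sphere_area * r ^ 3)))"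
proof (rule measure_eqI_generator_eq[where E = "range (%a::real. {..a})" and \<Omega> = UNIV and A = "%n::nat. {..real n}"])
 show "Int_stable (range (%a::real. {..a}))" by (auto simp: Int_stable_def)
 have m: "(%r::real. ennreal (indicator {0..} r * (sphere_area * r ^ 3))) \<in> borel_measurable lborel" by measurable
 have nm: "(norm :: real^4 => real) \<in> measurable lborel borel" by simp
 have e1: "emeasure (distr (lborel :: (real^4) measure) borel norm) {..a} = ennreal (unit_ball_vol 4 * (max 0 a) ^ 4)" for a :: real
 proof -
  have v: "norm -` {..a} \<inter> space lborel = cball (0 :: real^4) a" by auto
  have "emeasure (distr (lborel :: (real^4) measure) borel norm) {..a} = emeasure lborel (cball (0 :: real^4) a)"
   unfolding v[symmetric] by (rule emeasure_distr[OF nm]) simp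
  also have "... = ennreal (unit_ball_vol 4 * (max 0 a) ^ 4)"
  proof (cases "a >= 0")
   case True then show ?thesis using emeasure_cball[of a "0 :: real^4"] by simp
  next
   case False then have "cball (0 :: real^4) a = {}" by simp
   then show ?thesis using False by simp
  qed
  finally show ?thesis .
 qed
 have e2: "emeasure (density lborel (%r. ennreal (indicator {0..} r * (sphere_area * r ^ 3)))) {..a} = ennreal (unit_ball_vol 4 * (max 0 a) ^ 4)" for a :: real
 proof -
  have "emeasure (density lborel (%r. ennreal (indicator {0..} r * (sphere_area * r ^ 3)))) {..a} =
    (\<integral>\<^sup>+r. ennreal (indicator {0..} r * (sphere_area * r ^ 3)) * indicator {..a} r \<partial>lborel)"
   by (rule emeasure_density[OF m]) simp
  also have "... = (\<integral>\<^sup>+r. ennreal (sphere_area * r ^ 3) * indicator {0..max 0 a} r \<partial>lborel)"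
  proof (rule nn_integral_cong)
   fix r :: real
   show "ennreal (indicator {0..} r * (sphere_area * r ^ 3)) * indicator {..a} r = ennreal (sphere_area * r ^ 3) * indicator {0..max 0 a} r"
    by (cases "r = 0") (auto simp: indicator_def)
  qed
  also have "... = ennreal (unit_ball_vol 4 * (max 0 a) ^ 4 - unit_ball_vol 4 * 0 ^ 4)"
  proof (rule nn_integral_FTC_Icc)
   fix r :: real assume "r \<in> {0..max 0 a}"
   then have "0 <= r" by simp
   show "((%r. unit_ball_vol 4 * r ^ 4) has_deriv sphere_area * r ^ 3) (at r)"
    by (auto intro!: derivative_eq_intros simp: sphere_area_def)
   show "0 <= sphere_area * r ^ 3" using sphere_area_pos \<open>0 <= r\<close> by simp
  qed auto
  finally show ?thesis by simp
 qed
 show "emeasure (distr (lborel :: (real^4) measure) borel norm) X = emeasure (density lborel (%r. ennreal (indicator {0..} r * (sphere_area * r ^ 3)))) X"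
  if "X \<in> range (%a::real. {..a})" for X
  using that e1 e2 by auto
 show "emeasure (distr (lborel :: (real^4) measure) borel norm) {..real n} ~= \<infinity>" for n
  unfolding e1 by simp
 show "sets (distr (lborel :: (real^4) measure) borel norm) = sigma_sets UNIV (range (%a::real. {..a}))"
  by (simp add: borel_eq_atMost)
 show "sets (density lborel (%r. ennreal (indicator {0..} r * (sphere_area * r ^ 3)))) = sigma_sets UNIV (range (%a::real. {..a}))"
  by (simp add: borel_eq_atMost)
 show "(\<Union>i. {..real i}) = UNIV" using real_arch_simple by auto
qed auto

lemma polar_coordinates:
 fixes F :: "real => real"
 assumes F[measurable]: "F \<in> borel_measurable borel" and \<rho>: "\<rho> >= 0"
 shows "linteg (%x::real^4. indicator {x. norm x > \<rho>} x * F (norm x)) \<longleftrightarrow> set_integrable lborel {\<rho>..} (%r. F r * r ^ 3)"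
  and "(LI x. indicator {x::real^4. norm x > \<rho>} x * F (norm x)) = sphere_area * (LINT r:{\<rho>..}|lborel. F r * r ^ 3)"
proof -
 define f where "f r = indicator {\<rho><..} r * F r" for r
 define w where "w r = indicator {0..} r * (sphere_area * r ^ 3)" for r :: real
 have fm[measurable]: "f \<in> borel_measurable borel" unfolding f_def[abs_def] by measurable
 have wm[measurable]: "w \<in> borel_measurable borel" unfolding w_def[abs_def] by measurable
 have w0: "AE r in lborel. 0 <= w r" using sphere_area_pos by (auto simp: w_def indicator_def)
 have nm: "(norm :: real^4 => real) \<in> measurable lborel borel" by simp
 have fn: "(%x::real^4. indicator {x. norm x > \<rho>} x * F (norm x)) = (%x. f (norm x))"
  by (auto simp: f_def indicator_def)
 have fnm: "(%x::real^4. f (norm x)) \<in> borel_measurable lborel" using measurable_compose[OF nm fm] .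
 have gm: "(%r. sphere_area * (indicator {\<rho>..} r *\<^sub>R (F r * r ^ 3))) \<in> borel_measurable lborel" by measurable
 have fwm: "(%r. w r *\<^sub>R f r) \<in> borel_measurable lborel" by measurable
 have ae: "AE r in lborel. w r *\<^sub>R f r = sphere_area * (indicator {\<rho>..} r *\<^sub>R (F r * r ^ 3))"
  using AE_lborel_singleton[of \<rho>] by eventually_elim (use \<rho> in \<open>auto simp: w_def f_def indicator_def\<close>)
 have d: "distr (lborel :: (real^4) measure) borel norm = density lborel (%r. ennreal (w r))"
  unfolding w_def by (rule norm_distribution)
 have "linteg (%x::real^4. f (norm x)) \<longleftrightarrow> integrable (distr (lborel :: (real^4) measure) borel norm) f"
  using integrable_distr_eq[OF nm fm] integrable_completion[OF fnm] by simp
 also have "... \<longleftrightarrow> integrable lborel (%r. w r *\<^sub>R f r)"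
  unfolding d by (rule integrable_density) (use w0 in auto)
 also have "... \<longleftrightarrow> integrable lborel (%r. sphere_area * (indicator {\<rho>..} r *\<^sub>R (F r * r ^ 3)))"
  by (rule integrable_cong_AE[OF fwm gm ae])
 also have "... \<longleftrightarrow> integrable lborel (%r. indicator {\<rho>..} r *\<^sub>R (F r * r ^ 3))"
  using integrable_mult_right[where c = sphere_area and M = lborel and f = "%r. indicator {\<rho>..} r *\<^sub>R (F r * r ^ 3)"]
   integrable_mult_right[where c = "1 / sphere_area" and M = lborel and f = "%r. sphere_area * (indicator {\<rho>..} r *\<^sub>R (F r * r ^ 3))"] sphere_area_pos
  by auto
 finally show "linteg (%x::real^4. indicator {x. norm x > \<rho>} x * F (norm x)) \<longleftrightarrow> set_integrable lborel {\<rho>..} (%r. F r * r ^ 3)"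
  unfolding fn set_integrable_def .
 have "(LI x. f (norm (x::real^4))) = (LINT r|distr (lborel :: (real^4) measure) borel norm. f r)"
  using integral_distr[OF nm fm] integral_completion[OF fnm] by simp
 also have "... = (LINT r|lborel. w r *\<^sub>R f r)"
  unfolding d by (rule integral_density) (use w0 in auto)
 also have "... = (LINT r|lborel. sphere_area * (indicator {\<rho>..} r *\<^sub>R (F r * r ^ 3)))"
  by (rule integral_cong_AE[OF fwm gm ae])
 also have "... = sphere_area * (LINT r:{\<rho>..}|lborel. F r * r ^ 3)"
  unfolding set_lebesgue_integral_def by (rule integral_mult_right_zero)
 finally show "(LI x. indicator {x::real^4. norm x > \<rho>} x * F (norm x)) = sphere_area * (LINT r:{\<rho>..}|lborel. F r * r ^ 3)"
  unfolding fn .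
qed

section \<open>The Legendre function of degree -1/2\<close>

fun legc :: "nat => real" where
 "legc 0 = 1"
| "legc (Suc n) = legc n * ((real n + 1/2) / (real n + 1))^2"

lemma legc_pos: "legc n > 0"
 by (induction n) auto

lemma legc_Suc_le: "legc (Suc n) <= legc n"
proof -
 have "((real n + 1/2) / (real n + 1))^2 <= 1"
  by (intro power_le_one) (auto simp: field_simps)
 then show ?thesis using legc_pos[of n] by (simp add: mult_left_le)
qed

lemma legc_le_1: "legc n <= 1"
 by (induction n) (use legc_Suc_le order_trans in \<open>auto simp del: legc.simps(2)\<close>)

lemma legc_rec: "(real n + 1)^2 * legc (Suc n) = (real n + 1/2)^2 * legc n"
 by (simp add: power_divide)

text \<open>The derivatives of the hypergeometric function \<open>F(1/2, 1/2; 1; w)\<close>, whose coefficients are \<open>legc\<close>.\<close>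

definition hyp :: "nat => real => real" where
 "hyp j w = (\<Sum>n. (diffs ^^ j) legc n * w ^ n)"

lemma summable_diffs_legc:
 assumes "\<bar>w\<bar> < 1" shows "summable (%n. (diffs ^^ j) legc n * w ^ n)"
 using assms
proof (induction j arbitrary: w)
 case 0
 show ?case
 proof (rule summable_comparison_test')
  show "summable (%n. \<bar>w\<bar> ^ n)" using 0 by (simp add: summable_geometric)
  show "norm ((diffs ^^ 0) legc n * w ^ n) <= \<bar>w\<bar> ^ n" if "n >= 0" for n
   using legc_le_1[of n] legc_pos[of n]
   by (simp add: abs_mult power_abs mult_left_le_one_le)
 qed
next
 case (Suc j)
 show ?case
  using termdiff_converges[of w 1 "(diffs ^^ j) legc"] Suc by simp
qed

lemma hyp_deriv:
 assumes "\<bar>w\<bar> < 1" shows "(hyp j has_deriv hyp (Suc j) w) (at w)"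
proof -
 obtain K where K: "\<bar>w\<bar> < K" "K < 1" using assms dense by blast
 have "((%x. \<Sum>n. (diffs ^^ j) legc n * x ^ n) has_deriv (\<Sum>n. diffs ((diffs ^^ j) legc) n * w ^ n)) (at w)"
  by (rule termdiffs_strong[where K = K]) (use K summable_diffs_legc in auto)
 then show ?thesis by (simp add: hyp_def[abs_def])
qed

lemma diffs_legc_nonneg: "(diffs ^^ j) legc n >= 0"
 by (induction j arbitrary: n) (auto simp: diffs_def legc_pos less_imp_le)

text \<open>The equation \<open>w (1 - w) F'' + (1 - 2 w) F' = F / 4\<close>, read off from the recurrence for the coefficients.\<close>

lemma hyp_ode:
 assumes w: "\<bar>w\<bar> < 1"
 shows "w * (1 - w) * hyp 2 w + (1 - 2 * w) * hyp 1 w = hyp 0 w / 4"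
proof -
 have s0: "(%n. legc n * w ^ n) sums hyp 0 w"
  using summable_sums[OF summable_diffs_legc[OF w, of 0]] by (simp add: hyp_def)
 have s1: "(%n. diffs legc n * w ^ n) sums hyp 1 w"
  using summable_sums[OF summable_diffs_legc[OF w, of 1]] by (simp add: hyp_def)
 have s2: "(%n. diffs (diffs legc) n * w ^ n) sums hyp 2 w"
  using summable_sums[OF summable_diffs_legc[OF w, of 2]] by (simp add: hyp_def numeral_2_eq_2)
 have a1: "(%n. real n * legc n * w ^ n) sums (w * hyp 1 w)"
 proof -
  have "(%n. w * (diffs legc n * w ^ n)) sums (w * hyp 1 w)" using s1 by (rule sums_mult)
  then have "(%n. real (Suc n) * legc (Suc n) * w ^ (Suc n)) sums (w * hyp 1 w)"
   by (simp add: diffs_def mult_ac)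
  then show ?thesis using sums_Suc_iff[of "%n. real n * legc n * w ^ n" "w * hyp 1 w"] by simp
 qed
 have a2: "(%n. real n * diffs legc n * w ^ n) sums (w * hyp 2 w)"
 proof -
  have "(%n. w * (diffs (diffs legc) n * w ^ n)) sums (w * hyp 2 w)" using s2 by (rule sums_mult)
  then have "(%n. real (Suc n) * diffs legc (Suc n) * w ^ (Suc n)) sums (w * hyp 2 w)"
   by (simp add: diffs_def mult_ac)
  then show ?thesis using sums_Suc_iff[of "%n. real n * diffs legc n * w ^ n" "w * hyp 2 w"] by simp
 qed
 have a3: "(%n. real n * (real n - 1) * legc n * w ^ n) sums (w * (w * hyp 2 w))"
 proof -
  have "(%n. w * (real n * diffs legc n * w ^ n)) sums (w * (w * hyp 2 w))" using a2 by (rule sums_mult)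
  then have "(%n. real (Suc n) * (real (Suc n) - 1) * legc (Suc n) * w ^ (Suc n)) sums (w * (w * hyp 2 w))"
   by (simp add: diffs_def mult_ac)
  then show ?thesis using sums_Suc_iff[of "%n. real n * (real n - 1) * legc n * w ^ n" "w * (w * hyp 2 w)"] by simp
 qed
 have "(%n. real n * diffs legc n * w ^ n - real n * (real n - 1) * legc n * w ^ n + diffs legc n * w ^ n
   - 2 * (real n * legc n * w ^ n)) sums (w * hyp 2 w - w * (w * hyp 2 w) + hyp 1 w - 2 * (w * hyp 1 w))"
  by (intro sums_add sums_diff sums_mult a1 a2 a3 s1)
 moreover have "real n * diffs legc n * w ^ n - real n * (real n - 1) * legc n * w ^ n + diffs legc n * w ^ n
   - 2 * (real n * legc n * w ^ n) = legc n * w ^ n / 4" for n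
 proof -
  have "real n * diffs legc n + diffs legc n = (real n + 1)^2 * legc (Suc n)"
   by (simp add: diffs_def power2_eq_square algebra_simps del: legc.simps)
  also have "... = (real n + 1/2)^2 * legc n" by (rule legc_rec)
  finally have "real n * diffs legc n + diffs legc n = (real n + 1/2)^2 * legc n" .
  then have "(real n * diffs legc n + diffs legc n) * w ^ n = (real n + 1/2)^2 * legc n * w ^ n" by simp
  then show ?thesis by (simp add: power2_eq_square algebra_simps)
 qed
 ultimately have "(%n. legc n * w ^ n / 4) sums (w * hyp 2 w - w * (w * hyp 2 w) + hyp 1 w - 2 * (w * hyp 1 w))"
  by simp
 moreover have "(%n. legc n * w ^ n / 4) sums (hyp 0 w / 4)" using s0 by (rule sums_divide)
 ultimately have "w * hyp 2 w - w * (w * hyp 2 w) + hyp 1 w - 2 * (w * hyp 1 w) = hyp 0 w / 4"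
  by (rule sums_unique2)
 then show ?thesis by (simp add: algebra_simps)
qed

text \<open>The constant term of the series gives the lower bound. Consecutive coefficients have ratio at most \<open>9/8\<close>, so for \<open>w <= 1/2\<close> a geometric series with sum \<open>4/7\<close> bounds it from above.\<close>

lemma hyp_1_bounds:
 assumes w: "0 <= w" "w <= 1/2"
 shows "1/4 <= hyp 1 w" "hyp 1 w <= 3/5"
proof -
 have aw: "\<bar>w\<bar> < 1" using w by auto
 have s: "summable (%n. diffs legc n * w ^ n)" using summable_diffs_legc[OF aw, of 1] by simp
 have nn: "diffs legc n * w ^ n >= 0" for n
  using diffs_legc_nonneg[of 1 n] w by simp
 have "(\<Sum>n<1. diffs legc n * w ^ n) <= hyp 1 w"
  unfolding hyp_def using sum_le_suminf[OF s, of "{..<1}"] nn by simp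
 then show "1/4 <= hyp 1 w" by (simp add: diffs_def power2_eq_square)
 have g: "diffs legc n <= 1/4 * (9/8) ^ n" for n
 proof (induction n)
  case 0 show ?case by (simp add: diffs_def power2_eq_square)
 next
  case (Suc n)
  have "diffs legc (Suc n) = diffs legc n * ((real n + 3/2)^2 / ((real n + 1) * (real n + 2)))"
  proof -
   have alg: "(a + 2) * (c * ((a + 3/2) / (a + 2))^2) = (a + 1) * c * ((a + 3/2)^2 / ((a + 1) * (a + 2)))"
    if "a >= 0" for a c :: real
   proof -
    have "(a + 2) * (c * ((a + 3/2) / (a + 2))^2) = c * ((a + 3/2)^2 / (a + 2))"
     using that by (simp add: power_divide power2_eq_square[of "a + 2"])
    also have "... = (a + 1) * c * ((a + 3/2)^2 / ((a + 1) * (a + 2)))" using that by simp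
    finally show ?thesis .
   qed
   have "legc (Suc (Suc n)) = legc (Suc n) * ((real n + 3/2) / (real n + 2))^2"
    by (subst legc.simps(2)) (simp add: add.commute)
   then show ?thesis using alg[of "real n" "legc (Suc n)"]
    by (simp add: diffs_def add.commute[of 1] add.commute[of 2] del: legc.simps)
  qed
  also have "... <= diffs legc n * (9/8)"
  proof (rule mult_left_mono)
   have "8 * (real n + 3/2)^2 <= 9 * ((real n + 1) * (real n + 2))"
    by (simp add: power2_eq_square algebra_simps)
   then show "(real n + 3/2)^2 / ((real n + 1) * (real n + 2)) <= 9/8"
    by (simp add: divide_le_eq)
  qed (use diffs_legc_nonneg[of 1] in simp)
  also have "... <= 1/4 * (9/8) ^ Suc n" using Suc by simp
  finally show ?case .
 qed
 have gs: "(%n. 1/4 * (9/16::real) ^ n) sums (1/4 * (1 / (1 - 9/16)))"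
  by (intro sums_mult geometric_sums) simp
 have "hyp 1 w <= (\<Sum>n. 1/4 * (9/16::real) ^ n)"
  unfolding hyp_def
 proof (rule suminf_le)
  show "(diffs ^^ 1) legc n * w ^ n <= 1/4 * (9/16) ^ n" for n
  proof -
   have "diffs legc n * w ^ n <= (1/4 * (9/8) ^ n) * (1/2) ^ n"
    using g[of n] w diffs_legc_nonneg[of 1 n] by (intro mult_mono power_mono) auto
   also have "... = 1/4 * (9/16) ^ n" by (simp add: power_mult_distrib[symmetric])
   finally show ?thesis by simp
  qed
 qed (use s gs in \<open>auto simp: sums_iff\<close>)
 also have "... = 4/7" using gs by (simp add: sums_iff)
 finally show "hyp 1 w <= 3/5" by simp
qed

text \<open>The derivatives of the Legendre function of degree \<open>-1/2\<close>, as functions of \<open>z = 1 - 2 w\<close>.\<close>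

definition leg :: "nat => real => real" where
 "leg j z = (- 1/2) ^ j * hyp j ((1 - z) / 2)"

lemma leg_deriv:
 assumes "-1 < z" "z < 3" shows "(leg j has_deriv leg (Suc j) z) (at z)"
proof -
 have "\<bar>(1 - z) / 2\<bar> < 1" using assms by auto
 note h = hyp_deriv[OF this, of j]
 have "((%z. (1 - z) / 2) has_deriv -1/2) (at z)"
  by (auto intro!: derivative_eq_intros)
 from DERIV_chain2[OF h this]
 have "((%z. hyp j ((1 - z) / 2)) has_deriv hyp (Suc j) ((1 - z) / 2) * (- 1 / 2)) (at z)" .
 from DERIV_cmult[OF this, of "(- 1/2) ^ j"] show ?thesis
  by (simp add: leg_def[abs_def] mult_ac)
qed

lemma leg_ode:
 assumes "-1 < z" "z < 3"
 shows "(1 - z\<^sup>2) * leg 2 z = 2 * z * leg 1 z + leg 0 z / 4"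
proof -
 have "\<bar>(1 - z) / 2\<bar> < 1" using assms by auto
 from hyp_ode[OF this] show ?thesis
  by (simp add: leg_def power2_eq_square field_simps)
qed

lemma leg_0_1: "leg 0 1 = 1"
 using powser_zero[of legc] by (simp add: leg_def hyp_def)

lemma leg_1_bounds:
 assumes "0 <= z" "z <= 1" shows "- 3/10 <= leg 1 z" "leg 1 z <= - 1/8"
 using hyp_1_bounds[of "(1 - z) / 2"] assms by (auto simp: leg_def)

lemma leg_0_bounds:
 assumes "0 <= z" "z <= 1" shows "1 <= leg 0 z" "leg 0 z <= 2"
proof -
 have "1 <= leg 0 z \<and> leg 0 z <= 2"
 proof (cases "z = 1")
  case True then show ?thesis by (simp add: leg_0_1)
 next
  case False
  then have "z < 1" using assms by simp
  obtain y where y: "z < y" "y < 1" "leg 0 1 - leg 0 z = (1 - z) * leg 1 y"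
   using MVT2[OF \<open>z < 1\<close>, of "leg 0" "leg 1"] leg_deriv[of _ 0] assms by force
  have "- 3/10 <= leg 1 y" "leg 1 y <= 0" using leg_1_bounds[of y] y assms by auto
  then have "(1 - z) * leg 1 y <= 0" using \<open>z < 1\<close> by (intro mult_nonneg_nonpos) auto
  moreover have "(1 - z) * (- leg 1 y) <= 1 * (3/10)"
   by (rule mult_mono) (use \<open>- 3/10 <= leg 1 y\<close> \<open>leg 1 y <= 0\<close> assms in auto)
  ultimately show ?thesis using y(3) leg_0_1 by linarith
 qed
 then show "1 <= leg 0 z" "leg 0 z <= 2" by auto
qed

text \<open>With \<open>z = (t + v) / (t + s)\<close> the pair \<open>kerA z / (s + t)\<close>, \<open>kerB z / (s + t)\<close> is a self-similar solution of the radial system; the relations \<open>ker_rel1\<close> and \<open>ker_rel2\<close> below express this and amount to the Legendre equation.\<close>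

definition kerA :: "real => real" where "kerA z = (1 - z) * leg 1 z - leg 0 z / 2"
definition kerB :: "real => real" where "kerB z = - (1 + z) * leg 1 z - leg 0 z / 2"
definition kerA' :: "real => real" where "kerA' z = (1 - z) * leg 2 z - 3/2 * leg 1 z"
definition kerB' :: "real => real" where "kerB' z = - (1 + z) * leg 2 z - 3/2 * leg 1 z"

lemma kerA_deriv: "-1 < z ==> z < 3 ==> (kerA has_deriv kerA' z) (at z)"
 unfolding kerA_def[abs_def] kerA'_def
 by (auto intro!: derivative_eq_intros leg_deriv simp: numeral_2_eq_2 algebra_simps)

lemma kerB_deriv: "-1 < z ==> z < 3 ==> (kerB has_deriv kerB' z) (at z)"
 unfolding kerB_def[abs_def] kerB'_def
 by (auto intro!: derivative_eq_intros leg_deriv simp: numeral_2_eq_2 algebra_simps)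

lemma ker_rel1: "-1 < z ==> z < 3 ==> (1 - z) * kerB' z - kerB z = - kerA z / 2"
 using leg_ode[of z] unfolding kerA_def kerB_def kerA'_def kerB'_def
 by (simp add: power2_eq_square field_simps)

lemma ker_rel2: "-1 < z ==> z < 3 ==> (1 + z) * kerA' z + kerA z = kerB z / 2"
 using leg_ode[of z] unfolding kerA_def kerB_def kerA'_def kerB'_def
 by (simp add: power2_eq_square field_simps)

lemma kerA_1: "kerA 1 = - 1/2" by (simp add: kerA_def leg_0_1)

lemma kerA_minus_kerB: "kerA z - kerB z = 2 * leg 1 z" by (simp add: kerA_def kerB_def algebra_simps)

lemma ker_bounds:
 assumes "0 <= z" "z <= 1" shows "\<bar>kerA z\<bar> <= 2" "\<bar>kerB z\<bar> <= 2"
proof -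
 have 1: "\<bar>leg 1 z\<bar> <= 3/10" "\<bar>leg 0 z\<bar> <= 2" using leg_1_bounds[OF assms] leg_0_bounds[OF assms] by auto
 have 2: "\<bar>(1 - z) * leg 1 z\<bar> <= 1 * (3/10)" "\<bar>(1 + z) * leg 1 z\<bar> <= 2 * (3/10)"
  unfolding abs_mult using 1 assms by (intro mult_mono; simp)+
 show "\<bar>kerA z\<bar> <= 2" "\<bar>kerB z\<bar> <= 2" 
  unfolding kerA_def kerB_def mult_minus_left using 1 2 by linarith+
qed

section \<open>Half-lines and the Hardy inequality\<close>

lemma nonneg_half_line:
 fixes f :: "real => real"
 assumes c: "continuous_on {a..} f" and nn: "!!s. s >= a ==> f s >= 0"
  and b: "!!N. N >= a ==> integral {a..N} f <= C"
 shows "set_integrable lborel {a..} f" and "(LINT s:{a..}|lborel. f s) <= C"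
  and "!!N. N >= a ==> integral {a..N} f <= (LINT s:{a..}|lborel. f s)"
  and "((%N. integral {a..N} f) ---> (LINT s:{a..}|lborel. f s)) at_top"
proof -
 have ci: "continuous_on {a..N} f" for N using c by (rule continuous_on_subset) auto
 have mono: "integral {a..N} f <= integral {a..N'} f" if "a <= N" "N <= N'" for N N'
  by (rule integral_subset_le) (use that ci nn in \<open>auto intro: integrable_continuous_real\<close>)
 let ?F = "%i::nat. %s. indicator {a..a + real i} s *\<^sub>R f s"
 have F: "integrable lborel (?F i)" "integral\<^sup>L lborel (?F i) = integral {a..a + real i} f" for i
 proof -
  have si: "set_integrable lborel {a..a + real i} f" by (rule borel_integrable_atLeastAtMost'[OF ci])
  show "integrable lborel (?F i)" using si by (simp add: set_integrable_def)
  show "integral\<^sup>L lborel (?F i) = integral {a..a + real i} f"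
   using set_borel_integral_eq_integral(2)[OF si] by (simp add: set_lebesgue_integral_def)
 qed
 have inc: "incseq (%i. integral {a..a + real i} f)" by (auto simp: incseq_def intro!: mono)
 have bd: "integral {a..a + real i} f <= C" for i by (rule b) auto
 obtain L where L: "(%i. integral {a..a + real i} f) \<longlonglongrightarrow> L" "\<forall>i. integral {a..a + real i} f <= L"
  using incseq_convergent[OF inc, of C] bd by blast
 have hb: "has_bochner_integral lborel (%s. indicator {a..} s *\<^sub>R f s) L"
 proof (rule has_bochner_integral_monotone_convergence[where f = ?F])
  show "AE s in lborel. mono (%i. ?F i s)"
   using nn by (auto intro!: AE_I2 monoI simp: indicator_def split: if_splits)
  show "AE s in lborel. (%i. ?F i s) \<longlonglongrightarrow> indicator {a..} s *\<^sub>R f s"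
  proof (rule AE_I2)
   fix s
   obtain n where n: "s - a <= real n" using real_arch_simple by blast
   have "\<forall>\<^sub>F i in sequentially. ?F i s = indicator {a..} s *\<^sub>R f s"
    using eventually_ge_at_top[of n]
   proof eventually_elim
    case (elim i)
    then have "real n <= real i" by simp
    then show ?case using n by (auto simp: indicator_def)
   qed
   then show "(%i. ?F i s) \<longlonglongrightarrow> indicator {a..} s *\<^sub>R f s" by (rule tendsto_eventually)
  qed
  show "(%i. integral\<^sup>L lborel (?F i)) \<longlonglongrightarrow> L" using F L by simp
  show "(%s. indicator {a..} s *\<^sub>R f s) \<in> borel_measurable lborel"
   using borel_measurable_continuous_on_indicator[OF _ c] by simp
 qed (rule F)
 then show "set_integrable lborel {a..} f" by (auto simp: set_integrable_def has_bochner_integral_iff)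
 have LI: "(LINT s:{a..}|lborel. f s) = L" using hb by (simp add: set_lebesgue_integral_def has_bochner_integral_iff)
 show "(LINT s:{a..}|lborel. f s) <= C" unfolding LI using LIMSEQ_le_const2[OF L(1)] bd by blast
 show le: "integral {a..N} f <= (LINT s:{a..}|lborel. f s)" if "N >= a" for N
 proof -
  obtain n where n: "N - a <= real n" using real_arch_simple by blast
  have "integral {a..N} f <= integral {a..a + real n} f" using that n by (intro mono) auto
  then show ?thesis using L(2) LI order_trans by blast
 qed
 show "((%N. integral {a..N} f) ---> (LINT s:{a..}|lborel. f s)) at_top"
 proof (rule tendstoI)
  fix e :: real assume "e > 0"
  then obtain i where "\<bar>integral {a..a + real i} f - L\<bar> < e" using LIMSEQ_D[OF L(1)] by fastforce
  then have i: "integral {a..a + real i} f > L - e" by auto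
  show "\<forall>\<^sub>F N in at_top. dist (integral {a..N} f) (LINT s:{a..}|lborel. f s) < e"
   using eventually_ge_at_top[of "a + real i"]
  proof eventually_elim
   case (elim N)
   have "integral {a..a + real i} f <= integral {a..N} f" using elim by (intro mono) auto
   moreover have "integral {a..N} f <= L" using le[of N] LI elim by auto
   ultimately show ?case using i \<open>e > 0\<close> LI by (simp add: dist_real_def)
  qed
 qed
qed

lemma inverse_square_half_line:
 fixes a c :: real
 assumes "a + c > 0"
 shows "set_integrable lborel {a..} (%s. 1 / (s + c)^2)"
  and "(LINT s:{a..}|lborel. 1 / (s + c)^2) <= 1 / (a + c)"
  and "!!N. N >= a ==> integral {a..N} (%s. 1 / (s + c)^2) <= 1 / (a + c)"
proof -
 have I: "integral {a..N} (%s. 1 / (s + c)^2) = 1 / (a + c) - 1 / (N + c)" if "N >= a" for N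
 proof -
  have "((%s. 1 / (s + c)^2) has_integral (- 1 / (N + c)) - (- 1 / (a + c))) {a..N}"
  proof (rule fundamental_theorem_of_calculus[OF that])
   fix x assume "x \<in> {a..N}"
   then have "x + c > 0" using assms by auto
   then show "((%s. - 1 / (s + c)) has_vector_derivative 1 / (x + c)^2) (at x within {a..N})"
    unfolding has_real_derivative_iff_has_vector_derivative[symmetric]
    by (auto intro!: derivative_eq_intros simp: power2_eq_square)
  qed
  then show ?thesis by (simp add: integral_unique)
 qed
 show b: "integral {a..N} (%s. 1 / (s + c)^2) <= 1 / (a + c)" if "N >= a" for N
 proof -
  have "0 <= 1 / (N + c)" using that assms by simp
  then show ?thesis using I[OF that] by linarith
 qed
 have c: "continuous_on {a..} (%s. 1 / (s + c)^2)"
  using assms by (intro continuous_intros) auto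
 show "set_integrable lborel {a..} (%s. 1 / (s + c)^2)" "(LINT s:{a..}|lborel. 1 / (s + c)^2) <= 1 / (a + c)"
  by (rule nonneg_half_line(1,2)[OF c _ b]; simp)+
qed

lemma set_integrable_half_line_mult:
 fixes f g :: "real => real"
 assumes "continuous_on {a..} f" "continuous_on {a..} g"
  and "set_integrable lborel {a..} (%s. (f s)^2)" "set_integrable lborel {a..} (%s. (g s)^2)"
 shows "set_integrable lborel {a..} (%s. f s * g s)"
  and "\<bar>LINT s:{a..}|lborel. f s * g s\<bar> <= sqrt (LINT s:{a..}|lborel. (f s)^2) * sqrt (LINT s:{a..}|lborel. (g s)^2)"
proof -
 let ?f = "%s. indicator {a..} s * f s" and ?g = "%s. indicator {a..} s * g s"
 have m: "?f \<in> borel_measurable lborel" "?g \<in> borel_measurable lborel"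
  using borel_measurable_continuous_on_indicator[OF _ assms(1)] borel_measurable_continuous_on_indicator[OF _ assms(2)]
  by simp_all
 have e: "(%s. (?f s)^2) = (%s. indicator {a..} s *\<^sub>R (f s)\<^sup>2)" "(%s. (?g s)^2) = (%s. indicator {a..} s *\<^sub>R (g s)\<^sup>2)"
   "(%s. ?f s * ?g s) = (%s. indicator {a..} s *\<^sub>R (f s * g s))"
  by (auto simp: indicator_def)
 have i: "integrable lborel (%s. (?f s)^2)" "integrable lborel (%s. (?g s)^2)"
  using assms(3,4) unfolding e by (simp_all add: set_integrable_def)
 show "set_integrable lborel {a..} (%s. f s * g s)"
  using square_integrable_mult[OF m i] unfolding e by (simp add: set_integrable_def)
 have "\<bar>LINT s|lborel. ?f s * ?g s\<bar> <= (LINT s|lborel. \<bar>?f s * ?g s\<bar>)"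
  by (rule integral_abs_bound)
 also have "... <= sqrt (LINT s|lborel. (?f s)^2) * sqrt (LINT s|lborel. (?g s)^2)"
  by (rule integral_Cauchy_Schwarz[OF m i])
 finally show "\<bar>LINT s:{a..}|lborel. f s * g s\<bar> <= sqrt (LINT s:{a..}|lborel. (f s)^2) * sqrt (LINT s:{a..}|lborel. (g s)^2)"
  unfolding e by (simp add: set_lebesgue_integral_def)
qed

definition hardy_avg :: "(real => real) => real => real" where
 "hardy_avg f v = (LINT s:{v..}|lborel. f s / s)"

context
 fixes f :: "real => real" and R :: real
 assumes R: "R > 0" and fc: "continuous_on {R..} f"
  and fi: "set_integrable lborel {R..} (%s. (f s)^2)"
begin

lemma hardy_avg_integrable: "v >= R ==> set_integrable lborel {v..} (%s. f s / s)"
 and hardy_avg_bound: "v >= R ==> v * (hardy_avg f v)^2 <= (LINT s:{v..}|lborel. (f s)^2)"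
proof -
 assume xi: "v >= R"
 have c1: "continuous_on {v..} f" using fc by (rule continuous_on_subset) (use xi in auto)
 have c2: "continuous_on {v..} (%s. 1 / s)" using R xi by (intro continuous_intros) auto
 have i1: "set_integrable lborel {v..} (%s. (f s)^2)"
  using fi by (rule set_integrable_subset) (use xi in auto)
 have i2: "set_integrable lborel {v..} (%s. (1 / s)^2)"
  using inverse_square_half_line(1)[of v 0] R xi by (simp add: power_divide)
 note h = set_integrable_half_line_mult[OF c1 c2 i1 i2]
 show "set_integrable lborel {v..} (%s. f s / s)" using h(1) by simp
 have "\<bar>hardy_avg f v\<bar> <= sqrt (LINT s:{v..}|lborel. (f s)^2) * sqrt (LINT s:{v..}|lborel. (1 / s)^2)"
  using h(2) by (simp add: hardy_avg_def)
 also have "... <= sqrt (LINT s:{v..}|lborel. (f s)^2) * sqrt (1 / v)"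
 proof (intro mult_left_mono real_sqrt_le_mono)
  show "(LINT s:{v..}|lborel. (1 / s)^2) <= 1 / v"
   using inverse_square_half_line(2)[of v 0] R xi by (simp add: power_divide)
  have "0 <= (LINT s:{v..}|lborel. (f s)^2)"
   unfolding set_lebesgue_integral_def by (rule integral_nonneg_AE) (auto intro!: AE_I2)
  then show "0 <= sqrt (LINT s:{v..}|lborel. (f s)^2)" by simp
 qed
 finally have *: "\<bar>hardy_avg f v\<bar> <= sqrt ((LINT s:{v..}|lborel. (f s)^2) / v)"
  by (simp add: real_sqrt_mult[symmetric])
 have nn: "0 <= (LINT s:{v..}|lborel. (f s)^2) / v"
  unfolding set_lebesgue_integral_def using R xi by (intro divide_nonneg_nonneg integral_nonneg_AE) (auto intro!: AE_I2)
 have "(hardy_avg f v)^2 <= (LINT s:{v..}|lborel. (f s)^2) / v"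
  using power_mono[OF *, of 2] nn by simp
 then show "v * (hardy_avg f v)^2 <= (LINT s:{v..}|lborel. (f s)^2)"
  using R xi by (simp add: pos_le_divide_eq mult.commute)
qed

lemma hardy_avg_split: "R <= v ==> hardy_avg f v = hardy_avg f R - integral {R..v} (%s. f s / s)"
proof -
 assume xi: "R <= v"
 have ii: "set_integrable lborel {R..} (%s. f s / s)" by (rule hardy_avg_integrable) simp
 have si: "set_integrable lborel {R..<v} (%s. f s / s)" "set_integrable lborel {v..} (%s. f s / s)"
  by (rule set_integrable_subset[OF ii]; use xi in auto)+
 have "{R..} = {R..<v} \<union> {v..}" using xi by auto
 moreover have "{R..<v} \<inter> {v..} = {}" by auto
 ultimately have "hardy_avg f R = (LINT s:{R..<v}|lborel. f s / s) + hardy_avg f v"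
  unfolding hardy_avg_def using set_integral_Un[of "{R..<v}" "{v..}" lborel "%s. f s / s"] si by (simp only:)
 moreover have "(LINT s:{R..<v}|lborel. f s / s) = integral {R..<v} (%s. f s / s)"
  by (rule set_borel_integral_eq_integral(2)[OF si(1)])
 moreover have "integral {R..<v} (%s. f s / s) = integral {R..v} (%s. f s / s)"
  by (rule integral_spike_set; rule negligible_subset[of "{v}"]; auto)
 ultimately show ?thesis by simp
qed

lemma hardy_avg_continuous: "continuous_on {R..M} (hardy_avg f)"
proof -
 have fcM: "continuous_on {R..M} f" by (rule continuous_on_subset[OF fc]) auto
 have "continuous_on {R..M} (%s. f s / s)"
  using R by (intro continuous_on_divide fcM continuous_on_id) auto
 then have "continuous_on {R..M} (%v. hardy_avg f R - integral {R..v} (%s. f s / s))"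
  by (intro continuous_on_diff continuous_on_const indefinite_integral_continuous_1 integrable_continuous_real)
 then show ?thesis by (rule continuous_on_eq) (simp add: hardy_avg_split[symmetric])
qed

text \<open>Integration by parts: \<open>(y h^2)' = h^2 - 2 f h\<close> for \<open>h = hardy_avg f\<close>.\<close>

lemma hardy_identity:
 assumes "R <= M"
 shows "integral {R..M} (%v. (hardy_avg f v)^2) - 2 * integral {R..M} (%v. f v * hardy_avg f v)
  = M * (hardy_avg f M)^2 - R * (hardy_avg f R)^2"
proof -
 let ?B = "hardy_avg f"
 have fcM: "continuous_on {R..M} f" by (rule continuous_on_subset[OF fc]) auto
 have c: "continuous_on {R..M} (%s. f s / s)" using R fcM by (intro continuous_intros) auto
 have der: "(?B has_deriv - (f x / x)) (at x within {R..M})" if "x \<in> {R..M}" for x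
 proof -
  have "((%v. ?B R - integral {R..v} (%s. f s / s)) has_deriv 0 - f x / x) (at x within {R..M})"
   by (intro DERIV_diff DERIV_const integral_has_real_derivative[OF c that])
  then have "((%v. ?B R - integral {R..v} (%s. f s / s)) has_deriv - (f x / x)) (at x within {R..M})" by simp
  then show ?thesis
   by (rule has_field_derivative_transform_within[where d = 1]) (use that in \<open>simp_all add: hardy_avg_split[symmetric]\<close>)
 qed
 have "((%v. (?B v)^2 - 2 * (f v * ?B v)) has_integral M * (?B M)^2 - R * (?B R)^2) {R..M}"
 proof (rule fundamental_theorem_of_calculus[OF assms])
  fix x assume x: "x \<in> {R..M}"
  then have "x > 0" using R by auto
  show "((%v. v * (?B v)^2) has_vector_derivative (?B x)\<^sup>2 - 2 * (f x * ?B x)) (at x within {R..M})"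
   unfolding has_real_derivative_iff_has_vector_derivative[symmetric]
   using \<open>x > 0\<close> by (auto intro!: derivative_eq_intros der[OF x] simp: field_simps)
 qed
 moreover have "(%v. (?B v)^2) integrable_on {R..M}" "(%v. 2 * (f v * ?B v)) integrable_on {R..M}"
  using hardy_avg_continuous fcM by (auto intro!: integrable_continuous_real continuous_intros)
 ultimately show ?thesis
  using integral_diff[of "%v. (?B v)^2" "{R..M}" "%v. 2 * (f v * ?B v)"] by (simp add: integral_unique)
qed

text \<open>The quadratic form with kernel \<open>1 / max\<close> is nonnegative, up to the part of the norm beyond \<open>M\<close>.\<close>

lemma hardy_lower:
 assumes "R <= M"
 shows "2 * integral {R..M} (%v. f v * hardy_avg f v) >= - (LINT s:{M..}|lborel. (f s)^2)"
proof -
 have "0 <= integral {R..M} (%v. (hardy_avg f v)^2)"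
  by (intro integral_nonneg integrable_continuous_real continuous_intros hardy_avg_continuous) auto
 moreover have "M * (hardy_avg f M)^2 <= (LINT s:{M..}|lborel. (f s)^2)" using assms by (rule hardy_avg_bound)
 moreover have "0 <= R * (hardy_avg f R)^2" using R by simp
 ultimately show ?thesis using hardy_identity[OF assms] by linarith
qed

lemma hardy_upper:
 assumes "R <= M"
 shows "integral {R..M} (%v. f v * hardy_avg f v) <=
   2 * integral {R..M} (%s. (f s)^2) + (LINT s:{M..}|lborel. (f s)^2) / 2"
proof -
 let ?B = "hardy_avg f"
 have fcM: "continuous_on {R..M} f" by (rule continuous_on_subset[OF fc]) auto
 have i: "(%v. (?B v)^2) integrable_on {R..M}" "(%v. f v * ?B v) integrable_on {R..M}"
  "(%v. (f v)^2) integrable_on {R..M}"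
  using hardy_avg_continuous fcM by (auto intro!: integrable_continuous_real continuous_intros)
 have "integral {R..M} (%v. f v * ?B v) <= integral {R..M} (%v. (f v)^2 + (?B v)^2 / 4)"
 proof (rule integral_le)
  show "(%v. (f v)^2 + (?B v)^2 / 4) integrable_on {R..M}"
   using hardy_avg_continuous fcM by (auto intro!: integrable_continuous_real continuous_intros)
  fix x
  have "0 <= (f x - ?B x / 2)^2" by simp
  then show "f x * ?B x <= (f x)^2 + (?B x)^2 / 4" by (simp add: power2_eq_square algebra_simps)
 qed (use i in auto)
 also have "... = integral {R..M} (%v. (f v)^2) + integral {R..M} (%v. (?B v)^2) / 4"
  using i by (simp add: integral_add)
 finally have 1: "integral {R..M} (%v. f v * ?B v) <= integral {R..M} (%v. (f v)^2) + integral {R..M} (%v. (?B v)^2) / 4" .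
 have 2: "M * (hardy_avg f M)^2 <= (LINT s:{M..}|lborel. (f s)^2)" using assms by (rule hardy_avg_bound)
 have 3: "0 <= R * (hardy_avg f R)^2" using R by simp
 show ?thesis using 1 2 3 hardy_identity[OF assms] by linarith
qed

end

section \<open>The radial system in retarded time\<close>

lemma field_identities:
 fixes r :: real
 assumes "r > 0"
 shows "(0 * r - a * 1) / (r * r) = - (a / r) / r"
  and "(A' * (- z / r) * r - A * 1) / (r * r) = - (z * A' + A) / r^2"
  and "(A' * ((1 - z) / r) * r - A * 1) / (r * r) = 2 * (- (z * A' + A) / r^2) + (2 * ((1 + z) * A' + A)) / r / (2 * r)"
  and "(B' * ((1 - z) / r) * r - B * 1) / (r * r) = - ((- 2 * ((1 - z) * B' - B)) / r) / (2 * r)"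
  and "(((2 * p' + q / (2 * r)) * k + (2 * k' + l / (2 * r)) * p) + ((- p / (2 * r)) * l + (- k / (2 * r)) * q)) / 2
    = p' * k + p * k'"
 using assms by (simp_all add: field_simps power2_eq_square)

text \<open>\<open>P\<close> and \<open>Q\<close> are the incoming and outgoing parts in the coordinates \<open>t\<close> and \<open>s = r - t\<close>. Along outgoing rays \<open>s\<close> is constant, and \<open>Pin\<close> is the derivative along incoming rays. The bound \<open>tail M\<close>, uniform in time, is the energy beyond the cone \<open>s = M\<close>.\<close>

locale radial_system =
 fixes R :: real and P Q Ps :: "real => real => real" and tail :: "real => real"
 assumes R: "R > 0"
  and Qt: "!!t s. t >= 0 ==> s >= R ==> ((%t. Q t s) has_deriv - P t s / (2 * (s + t))) (at t)"
  and Pt: "!!t s. t >= 0 ==> s >= R ==>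
    ((%t. P t s) has_deriv 2 * Ps t s + Q t s / (2 * (s + t))) (at t)"
  and Pder: "!!t s. t >= 0 ==> s >= R ==> ((%s. P t s) has_deriv Ps t s) (at s)"
  and Pin: "!!t s. t >= 0 ==> s >= R ==>
    ((%\<sigma>. P (t - \<sigma>) (s + 2 * \<sigma>)) has_deriv - Q t s / (2 * (s + t))) (at 0)"
  and cP: "continuous_on ({0..} \<times> {R..}) (%x. P (fst x) (snd x))"
  and cQ: "continuous_on ({0..} \<times> {R..}) (%x. Q (fst x) (snd x))"
  and cPs: "continuous_on ({0..} \<times> {R..}) (%x. Ps (fst x) (snd x))"
  and init: "!!s. s >= R ==> Q 0 s = - P 0 s"
  and energy: "!!t M N. t >= 0 ==> R <= M ==> M <= N ==>
    integral {M..N} (%s. (P t s)^2 + (Q t s)^2) <= tail M"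
  and tail: "(tail ---> 0) at_top"
begin

definition E :: real where "E = tail R"

lemma cont_s:
 assumes "t >= 0" "S \<subseteq> {R..}"
 shows "continuous_on S (P t)" "continuous_on S (Q t)" "continuous_on S (Ps t)"
proof -
 have *: "continuous_on S (%s. (t, s))" by (intro continuous_intros)
 show "continuous_on S (P t)" "continuous_on S (Q t)" "continuous_on S (Ps t)"
  using continuous_on_compose2[OF cP *] continuous_on_compose2[OF cQ *] continuous_on_compose2[OF cPs *] assms
  by auto
qed

lemma cont_t:
 assumes "s >= R" "S \<subseteq> {0..}"
 shows "continuous_on S (%t. P t s)"
proof -
 have *: "continuous_on S (%t. (t, s))" by (intro continuous_intros)
 show ?thesis
  using continuous_on_compose2[OF cP *] assms by auto
qed

lemma cont_0: "continuous_on {R..} (P 0)"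
 using cont_s(1)[of 0 "{R..}"] by simp

lemma tail_nonneg: "M >= R ==> 0 <= tail M"
 using energy[of 0 M M] by simp

lemma E_nonneg: "E >= 0" using tail_nonneg[of R] by (simp add: E_def)

lemma energy_R:
 assumes "t >= 0" "R <= M"
 shows "integral {M..N} (%s. (P t s)^2 + (Q t s)^2) <= E"
proof (cases "M <= N")
 case True
 have c: "continuous_on {R..N} (%s. (P t s)^2 + (Q t s)^2)"
  using assms by (intro continuous_intros cont_s) auto
 have "integral {M..N} (%s. (P t s)^2 + (Q t s)^2) <= integral {R..N} (%s. (P t s)^2 + (Q t s)^2)"
  using assms True c
  by (intro integral_subset_le integrable_continuous_real continuous_on_subset[OF c]) auto
 also have "... <= E" unfolding E_def using assms True by (intro energy) auto
 finally show ?thesis .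
qed (use E_nonneg in auto)

lemma energy_PQ:
 assumes "t >= 0" "R <= M" "M <= N"
 shows "integral {M..N} (%s. (P t s)^2) <= tail M" "integral {M..N} (%s. (Q t s)^2) <= tail M"
  "integral {M..N} (%s. (P t s)^2) <= E" "integral {M..N} (%s. (Q t s)^2) <= E"
proof -
 have i: "(%s. (P t s)^2) integrable_on {M..N}" "(%s. (Q t s)^2) integrable_on {M..N}"
  using assms by (auto intro!: integrable_continuous_real continuous_intros cont_s)
 have "integral {M..N} (%s. (P t s)^2) + integral {M..N} (%s. (Q t s)^2) = integral {M..N} (%s. (P t s)^2 + (Q t s)^2)"
  using integral_add[OF i] by simp
 moreover have "0 <= integral {M..N} (%s. (P t s)^2)" "0 <= integral {M..N} (%s. (Q t s)^2)"
  using i by (auto intro: integral_nonneg)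
 ultimately show "integral {M..N} (%s. (P t s)^2) <= tail M" "integral {M..N} (%s. (Q t s)^2) <= tail M"
  "integral {M..N} (%s. (P t s)^2) <= E" "integral {M..N} (%s. (Q t s)^2) <= E"
  using energy[OF assms] energy_R[OF assms(1,2), of N] by linarith+
qed

text \<open>The similarity variable of the solution \<open>pk\<close>, \<open>qk\<close>, which is homogeneous about the point \<open>t = - v\<close> of the axis \<open>r = 0\<close>, where \<open>r = s + t\<close>.\<close>

definition zz :: "real => real => real => real" where "zz v t s = (t + v) / (t + s)"
definition pk :: "real => real => real => real" where "pk v t s = kerA (zz v t s) / (s + t)"
definition qk :: "real => real => real => real" where "qk v t s = kerB (zz v t s) / (s + t)"
definition pks :: "real => real => real => real" where
 "pks v t s = - (zz v t s * kerA' (zz v t s) + kerA (zz v t s)) / (s + t)^2"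

lemma zz_range: "t >= 0 ==> v > 0 ==> v <= s ==> 0 < zz v t s \<and> zz v t s <= 1"
 by (auto simp: zz_def divide_le_eq)

lemma zz_t: "s + t > 0 ==> ((%t. zz v t s) has_deriv (1 - zz v t s) / (s + t)) (at t)"
 unfolding zz_def by (auto intro!: derivative_eq_intros simp: field_simps)

lemma zz_s: "s + t > 0 ==> ((%s. zz v t s) has_deriv - zz v t s / (s + t)) (at s)"
proof -
 assume r: "s + t > 0"
 have "((%s. (t + v) / (s + t)) has_deriv (0 * (s + t) - (t + v) * 1) / ((s + t) * (s + t))) (at s)"
  by (rule DERIV_divide) (use r in \<open>auto intro!: derivative_eq_intros\<close>)
 then show ?thesis unfolding field_identities(1)[OF r] zz_def by (simp only: add.commute[of t])
qed

lemma pk_s: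
 assumes "t >= 0" "v > 0" "v <= s"
 shows "((%s. pk v t s) has_deriv pks v t s) (at s)"
proof -
 have r: "s + t > 0" using assms by simp
 note z = zz_range[OF assms]
 have k: "((%s. kerA (zz v t s)) has_deriv kerA' (zz v t s) * (- zz v t s / (s + t))) (at s)"
  by (rule DERIV_chain2[OF kerA_deriv zz_s[OF r]]) (use z in auto)
 have d: "((%s. kerA (zz v t s) / (s + t)) has_deriv
   (kerA' (zz v t s) * (- zz v t s / (s + t)) * (s + t) - kerA (zz v t s) * 1) / ((s + t) * (s + t))) (at s)"
  by (rule DERIV_divide[OF k]) (use r in \<open>auto intro!: derivative_eq_intros\<close>)
 show ?thesis
  unfolding pk_def pks_def using d unfolding field_identities(2)[OF r] .
qed

lemma pk_t:
 assumes "t >= 0" "v > 0" "v <= s"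
 shows "((%t. pk v t s) has_deriv 2 * pks v t s + qk v t s / (2 * (s + t))) (at t)"
proof -
 have r: "s + t > 0" using assms by simp
 note z = zz_range[OF assms]
 let ?z = "zz v t s"
 have k: "((%t. kerA (zz v t s)) has_deriv kerA' ?z * ((1 - ?z) / (s + t))) (at t)"
  by (rule DERIV_chain2[OF kerA_deriv zz_t[OF r]]) (use z in auto)
 have d: "((%t. kerA (zz v t s) / (s + t)) has_deriv
   (kerA' ?z * ((1 - ?z) / (s + t)) * (s + t) - kerA ?z * 1) / ((s + t) * (s + t))) (at t)"
  by (rule DERIV_divide[OF k]) (use r in \<open>auto intro!: derivative_eq_intros\<close>)
 have "(kerA' ?z * ((1 - ?z) / (s + t)) * (s + t) - kerA ?z * 1) / ((s + t) * (s + t)) =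
   2 * pks v t s + qk v t s / (2 * (s + t))"
 proof -
  have B: "kerB ?z = 2 * ((1 + ?z) * kerA' ?z + kerA ?z)" using ker_rel2[of ?z] z by auto
  show ?thesis unfolding pks_def qk_def B by (rule field_identities(3)[OF r])
 qed
 then show ?thesis unfolding pk_def using d by simp
qed

lemma qk_t:
 assumes "t >= 0" "v > 0" "v <= s"
 shows "((%t. qk v t s) has_deriv - pk v t s / (2 * (s + t))) (at t)"
proof -
 have r: "s + t > 0" using assms by simp
 note z = zz_range[OF assms]
 let ?z = "zz v t s"
 have k: "((%t. kerB (zz v t s)) has_deriv kerB' ?z * ((1 - ?z) / (s + t))) (at t)"
  by (rule DERIV_chain2[OF kerB_deriv zz_t[OF r]]) (use z in auto)
 have d: "((%t. kerB (zz v t s) / (s + t)) has_deriv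
   (kerB' ?z * ((1 - ?z) / (s + t)) * (s + t) - kerB ?z * 1) / ((s + t) * (s + t))) (at t)"
  by (rule DERIV_divide[OF k]) (use r in \<open>auto intro!: derivative_eq_intros\<close>)
 have "(kerB' ?z * ((1 - ?z) / (s + t)) * (s + t) - kerB ?z * 1) / ((s + t) * (s + t)) = - pk v t s / (2 * (s + t))"
 proof -
  have A: "kerA ?z = - 2 * ((1 - ?z) * kerB' ?z - kerB ?z)" using ker_rel1[of ?z] z by auto
  show ?thesis unfolding pk_def A by (rule field_identities(4)[OF r])
 qed
 then show ?thesis unfolding qk_def using d by simp
qed

lemma pk_bounds:
 assumes "t >= 0" "v > 0" "v <= s"
 shows "\<bar>pk v t s\<bar> <= 2 / (s + t)" "\<bar>qk v t s\<bar> <= 2 / (s + t)"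
 using ker_bounds[of "zz v t s"] zz_range[OF assms] assms
 by (auto simp: pk_def qk_def abs_divide intro!: divide_right_mono)

lemma pk_cone: "t >= 0 ==> v > 0 ==> pk v t v = - 1 / (2 * (v + t))"
 by (simp add: pk_def zz_def kerA_1)

lemma cont_zz:
 assumes "v > 0"
 shows "continuous_on ({0..} \<times> {v..}) (%x. zz v (fst x) (snd x))"
  and "continuous_on ({0..} \<times> {v..}) (%x. pk v (fst x) (snd x))"
  and "continuous_on ({0..} \<times> {v..}) (%x. qk v (fst x) (snd x))"
  and "continuous_on ({0..} \<times> {v..}) (%x. pks v (fst x) (snd x))"
proof -
 show z: "continuous_on ({0..} \<times> {v..}) (%x. zz v (fst x) (snd x))"
  unfolding zz_def using assms by (intro continuous_intros) auto
 have img: "(%x. zz v (fst x) (snd x)) ` ({0..} \<times> {v..}) \<subseteq> {-1<..<3}"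
  using zz_range[OF _ assms] by fastforce
 have lc: "continuous_on {-1<..<3} (leg j)" for j
  by (rule DERIV_continuous_on) (use leg_deriv in \<open>auto intro: has_field_derivative_at_within\<close>)
 have kc: "continuous_on {-1<..<3} kerA" "continuous_on {-1<..<3} kerB" "continuous_on {-1<..<3} kerA'"
  unfolding kerA_def[abs_def] kerB_def[abs_def] kerA'_def[abs_def]
  by (auto intro!: continuous_on_diff continuous_on_mult continuous_on_divide continuous_on_add continuous_on_minus
    continuous_on_const continuous_on_id lc)
 note c = continuous_on_compose2[OF kc(1) z img] continuous_on_compose2[OF kc(2) z img] continuous_on_compose2[OF kc(3) z img]
 show "continuous_on ({0..} \<times> {v..}) (%x. pk v (fst x) (snd x))"
  "continuous_on ({0..} \<times> {v..}) (%x. qk v (fst x) (snd x))"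
  "continuous_on ({0..} \<times> {v..}) (%x. pks v (fst x) (snd x))"
  unfolding pk_def qk_def pks_def using assms by (intro continuous_intros c z; auto)+
qed

definition HH :: "real => real => real => real" where
 "HH v t s = (P t s * pk v t s + Q t s * qk v t s) / 2"
definition HHt :: "real => real => real => real" where
 "HHt v t s = Ps t s * pk v t s + P t s * pks v t s"

lemma HH_t:
 assumes "t >= 0" "R <= v" "v <= s"
 shows "((%t. HH v t s) has_deriv HHt v t s) (at t)"
proof -
 have x: "v > 0" and s: "R <= s" and r: "s + t > 0" using assms R by auto
 have "((%t. (P t s * pk v t s + Q t s * qk v t s) / 2) has_deriv
   (((2 * Ps t s + Q t s / (2 * (s + t))) * pk v t s + (2 * pks v t s + qk v t s / (2 * (s + t))) * P t s)
   + ((- P t s / (2 * (s + t))) * qk v t s + (- pk v t s / (2 * (s + t))) * Q t s)) / 2) (at t)"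
  by (intro DERIV_cdivide DERIV_add DERIV_mult Pt Qt pk_t qk_t assms x s)
 moreover have "(((2 * Ps t s + Q t s / (2 * (s + t))) * pk v t s + (2 * pks v t s + qk v t s / (2 * (s + t))) * P t s)
   + ((- P t s / (2 * (s + t))) * qk v t s + (- pk v t s / (2 * (s + t))) * Q t s)) / 2 = HHt v t s"
  unfolding HHt_def by (rule field_identities(5)[OF r])
 ultimately show ?thesis unfolding HH_def by simp
qed

lemma cont_HH:
 assumes "R <= v"
 shows "continuous_on ({0..} \<times> {v..}) (%x. HH v (fst x) (snd x))"
  and "continuous_on ({0..} \<times> {v..}) (%x. HHt v (fst x) (snd x))"
proof -
 have x: "v > 0" using assms R by simp
 have sub: "{0..} \<times> {v..} \<subseteq> {0..} \<times> {R..}" using assms by auto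
 note c = continuous_on_subset[OF cP sub] continuous_on_subset[OF cQ sub] continuous_on_subset[OF cPs sub] cont_zz[OF x]
 show "continuous_on ({0..} \<times> {v..}) (%x. HH v (fst x) (snd x))"
  "continuous_on ({0..} \<times> {v..}) (%x. HHt v (fst x) (snd x))"
  unfolding HH_def HHt_def by (intro continuous_intros c; simp)+
qed

text \<open>The pairing of two solutions has time derivative \<open>(P pk)_s\<close>. At the end \<open>s = v\<close> the boundary term cancels against the derivative of \<open>Q\<close>, because \<open>pk = - 1 / (2 (s + t))\<close> there. The linear cutoff leaves a remainder of size \<open>1 / N\<close>.\<close>

lemma HH_flux:
 assumes t: "t >= 0" and xi: "R <= v" and N: "v < N"
 shows "((%t. integral {v..N} (%s. (1 - s / N) * HH v t s) + Q t v) has_deriv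
   (integral {v..N} (%s. P t s * pk v t s) - v * (P t v / (2 * (v + t)))) / N) (at t within {0..})"
proof -
 have x: "v > 0" "N > 0" using xi N R by auto
 have sec: "continuous_on {v..N} (%s. f (fst (u, s)) (snd (u, s)))"
  if "continuous_on ({0..} \<times> {v..}) (%x. f (fst x) (snd x))" "u >= 0" for f :: "real => real => real" and u
  by (rule continuous_on_compose2[OF that(1)]) (use that(2) in \<open>auto intro!: continuous_intros\<close>)
 have cH: "continuous_on {v..N} (HH v u)" "continuous_on {v..N} (HHt v u)" if "u >= 0" for u
  using sec[OF cont_HH(1)[OF xi] that] sec[OF cont_HH(2)[OF xi] that] by simp_all
 have cpk: "continuous_on {v..N} (pk v t)" using sec[OF cont_zz(2)[OF x(1)] t] by simp
 have cPt: "continuous_on {v..N} (P t)" by (rule cont_s) (use t xi in auto)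
 have D1: "((%t. integral (cbox v N) (%s. (1 - s / N) * HH v t s)) has_field_derivative
   integral (cbox v N) (%s. (1 - s / N) * HHt v t s)) (at t within {0..})"
 proof (rule leibniz_rule_field_derivative[where f = "%t s. (1 - s / N) * HH v t s" and fx = "%t s. (1 - s / N) * HHt v t s"])
  show "((%t. (1 - s / N) * HH v t s) has_field_derivative (1 - s / N) * HHt v t' s) (at t' within {0..})"
   if "t' \<in> {0..}" "s \<in> cbox v N" for t' s
   using that DERIV_cmult[OF has_field_derivative_at_within[OF HH_t[OF _ xi]]] by simp
  show "(%s. (1 - s / N) * HH v t' s) integrable_on cbox v N" if "t' \<in> {0..}" for t'
   using cH(1)[of t'] that x by (auto intro!: integrable_continuous_real continuous_intros)
  have sub: "{0..} \<times> cbox v N \<subseteq> {0..} \<times> {v..}" by auto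
  show "continuous_on ({0..} \<times> cbox v N) (%(t, s). (1 - s / N) * HHt v t s)"
   unfolding split_beta using x
   by (intro continuous_intros continuous_on_subset[OF cont_HH(2)[OF xi] sub]) auto
 qed (use t in auto)
 have FT: "((%s. - (P t s * pk v t s) / N + (1 - s / N) * HHt v t s) has_integral
   (1 - N / N) * (P t N * pk v t N) - (1 - v / N) * (P t v * pk v t v)) {v..N}"
 proof (rule fundamental_theorem_of_calculus)
  fix s assume s: "s \<in> {v..N}"
  have "((%s. (1 - s / N) * (P t s * pk v t s)) has_deriv
    (- (1 / N)) * (P t s * pk v t s) + (Ps t s * pk v t s + pks v t s * P t s) * (1 - s / N)) (at s)"
   by (intro DERIV_mult Pder pk_s) (use s t xi x in \<open>auto intro!: derivative_eq_intros\<close>)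
  moreover have "(- (1 / N)) * (P t s * pk v t s) + (Ps t s * pk v t s + pks v t s * P t s) * (1 - s / N)
    = - (P t s * pk v t s) / N + (1 - s / N) * HHt v t s"
   by (simp add: HHt_def algebra_simps)
  ultimately show "((%s. (1 - s / N) * (P t s * pk v t s)) has_vector_derivative
    - (P t s * pk v t s) / N + (1 - s / N) * HHt v t s) (at s within {v..N})"
   unfolding has_real_derivative_iff_has_vector_derivative[symmetric]
   by (metis has_field_derivative_at_within)
 qed (use N in auto)
 have i1: "(%s. - (P t s * pk v t s) / N) integrable_on {v..N}" "(%s. (1 - s / N) * HHt v t s) integrable_on {v..N}"
  "(%s. P t s * pk v t s) integrable_on {v..N}"
  using cH[OF t] cpk cPt x by (auto intro!: integrable_continuous_real continuous_intros)
 have "integral {v..N} (%s. - (P t s * pk v t s) / N) + integral {v..N} (%s. (1 - s / N) * HHt v t s)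
   = - ((1 - v / N) * (P t v * pk v t v))"
  using integral_unique[OF FT] integral_add[OF i1(1,2)] x by simp
 moreover have "integral {v..N} (%s. - (P t s * pk v t s) / N) = - integral {v..N} (%s. P t s * pk v t s) / N"
  by (simp add: integral_divide integral_neg)
 ultimately have I: "integral {v..N} (%s. (1 - s / N) * HHt v t s) =
   integral {v..N} (%s. P t s * pk v t s) / N + (1 - v / N) * (P t v / (2 * (v + t)))"
  using pk_cone[OF t x(1)] by (simp add: algebra_simps)
 have D2: "((%t. Q t v) has_deriv - P t v / (2 * (v + t))) (at t within {0..})"
  by (rule has_field_derivative_at_within[OF Qt[OF t xi]])
 have "integral (cbox v N) (%s. (1 - s / N) * HHt v t s) + (- P t v / (2 * (v + t))) =
   (integral {v..N} (%s. P t s * pk v t s) - v * (P t v / (2 * (v + t)))) / N"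
 proof -
  define X where "X = P t v / (2 * (v + t))"
  have m: "- P t v / (2 * (v + t)) = - X" by (simp add: X_def)
  have alg: "A / N + (1 - v / N) * X + - X = (A - v * X) / N" for A
   using x by (simp add: field_simps)
  show ?thesis unfolding m cbox_interval I unfolding X_def[symmetric] by (rule alg)
 qed
 then show ?thesis using DERIV_add[OF D1 D2] by simp
qed

end

lemma amgm_weighted: "l > 0 ==> \<bar>a * b\<bar> <= (l * a^2 + b^2 / l) / (2::real)"
proof -
 assume l: "l > 0"
 have "0 <= (l * \<bar>a\<bar> - \<bar>b\<bar>)^2" by simp
 then have "2 * l * (\<bar>a\<bar> * \<bar>b\<bar>) <= l^2 * a^2 + b^2"
  by (simp add: power2_diff power_mult_distrib algebra_simps)
 then show ?thesis using l by (simp add: abs_mult field_simps power2_eq_square)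
qed

context radial_system
begin

definition gK :: "real => real => real" where "gK v s = P 0 s * (leg 1 (v / s) / s)"
text \<open>The radiation field: the initial value \<open>- P 0 v\<close> of \<open>Q\<close> along the outgoing ray \<open>s = v\<close>, corrected by an integral transform of the data further out.\<close>

definition qinf :: "real => real" where "qinf v = (LINT s:{v..}|lborel. gK v s) - P 0 v"

lemma P0_square: 
 assumes "v >= R"
 shows "set_integrable lborel {v..} (%s. (P 0 s)^2)" "(LINT s:{v..}|lborel. (P 0 s)^2) <= tail v"
  "(LINT s:{v..}|lborel. (P 0 s)^2) <= E"
proof -
 have c: "continuous_on {v..} (%s. (P 0 s)^2)" using assms by (intro continuous_intros cont_s) auto
 show "set_integrable lborel {v..} (%s. (P 0 s)^2)" "(LINT s:{v..}|lborel. (P 0 s)^2) <= tail v"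
 proof -
  have b: "integral {v..N} (%s. (P 0 s)^2) <= tail v" if "N >= v" for N
   using energy_PQ(1)[of 0 v N] assms that by simp
  show "set_integrable lborel {v..} (%s. (P 0 s)^2)" "(LINT s:{v..}|lborel. (P 0 s)^2) <= tail v"
   by (rule nonneg_half_line(1,2)[OF c _ b]; simp)+
 qed
 show "(LINT s:{v..}|lborel. (P 0 s)^2) <= E"
  by (rule nonneg_half_line(2)[OF c]) (use energy_PQ(3)[of 0 v] assms in simp_all)
qed

lemma kernel_half_line:
 assumes "v >= R"
 shows "continuous_on {v..} (%s. leg 1 (v / s) / s)"
  and "set_integrable lborel {v..} (%s. (leg 1 (v / s) / s)^2)"
  and "(LINT s:{v..}|lborel. (leg 1 (v / s) / s)^2) <= 1 / v"
proof -
 have xi: "v > 0" using assms R by simp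
 have r: "0 < v / s \<and> v / s <= 1" if "s >= v" for s using xi that by auto
 have lc: "continuous_on {0..1} (leg 1)"
  by (rule DERIV_continuous_on[where D = "leg 2"])
    (use leg_deriv[of _ 1] in \<open>auto intro: has_field_derivative_at_within simp: numeral_2_eq_2\<close>)
 have cd: "continuous_on {v..} (%s. v / s)" using xi by (intro continuous_on_divide continuous_on_const continuous_on_id) auto
 have "continuous_on {v..} (%s. leg 1 (v / s))"
  by (rule continuous_on_compose2[OF lc cd]) (use r in force)
 then show c: "continuous_on {v..} (%s. leg 1 (v / s) / s)"
  using xi by (intro continuous_on_divide continuous_on_id) auto
 have c2: "continuous_on {v..} (%s. (leg 1 (v / s) / s)^2)" by (intro continuous_intros c)
 have b: "integral {v..N} (%s. (leg 1 (v / s) / s)^2) <= 1 / v" if "N >= v" for N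
 proof -
  have "integral {v..N} (%s. (leg 1 (v / s) / s)^2) <= integral {v..N} (%s. 1 / (s + 0)^2)"
  proof (rule integral_le)
   show "(%s. (leg 1 (v / s) / s)^2) integrable_on {v..N}"
    by (rule integrable_continuous_real[OF continuous_on_subset[OF c2]]) auto
   show "(%s. 1 / (s + 0)^2) integrable_on {v..N}"
    using xi by (intro integrable_continuous_real continuous_intros) auto
   fix s assume s: "s \<in> {v..N}"
   have "\<bar>leg 1 (v / s)\<bar> <= 1" using leg_1_bounds[of "v / s"] r[of s] s by auto
   then have "(leg 1 (v / s))^2 <= 1" by (simp add: abs_square_le_1)
   then show "(leg 1 (v / s) / s)^2 <= 1 / (s + 0)^2"
    by (simp add: power_divide divide_right_mono)
  qed
  also have "... <= 1 / (v + 0)" by (rule inverse_square_half_line(3)) (use xi that in auto)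
  finally show ?thesis by simp
 qed
 show "set_integrable lborel {v..} (%s. (leg 1 (v / s) / s)^2)" "(LINT s:{v..}|lborel. (leg 1 (v / s) / s)^2) <= 1 / v"
  by (rule nonneg_half_line(1,2)[OF c2 _ b]; simp)+
qed

lemma gK_integrable: "v >= R ==> set_integrable lborel {v..} (gK v)"
 and gK_bound: "v >= R ==> \<bar>LINT s:{v..}|lborel. gK v s\<bar> <= (E + 1) / sqrt v"
 and gK_cont: "v >= R ==> continuous_on {v..} (gK v)"
proof -
 assume xi: "v >= R"
 have c: "continuous_on {v..} (P 0)" using xi by (intro cont_s) auto
 note k = kernel_half_line[OF xi]
 note h = set_integrable_half_line_mult[OF c k(1) P0_square(1)[OF xi] k(2)]
 show "set_integrable lborel {v..} (gK v)" using h(1) by (simp add: gK_def[abs_def])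
 show "continuous_on {v..} (gK v)" unfolding gK_def[abs_def] by (intro continuous_on_mult c k(1))
 have "\<bar>LINT s:{v..}|lborel. gK v s\<bar> <= sqrt (LINT s:{v..}|lborel. (P 0 s)^2) * sqrt (LINT s:{v..}|lborel. (leg 1 (v / s) / s)^2)"
  using h(2) by (simp add: gK_def)
 also have "... <= sqrt E * sqrt (1 / v)"
 proof (rule mult_mono)
  show "sqrt (LINT s:{v..}|lborel. (P 0 s)^2) <= sqrt E" by (rule real_sqrt_le_mono[OF P0_square(3)[OF xi]])
  show "sqrt (LINT s:{v..}|lborel. (leg 1 (v / s) / s)^2) <= sqrt (1 / v)" by (rule real_sqrt_le_mono[OF k(3)])
  show "0 <= sqrt (LINT s:{v..}|lborel. (leg 1 (v / s) / s)^2)"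
   unfolding set_lebesgue_integral_def real_sqrt_ge_0_iff by (rule integral_nonneg_AE) (auto intro!: AE_I2)
 qed (simp add: E_nonneg)
 also have "... <= (E + 1) * sqrt (1 / v)"
 proof (rule mult_right_mono)
  have "E <= (E + 1)^2" using E_nonneg by (simp add: power2_eq_square algebra_simps)
  then show "sqrt E <= E + 1" using E_nonneg by (intro real_le_lsqrt) auto
 qed (use xi R in simp)
 finally show "\<bar>LINT s:{v..}|lborel. gK v s\<bar> <= (E + 1) / sqrt v"
  by (simp add: real_sqrt_divide)
qed

lemma HH_0: "v >= R ==> s >= v ==> HH v 0 s = gK v s"
proof -
 assume "v >= R" "s >= v"
 then have s: "s >= R" "s > 0" using R by auto
 have "HH v 0 s = P 0 s * (kerA (v / s) - kerB (v / s)) / (2 * s)"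
  using init[OF s(1)] s by (simp add: HH_def pk_def qk_def zz_def field_simps)
 then show ?thesis unfolding kerA_minus_kerB gK_def by simp
qed

lemma HH_integral_bound:
 assumes t: "t >= 0" and xi: "v >= R" and N: "v < N"
 shows "\<bar>integral {v..N} (%s. (1 - s / N) * HH v t s)\<bar> <= (E + 2) / sqrt (v + t)"
proof -
 have x: "v > 0" using xi R by simp
 define w where "w = sqrt (v + t)"
 have w: "w > 0" "w\<^sup>2 = v + t" using x t by (auto simp: w_def)
 have sec: "continuous_on {v..N} (%s. HH v (fst (t, s)) (snd (t, s)))"
  by (rule continuous_on_compose2[OF cont_HH(1)[OF xi]]) (use t in \<open>auto intro!: continuous_intros\<close>)
 then have cH: "continuous_on {v..N} (HH v t)" by simp
 have cPQ: "continuous_on {v..N} (P t)" "continuous_on {v..N} (Q t)" using t xi by (auto intro!: cont_s)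
 let ?g = "%s. (1 / (2 * w)) * ((P t s)^2 + (Q t s)^2) + w * (1 / (s + t)^2)"
 have ci: "(%s. (P t s)^2 + (Q t s)^2) integrable_on {v..N}" "(%s. 1 / (s + t)^2) integrable_on {v..N}"
  using x t by (auto intro!: integrable_continuous_real continuous_intros cPQ)
 have "norm (integral {v..N} (%s. (1 - s / N) * HH v t s)) <= integral {v..N} ?g"
 proof (rule integral_norm_bound_integral)
  show "(%s. (1 - s / N) * HH v t s) integrable_on {v..N}"
   using x N by (intro integrable_continuous_real continuous_intros cH) auto
  show "?g integrable_on {v..N}"
   by (rule integrable_add[OF integrable_on_mult_right[OF ci(1)] integrable_on_mult_right[OF ci(2)]])
  fix s assume s: "s \<in> {v..N}"
  then have r: "s + t > 0" "0 <= 1 - s / N" "1 - s / N <= 1" using x t by auto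
  have pb: "\<bar>pk v t s\<bar> <= 2 / (s + t)" "\<bar>qk v t s\<bar> <= 2 / (s + t)" using pk_bounds[OF t x] s by auto
  have "\<bar>HH v t s\<bar> <= (\<bar>P t s\<bar> * \<bar>pk v t s\<bar> + \<bar>Q t s\<bar> * \<bar>qk v t s\<bar>) / 2"
   unfolding HH_def using abs_triangle_ineq[of "P t s * pk v t s" "Q t s * qk v t s"] by (simp add: abs_mult)
  also have "... <= (\<bar>P t s\<bar> * (2 / (s + t)) + \<bar>Q t s\<bar> * (2 / (s + t))) / 2"
   using pb by (intro divide_right_mono add_mono mult_left_mono) auto
  also have "... = \<bar>P t s * (1 / (s + t))\<bar> + \<bar>Q t s * (1 / (s + t))\<bar>"
  proof -
   have g: "(A * (2 / x) + B * (2 / x)) / 2 = A * (1 / x) + B * (1 / x)" for A B x :: real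
    by (cases "x = 0") (simp_all add: field_simps)
   show ?thesis unfolding g using r by (simp add: abs_mult)
  qed
  also have "... <= ((1 / w) * (P t s)^2 + (1 / (s + t))^2 / (1 / w)) / 2 + ((1 / w) * (Q t s)^2 + (1 / (s + t))^2 / (1 / w)) / 2"
   using w by (intro add_mono amgm_weighted) auto
  also have "... = ?g s" by (simp add: power_divide add_divide_distrib algebra_simps)
  finally have H: "\<bar>HH v t s\<bar> <= ?g s" .
  have "norm ((1 - s / N) * HH v t s) = (1 - s / N) * \<bar>HH v t s\<bar>" using r by (simp add: abs_mult)
  also have "... <= 1 * \<bar>HH v t s\<bar>" using r by (intro mult_right_mono) auto
  finally show "norm ((1 - s / N) * HH v t s) <= ?g s" using H by simp
 qed
 also have "integral {v..N} ?g = integral {v..N} (%s. (1 / (2 * w)) * ((P t s)^2 + (Q t s)^2)) + integral {v..N} (%s. w * (1 / (s + t)^2))"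
  by (rule integral_add[OF integrable_on_mult_right[OF ci(1)] integrable_on_mult_right[OF ci(2)]])
 also have "... = (1 / (2 * w)) * integral {v..N} (%s. (P t s)^2 + (Q t s)^2) + w * integral {v..N} (%s. 1 / (s + t)^2)"
  by (simp only: integral_mult_right)
 also have "... <= (1 / (2 * w)) * E + w * (1 / (v + t))"
  using energy_R[OF t xi, of N] inverse_square_half_line(3)[of v t N] w x t N
  by (intro add_mono mult_left_mono) auto
 also have "... = (E / 2 + 1) / w" unfolding w(2)[symmetric] using w(1) by (simp add: power2_eq_square field_simps)
 also have "... <= (E + 2) / w" using w E_nonneg by (intro divide_right_mono) auto
 finally show ?thesis by (simp add: w_def)
qed

text \<open>By \<open>HH_flux\<close> the sum of \<open>Q\<close> and the pairing changes by a multiple of \<open>1 / N\<close>, so it is conserved in the limit. Its value at time \<open>0\<close> is \<open>qinf v\<close>, and the pairing at time \<open>T\<close> is small because the kernel, of size at most \<open>2 / (s + T)\<close>, has small norm in \<open>L^2\<close>.\<close>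

lemma Q_limit:
 assumes T: "T >= 0" and xi: "v >= R"
 shows "\<bar>Q T v - qinf v\<bar> <= (E + 2) / sqrt (v + T)"
proof -
 have x: "v > 0" using xi R by simp
 have "compact ((%t. P t v) ` {0..T})" by (intro compact_continuous_image cont_t xi) auto
 then obtain Cp where Cp: "!!t. t \<in> {0..T} ==> \<bar>P t v\<bar> <= Cp"
  by (meson bounded_real compact_imp_bounded imageI)
 define D where "D = (E + 4 / v) / 2 + Cp"
 let ?G = "%N t. integral {v..N} (%s. (1 - s / N) * HH v t s) + Q t v"
 have step: "\<bar>?G N T - ?G N 0\<bar> <= D / N * T" if N: "v < N" for N
 proof -
  have "norm (?G N T - ?G N 0) <= D / N * norm (T - 0)"
  proof (rule field_differentiable_bound[of "{0..T}" "?G N"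
    "%t. (integral {v..N} (%s. P t s * pk v t s) - v * (P t v / (2 * (v + t)))) / N"])
   fix t assume t: "t \<in> {0..T}"
   then have t0: "t >= 0" by simp
   show "(?G N has_field_derivative (integral {v..N} (%s. P t s * pk v t s) - v * (P t v / (2 * (v + t)))) / N) (at t within {0..T})"
    by (rule has_field_derivative_subset[OF HH_flux[OF t0 xi N]]) auto
   have sec: "continuous_on {v..N} (%s. pk v (fst (t, s)) (snd (t, s)))"
    by (rule continuous_on_compose2[OF cont_zz(2)[OF x]]) (use t0 in \<open>auto intro!: continuous_intros\<close>)
   then have ck: "continuous_on {v..N} (pk v t)" by simp
   have cPt: "continuous_on {v..N} (P t)" using t0 xi by (auto intro!: cont_s)
   have ci: "(%s. (P t s)^2) integrable_on {v..N}" "(%s. 1 / (s + t)^2) integrable_on {v..N}"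
    using x t0 by (auto intro!: integrable_continuous_real continuous_intros cPt)
   have "norm (integral {v..N} (%s. P t s * pk v t s)) <= integral {v..N} (%s. (1/2) * (P t s)^2 + 2 * (1 / (s + t)^2))"
   proof (rule integral_norm_bound_integral)
    show "(%s. P t s * pk v t s) integrable_on {v..N}"
     by (intro integrable_continuous_real continuous_intros ck cPt)
    show "(%s. (1/2) * (P t s)^2 + 2 * (1 / (s + t)^2)) integrable_on {v..N}"
     using ci by (intro integrable_add integrable_on_mult_right)
    fix s assume s: "s \<in> {v..N}"
    have pb: "\<bar>pk v t s\<bar> <= 2 / (s + t)" using pk_bounds(1)[OF t0 x] s by auto
    have "\<bar>P t s * pk v t s\<bar> <= (1 * (P t s)^2 + (pk v t s)^2 / 1) / 2" by (rule amgm_weighted) simp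
    moreover have "(pk v t s)^2 <= (2 / (s + t))^2" using pb by (metis abs_ge_zero power2_abs power_mono)
    ultimately show "norm (P t s * pk v t s) <= (1/2) * (P t s)^2 + 2 * (1 / (s + t)^2)"
     by (simp add: power_divide)
   qed
   also have "... = integral {v..N} (%s. (1/2) * (P t s)^2) + integral {v..N} (%s. 2 * (1 / (s + t)^2))"
    by (rule integral_add[OF integrable_on_mult_right[OF ci(1)] integrable_on_mult_right[OF ci(2)]])
   also have "... = (1/2) * integral {v..N} (%s. (P t s)^2) + 2 * integral {v..N} (%s. 1 / (s + t)^2)"
    by (simp only: integral_mult_right)
   also have "... <= (1/2) * E + 2 * (1 / (v + t))"
    using energy_PQ(3)[OF t0 xi, of N] inverse_square_half_line(3)[of v t N] x t0 N
    by (intro add_mono mult_left_mono) auto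
   also have "... <= (1/2) * E + 2 * (1 / v)" using x t0 by (intro add_mono mult_left_mono divide_left_mono) auto
   finally have 1: "\<bar>integral {v..N} (%s. P t s * pk v t s)\<bar> <= (E + 4 / v) / 2" by simp
   have "\<bar>v * (P t v / (2 * (v + t)))\<bar> = (v / (2 * (v + t))) * \<bar>P t v\<bar>" using x t0 by (simp add: abs_mult)
   also have "... <= 1 * \<bar>P t v\<bar>" using x t0 by (intro mult_right_mono) (auto simp: divide_le_eq)
   finally have 2: "\<bar>v * (P t v / (2 * (v + t)))\<bar> <= Cp" using Cp[OF t] by simp
   have "\<bar>integral {v..N} (%s. P t s * pk v t s) - v * (P t v / (2 * (v + t)))\<bar> <= D"
    using 1 2 unfolding D_def by linarith
   then show "norm ((integral {v..N} (%s. P t s * pk v t s) - v * (P t v / (2 * (v + t)))) / N) <= D / N"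
    using x N by (simp add: divide_right_mono)
  qed (use T in auto)
  then show ?thesis using T by simp
 qed
 have gi: "integrable lborel (%s. indicator {v..} s *\<^sub>R gK v s)" using gK_integrable[OF xi] by (simp add: set_integrable_def)
 have conv: "(%n. LINT s|lborel. indicator {v..real n} s *\<^sub>R ((1 - s / real n) * gK v s)) \<longlonglongrightarrow> (LINT s|lborel. indicator {v..} s *\<^sub>R gK v s)"
 proof (rule integral_dominated_convergence[where w = "%s. \<bar>indicator {v..} s *\<^sub>R gK v s\<bar>"])
  show "AE s in lborel. (%n. indicator {v..real n} s *\<^sub>R ((1 - s / real n) * gK v s)) \<longlonglongrightarrow> indicator {v..} s *\<^sub>R gK v s"
  proof (rule AE_I2)
   fix s
   have "(%n. s / real n) \<longlonglongrightarrow> 0" by (rule lim_const_over_n)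
   then have 1: "(%n. indicator {v..} s *\<^sub>R ((1 - s / real n) * gK v s)) \<longlonglongrightarrow> indicator {v..} s *\<^sub>R ((1 - 0) * gK v s)"
    by (intro tendsto_intros)
   obtain k where k: "s <= real k" using real_arch_simple by blast
   have "\<forall>\<^sub>F n in sequentially. indicator {v..} s *\<^sub>R ((1 - s / real n) * gK v s) = indicator {v..real n} s *\<^sub>R ((1 - s / real n) * gK v s)"
    using eventually_ge_at_top[of k]
   proof eventually_elim
    case (elim n)
    then have "s <= real n" using k by linarith
    then show ?case by (auto simp: indicator_def)
   qed
   from Lim_transform_eventually[OF 1 this]
   show "(%n. indicator {v..real n} s *\<^sub>R ((1 - s / real n) * gK v s)) \<longlonglongrightarrow> indicator {v..} s *\<^sub>R gK v s" by simp
  qed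
  show "AE s in lborel. norm (indicator {v..real n} s *\<^sub>R ((1 - s / real n) * gK v s)) <= \<bar>indicator {v..} s *\<^sub>R gK v s\<bar>" for n
  proof (rule AE_I2)
   fix s
   show "norm (indicator {v..real n} s *\<^sub>R ((1 - s / real n) * gK v s)) <= \<bar>indicator {v..} s *\<^sub>R gK v s\<bar>"
   proof (cases "s \<in> {v..real n}")
    case True
    then have "\<bar>1 - s / real n\<bar> <= 1" using x by auto
    then show ?thesis using True by (simp add: abs_mult mult_left_le_one_le)
   qed simp
  qed
  have m1: "(%s. indicator {v..real n} s * (1 - s / real n)) \<in> borel_measurable lborel" for n by measurable
  have m2: "(%s. indicator {v..} s *\<^sub>R gK v s) \<in> borel_measurable lborel" using gi by auto
  have "(%s. (indicator {v..real n} s * (1 - s / real n)) * (indicator {v..} s *\<^sub>R gK v s)) \<in> borel_measurable lborel" for n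
   by (rule borel_measurable_times[OF m1 m2])
  moreover have "(%s. (indicator {v..real n} s * (1 - s / real n)) * (indicator {v..} s *\<^sub>R gK v s)) =
    (%s. indicator {v..real n} s *\<^sub>R ((1 - s / real n) * gK v s))" for n
   by (auto simp: indicator_def fun_eq_iff)
  ultimately show "(%s. indicator {v..real n} s *\<^sub>R ((1 - s / real n) * gK v s)) \<in> borel_measurable lborel" for n
   by simp
  show "(%s. indicator {v..} s *\<^sub>R gK v s) \<in> borel_measurable lborel" using gi by auto
  show "integrable lborel (%s. \<bar>indicator {v..} s *\<^sub>R gK v s\<bar>)" using gi by (rule integrable_abs)
 qed
 let ?B = "(E + 2) / sqrt (v + T)"
 obtain n0 where n0: "v < real n0" using reals_Archimedean2 by blast
 have ev: "\<forall>\<^sub>F n in sequentially. \<bar>Q T v + P 0 v - (LINT s|lborel. indicator {v..real n} s *\<^sub>R ((1 - s / real n) * gK v s))\<bar> <= ?B + D * T / real n"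
  using eventually_ge_at_top[of n0]
 proof eventually_elim
  case (elim n)
  then have N: "v < real n" using n0 by linarith
  have cg: "continuous_on {v..real n} (%s. (1 - s / real n) * gK v s)"
   using N x by (intro continuous_intros continuous_on_subset[OF gK_cont[OF xi]]) auto
  have "(LINT s|lborel. indicator {v..real n} s *\<^sub>R ((1 - s / real n) * gK v s)) = integral {v..real n} (%s. (1 - s / real n) * gK v s)"
   using set_borel_integral_eq_integral(2)[OF borel_integrable_atLeastAtMost'[OF cg]] by (simp add: set_lebesgue_integral_def)
  also have "... = integral {v..real n} (%s. (1 - s / real n) * HH v 0 s)"
   by (rule integral_cong) (use HH_0[OF xi] in auto)
  finally have e: "(LINT s|lborel. indicator {v..real n} s *\<^sub>R ((1 - s / real n) * gK v s)) = ..." .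
  have "\<bar>?G (real n) T - ?G (real n) 0\<bar> <= D * T / real n" using step[OF N] by simp
  then show ?case
   using HH_integral_bound[OF T xi N] init[OF xi] unfolding e by linarith
 qed
 have l1: "(%n. \<bar>Q T v + P 0 v - (LINT s|lborel. indicator {v..real n} s *\<^sub>R ((1 - s / real n) * gK v s))\<bar>) \<longlonglongrightarrow>
   \<bar>Q T v + P 0 v - (LINT s|lborel. indicator {v..} s *\<^sub>R gK v s)\<bar>"
  by (intro tendsto_intros conv)
 have l2: "(%n. ?B + D * T / real n) \<longlonglongrightarrow> ?B + 0" by (intro tendsto_intros lim_const_over_n)
 have "\<bar>Q T v + P 0 v - (LINT s|lborel. indicator {v..} s *\<^sub>R gK v s)\<bar> <= ?B + 0"
  by (rule tendsto_le[OF _ l2 l1 ev]) simp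
 then show ?thesis by (simp add: qinf_def set_lebesgue_integral_def algebra_simps)
qed

lemma Q_bound:
 assumes "t >= 0" "s >= R"
 shows "\<bar>Q t s\<bar> <= \<bar>P 0 s\<bar> + (E + 1) / sqrt s + (E + 2) / sqrt (s + t)"
 using Q_limit[OF assms] gK_bound[OF assms(2)] unfolding qinf_def by linarith

end

context radial_system
begin

text \<open>Integrate along the incoming ray back to time \<open>0\<close>. There \<open>s + t >= T\<close>, and \<open>Q\<close> is bounded by the initial data up to terms of inverse square root size; \<open>Mj\<close> is a primitive of the resulting bound \<open>Mj'\<close>.\<close>

lemma P_bound:
 assumes T: "T > 0" and xi: "v >= R"
 shows "\<bar>P T v\<bar> <= \<bar>P 0 (v + 2 * T)\<bar> + (2 * E + 3) / sqrt T"
proof -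
 have x: "v > 0" using xi R by simp
 define w where "w = sqrt T"
 have w: "w > 0" "w\<^sup>2 = T" using T by (auto simp: w_def)
 define y where "y \<sigma> = P (T - \<sigma>) (v + 2 * \<sigma>)" for \<sigma>
 define \<Phi> where "\<Phi> u = integral {v..u} (%s. (P 0 s)^2)" for u
 define Mj where "Mj \<sigma> = (1 / (2 * T)) * ((w * (\<Phi> (v + 2 * \<sigma>) / 2) + \<sigma> / w) / 2 + (E + 1) * sqrt (v + 2 * \<sigma>) + (E + 2) / w * \<sigma>)" for \<sigma>
 define Mj' where "Mj' \<sigma> = (1 / (2 * T)) * ((w * (P 0 (v + 2 * \<sigma>))^2 + 1 / w) / 2 + (E + 1) / sqrt (v + 2 * \<sigma>) + (E + 2) / w)" for \<sigma>
 have c0: "continuous_on {v..u} (%s. (P 0 s)^2)" for u using xi by (intro continuous_intros cont_s) auto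
 have \<Phi>c: "continuous_on {v..v + 2 * T} \<Phi>"
  unfolding \<Phi>_def by (intro indefinite_integral_continuous_1 integrable_continuous_real c0)
 have \<Phi>d: "(\<Phi> has_deriv (P 0 u)\<^sup>2) (at u)" if "v < u" for u
 proof -
  have "(\<Phi> has_deriv (P 0 u)\<^sup>2) (at u within {v..u + 1})"
   unfolding \<Phi>_def by (rule integral_has_real_derivative[OF c0]) (use that in auto)
  moreover have "at u within {v..u + 1} = at u"
   by (rule at_within_interior) (use that in simp)
  ultimately show ?thesis by (simp only:)
 qed
 have "norm (y T - y 0) <= Mj T - Mj 0"
 proof (rule differentiable_bound_general[of 0 T y Mj])
  have "continuous_on {0..T} (%\<sigma>. (T - \<sigma>, v + 2 * \<sigma>))" by (intro continuous_intros)
  moreover have "(%\<sigma>. (T - \<sigma>, v + 2 * \<sigma>)) ` {0..T} \<subseteq> {0..} \<times> {R..}" using xi by auto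
  ultimately have "continuous_on {0..T} (%\<sigma>. P (fst (T - \<sigma>, v + 2 * \<sigma>)) (snd (T - \<sigma>, v + 2 * \<sigma>)))"
   by (rule continuous_on_compose2[OF cP])
  then show "continuous_on {0..T} y" by (simp add: y_def[abs_def])
  show "continuous_on {0..T} Mj" unfolding Mj_def
   by (intro continuous_intros continuous_on_compose2[OF \<Phi>c]) (use w in auto)
  fix \<sigma> assume s: "0 < \<sigma>" "\<sigma> < T"
  let ?t = "T - \<sigma>" and ?s = "v + 2 * \<sigma>"
  have ts: "?t >= 0" "?s >= R" "?s > 0" "v < ?s" using s xi x by auto
  have "((%h. P (?t - h) (?s + 2 * h)) has_deriv - Q ?t ?s / (2 * (?s + ?t))) (at 0)"
   by (rule Pin[OF ts(1,2)])
  moreover have "(%h. P (?t - h) (?s + 2 * h)) = (%h. y (h + \<sigma>))"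
   by (auto simp: y_def algebra_simps)
  ultimately have "((%h. y (h + \<sigma>)) has_deriv - Q ?t ?s / (2 * (?s + ?t))) (at 0)" by simp
  then have "(y has_deriv - Q ?t ?s / (2 * (?s + ?t))) (at \<sigma>)"
   using DERIV_shift[of y "- Q ?t ?s / (2 * (?s + ?t))" 0 \<sigma>] by simp
  then show "(y has_vector_derivative - Q ?t ?s / (2 * (?s + ?t))) (at \<sigma>)"
   by (simp add: has_real_derivative_iff_has_vector_derivative)
  have "((%\<sigma>. \<Phi> (v + 2 * \<sigma>)) has_deriv (P 0 ?s)\<^sup>2 * 2) (at \<sigma>)"
   by (rule DERIV_chain2[where f = \<Phi> and g = "%\<sigma>. v + 2 * \<sigma>" and x = \<sigma>, OF \<Phi>d[OF ts(4)]]) (auto intro!: derivative_eq_intros)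
  moreover have "((%\<sigma>. sqrt (v + 2 * \<sigma>)) has_deriv (inverse (sqrt ?s) / 2) * 2) (at \<sigma>)"
   by (rule DERIV_chain2[where f = sqrt and g = "%\<sigma>. v + 2 * \<sigma>" and x = \<sigma>, OF DERIV_real_sqrt[OF ts(3)]]) (auto intro!: derivative_eq_intros)
  ultimately have "(Mj has_deriv (1 / (2 * T)) * ((w * ((P 0 ?s)^2 * 2 / 2) + 1 / w) / 2
     + (E + 1) * ((inverse (sqrt ?s) / 2) * 2) + (E + 2) / w * 1)) (at \<sigma>)"
   unfolding Mj_def by (intro DERIV_cmult DERIV_add DERIV_cdivide DERIV_ident)
  moreover have "(1 / (2 * T)) * ((w * ((P 0 ?s)^2 * 2 / 2) + 1 / w) / 2
     + (E + 1) * ((inverse (sqrt ?s) / 2) * 2) + (E + 2) / w * 1) = Mj' \<sigma>"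
  proof -
   have e: "x * 2 / 2 = x" "(inverse r / 2) * 2 = 1 / r" "u * (1 / r) = u / r" "x * 1 = x" for x r u :: real
    by (simp_all add: inverse_eq_divide)
   show ?thesis unfolding Mj'_def e ..
  qed
  ultimately have "(Mj has_deriv Mj' \<sigma>) (at \<sigma>)" by (simp only:)
  then show "(Mj has_vector_derivative Mj' \<sigma>) (at \<sigma>)"
   by (simp add: has_real_derivative_iff_has_vector_derivative)
  have r: "?s + ?t >= T" "?s + ?t > 0" using s x by auto
  have "norm (- Q ?t ?s / (2 * (?s + ?t))) = \<bar>Q ?t ?s\<bar> / (2 * (?s + ?t))" using r by simp
  also have "... <= \<bar>Q ?t ?s\<bar> / (2 * T)" using r T by (intro divide_left_mono) auto
  also have "... = (1 / (2 * T)) * \<bar>Q ?t ?s\<bar>" by simp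
  also have "... <= Mj' \<sigma>"
   unfolding Mj'_def
  proof (rule mult_left_mono)
   have 1: "\<bar>P 0 ?s * 1\<bar> <= (w * (P 0 ?s)^2 + 1^2 / w) / 2" using w by (intro amgm_weighted)
   have "w <= sqrt (?s + ?t)" unfolding w_def using r by (intro real_sqrt_le_mono)
   moreover have "sqrt (?s + ?t) > 0" using r by simp
   ultimately have 2: "(E + 2) / sqrt (?s + ?t) <= (E + 2) / w"
    using w(1) E_nonneg by (intro divide_left_mono mult_pos_pos) simp_all
   show "\<bar>Q ?t ?s\<bar> <= (w * (P 0 ?s)^2 + 1 / w) / 2 + (E + 1) / sqrt ?s + (E + 2) / w"
    using Q_bound[OF ts(1,2)] 1 2 unfolding mult_1_right power_one by linarith
  qed (use T in simp)
  finally show "norm (- Q ?t ?s / (2 * (?s + ?t))) <= Mj' \<sigma>" .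
 qed (use T in auto)
 also have "Mj T - Mj 0 = (1 / (2 * T)) * ((w * ((\<Phi> (v + 2 * T) - \<Phi> v) / 2) + T / w) / 2 + (E + 1) * (sqrt (v + 2 * T) - sqrt v) + (E + 2) / w * T)"
  by (simp add: Mj_def algebra_simps add_divide_distrib diff_divide_distrib)
 also have "... <= (1 / (2 * T)) * ((w * (E / 2) + w) / 2 + (E + 1) * (2 * w) + (E + 2) * w)"
 proof (intro mult_left_mono add_mono divide_right_mono)
  show "(\<Phi> (v + 2 * T) - \<Phi> v) <= E" using energy_PQ(3)[of 0 v "v + 2 * T"] xi T by (simp add: \<Phi>_def)
  show "T / w <= w" using w by (simp add: power2_eq_square[symmetric] divide_le_eq)
  show "sqrt (v + 2 * T) - sqrt v <= 2 * w"
  proof -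
   have "sqrt (v + 2 * T) <= sqrt v + 2 * w"
   proof (rule real_le_lsqrt)
    show "v + 2 * T <= (sqrt v + 2 * w)^2"
    proof -
     have "(sqrt v + 2 * w)^2 = v + 4 * T + 4 * (sqrt v * w)"
      using w(2) x by (simp add: power2_sum power_mult_distrib)
     moreover have "0 <= sqrt v * w" using w(1) x by simp
     ultimately show ?thesis using T by linarith
    qed
   qed (use x w in auto)
   then show ?thesis by simp
  qed
  show "(E + 2) / w * T <= (E + 2) * w"
   unfolding w(2)[symmetric] using w(1) by (simp add: power2_eq_square)
 qed (use T w E_nonneg in auto)
 also have "... = (13 / 4 * E + 9/2) * (w / (2 * T))" by (simp add: field_simps)
 also have "w / (2 * T) = 1 / (2 * w)" unfolding w(2)[symmetric] using w(1) by (simp add: power2_eq_square)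
 also have "(13 / 4 * E + 9/2) * (1 / (2 * w)) <= (2 * E + 3) / w"
  using w E_nonneg by (simp add: field_simps)
 finally have "\<bar>y T - y 0\<bar> <= (2 * E + 3) / w" by simp
 then show ?thesis by (simp add: y_def w_def)
qed

lemma SP_integrable:
 assumes "t >= 0"
 shows "set_integrable lborel {R..} (%s. (P t s)^2)" "set_integrable lborel {R..} (%s. (Q t s)^2)"
proof -
 have c: "continuous_on {R..} (%s. (P t s)^2)" "continuous_on {R..} (%s. (Q t s)^2)"
  using assms by (intro continuous_intros cont_s; simp)+
 have b: "integral {R..N} (%s. (P t s)^2) <= E" "integral {R..N} (%s. (Q t s)^2) <= E" if "N >= R" for N
  using energy_PQ(3,4)[OF assms order_refl that] by auto
 show "set_integrable lborel {R..} (%s. (P t s)^2)" by (rule nonneg_half_line(1)[OF c(1) _ b(1)]) auto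
 show "set_integrable lborel {R..} (%s. (Q t s)^2)" by (rule nonneg_half_line(1)[OF c(2) _ b(2)]) auto
qed

lemma half_line_le:
 assumes t: "t >= 0" and M: "M >= R"
 shows "(LINT s:{R..}|lborel. (P t s)^2) <= integral {R..M} (%s. (P t s)^2) + tail M"
  and "(LINT s:{R..}|lborel. (Q t s)^2) <= integral {R..M} (%s. (Q t s)^2) + tail M"
  and "integral {R..M} (%s. (Q t s)^2) <= (LINT s:{R..}|lborel. (Q t s)^2)"
proof -
 have *: "integral {R..N} f <= integral {R..M} f + tail M"
  if f: "continuous_on {R..} f" "!!s. f s >= 0" "!!N. M <= N ==> integral {M..N} f <= tail M" and N: "N >= R" for f :: "real => real" and N
 proof (cases "M <= N")
  case True
  have i: "f integrable_on {R..N}" by (rule integrable_continuous_real[OF continuous_on_subset[OF f(1)]]) auto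
  have "integral {R..N} f = integral {R..M} f + integral {M..N} f"
   using Henstock_Kurzweil_Integration.integral_combine[OF M True i] by simp
  then show ?thesis using f(3)[OF True] by simp
 next
  case False
  have "integral {R..N} f <= integral {R..M} f"
   using False f M by (intro integral_subset_le integrable_continuous_real continuous_on_subset[OF f(1)]) auto
  then show ?thesis using tail_nonneg[OF M] by simp
 qed
 have c: "continuous_on {R..} (%s. (P t s)^2)" "continuous_on {R..} (%s. (Q t s)^2)"
  using t by (intro continuous_intros cont_s; simp)+
 show "(LINT s:{R..}|lborel. (P t s)^2) <= integral {R..M} (%s. (P t s)^2) + tail M"
  by (rule nonneg_half_line(2)[OF c(1) _ *[OF c(1)]]) (use energy_PQ(1)[OF t M] in auto)
 show "(LINT s:{R..}|lborel. (Q t s)^2) <= integral {R..M} (%s. (Q t s)^2) + tail M"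
  by (rule nonneg_half_line(2)[OF c(2) _ *[OF c(2)]]) (use energy_PQ(2)[OF t M] in auto)
 have b: "integral {R..N} (%s. (Q t s)^2) <= E" if "N >= R" for N
  using energy_PQ(4)[OF t order_refl that] by auto
 show "integral {R..M} (%s. (Q t s)^2) <= (LINT s:{R..}|lborel. (Q t s)^2)"
  by (rule nonneg_half_line(3)[OF c(2) _ b M]) auto
qed

lemma P_tendsto_0: "((%t. LINT s:{R..}|lborel. (P t s)^2) ---> 0) at_top"
proof (rule tendstoI)
 fix e :: real assume e: "e > 0"
 have "\<forall>\<^sub>F M in at_top. tail M < e / 2" using order_tendstoD(2)[OF tail, of "e / 2"] e by simp
 then obtain M where M: "M >= R" "tail M < e / 2"
  by (metis (no_types, lifting) eventually_at_top_linorder linorder_le_cases order_refl order_trans)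
 define C where "C = 2 * E + 3"
 let ?h = "%t. 2 * tail (R + 2 * t) + 2 * C^2 * (M - R) * inverse t"
 have "filterlim (%t::real. R + 2 * t) at_top at_top"
  by (intro filterlim_tendsto_add_at_top[OF tendsto_const] filterlim_tendsto_pos_mult_at_top[OF tendsto_const] filterlim_ident) simp
 then have "((%t. tail (R + 2 * t)) ---> 0) at_top" by (rule filterlim_compose[OF tail])
 then have "(?h ---> 2 * 0 + 2 * C^2 * (M - R) * 0) at_top"
  by (intro tendsto_intros tendsto_inverse_0_at_top filterlim_ident)
 then have "\<forall>\<^sub>F t in at_top. ?h t < e / 2" using order_tendstoD(2)[of ?h 0 at_top "e / 2"] e by simp
 then show "\<forall>\<^sub>F t in at_top. dist (LINT s:{R..}|lborel. (P t s)^2) 0 < e"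
  using eventually_gt_at_top[of 0]
 proof eventually_elim
  case (elim t)
  have t: "t >= 0" using elim by simp
  have cs: "continuous_on {R..M} (%s. (P 0 (s + 2 * t))^2)"
   using t by (intro continuous_intros continuous_on_compose2[OF cont_0]) auto
  have "integral {R..M} (%s. (P t s)^2) <= integral {R..M} (%s. 2 * (P 0 (s + 2 * t))^2 + 2 * C^2 / t)"
  proof (rule integral_le)
   show "(%s. (P t s)^2) integrable_on {R..M}" using t by (auto intro!: integrable_continuous_real continuous_intros cont_s)
   show "(%s. 2 * (P 0 (s + 2 * t))^2 + 2 * C^2 / t) integrable_on {R..M}"
    by (intro integrable_continuous_real continuous_on_add continuous_on_mult continuous_on_const cs)
   fix s assume "s \<in> {R..M}"
   then have "\<bar>P t s\<bar> <= \<bar>P 0 (s + 2 * t)\<bar> + C / sqrt t"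
    using P_bound[of t s] elim by (simp add: C_def)
   then have "(P t s)^2 <= (\<bar>P 0 (s + 2 * t)\<bar> + C / sqrt t)^2" by (metis abs_ge_zero power2_abs power_mono)
   also have "... <= 2 * \<bar>P 0 (s + 2 * t)\<bar>\<^sup>2 + 2 * (C / sqrt t)^2"
   proof -
    have "0 <= (\<bar>P 0 (s + 2 * t)\<bar> - C / sqrt t)^2" by simp
    then show ?thesis by (simp add: power2_sum power2_diff)
   qed
   finally show "(P t s)^2 <= 2 * (P 0 (s + 2 * t))^2 + 2 * C^2 / t" using t by (simp add: power_divide)
  qed
  also have "... = 2 * integral {R..M} (%s. (P 0 (s + 2 * t))^2) + 2 * C^2 / t * (M - R)"
  proof -
   have "integral {R..M} (%s. 2 * (P 0 (s + 2 * t))^2 + 2 * C^2 / t) =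
    integral {R..M} (%s. 2 * (P 0 (s + 2 * t))^2) + integral {R..M} (%s. 2 * C^2 / t)"
    by (intro integral_add integrable_continuous_real continuous_on_mult continuous_on_const cs)
   then show ?thesis using M by (simp add: mult.commute)
  qed
  also have "integral {R..M} (%s. (P 0 (s + 2 * t))^2) = integral {R + 2 * t..M + 2 * t} (%s. (P 0 s)^2)"
   using integral_shift_real_ivl[of "R + 2 * t" "2 * t" "M + 2 * t" "%s. (P 0 s)^2"] by simp
  also have "... <= tail (R + 2 * t)" using energy_PQ(1)[of 0 "R + 2 * t" "M + 2 * t"] t M by simp
  finally have "integral {R..M} (%s. (P t s)^2) <= ?h t" by (simp add: divide_inverse mult_ac)
  then have "(LINT s:{R..}|lborel. (P t s)^2) < e"
   using half_line_le(1)[OF t M(1)] M(2) elim by linarith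
  moreover have "0 <= (LINT s:{R..}|lborel. (P t s)^2)"
   unfolding set_lebesgue_integral_def by (rule integral_nonneg_AE) (auto intro!: AE_I2)
  ultimately show ?case by simp
 qed
qed

lemma Q_uniform: "uniform_limit {R..M} Q qinf at_top"
proof (rule uniform_limitI)
 fix e :: real assume e: "e > 0"
 have "((%T. (E + 2) * inverse (sqrt T)) ---> (E + 2) * 0) at_top"
  by (intro tendsto_intros tendsto_inverse_0_at_top sqrt_at_top)
 then have "\<forall>\<^sub>F T in at_top. (E + 2) * inverse (sqrt T) < e"
  using order_tendstoD(2)[of "%T. (E + 2) * inverse (sqrt T)" 0 at_top e] e by simp
 then show "\<forall>\<^sub>F T in at_top. \<forall>v\<in>{R..M}. dist (Q T v) (qinf v) < e"
  using eventually_gt_at_top[of 0]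
 proof eventually_elim
  case (elim T)
  show ?case
  proof
   fix v assume xi: "v \<in> {R..M}"
   have "\<bar>Q T v - qinf v\<bar> <= (E + 2) / sqrt (v + T)" using Q_limit[of T v] xi elim by simp
   also have "... <= (E + 2) / sqrt T" using elim xi R E_nonneg by (intro divide_left_mono) auto
   also have "... < e" using elim by (simp add: divide_inverse)
   finally show "dist (Q T v) (qinf v) < e" by (simp add: dist_real_def)
  qed
 qed
qed

lemma qinf_continuous: "continuous_on {R..M} qinf"
proof (rule uniform_limit_theorem[OF _ Q_uniform])
 show "\<forall>\<^sub>F t in at_top. continuous_on {R..M} (Q t)"
  using eventually_ge_at_top[of 0] by eventually_elim (auto intro!: cont_s)
qed simp

lemma Q_square_tendsto: "((%t. integral {R..M} (%s. (Q t s)^2)) ---> integral {R..M} (%s. (qinf s)^2)) at_top"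
proof -
 have bdd: "bounded (qinf ` {R..M})"
  by (intro compact_imp_bounded compact_continuous_image qinf_continuous) auto
 have u: "uniform_limit {R..M} (%t s. Q t s * Q t s) (%s. qinf s * qinf s) at_top"
  by (rule uniform_lim_mult[OF Q_uniform Q_uniform bdd bdd])
 show ?thesis
 proof (rule tendstoI)
  fix e :: real assume e: "e > 0"
  define d where "d = e / (\<bar>M - R\<bar> + 1)"
  have d: "d > 0" using e by (simp add: d_def)
  show "\<forall>\<^sub>F t in at_top. dist (integral {R..M} (%s. (Q t s)^2)) (integral {R..M} (%s. (qinf s)^2)) < e"
   using uniform_limitD[OF u d] eventually_ge_at_top[of 0]
  proof eventually_elim
   case (elim t)
   have c: "continuous_on {R..M} (Q t)" using elim by (auto intro!: cont_s)
   have i: "(%s. (Q t s)^2) integrable_on {R..M}" "(%s. (qinf s)^2) integrable_on {R..M}"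
    by (auto intro!: integrable_continuous_real continuous_intros c qinf_continuous)
   have "norm (integral {R..M} (%s. (Q t s)^2 - (qinf s)\<^sup>2)) <= integral {R..M} (%s. d)"
    by (rule integral_norm_bound_integral)
      (use i elim in \<open>auto intro!: integrable_diff less_imp_le simp: dist_real_def power2_eq_square\<close>)
   also have "... <= d * \<bar>M - R\<bar>" using d by (simp add: mult_left_mono)
   also have "... < e" using e by (simp add: d_def field_simps)
   finally show ?case using integral_diff[OF i] by (simp add: dist_real_def)
  qed
 qed
qed

lemma qinf_square_bound: "integral {R..M} (%s. (qinf s)^2) <= E"
proof (cases "R <= M")
 case True
 show ?thesis
 proof (rule tendsto_upperbound[OF Q_square_tendsto])
  show "\<forall>\<^sub>F t in at_top. integral {R..M} (%s. (Q t s)^2) <= E"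
   using eventually_ge_at_top[of 0] by eventually_elim (use energy_PQ(4) True in auto)
 qed simp
qed (use E_nonneg in auto)

text \<open>The constants: \<open>k = 1/5 + m\<close> with \<open>\<bar>m\<bar> <= 1/10\<close>. The constant part is handled by \<open>hardy_lower\<close>, and by \<open>hardy_upper\<close> the remainder costs at most \<open>2 * (1/10) * 2 = 2/5\<close> of the norm.\<close>

lemma qinf_lower:
 assumes M: "R <= M"
 shows "integral {R..M} (%s. (qinf s)^2) >= 3/5 * integral {R..M} (%s. (P 0 s)^2) - 3/10 * tail M"
proof -
 let ?b = "P 0" and ?a = "%s. \<bar>P 0 s\<bar>"
 have cb: "continuous_on {R..} ?b" "continuous_on {R..} ?a" using cont_0 by (auto intro!: continuous_intros)
 have sb: "set_integrable lborel {R..} (%s. (?b s)^2)" "set_integrable lborel {R..} (%s. (?a s)^2)"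
  using P0_square(1)[of R] by simp_all
 note hb = R cb(1) sb(1) and ha = R cb(2) sb(2)
 let ?B = "hardy_avg ?b" and ?A = "hardy_avg ?a"
 \<comment> \<open>\<open>leg 1\<close> lies within \<open>1/10\<close> of \<open>- 1/5\<close>, so the transform differs from \<open>- ?B / 5\<close> by at most \<open>?A / 10\<close>.\<close>
 have pt: "(qinf v)^2 >= (?b v)^2 + (2/5) * (?b v * ?B v) - (1/5) * (?a v * ?A v)" if xi: "v \<in> {R..M}" for v
 proof -
  have x: "v >= R" "v > 0" using xi R by auto
  have i1: "set_integrable lborel {v..} (%s. ?b s / s)" "set_integrable lborel {v..} (%s. ?a s / s)"
   using hardy_avg_integrable[OF hb x(1)] hardy_avg_integrable[OF ha x(1)] .
  define K where "K = (LINT s:{v..}|lborel. gK v s)"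
  have "K + (1/5) * ?B v = (LINT s:{v..}|lborel. gK v s + (1/5) * (?b s / s))"
   unfolding K_def hardy_avg_def using set_integral_add(2)[OF gK_integrable[OF x(1)] set_integrable_mult_right[OF i1(1)], of "1/5"]
    set_integral_mult_right[of lborel "{v..}" "1/5" "%s. ?b s / s"] by simp
  moreover have "\<bar>LINT s:{v..}|lborel. gK v s + (1/5) * (?b s / s)\<bar> <= (LINT s:{v..}|lborel. (1/10) * (?a s / s))"
  proof -
   have si: "set_integrable lborel {v..} (%s. gK v s + (1/5) * (?b s / s))"
    by (rule set_integral_add(1)[OF gK_integrable[OF x(1)] set_integrable_mult_right]) (rule i1)
   have "\<bar>LINT s:{v..}|lborel. gK v s + (1/5) * (?b s / s)\<bar> <= (LINT s:{v..}|lborel. \<bar>gK v s + (1/5) * (?b s / s)\<bar>)"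
    using set_integral_norm_bound[OF si] by simp
   also have "... <= (LINT s:{v..}|lborel. (1/10) * (?a s / s))"
   proof (rule set_integral_mono)
    show "set_integrable lborel {v..} (%s. \<bar>gK v s + (1/5) * (?b s / s)\<bar>)" by (rule set_integrable_abs[OF si])
    show "set_integrable lborel {v..} (%s. (1/10) * (?a s / s))" by (rule set_integrable_mult_right) (rule i1)
    fix s assume s: "s \<in> {v..}"
    then have z: "0 <= v / s" "v / s <= 1" "s > 0" using x by auto
    have "gK v s + (1/5) * (?b s / s) = (leg 1 (v / s) + 1/5) * (?b s / s)" by (simp add: gK_def algebra_simps)
    then have "\<bar>gK v s + (1/5) * (?b s / s)\<bar> = \<bar>leg 1 (v / s) + 1/5\<bar> * (?a s / s)" using z by (simp add: abs_mult)
    also have "\<bar>leg 1 (v / s) + 1/5\<bar> <= 1/10" using leg_1_bounds[OF z(1,2)] by linarith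
    then have "\<bar>leg 1 (v / s) + 1/5\<bar> * (?a s / s) <= (1/10) * (?a s / s)" using z by (intro mult_right_mono) auto
    finally show "\<bar>gK v s + (1/5) * (?b s / s)\<bar> <= (1/10) * (?a s / s)" .
   qed
   finally show ?thesis .
  qed
  moreover have "(LINT s:{v..}|lborel. (1/10) * (?a s / s)) = (1/10) * ?A v"
   unfolding hardy_avg_def by (rule set_integral_mult_right)
  ultimately have d: "\<bar>K + (1/5) * ?B v\<bar> <= (1/10) * ?A v" by simp
  have "\<bar>?b v * (K + (1/5) * ?B v)\<bar> <= ?a v * ((1/10) * ?A v)"
   unfolding abs_mult[of "?b v"] using d by (intro mult_left_mono) auto
  then have "- (2 * (?b v * K)) >= (2/5) * (?b v * ?B v) - (1/5) * (?a v * ?A v)"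
   unfolding abs_le_iff by (simp add: algebra_simps)
  moreover have "(qinf v)^2 >= (?b v)^2 - 2 * (?b v * K)"
   unfolding qinf_def K_def[symmetric] by (simp add: power2_diff)
  ultimately show ?thesis by linarith
 qed
 have cM: "continuous_on {R..M} ?b" "continuous_on {R..M} ?a" "continuous_on {R..M} ?B" "continuous_on {R..M} ?A"
  using continuous_on_subset[OF cb(1), of "{R..M}"] continuous_on_subset[OF cb(2), of "{R..M}"]
   hardy_avg_continuous[OF hb] hardy_avg_continuous[OF ha] by auto
 have i: "(%v. (?b v)^2) integrable_on {R..M}" "(%v. ?b v * ?B v) integrable_on {R..M}" "(%v. ?a v * ?A v) integrable_on {R..M}"
  by (intro integrable_continuous_real continuous_on_mult continuous_on_power cM)+
 have "integral {R..M} (%v. (?b v)^2 + (2/5) * (?b v * ?B v) - (1/5) * (?a v * ?A v)) <= integral {R..M} (%s. (qinf s)^2)"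
 proof (rule integral_le)
  show "(%v. (?b v)^2 + (2/5) * (?b v * ?B v) - (1/5) * (?a v * ?A v)) integrable_on {R..M}"
   by (intro integrable_diff[OF integrable_add[OF i(1) integrable_on_mult_right[OF i(2)]] integrable_on_mult_right[OF i(3)]])
  show "(%s. (qinf s)^2) integrable_on {R..M}"
   by (intro integrable_continuous_real continuous_on_power qinf_continuous)
 qed (use pt in auto)
 also have "integral {R..M} (%v. (?b v)^2 + (2/5) * (?b v * ?B v) - (1/5) * (?a v * ?A v)) =
   integral {R..M} (%v. (?b v)^2) + (2/5) * integral {R..M} (%v. ?b v * ?B v) - (1/5) * integral {R..M} (%v. ?a v * ?A v)"
  by (simp only: integral_diff[OF integrable_add[OF i(1) integrable_on_mult_right[OF i(2)]] integrable_on_mult_right[OF i(3)]]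
    integral_add[OF i(1) integrable_on_mult_right[OF i(2)]] integral_mult_right)
 finally have 1: "integral {R..M} (%s. (qinf s)^2) >= ..." .
 have 2: "2 * integral {R..M} (%v. ?b v * ?B v) >= - tail M"
  using hardy_lower[OF hb M] P0_square(2)[OF M] by linarith
 have 3: "integral {R..M} (%v. ?a v * ?A v) <= 2 * integral {R..M} (%s. (?b s)^2) + tail M / 2"
  using hardy_upper[OF ha M] P0_square(2)[OF M] by simp
 show ?thesis using 1 2 3 by linarith
qed

theorem radial_limits:
 shows "\<exists>J. ((%t. LINT s:{R..}|lborel. (Q t s)^2) ---> J) at_top \<and>
   J >= 3/5 * (LINT s:{R..}|lborel. (P 0 s)^2)"
proof -
 have cq: "continuous_on {R..} (%s. (qinf s)^2)"
 proof -
  have "continuous_on {R..} qinf"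
   unfolding continuous_on_eq_continuous_within
  proof
   fix x assume x: "x \<in> {R..}"
   have "continuous (at x within {R..x + 1}) qinf"
    using qinf_continuous[of "x + 1"] x by (simp add: continuous_on_eq_continuous_within)
   moreover have "at x within {R..x + 1} = at x within {R..}"
    by (rule at_within_nhd[of x "{..<x + 1}"]) auto
   ultimately show "continuous (at x within {R..}) qinf" by simp
  qed
  then show ?thesis by (intro continuous_on_power)
 qed
 define J where "J = (LINT s:{R..}|lborel. (qinf s)^2)"
 have qb: "integral {R..N} (%s. (qinf s)^2) <= E" for N by (rule qinf_square_bound)
 have Jlim: "((%N. integral {R..N} (%s. (qinf s)^2)) ---> J) at_top"
  unfolding J_def by (rule nonneg_half_line(4)[OF cq _ qb]) simp
 have "((%t. LINT s:{R..}|lborel. (Q t s)^2) ---> J) at_top"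
 proof (rule tendstoI)
  fix e :: real assume e: "e > 0"
  have "\<forall>\<^sub>F M in at_top. tail M < e / 3" using order_tendstoD(2)[OF tail, of "e / 3"] e by simp
  moreover have "\<forall>\<^sub>F M in at_top. dist (integral {R..M} (%s. (qinf s)^2)) J < e / 3"
   using tendstoD[OF Jlim, of "e / 3"] e by simp
  ultimately have "\<forall>\<^sub>F M in at_top. tail M < e / 3 \<and> dist (integral {R..M} (%s. (qinf s)^2)) J < e / 3 \<and> M >= R"
   using eventually_ge_at_top[of R] by eventually_elim auto
  then obtain M where M: "tail M < e / 3" "dist (integral {R..M} (%s. (qinf s)^2)) J < e / 3" "M >= R"
   using eventually_happens[of _ "at_top :: real filter"] by auto
  have "\<forall>\<^sub>F t in at_top. dist (integral {R..M} (%s. (Q t s)^2)) (integral {R..M} (%s. (qinf s)^2)) < e / 3"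
   using tendstoD[OF Q_square_tendsto, of "e / 3"] e by simp
  then show "\<forall>\<^sub>F t in at_top. dist (LINT s:{R..}|lborel. (Q t s)^2) J < e"
   using eventually_ge_at_top[of 0]
  proof eventually_elim
   case (elim t)
   show ?case using elim M half_line_le(2,3)[OF elim(2) M(3)] unfolding dist_real_def by linarith
  qed
 qed
 moreover have "3/5 * (LINT s:{R..}|lborel. (P 0 s)^2) <= J"
 proof -
  have c0: "continuous_on {R..} (%s. (P 0 s)^2)" by (intro continuous_on_power cont_0)
  have b0: "integral {R..N} (%s. (P 0 s)^2) <= E" if "N >= R" for N using energy_PQ(3)[of 0 R N] that by simp
  have "((%N. integral {R..N} (%s. (P 0 s)^2)) ---> (LINT s:{R..}|lborel. (P 0 s)^2)) at_top"
   by (rule nonneg_half_line(4)[OF c0 _ b0]) auto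
  then have l: "((%M. 3/5 * integral {R..M} (%s. (P 0 s)^2) - 3/10 * tail M) ---> 3/5 * (LINT s:{R..}|lborel. (P 0 s)^2) - 3/10 * 0) at_top"
   by (intro tendsto_intros tail)
  have "3/5 * (LINT s:{R..}|lborel. (P 0 s)^2) - 3/10 * 0 <= J"
  proof (rule tendsto_le[OF _ Jlim l])
   show "\<forall>\<^sub>F M in at_top. 3/5 * integral {R..M} (%s. (P 0 s)^2) - 3/10 * tail M <= integral {R..M} (%s. (qinf s)^2)"
    using eventually_ge_at_top[of R] by eventually_elim (use qinf_lower in auto)
  qed simp
  then show ?thesis by simp
 qed
 ultimately show ?thesis by blast
qed

end

section \<open>The radial profile of a mollified solution\<close>

text \<open>The mean value theorem in \<open>t\<close>, at the moving point \<open>r + \<beta> \<sigma>\<close>, and continuity of the time derivative.\<close>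

lemma line_derivative:
 fixes F Ft :: "real => real => real"
 assumes Ft: "!!t r. ((%t. F t r) has_deriv Ft t r) (at t)"
  and c: "continuous_on UNIV (%p. Ft (fst p) (snd p))"
  and Fr: "((%r. F t r) has_deriv Fr) (at r)"
 shows "((%\<sigma>. F (t + \<alpha> * \<sigma>) (r + \<beta> * \<sigma>)) has_deriv \<alpha> * Ft t r + \<beta> * Fr) (at 0)"
proof -
 define G where "G \<sigma> = F (t + \<alpha> * \<sigma>) (r + \<beta> * \<sigma>) - F t (r + \<beta> * \<sigma>)" for \<sigma>
 have "\<exists>\<theta>. 0 < \<theta> \<and> \<theta> < 1 \<and> G \<sigma> = \<alpha> * \<sigma> * Ft (t + \<alpha> * \<sigma> * \<theta>) (r + \<beta> * \<sigma>)" for \<sigma>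
 proof -
  have "((%\<theta>. F (t + \<alpha> * \<sigma> * \<theta>) (r + \<beta> * \<sigma>)) has_deriv Ft (t + \<alpha> * \<sigma> * \<theta>) (r + \<beta> * \<sigma>) * (\<alpha> * \<sigma>)) (at \<theta>)" for \<theta>
   by (rule DERIV_chain2[where f = "%t. F t (r + \<beta> * \<sigma>)" and g = "%\<theta>. t + \<alpha> * \<sigma> * \<theta>" and x = \<theta>, OF Ft])
    (auto intro!: derivative_eq_intros)
  from MVT2[of 0 1, OF _ this] obtain \<theta> where "0 < \<theta>" "\<theta> < 1"
   "F (t + \<alpha> * \<sigma> * 1) (r + \<beta> * \<sigma>) - F (t + \<alpha> * \<sigma> * 0) (r + \<beta> * \<sigma>) = (1 - 0) * (Ft (t + \<alpha> * \<sigma> * \<theta>) (r + \<beta> * \<sigma>) * (\<alpha> * \<sigma>))"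
   by auto
  then show ?thesis by (intro exI[of _ \<theta>]) (simp add: G_def mult_ac)
 qed
 then obtain \<theta> where th: "!!\<sigma>. 0 < \<theta> \<sigma> \<and> \<theta> \<sigma> < 1 \<and> G \<sigma> = \<alpha> * \<sigma> * Ft (t + \<alpha> * \<sigma> * \<theta> \<sigma>) (r + \<beta> * \<sigma>)" by metis
 have l1: "((%\<sigma>. \<sigma> * \<theta> \<sigma>) ---> 0) (at 0)"
 proof (rule Lim_null_comparison)
  have "norm (\<sigma> * \<theta> \<sigma>) <= \<bar>\<sigma>\<bar>" for \<sigma> using th[of \<sigma>] mult_left_mono[of "\<theta> \<sigma>" 1 "\<bar>\<sigma>\<bar>"] by (simp add: abs_mult)
  then show "\<forall>\<^sub>F \<sigma> in at 0. norm (\<sigma> * \<theta> \<sigma>) <= \<bar>\<sigma>\<bar>" by simp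
  show "((%\<sigma>::real. \<bar>\<sigma>\<bar>) ---> 0) (at 0)" by (rule tendsto_eq_intros) auto
 qed
 have l2: "((%\<sigma>. (t + \<alpha> * (\<sigma> * \<theta> \<sigma>), r + \<beta> * \<sigma>)) ---> (t + \<alpha> * 0, r + \<beta> * 0)) (at 0)"
  by (intro tendsto_Pair tendsto_add tendsto_mult tendsto_const l1 tendsto_ident_at)
 have "isCont (%p. Ft (fst p) (snd p)) (t + \<alpha> * 0, r + \<beta> * 0)" using c by (simp add: continuous_on_eq_continuous_at)
 from isCont_tendsto_compose[OF this l2]
 have l3: "((%\<sigma>. \<alpha> * Ft (t + \<alpha> * \<sigma> * \<theta> \<sigma>) (r + \<beta> * \<sigma>)) ---> \<alpha> * Ft t r) (at 0)"
  by (intro tendsto_mult tendsto_const) (simp add: mult_ac)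
 have G0: "G 0 = 0" by (simp add: G_def)
 have "((%h. (G (0 + h) - G 0) / h) ---> \<alpha> * Ft t r) (at 0)"
 proof (rule Lim_transform_eventually[OF l3])
  have "\<alpha> * Ft (t + \<alpha> * \<sigma> * \<theta> \<sigma>) (r + \<beta> * \<sigma>) = (G (0 + \<sigma>) - G 0) / \<sigma>" if "\<sigma> ~= 0" for \<sigma>
   using th[of \<sigma>] that G0 by simp
  then show "\<forall>\<^sub>F \<sigma> in at 0. \<alpha> * Ft (t + \<alpha> * \<sigma> * \<theta> \<sigma>) (r + \<beta> * \<sigma>) = (G (0 + \<sigma>) - G 0) / \<sigma>"
   unfolding eventually_at_filter by simp
 qed
 then have dG: "(G has_deriv \<alpha> * Ft t r) (at 0)" by (simp add: DERIV_def)
 have dl: "((%\<sigma>. r + \<beta> * \<sigma>) has_deriv \<beta>) (at 0)" by (auto intro!: derivative_eq_intros)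
 have Fr': "((%r. F t r) has_deriv Fr) (at (r + \<beta> * 0))" using Fr by simp
 note dr = DERIV_chain2[where f = "F t" and g = "%\<sigma>. r + \<beta> * \<sigma>" and x = 0, OF Fr' dl]
 have "((%\<sigma>. G \<sigma> + F t (r + \<beta> * \<sigma>)) has_deriv \<alpha> * Ft t r + Fr * \<beta>) (at 0)" by (rule DERIV_add[OF dG dr])
 then show ?thesis by (simp add: G_def mult.commute[of \<beta>])
qed

lemma inner_square_sum: "(\<Sum>b\<in>Basis. (x \<bullet> b)^2) = (norm x)^2" for x :: "'a::euclidean_space"
 unfolding power2_norm_eq_inner euclidean_inner[of x x] by (simp add: power2_eq_square)

locale radial_profile = radial_weak_wave +
 fixes \<eta> :: "real^4 => real" and \<epsilon> R :: real
 assumes moll: "mollifier \<epsilon> \<eta>" and sym: "!!x y. norm x = norm y ==> \<eta> x = \<eta> y"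
  and ierr: "linteg (err \<eta> 0)" and R: "R > 0"
begin

lemma \<eta>: "\<eta> \<in> testfuns" using moll by (simp add: mollifier_def)

definition ray :: "real^4" where "ray = axis 1 1"

lemma ray: "ray \<in> Basis" "norm ray = 1" "ray \<bullet> ray = 1"
 by (simp_all add: ray_def axis_in_Basis_iff norm_axis_1 inner_axis_axis)

definition U where "U t r = S \<eta> t (r *\<^sub>R ray)"
definition Ur where "Ur t r = S (pd ray \<eta>) t (r *\<^sub>R ray)"
definition Urr where "Urr t r = S (pd ray (pd ray \<eta>)) t (r *\<^sub>R ray)"
definition Ut where "Ut t r = V \<eta> t (r *\<^sub>R ray)"
definition Utr where "Utr t r = V (pd ray \<eta>) t (r *\<^sub>R ray)"
definition Utt where "Utt t r = S (laplacian \<eta>) t (r *\<^sub>R ray)"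

lemmas \<eta>r = test_partial_deriv[OF \<eta>, of ray] and \<eta>rr = test_partial_deriv[OF test_partial_deriv[OF \<eta>, of ray], of ray]

lemma S_ray: "\<psi> \<in> testfuns ==> continuous_on UNIV (%p. S \<psi> (fst p) (snd p *\<^sub>R ray))"
 by (rule continuous_on_compose2[OF S_continuous, of \<psi> UNIV "%p. (fst p, snd p *\<^sub>R ray)", simplified])
  (auto intro!: continuous_intros)

lemma V_ray: "\<psi> \<in> testfuns ==> continuous_on UNIV (%p. V \<psi> (fst p) (snd p *\<^sub>R ray))"
 by (rule continuous_on_compose2[OF V_continuous, of \<psi> UNIV "%p. (fst p, snd p *\<^sub>R ray)", simplified])
  (auto intro!: continuous_intros)

lemma profile_continuous:
 "continuous_on UNIV (%p. U (fst p) (snd p))" "continuous_on UNIV (%p. Ur (fst p) (snd p))"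
 "continuous_on UNIV (%p. Urr (fst p) (snd p))" "continuous_on UNIV (%p. Ut (fst p) (snd p))"
 "continuous_on UNIV (%p. Utr (fst p) (snd p))" "continuous_on UNIV (%p. Utt (fst p) (snd p))"
 unfolding U_def Ur_def Urr_def Ut_def Utr_def Utt_def
 by (rule S_ray V_ray \<eta> \<eta>r \<eta>rr test_laplacian[OF \<eta>])+

lemma slice_continuous:
 fixes f :: "real => real => real"
 assumes "continuous_on UNIV (%p. f (fst p) (snd p))" shows "continuous_on A (f t)"
proof -
 have "continuous_on A (%x::real. (t, x))" by (intro continuous_intros)
 from continuous_on_compose2[OF assms this] show ?thesis by simp
qed

lemmas U_cont = slice_continuous[OF profile_continuous(1)] and Ur_cont = slice_continuous[OF profile_continuous(2)]
 and Ut_cont = slice_continuous[OF profile_continuous(4)]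

lemma S_r: "\<psi> \<in> testfuns ==>
  ((%r. S \<psi> t (r *\<^sub>R ray)) has_deriv S (pd ray \<psi>) t (r *\<^sub>R ray)) (at r)"
 using S_x[of \<psi> t 0 ray r] by simp

lemma V_r: "\<psi> \<in> testfuns ==>
  ((%r. V \<psi> t (r *\<^sub>R ray)) has_deriv V (pd ray \<psi>) t (r *\<^sub>R ray)) (at r)"
 using V_x[of \<psi> t 0 ray r] by simp

lemma profile_derivs:
 "((%r. U t r) has_deriv Ur t r) (at r)" "((%r. Ur t r) has_deriv Urr t r) (at r)"
 "((%r. Ut t r) has_deriv Utr t r) (at r)"
 "((%t. U t r) has_deriv Ut t r) (at t)" "((%t. Ur t r) has_deriv Utr t r) (at t)"
 "((%t. Ut t r) has_deriv Utt t r) (at t)"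
 unfolding U_def Ur_def Urr_def Ut_def Utr_def Utt_def
 by (rule S_r[OF \<eta>] S_r[OF \<eta>r] V_r[OF \<eta>] S_t[OF \<eta>] S_t[OF \<eta>r] V_t[OF \<eta>])+

lemma radial_form:
 assumes "t >= 0"
 shows "S \<eta> t x = U t (norm x)" "V \<eta> t x = Ut t (norm x)"
proof -
 have "norm x = norm (norm x *\<^sub>R ray)" by (simp add: ray)
 from S_radial[OF \<eta> sym assms this] show "S \<eta> t x = U t (norm x)" "V \<eta> t x = Ut t (norm x)"
  by (simp_all add: U_def Ut_def)
qed

lemma norm_line_deriv:
 fixes x b :: "real^4"
 assumes "x ~= 0"
 shows "((%s. norm (x + s *\<^sub>R b)) has_deriv (x \<bullet> b) / norm x) (at 0)"
proof -
 have g: "((%s. x + s *\<^sub>R b) has_derivative (%s. s *\<^sub>R b)) (at 0)" by (auto intro!: derivative_eq_intros)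
 have n: "(norm has_derivative (%h. h \<bullet> sgn x)) (at (x + 0 *\<^sub>R b))" using has_derivative_norm[OF assms] by simp
 have "((%s. norm (x + s *\<^sub>R b)) has_derivative (%s. (s *\<^sub>R b) \<bullet> sgn x)) (at 0)"
  using has_derivative_compose[OF g n] .
 moreover have "(%s. (s *\<^sub>R b) \<bullet> sgn x) = (*) ((x \<bullet> b) / norm x)"
  by (rule ext) (simp add: sgn_div_norm inner_commute[of b] field_simps)
 ultimately show ?thesis unfolding has_field_derivative_def by simp
qed

text \<open>The chain rule for \<open>S \<eta> t x = U t (norm x)\<close>.\<close>

lemma gradient_form:
 assumes t: "t >= 0" and x: "x ~= 0"
 shows "S (pd b \<eta>) t x = Ur t (norm x) * ((x \<bullet> b) / norm x)"
proof -
 have U': "((%r. U t r) has_deriv Ur t (norm x)) (at (norm (x + 0 *\<^sub>R b)))" using profile_derivs(1) by simp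
 have "((%s. S \<eta> t (x + s *\<^sub>R b)) has_deriv Ur t (norm x) * ((x \<bullet> b) / norm x)) (at 0)"
  unfolding radial_form(1)[OF t]
  by (rule DERIV_chain2[where f = "U t" and g = "%s. norm (x + s *\<^sub>R b)" and x = 0, OF U' norm_line_deriv[OF x]])
 then show ?thesis using S_x0[OF \<eta>, of t x b] DERIV_unique by blast
qed

lemma shifted_gradient_square:
 assumes t: "t >= 0" and x: "x ~= 0"
 shows "(\<Sum>b\<in>Basis. (S (pd b \<eta>) t x + c * (x \<bullet> b) / (norm x) ^ 4)^2) = (Ur t (norm x) + c / (norm x) ^ 3)^2"
proof -
 have n: "norm x > 0" using x by simp
 have "S (pd b \<eta>) t x + c * (x \<bullet> b) / (norm x) ^ 4 = (Ur t (norm x) + c / (norm x) ^ 3) / norm x * (x \<bullet> b)" for b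
  unfolding gradient_form[OF t x] using n by (simp add: divide_simps) (simp add: algebra_simps eval_nat_numeral)
 then have "(\<Sum>b\<in>Basis. (S (pd b \<eta>) t x + c * (x \<bullet> b) / (norm x) ^ 4)^2) = ((Ur t (norm x) + c / (norm x) ^ 3) / norm x)^2 * (norm x)^2"
  by (simp only: power_mult_distrib sum_distrib_left[symmetric] inner_square_sum)
 then show ?thesis using n by (simp only: power_mult_distrib[symmetric]) simp
qed

text \<open>Each of the three directions orthogonal to the ray contributes \<open>Ur / r\<close> to the Laplacian.\<close>

lemma radial_wave_equation:
 assumes t: "t >= 0" and r: "r > 0"
 shows "Utt t r = Urr t r + 3 * Ur t r / r"
proof -
 define x where "x = r *\<^sub>R ray"
 have x: "x ~= 0" "norm x = r" using r ray by (auto simp: x_def)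
 have o: "S (pd b (pd b \<eta>)) t x = Ur t r / r" if b: "b \<in> Basis" "b ~= ray" for b
 proof -
  have xb: "x \<bullet> b = 0" "b \<bullet> b = 1" using b ray(1) by (auto simp: x_def inner_not_same_Basis inner_Basis)
  have ne: "\<forall>\<^sub>F s in nhds 0. x + s *\<^sub>R b ~= 0"
  proof (rule always_eventually, rule allI)
   fix s have "(x + s *\<^sub>R b) \<bullet> ray = r" using b ray by (simp add: x_def inner_add_left inner_not_same_Basis)
   then show "x + s *\<^sub>R b ~= 0" using r by auto
  qed
  have U': "((%r. Ur t r) has_deriv Urr t r) (at (norm (x + 0 *\<^sub>R b)))" using profile_derivs(2)[of t r] x by simp
  note d1 = DERIV_chain2[where f = "Ur t" and g = "%s. norm (x + s *\<^sub>R b)" and x = 0, OF U' norm_line_deriv[OF x(1)]]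
  have "((%s. Ur t (norm (x + s *\<^sub>R b)) * (s / norm (x + s *\<^sub>R b))) has_deriv
    (Urr t r * ((x \<bullet> b) / norm x)) * (0 / norm (x + 0 *\<^sub>R b)) +
    ((1 * norm (x + 0 *\<^sub>R b) - 0 * ((x \<bullet> b) / norm x)) / (norm (x + 0 *\<^sub>R b) * norm (x + 0 *\<^sub>R b))) * Ur t (norm (x + 0 *\<^sub>R b))) (at 0)"
   by (intro DERIV_mult d1 DERIV_divide DERIV_ident norm_line_deriv[OF x(1)]) (use x r in simp)
  then have d: "((%s. Ur t (norm (x + s *\<^sub>R b)) * (s / norm (x + s *\<^sub>R b))) has_deriv Ur t r / r) (at 0)"
   using x r by simp
  have e: "\<forall>\<^sub>F s in nhds 0. S (pd b \<eta>) t (x + s *\<^sub>R b) = Ur t (norm (x + s *\<^sub>R b)) * (s / norm (x + s *\<^sub>R b))"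
   using ne by eventually_elim (simp add: gradient_form[OF t] inner_add_left xb)
  have "((%s. S (pd b \<eta>) t (x + s *\<^sub>R b)) has_deriv Ur t r / r) (at 0)"
   using d DERIV_cong_ev[OF refl e refl] by simp
  then show ?thesis using S_x0[OF test_partial_deriv[OF \<eta>], of b t x b] DERIV_unique by blast
 qed
 have "Utt t r = (\<Sum>b\<in>Basis. S (pd b (pd b \<eta>)) t x)"
  unfolding Utt_def x_def by (rule S_laplacian[OF \<eta>])
 also have "... = Urr t r + (\<Sum>b\<in>Basis - {ray}. S (pd b (pd b \<eta>)) t x)"
  unfolding sum.remove[OF finite_Basis ray(1)] Urr_def x_def ..
 also have "(\<Sum>b\<in>Basis - {ray}. S (pd b (pd b \<eta>)) t x) = (\<Sum>b\<in>Basis - {ray}. Ur t r / r)"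
  by (rule sum.cong) (use o in auto)
 also have "... = 3 * Ur t r / r" using ray(1) by (simp add: card_Diff_singleton)
 finally show ?thesis .
qed

text \<open>In these variables \<open>B = r^(-1/2) (r^2 u)_r\<close>, which vanishes exactly when \<open>u\<close> is a multiple of \<open>1 / r^2\<close>.\<close>

definition A where "A t r = r * sqrt r * Ut t r"
definition B where "B t r = r * sqrt r * Ur t r + 2 * sqrt r * U t r"
definition A\<^sub>t where "A\<^sub>t t r = r * sqrt r * Utt t r"
definition B\<^sub>t where "B\<^sub>t t r = r * sqrt r * Utr t r + 2 * sqrt r * Ut t r"
definition A\<^sub>r where "A\<^sub>r t r = 3 / 2 * sqrt r * Ut t r + r * sqrt r * Utr t r"
definition B\<^sub>r where "B\<^sub>r t r = 3 / 2 * sqrt r * Ur t r + r * sqrt r * Urr t r + (U t r / sqrt r + 2 * sqrt r * Ur t r)"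

lemma ab_t: "((%t. A t r) has_deriv A\<^sub>t t r) (at t)" "((%t. B t r) has_deriv B\<^sub>t t r) (at t)"
 unfolding A_def B_def A\<^sub>t_def B\<^sub>t_def by (intro DERIV_cmult DERIV_add profile_derivs)+

lemma ab_r:
 assumes r: "r > 0"
 shows "((%r. A t r) has_deriv A\<^sub>r t r) (at r)" "((%r. B t r) has_deriv B\<^sub>r t r) (at r)"
proof -
 define q where "q = sqrt r"
 have q: "q > 0" "q * q = r" using r by (auto simp: q_def)
 have s: "(sqrt has_deriv 1 / (2 * q)) (at r)"
  by (rule DERIV_cong[OF DERIV_real_sqrt[OF r]]) (simp add: q_def divide_simps)
 have w: "((%r. r * sqrt r) has_deriv 3 / 2 * q) (at r)"
  by (rule DERIV_cong[OF DERIV_mult[OF DERIV_ident s]]) (use q in \<open>simp add: q_def[symmetric] field_simps\<close>)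
 show "((%r. A t r) has_deriv A\<^sub>r t r) (at r)" unfolding A_def
  by (rule DERIV_cong[OF DERIV_mult[OF w profile_derivs(3)]]) (simp add: A\<^sub>r_def q_def mult_ac)
 have s2: "((%r. 2 * sqrt r) has_deriv 1 / q) (at r)"
  by (rule DERIV_cong[OF DERIV_cmult[OF s]]) simp
 show "((%r. B t r) has_deriv B\<^sub>r t r) (at r)" unfolding B_def
  by (rule DERIV_cong[OF DERIV_add[OF DERIV_mult[OF w profile_derivs(2)] DERIV_mult[OF s2 profile_derivs(1)]]])
   (simp add: B\<^sub>r_def q_def mult_ac)
qed

lemma ab_equations:
 assumes t: "t >= 0" and r: "r > 0"
 shows "A\<^sub>t t r - B\<^sub>r t r = - B t r / (2 * r)" "B\<^sub>t t r - A\<^sub>r t r = A t r / (2 * r)"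
proof -
 define q where "q = sqrt r"
 have q: "q > 0" and rq: "r = q * q" using r by (auto simp: q_def)
 show "A\<^sub>t t r - B\<^sub>r t r = - B t r / (2 * r)"
  unfolding A\<^sub>t_def B\<^sub>r_def B_def radial_wave_equation[OF t r] q_def[symmetric] unfolding rq using q by (simp add: field_simps)
 show "B\<^sub>t t r - A\<^sub>r t r = A t r / (2 * r)"
  unfolding B\<^sub>t_def A\<^sub>r_def A_def q_def[symmetric] unfolding rq using q by (simp add: field_simps)
qed

lemma ab_t_continuous:
 "continuous_on UNIV (%p. A\<^sub>t (fst p) (snd p))" "continuous_on UNIV (%p. B\<^sub>t (fst p) (snd p))"
 unfolding A\<^sub>t_def B\<^sub>t_def by (intro continuous_intros profile_continuous)+

lemma ab_line:
 assumes r: "r > 0"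
 shows "((%\<sigma>. A (t + \<alpha> * \<sigma>) (r + \<beta> * \<sigma>)) has_deriv \<alpha> * A\<^sub>t t r + \<beta> * A\<^sub>r t r) (at 0)"
  "((%\<sigma>. B (t + \<alpha> * \<sigma>) (r + \<beta> * \<sigma>)) has_deriv \<alpha> * B\<^sub>t t r + \<beta> * B\<^sub>r t r) (at 0)"
 by (rule line_derivative[OF ab_t(1) ab_t_continuous(1) ab_r(1)[OF r]] line_derivative[OF ab_t(2) ab_t_continuous(2) ab_r(2)[OF r]])+

definition P where "P t s = A t (s + t) + B t (s + t)"
definition Q where "Q t s = A t (s + t) - B t (s + t)"
definition Ps where "Ps t s = A\<^sub>r t (s + t) + B\<^sub>r t (s + t)"

lemma PQ_equations:
 assumes t: "t >= 0" and s: "s >= R"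
 shows "((%t. Q t s) has_deriv - P t s / (2 * (s + t))) (at t)"
  and "((%t. P t s) has_deriv 2 * Ps t s + Q t s / (2 * (s + t))) (at t)"
  and "((%s. P t s) has_deriv Ps t s) (at s)"
  and "((%\<sigma>. P (t - \<sigma>) (s + 2 * \<sigma>)) has_deriv - Q t s / (2 * (s + t))) (at 0)"
proof -
 have r: "s + t > 0" using t s R by simp
 note A = ab_line[OF r, of t] and eq = ab_equations[OF t r]
 have e1: "A\<^sub>t t (s + t) = B\<^sub>r t (s + t) - B t (s + t) / (2 * (s + t))" "B\<^sub>t t (s + t) = A\<^sub>r t (s + t) + A t (s + t) / (2 * (s + t))"
  using eq by linarith+
 have "((%\<sigma>. Q (\<sigma> + t) s) has_deriv - P t s / (2 * (s + t))) (at 0)"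
  by (rule DERIV_cong[OF DERIV_diff[OF A(1)[of 1 1] A(2)[of 1 1], THEN DERIV_cong_ev[OF refl always_eventually refl, THEN iffD2, rotated]]])
   (auto simp: Q_def P_def e1 add_divide_distrib diff_divide_distrib algebra_simps)
 then show "((%t. Q t s) has_deriv - P t s / (2 * (s + t))) (at t)"
  using DERIV_shift[of "%t. Q t s" _ 0 t] by simp
 have "((%\<sigma>. P (\<sigma> + t) s) has_deriv 2 * Ps t s + Q t s / (2 * (s + t))) (at 0)"
  by (rule DERIV_cong[OF DERIV_add[OF A(1)[of 1 1] A(2)[of 1 1], THEN DERIV_cong_ev[OF refl always_eventually refl, THEN iffD2, rotated]]])
   (auto simp: Q_def P_def Ps_def e1 add_divide_distrib diff_divide_distrib algebra_simps)
 then show "((%t. P t s) has_deriv 2 * Ps t s + Q t s / (2 * (s + t))) (at t)"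
  using DERIV_shift[of "%t. P t s" _ 0 t] by simp
 show "((%s. P t s) has_deriv Ps t s) (at s)"
  using DERIV_add[OF ab_r[OF r, of t]] DERIV_shift[of "%r. A t r + B t r" _ s t] by (simp add: P_def Ps_def)
 show "((%\<sigma>. P (t - \<sigma>) (s + 2 * \<sigma>)) has_deriv - Q t s / (2 * (s + t))) (at 0)"
  by (rule DERIV_cong[OF DERIV_add[OF A(1)[of "-1" 1] A(2)[of "-1" 1], THEN DERIV_cong_ev[OF refl always_eventually refl, THEN iffD2, rotated]]])
   (auto simp: Q_def P_def e1 add_divide_distrib diff_divide_distrib algebra_simps)
qed

lemma ab_continuous:
 "continuous_on UNIV (%p. A (fst p) (snd p))" "continuous_on UNIV (%p. B (fst p) (snd p))"
 "continuous_on (UNIV \<times> {0<..}) (%p. A\<^sub>r (fst p) (snd p) + B\<^sub>r (fst p) (snd p))"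
proof -
 note c = profile_continuous continuous_on_subset[OF profile_continuous(1) subset_UNIV] continuous_on_subset[OF profile_continuous(2) subset_UNIV]
  continuous_on_subset[OF profile_continuous(3) subset_UNIV] continuous_on_subset[OF profile_continuous(4) subset_UNIV]
  continuous_on_subset[OF profile_continuous(5) subset_UNIV]
 show "continuous_on UNIV (%p. A (fst p) (snd p))" "continuous_on UNIV (%p. B (fst p) (snd p))"
  unfolding A_def B_def by (intro continuous_intros profile_continuous)+
 show "continuous_on (UNIV \<times> {0<..}) (%p. A\<^sub>r (fst p) (snd p) + B\<^sub>r (fst p) (snd p))"
  unfolding A\<^sub>r_def B\<^sub>r_def by (intro continuous_intros c) auto
qed

lemma PQ_continuous:
 "continuous_on ({0..} \<times> {R..}) (%x. P (fst x) (snd x))" "continuous_on ({0..} \<times> {R..}) (%x. Q (fst x) (snd x))"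
 "continuous_on ({0..} \<times> {R..}) (%x. Ps (fst x) (snd x))"
proof -
 have m: "continuous_on ({0..} \<times> {R..}) (%x::real \<times> real. (fst x, snd x + fst x))" by (intro continuous_intros)
 have A: "continuous_on ({0..} \<times> {R..}) (%x. A (fst x) (snd x + fst x))" "continuous_on ({0..} \<times> {R..}) (%x. B (fst x) (snd x + fst x))"
  using continuous_on_compose2[OF ab_continuous(1) m subset_UNIV] continuous_on_compose2[OF ab_continuous(2) m subset_UNIV] by simp_all
 show "continuous_on ({0..} \<times> {R..}) (%x. P (fst x) (snd x))" "continuous_on ({0..} \<times> {R..}) (%x. Q (fst x) (snd x))"
  unfolding P_def Q_def by (intro continuous_on_add continuous_on_diff A)+
 have "(%x::real \<times> real. (fst x, snd x + fst x)) ` ({0..} \<times> {R..}) \<subseteq> UNIV \<times> {0<..}" using R by auto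
 from continuous_on_compose2[OF ab_continuous(3) m this]
 show "continuous_on ({0..} \<times> {R..}) (%x. Ps (fst x) (snd x))" unfolding Ps_def by simp
qed

end

section \<open>Exterior energies of a mollified solution\<close>

text \<open>Integrals over a half-line are compared through identities on bounded intervals whose boundary terms \<open>k\<close> converge.\<close>

lemma half_line_limit:
 fixes f h k :: "real => real"
 assumes f: "continuous_on {\<rho>..} f" "!!s. s >= \<rho> ==> f s >= 0" and h: "continuous_on {\<rho>..} h" "!!s. s >= \<rho> ==> h s >= 0"
  and b: "!!N. N >= \<rho> ==> integral {\<rho>..N} h <= C"
  and id: "!!N. N >= \<rho> ==> integral {\<rho>..N} f = integral {\<rho>..N} h + k N" and k: "(k ---> k0) at_top"
 shows "set_integrable lborel {\<rho>..} f" "(LINT s:{\<rho>..}|lborel. f s) = (LINT s:{\<rho>..}|lborel. h s) + k0"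
proof -
 have "((%N. integral {\<rho>..N} h + k N) ---> (LINT s:{\<rho>..}|lborel. h s) + k0) at_top"
  by (intro tendsto_add k nonneg_half_line(4)[OF h b])
 then have l: "((%N. integral {\<rho>..N} f) ---> (LINT s:{\<rho>..}|lborel. h s) + k0) at_top"
  by (rule Lim_transform_eventually) (use id in \<open>auto intro: eventually_at_top_linorderI[of \<rho>]\<close>)
 have bf: "integral {\<rho>..N} f <= (LINT s:{\<rho>..}|lborel. h s) + k0" if "N >= \<rho>" for N
 proof (rule tendsto_lowerbound[OF l])
  have "integral {\<rho>..N} f <= integral {\<rho>..N'} f" if "N' >= N" for N'
   using that \<open>N >= \<rho>\<close> f(2)
   by (intro integral_subset_le integrable_continuous_real continuous_on_subset[OF f(1)]) auto
  then show "\<forall>\<^sub>F N' in at_top. integral {\<rho>..N} f <= integral {\<rho>..N'} f" by (auto intro: eventually_at_top_linorderI[of N])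
 qed simp
 show "set_integrable lborel {\<rho>..} f" by (rule nonneg_half_line(1)[OF f bf])
 show "(LINT s:{\<rho>..}|lborel. f s) = (LINT s:{\<rho>..}|lborel. h s) + k0"
  by (rule tendsto_unique[OF _ nonneg_half_line(4)[OF f bf] l]) simp
qed

lemma half_line_shift:
 fixes f :: "real => real"
 shows "(LINT r:{\<rho> + t..}|lborel. f r) = (LINT s:{\<rho>..}|lborel. f (s + t))"
proof -
 have "(LINT r:{\<rho> + t..}|lborel. f r) = (LINT s|lborel. indicator {\<rho> + t..} (t + 1 * s) *\<^sub>R f (t + 1 * s))"
  unfolding set_lebesgue_integral_def
  using lborel_integral_real_affine[of 1 "%r. indicator {\<rho> + t..} r *\<^sub>R f r" t] by simp
 also have "... = (LINT s:{\<rho>..}|lborel. f (s + t))"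
  unfolding set_lebesgue_integral_def by (rule Bochner_Integration.integral_cong) (auto simp: indicator_def add.commute)
 finally show ?thesis .
qed

text \<open>A continuously differentiable step from \<open>0\<close> on \<open>{..M - 1}\<close> to \<open>1\<close> on \<open>{M..}\<close>.\<close>

definition step :: "real => real => real" where "step M s = (max 0 (1 - (max 0 (M - s))\<^sup>2))^2"
definition step' :: "real => real => real" where
 "step' M s = 2 * max 0 (1 - (max 0 (M - s))\<^sup>2) * (2 * max 0 (M - s))"

lemma step:
 shows "(step M has_deriv step' M s) (at s)" "continuous_on UNIV (step' M)" "step M s >= 0" "step' M s >= 0"
  "step M s <= 1" "s >= M ==> step M s = 1" "s <= M - 1 ==> step M s = 0"
proof -
 have "((%s. M - s) has_deriv -1) (at s)" by (auto intro!: derivative_eq_intros)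
 note d1 = DERIV_chain2[where f = "%s. (max 0 s)^2" and g = "%s. M - s" and x = s, OF positive_part_square_deriv this]
 have d2: "((%s. 1 - (max 0 (M - s))\<^sup>2) has_deriv 0 - 2 * max 0 (M - s) * -1) (at s)"
  by (intro DERIV_diff DERIV_const d1)
 note d3 = DERIV_chain2[where f = "%s. (max 0 s)^2" and g = "%s. 1 - (max 0 (M - s))\<^sup>2" and x = s, OF positive_part_square_deriv d2]
 show "(step M has_deriv step' M s) (at s)"
  unfolding step_def[abs_def] step'_def by (rule DERIV_cong[OF d3]) simp
 show "continuous_on UNIV (step' M)" unfolding step'_def[abs_def] by (intro continuous_intros)
 show "step M s >= 0" by (simp add: step_def)
 show "step' M s >= 0" unfolding step'_def by (intro mult_nonneg_nonneg) auto
 show "step M s <= 1" unfolding step_def by (rule power_le_one) auto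
 show "s >= M ==> step M s = 1" by (simp add: step_def)
 assume "s <= M - 1"
 then have "1\<^sup>2 <= (max 0 (M - s))^2" by (intro power_mono) auto
 then show "step M s = 0" by (simp add: step_def)
qed

context radial_profile
begin

definition dens where "dens t x = (V \<eta> t x)^2 + (\<Sum>b\<in>Basis. (S (pd b \<eta>) t x)^2)"

lemma dens_nonneg: "dens t x >= 0" unfolding dens_def by (intro add_nonneg_nonneg sum_nonneg) auto

lemma mollified_measurable:
 "V \<eta> t \<in> lmeas" "S (pd b \<eta>) t \<in> lmeas"
 using borel_measurable_continuous_onI[OF convol_continuous[OF v_li \<eta>]] borel_measurable_continuous_onI[OF convol_continuous[OF u_li test_partial_deriv[OF \<eta>]]]
 by (simp_all add: V_def[abs_def] S_def[abs_def] measurable_completion)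

lemma dens_measurable: "dens t \<in> lmeas"
 unfolding dens_def[abs_def] by (intro borel_measurable_add borel_measurable_sum borel_measurable_power mollified_measurable)

definition data where "data t x = (v t x)^2 + (\<Sum>b\<in>Basis. (g t x \<bullet> b)^2)"

lemma data_integrable: "linteg (data t)"
 unfolding data_def[abs_def]
 by (intro Bochner_Integration.integrable_add v_sq(2) Bochner_Integration.integrable_sum g_sq(2))

lemma dens_le: "dens t x <= 2 * err \<eta> t x + 2 * data t x"
proof -
 have sq: "x\<^sup>2 <= 2 * (x - y)^2 + 2 * y^2" for x y :: real
  using square_norm_add_le[of 1 "x - y" y] by simp
 have "dens t x <= (2 * (V \<eta> t x - v t x)^2 + 2 * (v t x)^2) + (\<Sum>b\<in>Basis. 2 * (S (pd b \<eta>) t x - g t x \<bullet> b)^2 + 2 * (g t x \<bullet> b)^2)"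
  unfolding dens_def by (intro add_mono sum_mono sq)
 also have "... = 2 * err \<eta> t x + 2 * data t x"
  unfolding err_def data_def sum.distrib sum_distrib_left[symmetric] by (simp add: algebra_simps)
 finally show ?thesis .
qed

lemma dens_integrable:
 assumes t: "t >= 0" shows "linteg (dens t)"
proof (rule Bochner_Integration.integrable_bound[OF _ dens_measurable])
 show "linteg (%x. 2 * err \<eta> t x + 2 * data t x)"
  by (intro Bochner_Integration.integrable_add integrable_mult_right[of 2, OF err_uniform(1)[OF moll ierr t]] integrable_mult_right[of 2, OF data_integrable])
 have "norm (dens t x) <= norm (2 * err \<eta> t x + 2 * data t x)" for x
  using dens_le[of t x] dens_nonneg[of t x] by simp
 then show "AE x in lebesgue. norm (dens t x) <= norm (2 * err \<eta> t x + 2 * data t x)" by simp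
qed

text \<open>Kinetic, potential and total energy outside the ball of radius \<open>\<rho>\<close>.\<close>

definition kin where "kin t \<rho> = (LI x. indicator {x. norm x > \<rho>} x * (V \<eta> t x)^2)"
definition pot where "pot t \<rho> = (LI x. indicator {x. norm x > \<rho>} x * (\<Sum>b\<in>Basis. (S (pd b \<eta>) t x)^2))"
definition tot where "tot t \<rho> = (LI x. indicator {x. norm x > \<rho>} x * dens t x)"

lemma exterior_set: "{x::real^4. norm x > \<rho>} \<in> sets lebesgue"
proof -
 have "open {x::real^4. norm x > \<rho>}" by (intro open_Collect_less continuous_intros)
 then have "{x::real^4. norm x > \<rho>} \<in> sets lborel" by simp
 then show ?thesis by (rule sets_completionI_sets)
qed

lemma exterior_integrable:
 assumes m: "f \<in> lmeas" and le: "!!x. \<bar>f x\<bar> <= dens t x" and t: "t >= 0"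
 shows "linteg (%x. indicator {x. norm x > \<rho>} x * f x)"
proof (rule Bochner_Integration.integrable_bound[OF dens_integrable[OF t]])
 show "(%x. indicator {x. norm x > \<rho>} x * f x) \<in> lmeas"
  by (intro borel_measurable_times borel_measurable_indicator exterior_set m)
 show "AE x in lebesgue. norm (indicator {x. norm x > \<rho>} x * f x) <= norm (dens t x)"
  using le dens_nonneg[of t] by (intro AE_I2) (auto simp: indicator_def)
qed

lemma kin_integrable: "t >= 0 ==> linteg (%x. indicator {x. norm x > \<rho>} x * (V \<eta> t x)^2)"
 by (rule exterior_integrable) (auto intro!: borel_measurable_power mollified_measurable sum_nonneg simp: dens_def)

lemma pot_integrable: "t >= 0 ==> linteg (%x. indicator {x. norm x > \<rho>} x * (\<Sum>b\<in>Basis. (S (pd b \<eta>) t x)^2))"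
proof (rule exterior_integrable)
 have "0 <= (\<Sum>b\<in>Basis. (S (pd b \<eta>) t x)^2)" for x by (intro sum_nonneg) simp
 then show "\<bar>\<Sum>b\<in>Basis. (S (pd b \<eta>) t x)^2\<bar> <= dens t x" for x by (simp add: dens_def)
qed (intro borel_measurable_power borel_measurable_sum mollified_measurable)

lemma kin_pot: "t >= 0 ==> kin t \<rho> + pot t \<rho> = tot t \<rho>"
 unfolding kin_def pot_def tot_def dens_def distrib_left
 by (rule Bochner_Integration.integral_add[symmetric]) (rule kin_integrable pot_integrable; assumption)+

lemma tot_tendsto_0:
 assumes t: "t >= 0" shows "((%\<rho>. tot t \<rho>) ---> 0) at_top"
proof -
 have "((%\<rho>. tot t \<rho>) ---> (LINT x|(lebesgue :: (real^4) measure). 0)) at_top"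
  unfolding tot_def
 proof (rule integral_dominated_convergence_at_top[where w = "dens t"])
  show "\<forall>\<^sub>F \<rho> in at_top. AE x in lebesgue. norm (indicator {x. norm x > \<rho>} x * dens t x) <= dens t x"
   by (intro always_eventually allI AE_I2) (use dens_nonneg[of t] in \<open>auto simp: indicator_def\<close>)
  show "AE x in lebesgue. ((%\<rho>. indicator {x. norm x > \<rho>} x * dens t x) ---> 0) at_top"
  proof (rule AE_I2)
   fix x :: "real^4"
   have "\<forall>\<^sub>F \<rho> in at_top. indicator {x. norm x > \<rho>} x * dens t x = 0"
    using eventually_ge_at_top[of "norm x"] by eventually_elim (simp add: indicator_def)
   then show "((%\<rho>. indicator {x. norm x > \<rho>} x * dens t x) ---> 0) at_top" by (rule tendsto_eventually)
  qed
  show "(%x. indicator {x. norm x > \<rho>} x * dens t x) \<in> lmeas" for \<rho>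
   by (intro borel_measurable_times borel_measurable_indicator exterior_set dens_measurable)
 qed (use dens_integrable[OF t] in auto)
 then show ?thesis by simp
qed

text \<open>The energy inequality with the weight \<open>step M\<close>; the loss of \<open>2\<close> covers the width of the step and the difference between \<open>japanese\<close> and the norm.\<close>

lemma tot_propagation:
 assumes t: "t >= 0" shows "tot t (M + t) <= tot 0 (M - 2)"
proof -
 interpret D: wave_system "V \<eta>" "%b. S (pd b \<eta>)" "%b. V (pd b \<eta>)" "%b. S (pd b (pd b \<eta>))"
  by (rule mollified_wave_system[OF \<eta>])
 have en: "D.en = dens" by (intro ext) (simp add: D.en_def dens_def)
 have jm: "japanese \<in> borel_measurable (borel :: (real^4) measure)" by (rule borel_measurable_continuous_onI[OF japanese_continuous])
 have sm: "step M \<in> borel_measurable borel" using step(1) by (intro borel_measurable_continuous_onI) (meson DERIV_isCont continuous_at_imp_continuous_on)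
 have m: "(%x. step M (japanese x)) \<in> borel_measurable (lebesgue :: (real^4) measure)"
  using measurable_compose[OF jm sm] by (simp add: measurable_completion)
 have i0: "linteg (%x. step M (japanese x) * D.en 0 x)" unfolding en
 proof (rule Bochner_Integration.integrable_bound[OF dens_integrable[of 0]])
  show "(%x. step M (japanese x) * dens 0 x) \<in> lmeas" by (intro borel_measurable_times m dens_measurable)
  show "AE x in lebesgue. norm (step M (japanese x) * dens 0 x) <= norm (dens 0 x)"
   using step(3,5) by (intro AE_I2) (simp add: abs_mult mult_left_le_one_le)
 qed simp
 note ee = D.exterior_energy[OF step(1,2,3,4) t i0, unfolded en]
 have it: "linteg (%x. indicator {x. norm x > \<rho>} x * dens s x)" if "s >= 0" for \<rho> s
  using that dens_nonneg by (intro exterior_integrable dens_measurable) auto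
 have "tot t (M + t) <= (LI x. step M (japanese x - t) * dens t x)"
  unfolding tot_def
 proof (rule integral_mono[OF it[OF t] ee(1)])
  fix x :: "real^4"
  have "indicator {x. norm x > M + t} x <= step M (japanese x - t)"
   using japanese_ge[of x] step(6)[of M "japanese x - t"] step(3)[of M "japanese x - t"] by (auto simp: indicator_def)
  then show "indicator {x. norm x > M + t} x * dens t x <= step M (japanese x - t) * dens t x"
   using dens_nonneg by (rule mult_right_mono)
 qed
 also have "... <= (LI x. step M (japanese x) * dens 0 x)" by (rule ee(2))
 also have "... <= tot 0 (M - 2)"
  unfolding tot_def
 proof (rule integral_mono[OF i0[unfolded en] it])
  fix x :: "real^4"
  have "step M (japanese x) <= indicator {x. norm x > M - 2} x"
   using japanese_le[of x] step(7)[of "japanese x" M] step(5)[of M "japanese x"] by (auto simp: indicator_def)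
  then show "step M (japanese x) * dens 0 x <= indicator {x. norm x > M - 2} x * dens 0 x"
   using dens_nonneg by (rule mult_right_mono)
 qed simp
 finally show ?thesis .
qed

lemma kin_radial:
 assumes t: "t >= 0" and \<rho>: "\<rho> > 0"
 shows "set_integrable lborel {\<rho>..} (%r. (Ut t r)^2 * r ^ 3)" "kin t \<rho> = sphere_area * (LINT r:{\<rho>..}|lborel. (Ut t r)^2 * r ^ 3)"
proof -
 have m: "(%r. (Ut t r)^2) \<in> borel_measurable borel" by (intro borel_measurable_power borel_measurable_continuous_onI Ut_cont)
 have \<rho>': "\<rho> >= 0" using \<rho> by simp
 have e: "(%x. indicator {x. norm x > \<rho>} x * (V \<eta> t x)^2) = (%x. indicator {x. norm x > \<rho>} x * (Ut t (norm x))^2)"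
  by (simp add: radial_form(2)[OF t])
 show "set_integrable lborel {\<rho>..} (%r. (Ut t r)^2 * r ^ 3)"
  using polar_coordinates(1)[OF m \<rho>'] kin_integrable[OF t, of \<rho>] unfolding e by blast
 show "kin t \<rho> = sphere_area * (LINT r:{\<rho>..}|lborel. (Ut t r)^2 * r ^ 3)"
  unfolding kin_def e by (rule polar_coordinates(2)[OF m \<rho>'])
qed

lemma pot_radial:
 assumes t: "t >= 0" and \<rho>: "\<rho> > 0"
 shows "set_integrable lborel {\<rho>..} (%r. (Ur t r)^2 * r ^ 3)" "pot t \<rho> = sphere_area * (LINT r:{\<rho>..}|lborel. (Ur t r)^2 * r ^ 3)"
proof -
 have m: "(%r. (Ur t r)^2) \<in> borel_measurable borel" by (intro borel_measurable_power borel_measurable_continuous_onI Ur_cont)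
 have \<rho>': "\<rho> >= 0" using \<rho> by simp
 have e: "(%x. indicator {x. norm x > \<rho>} x * (\<Sum>b\<in>Basis. (S (pd b \<eta>) t x)^2)) = (%x. indicator {x. norm x > \<rho>} x * (Ur t (norm x))^2)"
 proof
  fix x :: "real^4"
  show "indicator {x. norm x > \<rho>} x * (\<Sum>b\<in>Basis. (S (pd b \<eta>) t x)^2) = indicator {x. norm x > \<rho>} x * (Ur t (norm x))^2"
   using shifted_gradient_square[OF t, of x 0] \<rho> by (cases "x = 0") (auto simp: indicator_def)
 qed
 show "set_integrable lborel {\<rho>..} (%r. (Ur t r)^2 * r ^ 3)"
  using polar_coordinates(1)[OF m \<rho>'] pot_integrable[OF t, of \<rho>] unfolding e by blast
 show "pot t \<rho> = sphere_area * (LINT r:{\<rho>..}|lborel. (Ur t r)^2 * r ^ 3)"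
  unfolding pot_def e by (rule polar_coordinates(2)[OF m \<rho>'])
qed

lemma kin_pot_le_tot:
 assumes "t >= 0" shows "kin t \<rho> <= tot t \<rho>" "pot t \<rho> <= tot t \<rho>"
proof -
 have "0 <= kin t \<rho>" unfolding kin_def by (intro Bochner_Integration.integral_nonneg) simp
 moreover have "0 <= pot t \<rho>" unfolding pot_def by (intro Bochner_Integration.integral_nonneg mult_nonneg_nonneg sum_nonneg) auto
 ultimately show "kin t \<rho> <= tot t \<rho>" "pot t \<rho> <= tot t \<rho>" using kin_pot[OF assms, of \<rho>] by linarith+
qed

lemma half_line_partial:
 fixes f :: "real => real"
 assumes i: "set_integrable lborel {\<rho>..} f" and nn: "!!r. r >= \<rho> ==> f r >= 0"
 shows "integral {\<rho>..L} f <= (LINT r:{\<rho>..}|lborel. f r)"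
proof -
 have s: "set_integrable lborel {\<rho>..L} f" by (rule set_integrable_subset[OF i]) auto
 have "integral {\<rho>..L} f = (LINT r:{\<rho>..L}|lborel. f r)" using set_borel_integral_eq_integral(2)[OF s] by simp
 also have "... <= (LINT r:{\<rho>..}|lborel. f r)"
  unfolding set_lebesgue_integral_def
  by (rule integral_mono[OF s[unfolded set_integrable_def] i[unfolded set_integrable_def]]) (use nn in \<open>auto simp: indicator_def\<close>)
 finally show ?thesis .
qed

text \<open>The cross term \<open>2 c u_r\<close> and the square \<open>c^2 / r^3\<close> are exact derivatives.\<close>

lemma square_completion:
 assumes \<rho>: "0 < \<rho>" "\<rho> <= L"
 shows "integral {\<rho>..L} (%r. (Ur t r + c / r ^ 3)^2 * r ^ 3) =
   integral {\<rho>..L} (%r. (Ur t r)^2 * r ^ 3) + (2 * c * (U t L - U t \<rho>) + c^2 * (1 / (2 * \<rho>^2) - 1 / (2 * L^2)))"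
proof -
 define k where "k r = 2 * c * U t r - c\<^sup>2 / (2 * r^2)" for r
 have "((%r. 2 * c * Ur t r + c^2 / r ^ 3) has_integral k L - k \<rho>) {\<rho>..L}"
 proof (rule fundamental_theorem_of_calculus[OF \<rho>(2)])
  fix r assume "r \<in> {\<rho>..L}"
  then have r: "r > 0" using \<rho> by simp
  have "((%r. 2 * c * U t r) has_deriv 2 * c * Ur t r) (at r)" by (rule DERIV_cmult[OF profile_derivs(1)])
  moreover have "((%r. c\<^sup>2 / (2 * r^2)) has_deriv - (c^2 / r ^ 3)) (at r)"
   using r by (auto intro!: derivative_eq_intros simp: divide_simps) (simp add: eval_nat_numeral algebra_simps)
  ultimately have "(k has_deriv 2 * c * Ur t r - (- (c^2 / r ^ 3))) (at r)"
   unfolding k_def[abs_def] by (rule DERIV_diff)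
  then show "(k has_vector_derivative 2 * c * Ur t r + c^2 / r ^ 3) (at r within {\<rho>..L})"
   by (simp add: has_real_derivative_iff_has_vector_derivative[symmetric] has_field_derivative_at_within)
 qed
 moreover have "((%r. (Ur t r)^2 * r ^ 3) has_integral integral {\<rho>..L} (%r. (Ur t r)^2 * r ^ 3)) {\<rho>..L}"
  by (intro integrable_integral integrable_continuous_real continuous_intros Ur_cont)
 ultimately have "((%r. (Ur t r)^2 * r ^ 3 + (2 * c * Ur t r + c^2 / r ^ 3)) has_integral integral {\<rho>..L} (%r. (Ur t r)^2 * r ^ 3) + (k L - k \<rho>)) {\<rho>..L}"
  by (intro has_integral_add)
 moreover have "(Ur t r)^2 * r ^ 3 + (2 * c * Ur t r + c^2 / r ^ 3) = (Ur t r + c / r ^ 3)^2 * r ^ 3" if "r \<in> {\<rho>..L}" for r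
  using that \<rho> by (simp add: field_simps power2_eq_square)
 ultimately have "((%r. (Ur t r + c / r ^ 3)^2 * r ^ 3) has_integral integral {\<rho>..L} (%r. (Ur t r)^2 * r ^ 3) + (k L - k \<rho>)) {\<rho>..L}"
  using has_integral_cong by (metis (no_types, lifting))
 then show ?thesis by (simp add: integral_unique k_def algebra_simps)
qed

text \<open>The difference of the integrands is \<open>(2 r^2 u^2)_r\<close>.\<close>

lemma b_identity:
 assumes \<rho>: "0 < \<rho>" "\<rho> <= L"
 shows "integral {\<rho>..L} (%r. (B t r)^2) = integral {\<rho>..L} (%r. (Ur t r)^2 * r ^ 3) + (2 * L^2 * (U t L)^2 - 2 * \<rho>^2 * (U t \<rho>)^2)"
proof -
 define k where "k r = 2 * r^2 * (U t r)^2" for r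
 have "((%r. 4 * r * (U t r)^2 + 4 * r^2 * U t r * Ur t r) has_integral k L - k \<rho>) {\<rho>..L}"
 proof (rule fundamental_theorem_of_calculus[OF \<rho>(2)])
  fix r
  have "(k has_deriv 4 * r * (U t r)^2 + 4 * r^2 * U t r * Ur t r) (at r)"
   unfolding k_def[abs_def] by (auto intro!: derivative_eq_intros profile_derivs(1) simp: algebra_simps)
  then show "(k has_vector_derivative 4 * r * (U t r)^2 + 4 * r^2 * U t r * Ur t r) (at r within {\<rho>..L})"
   by (simp add: has_real_derivative_iff_has_vector_derivative[symmetric] has_field_derivative_at_within)
 qed
 moreover have "((%r. (Ur t r)^2 * r ^ 3) has_integral integral {\<rho>..L} (%r. (Ur t r)^2 * r ^ 3)) {\<rho>..L}"
  by (intro integrable_integral integrable_continuous_real continuous_intros Ur_cont)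
 ultimately have i: "((%r. (Ur t r)^2 * r ^ 3 + (4 * r * (U t r)^2 + 4 * r^2 * U t r * Ur t r)) has_integral integral {\<rho>..L} (%r. (Ur t r)^2 * r ^ 3) + (k L - k \<rho>)) {\<rho>..L}"
  by (intro has_integral_add)
 have e: "(Ur t r)^2 * r ^ 3 + (4 * r * (U t r)^2 + 4 * r^2 * U t r * Ur t r) = (B t r)^2" if "r \<in> {\<rho>..L}" for r
 proof -
  define q where "q = sqrt r"
  have rq: "r = q^2" using that \<rho> by (simp add: q_def)
  show ?thesis unfolding B_def q_def[symmetric] unfolding rq by (simp add: algebra_simps eval_nat_numeral)
 qed
 have "((%r. (B t r)^2) has_integral integral {\<rho>..L} (%r. (Ur t r)^2 * r ^ 3) + (k L - k \<rho>)) {\<rho>..L}"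
  by (rule has_integral_eq[OF e i])
 then show ?thesis by (simp add: integral_unique k_def)
qed

end

context radial_profile
begin

definition pot1 where "pot1 t \<rho> = (LINT r:{\<rho>..}|lborel. (Ur t r)^2 * r ^ 3)"
definition kin1 where "kin1 t \<rho> = (LINT r:{\<rho>..}|lborel. (Ut t r)^2 * r ^ 3)"

lemma one_dim_energy:
 assumes t: "t >= 0" and \<rho>: "\<rho> > 0"
 shows "kin t \<rho> = sphere_area * kin1 t \<rho>" "pot t \<rho> = sphere_area * pot1 t \<rho>"
  "kin1 t \<rho> + pot1 t \<rho> = tot t \<rho> / sphere_area" "pot1 t \<rho> <= tot t \<rho> / sphere_area" "pot1 t \<rho> >= 0"
  "integral {\<rho>..L} (%r. (Ur t r)^2 * r ^ 3) <= pot1 t \<rho>" "integral {\<rho>..L} (%r. (Ut t r)^2 * r ^ 3) <= kin1 t \<rho>"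
proof -
 note s = sphere_area_pos
 show k: "kin t \<rho> = sphere_area * kin1 t \<rho>" unfolding kin1_def by (rule kin_radial(2)[OF t \<rho>])
 show p: "pot t \<rho> = sphere_area * pot1 t \<rho>" unfolding pot1_def by (rule pot_radial(2)[OF t \<rho>])
 have "sphere_area * (kin1 t \<rho> + pot1 t \<rho>) = tot t \<rho>" using kin_pot[OF t, of \<rho>] k p by (simp add: distrib_left)
 then show "kin1 t \<rho> + pot1 t \<rho> = tot t \<rho> / sphere_area" using s by (simp add: field_simps)
 show "pot1 t \<rho> <= tot t \<rho> / sphere_area" using kin_pot_le_tot(2)[OF t, of \<rho>] p s by (simp add: field_simps)
 show i: "integral {\<rho>..L} (%r. (Ur t r)^2 * r ^ 3) <= pot1 t \<rho>" for L
  unfolding pot1_def by (rule half_line_partial[OF pot_radial(1)[OF t \<rho>]]) (use \<rho> in auto)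
 show "integral {\<rho>..L} (%r. (Ut t r)^2 * r ^ 3) <= kin1 t \<rho>"
  unfolding kin1_def by (rule half_line_partial[OF kin_radial(1)[OF t \<rho>]]) (use \<rho> in auto)
 show "pot1 t \<rho> >= 0" using i[of \<rho>] by simp
qed

text \<open>The quadratic polynomial in \<open>c\<close> of \<open>square_completion\<close> is nonnegative; the chosen \<open>c\<close> minimises it.\<close>

lemma profile_hoelder:
 assumes t: "t >= 0" and \<rho>: "0 < \<rho>" "\<rho> < L"
 shows "(U t L - U t \<rho>)^2 <= (1 / (2 * \<rho>^2) - 1 / (2 * L^2)) * pot1 t \<rho>"
proof -
 define Y where "Y = 1 / (2 * \<rho>^2) - 1 / (2 * L^2)"
 define D where "D = U t L - U t \<rho>"
 \<comment> \<open>The minimiser of the quadratic polynomial below.\<close>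
 define c where "c = - D / Y"
 have "\<rho>\<^sup>2 < L\<^sup>2" using \<rho> by (intro power_strict_mono) auto
 then have Y: "Y > 0" using \<rho> by (simp add: Y_def frac_less2)
 have "continuous_on {\<rho>..L} (%r. (Ur t r + c / r ^ 3)^2 * r ^ 3)" using \<rho> by (intro continuous_intros Ur_cont) auto
 then have "0 <= integral {\<rho>..L} (%r. (Ur t r + c / r ^ 3)^2 * r ^ 3)"
  by (intro integral_nonneg integrable_continuous_real) (use \<rho> in auto)
 also have "... = integral {\<rho>..L} (%r. (Ur t r)^2 * r ^ 3) + (2 * c * D + c^2 * Y)"
  unfolding Y_def D_def by (rule square_completion) (use \<rho> in auto)
 also have "2 * c * D + c^2 * Y = - (D^2 / Y)" unfolding c_def using Y by (simp add: field_simps power2_eq_square)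
 finally have "D\<^sup>2 / Y <= pot1 t \<rho>" using one_dim_energy(6)[OF t \<rho>(1), of L] by linarith
 then show ?thesis unfolding D_def[symmetric] Y_def[symmetric] using Y by (simp add: divide_le_eq mult.commute)
qed

lemma U_tendsto_0: "((%r. U t r) ---> 0) at_top"
proof (rule tendstoI)
 fix e :: real assume e: "e > 0"
 then have "e / 2 > 0" by simp
 then obtain N where N: "!!x. norm x >= N ==> \<bar>S \<eta> t x\<bar> <= e / 2" using S_decay[OF \<eta>, of "e / 2" t] by blast
 show "\<forall>\<^sub>F r in at_top. dist (U t r) 0 < e"
  using eventually_ge_at_top[of N] eventually_ge_at_top[of 0]
 proof eventually_elim
  case (elim r)
  then have "norm (r *\<^sub>R ray) >= N" by (simp add: ray)
  from N[OF this] show ?case using e by (simp add: U_def)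
 qed
qed

lemma U_bound:
 assumes t: "t >= 0" and N: "N > 0" shows "2 * N^2 * (U t N)^2 <= pot1 t N"
proof -
 have "((%L. (U t L - U t N)^2) ---> (0 - U t N)^2) at_top" by (intro tendsto_intros U_tendsto_0)
 moreover have "(U t L - U t N)^2 <= 1 / (2 * N^2) * pot1 t N" if "L > N" for L
  by (rule order_trans[OF profile_hoelder[OF t N that] mult_right_mono[OF _ one_dim_energy(5)[OF t N]]]) (use N that in simp)
 ultimately have "(0 - U t N)^2 <= 1 / (2 * N^2) * pot1 t N"
  by (intro tendsto_upperbound) (auto intro: eventually_mono[OF eventually_gt_at_top])
 then show ?thesis using N by (simp add: field_simps)
qed

lemma weighted_U_tendsto_0:
 assumes t: "t >= 0" shows "((%L. 2 * L^2 * (U t L)^2) ---> 0) at_top"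
proof (rule Lim_null_comparison)
 show "\<forall>\<^sub>F L in at_top. norm (2 * L^2 * (U t L)^2) <= tot t L / sphere_area"
  using eventually_gt_at_top[of 0]
  by eventually_elim (use order_trans[OF U_bound[OF t] one_dim_energy(4)[OF t]] in simp)
 show "((%L. tot t L / sphere_area) ---> 0) at_top" using tendsto_divide[OF tot_tendsto_0[OF t] tendsto_const] sphere_area_pos by fastforce
qed

lemma b_half_line:
 assumes t: "t >= 0" and \<rho>: "\<rho> > 0"
 shows "set_integrable lborel {\<rho>..} (%r. (B t r)^2)" "(LINT r:{\<rho>..}|lborel. (B t r)^2) = pot1 t \<rho> - 2 * \<rho>^2 * (U t \<rho>)^2"
proof -
 have "((%L. 2 * L^2 * (U t L)^2 - 2 * \<rho>^2 * (U t \<rho>)^2) ---> 0 - 2 * \<rho>^2 * (U t \<rho>)^2) at_top"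
  by (intro tendsto_diff weighted_U_tendsto_0[OF t] tendsto_const)
 note h = half_line_limit[OF _ _ _ _ one_dim_energy(6)[OF t \<rho>] b_identity[OF \<rho>] this]
 have cB: "continuous_on {\<rho>..} (%r. (B t r)^2)" unfolding B_def by (intro continuous_intros U_cont Ur_cont)
 have cU: "continuous_on {\<rho>..} (%r. (Ur t r)^2 * r ^ 3)" by (intro continuous_intros Ur_cont)
 show "set_integrable lborel {\<rho>..} (%r. (B t r)^2)" by (rule h(1)[OF cB _ cU]) (use \<rho> in auto)
 have "(LINT r:{\<rho>..}|lborel. (B t r)^2) = (LINT r:{\<rho>..}|lborel. (Ur t r)^2 * r ^ 3) + (0 - 2 * \<rho>^2 * (U t \<rho>)^2)"
  by (rule h(2)[OF cB _ cU]) (use \<rho> in auto)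
 then show "(LINT r:{\<rho>..}|lborel. (B t r)^2) = pot1 t \<rho> - 2 * \<rho>^2 * (U t \<rho>)^2" by (simp add: pot1_def)
qed

text \<open>Both sides equal the exterior Dirichlet energy minus \<open>2 R^2 u(R)^2\<close>, by \<open>square_completion\<close> with \<open>c = 2 R^2 u(R)\<close> and by \<open>b_identity\<close>.\<close>

lemma projection_energy:
 "(LI x. indicator {x. norm x > R} x *
   (\<Sum>b\<in>Basis. (S (pd b \<eta>) 0 x + 2 * R^2 * U 0 R * (x \<bullet> b) / (norm x) ^ 4)^2)) = sphere_area * (LINT r:{R..}|lborel. (B 0 r)^2)"
proof -
 define c where "c = 2 * R^2 * U 0 R"
 have t: "(0::real) <= 0" by simp
 have m: "(%r. (Ur 0 r + c / r ^ 3)^2) \<in> borel_measurable borel"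
 proof -
  have "Ur 0 \<in> borel_measurable borel" by (rule borel_measurable_continuous_onI[OF Ur_cont])
  then show ?thesis by measurable
 qed
 have e: "(%x. indicator {x. norm x > R} x * (\<Sum>b\<in>Basis. (S (pd b \<eta>) 0 x + c * (x \<bullet> b) / (norm x) ^ 4)^2)) =
   (%x. indicator {x. norm x > R} x * (Ur 0 (norm x) + c / (norm x) ^ 3)^2)"
 proof
  fix x :: "real^4"
  show "indicator {x. norm x > R} x * (\<Sum>b\<in>Basis. (S (pd b \<eta>) 0 x + c * (x \<bullet> b) / (norm x) ^ 4)^2) =
   indicator {x. norm x > R} x * (Ur 0 (norm x) + c / (norm x) ^ 3)^2"
   using shifted_gradient_square[OF t, of x c] R by (cases "x = 0") (auto simp: indicator_def)
 qed
 have k: "((%L. 2 * c * (U 0 L - U 0 R) + c^2 * (1 / (2 * R^2) - 1 / (2 * L^2))) ---> 2 * c * (0 - U 0 R) + c^2 * (1 / (2 * R^2) - 0)) at_top"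
 proof (intro tendsto_add tendsto_mult tendsto_const tendsto_diff U_tendsto_0)
  show "((%L::real. 1 / (2 * L^2)) ---> 0) at_top"
   by (rule real_tendsto_divide_at_top[OF tendsto_const]) (auto intro!: filterlim_tendsto_pos_mult_at_top[OF tendsto_const] filterlim_pow_at_top filterlim_ident)
 qed
 have "(LINT r:{R..}|lborel. (Ur 0 r + c / r ^ 3)^2 * r ^ 3) = (LINT r:{R..}|lborel. (Ur 0 r)^2 * r ^ 3) + (2 * c * (0 - U 0 R) + c^2 * (1 / (2 * R^2) - 0))"
 proof (rule half_line_limit(2)[OF _ _ _ _ one_dim_energy(6)[OF t R] square_completion[OF R] k])
  show "continuous_on {R..} (%r. (Ur 0 r + c / r ^ 3)^2 * r ^ 3)" using R by (intro continuous_intros Ur_cont) auto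
  show "continuous_on {R..} (%r. (Ur 0 r)^2 * r ^ 3)" by (intro continuous_intros Ur_cont)
 qed (use R in auto)
 also have "... = (LINT r:{R..}|lborel. (B 0 r)^2)"
  unfolding b_half_line(2)[OF t R] pot1_def using R by (simp add: c_def field_simps power2_eq_square)
 finally show ?thesis unfolding c_def[symmetric] e using polar_coordinates(2)[OF m, of R] R by simp
qed

definition tail where "tail M = 2 * (tot 0 (M - 2) / sphere_area)"

lemma tail_tendsto_0: "(tail ---> 0) at_top"
proof -
 have "filterlim (%M::real. M - 2) at_top at_top"
  using filterlim_tendsto_add_at_top[OF tendsto_const filterlim_ident, of "-2 :: real"] by (simp add: add.commute)
 from filterlim_compose[OF tot_tendsto_0[of 0] this] have "((%M. 2 * (tot 0 (M - 2) / sphere_area)) ---> 2 * (0 / sphere_area)) at_top"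
  by (intro tendsto_intros) (use sphere_area_pos in auto)
 then show ?thesis by (simp add: tail_def[abs_def])
qed

lemma tot_le_tail: "t >= 0 ==> 2 * (tot t (M + t) / sphere_area) <= tail M"
 unfolding tail_def using tot_propagation[of t M] sphere_area_pos by (simp add: divide_right_mono)

lemma PQ_energy:
 assumes t: "t >= 0" and M: "R <= M" "M <= N"
 shows "integral {M..N} (%s. (P t s)^2 + (Q t s)^2) <= tail M"
proof -
 have \<rho>: "M + t > 0" "M + t <= N + t" using t M R by auto
 have c: "continuous_on X (A t)" "continuous_on X (B t)" for X
  unfolding A_def B_def by (intro continuous_intros U_cont Ur_cont Ut_cont)+
 have i: "(%r. (A t r)^2) integrable_on {M + t..N + t}" "(%r. (B t r)^2) integrable_on {M + t..N + t}"
  by (intro integrable_continuous_real continuous_intros c)+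
 have e: "(P t s)^2 + (Q t s)^2 = 2 * ((A t (s + t))^2 + (B t (s + t))^2)" for s
  by (simp add: P_def Q_def power2_eq_square algebra_simps)
 have hi: "((%r. 2 * ((A t r)^2 + (B t r)^2)) has_integral 2 * (integral {M + t..N + t} (%r. (A t r)^2) + integral {M + t..N + t} (%r. (B t r)^2))) {M + t..N + t}"
  by (intro has_integral_mult_right has_integral_add integrable_integral i)
 have "((%s. (P t s)^2 + (Q t s)^2) has_integral 2 * (integral {M + t..N + t} (%r. (A t r)^2) + integral {M + t..N + t} (%r. (B t r)^2))) {M..N}"
  unfolding e using has_integral_shift_real_ivl[OF hi, of t] by simp
 then have "integral {M..N} (%s. (P t s)^2 + (Q t s)^2) = 2 * (integral {M + t..N + t} (%r. (A t r)^2) + integral {M + t..N + t} (%r. (B t r)^2))"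
  by (rule integral_unique)
 also have "integral {M + t..N + t} (%r. (A t r)^2) = integral {M + t..N + t} (%r. (Ut t r)^2 * r ^ 3)"
  by (rule integral_cong) (use \<rho> in \<open>simp add: A_def power_mult_distrib eval_nat_numeral\<close>)
 also have "... <= kin1 t (M + t)" by (rule one_dim_energy(7)[OF t \<rho>(1)])
 also have "integral {M + t..N + t} (%r. (B t r)^2) <= (LINT r:{M + t..}|lborel. (B t r)^2)"
  by (rule half_line_partial[OF b_half_line(1)[OF t \<rho>(1)]]) simp
 also have "... <= pot1 t (M + t)" unfolding b_half_line(2)[OF t \<rho>(1)] by simp
 finally show ?thesis using one_dim_energy(3)[OF t \<rho>(1)] tot_le_tail[OF t, of M] by simp
qed

lemma PQ_radial_system: "radial_system R P Q Ps tail"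
proof
 show "Q 0 s = - P 0 s" for s by (simp add: P_def Q_def A_def Ut_def V_zero[OF \<eta>])
qed (fact R PQ_equations PQ_continuous PQ_energy tail_tendsto_0)+

text \<open>Split at \<open>r = M + t\<close>. Beyond it there is little energy. Between \<open>R + t\<close> and \<open>M + t\<close> the profile is nearly constant by \<open>profile_hoelder\<close>, since the length \<open>M - R\<close> is fixed while \<open>R + t\<close> grows.\<close>

lemma boundary_term_tendsto_0: "((%t. 2 * (R + t)^2 * (U t (R + t))^2) ---> 0) at_top"
proof (rule tendstoI)
 fix e :: real assume e: "e > 0"
 define K where "K = tail R"
 have "\<forall>\<^sub>F M in at_top. tail M < e / 2" using order_tendstoD(2)[OF tail_tendsto_0, of "e / 2"] e by simp
 from eventually_happens'[OF _ eventually_conj[OF this eventually_gt_at_top[of R]]]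
 obtain M where M: "tail M < e / 2" "M > R" by auto
 have tend: "((%t. 2 * (M - R) * K / (R + t)) ---> 0) at_top"
  by (intro real_tendsto_divide_at_top[OF tendsto_const] filterlim_tendsto_add_at_top[OF tendsto_const] filterlim_ident)
 have ev: "\<forall>\<^sub>F t in at_top. 2 * (M - R) * K / (R + t) < e / 2" using order_tendstoD(2)[OF tend, of "e / 2"] e by simp
 show "\<forall>\<^sub>F t in at_top. dist (2 * (R + t)^2 * (U t (R + t))^2) 0 < e"
  using ev eventually_ge_at_top[of 0]
 proof eventually_elim
  case (elim t)
  define \<rho> L where "\<rho> = R + t" and "L = M + t"
  have t: "t >= 0" and \<rho>: "0 < \<rho>" "\<rho> < L" and L: "L > 0" using elim R M by (auto simp: \<rho>_def L_def)
  have far: "2 * \<rho>^2 * (U t L)^2 <= tail M / 2"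
  proof -
   have "2 * \<rho>^2 * (U t L)^2 <= 2 * L^2 * (U t L)^2" using \<rho> by (intro mult_right_mono mult_left_mono power_mono) auto
   also have "... <= tail M / 2"
    using U_bound[OF t L] one_dim_energy(4)[OF t L] tot_le_tail[OF t, of M] by (simp add: L_def)
   finally show ?thesis .
  qed
  have "1 / (2 * \<rho>^2) - 1 / (2 * L^2) <= (L - \<rho>) / \<rho> ^ 3"
  proof -
   have "1 / (2 * \<rho>^2) - 1 / (2 * L^2) = (L - \<rho>) / \<rho>^2 * ((L + \<rho>) / (2 * L^2))"
    using \<rho> L by (simp add: field_simps power2_eq_square)
   also have "... <= (L - \<rho>) / \<rho>^2 * (1 / \<rho>)"
   proof (rule mult_left_mono)
    have "(L + \<rho>) * \<rho> <= 2 * L * L" using \<rho> by (intro mult_mono) auto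
    then show "(L + \<rho>) / (2 * L^2) <= 1 / \<rho>" using \<rho> L by (simp add: divide_simps power2_eq_square)
   qed (use \<rho> in simp)
   finally show ?thesis by (simp add: eval_nat_numeral)
  qed
  then have "(U t L - U t \<rho>)^2 <= (L - \<rho>) / \<rho> ^ 3 * pot1 t \<rho>"
   using order_trans[OF profile_hoelder[OF t \<rho>] mult_right_mono[OF _ one_dim_energy(5)[OF t \<rho>(1)]]] by blast
  also have "... <= (L - \<rho>) / \<rho> ^ 3 * (K / 2)"
   using one_dim_energy(4)[OF t \<rho>(1)] tot_le_tail[OF t, of R] \<rho> by (intro mult_left_mono) (auto simp: \<rho>_def K_def)
  finally have "4 * \<rho>^2 * (U t L - U t \<rho>)^2 <= 4 * \<rho>^2 * ((L - \<rho>) / \<rho> ^ 3 * (K / 2))" by (intro mult_left_mono) auto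
  also have "... = 2 * (M - R) * K / (R + t)" using \<rho>(1) by (simp add: eval_nat_numeral L_def \<rho>_def[symmetric] field_simps) (simp add: \<rho>_def algebra_simps)
  finally have near: "4 * \<rho>^2 * (U t L - U t \<rho>)^2 < e / 2" using elim(1) by simp
  have "(U t \<rho>)^2 <= 2 * (U t L)^2 + 2 * (U t L - U t \<rho>)^2"
   using square_norm_add_le[of 1 "U t L" "U t \<rho> - U t L"] by (simp add: power2_commute)
  then have "2 * \<rho>^2 * (U t \<rho>)^2 <= 2 * \<rho>^2 * (2 * (U t L)^2 + 2 * (U t L - U t \<rho>)^2)" by (intro mult_left_mono) auto
  also have "... = 2 * (2 * \<rho>^2 * (U t L)^2) + 4 * \<rho>^2 * (U t L - U t \<rho>)^2" by (simp add: algebra_simps)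
  also have "... < e" using far near M(1) by linarith
  finally show ?case by (simp add: \<rho>_def)
 qed
qed

text \<open>Exterior kinetic and potential energy are the integrals of \<open>((P + Q) / 2)^2\<close> and \<open>((P - Q) / 2)^2\<close>; as \<open>P\<close> tends to \<open>0\<close>, both are asymptotically a quarter of the integral of \<open>Q^2\<close>.\<close>

theorem mollified_limits:
 "\<exists>E. ((%t. kin t (R + t)) ---> E) at_top \<and> ((%t. pot t (R + t)) ---> E) at_top \<and>
   E >= 3/20 * (LI x. indicator {x. norm x > R} x *
   (\<Sum>b\<in>Basis. (S (pd b \<eta>) 0 x + 2 * R^2 * U 0 R * (x \<bullet> b) / (norm x) ^ 4)^2))"
proof -
 interpret RS: radial_system R P Q Ps tail by (rule PQ_radial_system)
 obtain J where J: "((%t. LINT s:{R..}|lborel. (Q t s)^2) ---> J) at_top" "J >= 3/5 * (LINT s:{R..}|lborel. (P 0 s)^2)"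
  using RS.radial_limits by blast
 note P0 = RS.P_tendsto_0
 define PP QQ PQ where "PP t = (LINT s:{R..}|lborel. (P t s)^2)" and "QQ t = (LINT s:{R..}|lborel. (Q t s)^2)"
  and "PQ t = (LINT s:{R..}|lborel. P t s * Q t s)" for t
 have cross: "integrable lborel (%s. indicator {R..} s *\<^sub>R (P t s * Q t s)) \<and> \<bar>PQ t\<bar> <= sqrt (PP t) * sqrt (QQ t)" if t: "t >= 0" for t
 proof -
  define p q where "p s = indicator {R..} s *\<^sub>R P t s" and "q s = indicator {R..} s *\<^sub>R Q t s" for s
  have m: "p \<in> borel_measurable lborel" "q \<in> borel_measurable lborel"
   using borel_measurable_continuous_on_indicator[OF _ RS.cont_s(1)[OF t order_refl]] borel_measurable_continuous_on_indicator[OF _ RS.cont_s(2)[OF t order_refl]]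
   by (simp_all add: p_def[abs_def] q_def[abs_def])
  have sq: "(%s. (p s)^2) = (%s. indicator {R..} s *\<^sub>R (P t s)\<^sup>2)" "(%s. (q s)^2) = (%s. indicator {R..} s *\<^sub>R (Q t s)\<^sup>2)"
   "(%s. p s * q s) = (%s. indicator {R..} s *\<^sub>R (P t s * Q t s))"
   by (auto simp: p_def q_def indicator_def)
  have i: "integrable lborel (%s. (p s)^2)" "integrable lborel (%s. (q s)^2)"
   unfolding sq using RS.SP_integrable[OF t] by (simp_all add: set_integrable_def)
  have "\<bar>LINT s|lborel. p s * q s\<bar> <= sqrt (LINT s|lborel. (p s)^2) * sqrt (LINT s|lborel. (q s)^2)"
   by (rule order_trans[OF integral_abs_bound integral_Cauchy_Schwarz[OF m i]])
  then show ?thesis using square_integrable_mult[OF m i] unfolding sq by (simp add: PP_def QQ_def PQ_def set_lebesgue_integral_def)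
 qed
 have PQ0: "((%t. PQ t) ---> 0) at_top"
 proof (rule Lim_null_comparison)
  show "\<forall>\<^sub>F t in at_top. norm (PQ t) <= sqrt (PP t) * sqrt (QQ t)"
   using eventually_ge_at_top[of 0] by eventually_elim (use cross in simp)
  have "((%t. sqrt (PP t) * sqrt (QQ t)) ---> sqrt 0 * sqrt J) at_top"
   unfolding PP_def QQ_def by (intro tendsto_intros P0 J(1))
  then show "((%t. sqrt (PP t) * sqrt (QQ t)) ---> 0) at_top" by simp
 qed
 have half: "((%t. (PP t + \<sigma> * (2 * PQ t) + QQ t) / 4) ---> J / 4) at_top" for \<sigma> :: real
 proof -
  have "((%t. (PP t + \<sigma> * (2 * PQ t) + QQ t) / 4) ---> (0 + \<sigma> * (2 * 0) + J) / 4) at_top"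
   unfolding PP_def QQ_def by (intro tendsto_intros P0 J(1) PQ0) simp
  then show ?thesis by simp
 qed
 have comb: "(LINT s:{R..}|lborel. ((P t s + \<sigma> * Q t s) / 2)^2) = (PP t + \<sigma> * (2 * PQ t) + QQ t) / 4"
  if t: "t >= 0" and \<sigma>: "\<sigma> * \<sigma> = 1" for t \<sigma>
 proof -
  have i: "set_integrable lborel {R..} (%s. (P t s)^2 / 4)" "set_integrable lborel {R..} (%s. \<sigma> * (P t s * Q t s) / 2)" "set_integrable lborel {R..} (%s. (Q t s)^2 / 4)"
   using RS.SP_integrable[OF t] cross[OF t] by (auto simp: set_integrable_def mult_ac)
  have "((P t s + \<sigma> * Q t s) / 2)^2 = (P t s)^2 / 4 + \<sigma> * (P t s * Q t s) / 2 + (\<sigma> * \<sigma>) * (Q t s)^2 / 4" for s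
   by (simp add: power2_eq_square field_simps)
  then have e: "((P t s + \<sigma> * Q t s) / 2)^2 = (P t s)^2 / 4 + \<sigma> * (P t s * Q t s) / 2 + (Q t s)^2 / 4" for s
   unfolding \<sigma> by simp
  show ?thesis unfolding e set_integral_add(2)[OF set_integral_add(1)[OF i(1,2)] i(3)] set_integral_add(2)[OF i(1,2)] PP_def QQ_def PQ_def
   by simp
 qed
 have kin_eq: "kin t (R + t) = sphere_area * ((PP t + 1 * (2 * PQ t) + QQ t) / 4)" if t: "t >= 0" for t
 proof -
  have \<rho>: "R + t > 0" using R t by simp
  have "kin1 t (R + t) = (LINT r:{R + t..}|lborel. (A t r)^2)" unfolding kin1_def
   by (rule set_lebesgue_integral_cong) (use \<rho> in \<open>auto simp: A_def power_mult_distrib eval_nat_numeral\<close>)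
  also have "... = (LINT s:{R..}|lborel. (A t (s + t))^2)" by (rule half_line_shift)
  also have "... = (LINT s:{R..}|lborel. ((P t s + 1 * Q t s) / 2)^2)" by (simp add: P_def Q_def)
  finally show ?thesis using comb[OF t, of 1] one_dim_energy(1)[OF t \<rho>] by simp
 qed
 have pot_eq: "pot t (R + t) = sphere_area * ((PP t + (- 1) * (2 * PQ t) + QQ t) / 4 + 2 * (R + t)^2 * (U t (R + t))^2)" if t: "t >= 0" for t
 proof -
  have \<rho>: "R + t > 0" using R t by simp
  have "(LINT r:{R + t..}|lborel. (B t r)^2) = (LINT s:{R..}|lborel. (B t (s + t))^2)" by (rule half_line_shift)
  also have "... = (LINT s:{R..}|lborel. ((P t s + (- 1) * Q t s) / 2)^2)" by (simp add: P_def Q_def)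
  finally have "(LINT r:{R + t..}|lborel. (B t r)^2) = (PP t + (- 1) * (2 * PQ t) + QQ t) / 4" using comb[OF t, of "- 1"] by simp
  then have "pot1 t (R + t) = (PP t + (- 1) * (2 * PQ t) + QQ t) / 4 + 2 * (R + t)^2 * (U t (R + t))^2"
   using b_half_line(2)[OF t \<rho>] by linarith
  then show ?thesis using one_dim_energy(2)[OF t \<rho>] by simp
 qed
 have "((%t. sphere_area * ((PP t + 1 * (2 * PQ t) + QQ t) / 4)) ---> sphere_area * (J / 4)) at_top"
  by (intro tendsto_mult tendsto_const half)
 then have 1: "((%t. kin t (R + t)) ---> sphere_area * (J / 4)) at_top"
  by (rule Lim_transform_eventually) (auto intro!: eventually_at_top_linorderI[of 0] simp: kin_eq)
 have "((%t. sphere_area * ((PP t + (- 1) * (2 * PQ t) + QQ t) / 4 + 2 * (R + t)^2 * (U t (R + t))^2)) ---> sphere_area * (J / 4 + 0)) at_top"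
  by (intro tendsto_mult[OF tendsto_const] tendsto_add half boundary_term_tendsto_0)
 then have 2: "((%t. pot t (R + t)) ---> sphere_area * (J / 4 + 0)) at_top"
  by (rule Lim_transform_eventually) (auto intro!: eventually_at_top_linorderI[of 0] simp: pot_eq)
 have "P 0 s = B 0 s" for s by (simp add: P_def A_def Ut_def V_zero[OF \<eta>])
 then have "sphere_area * (J / 4) >= 3/20 * (sphere_area * (LINT r:{R..}|lborel. (B 0 r)^2))"
  using J(2) sphere_area_pos by simp
 then show ?thesis unfolding projection_energy using 1 2 by (intro exI[of _ "sphere_area * (J / 4)"]) simp
qed

text \<open>The constant depends on the mollifier through the error only, so it stays bounded as the mollification is removed.\<close>

lemma profile_uniform_hoelder:
 assumes L: "R < L"
 shows "(U 0 L - U 0 R)^2 <= (1 / (2 * R^2) - 1 / (2 * L^2)) *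
  ((2 * (LI x. err \<eta> 0 x) + 2 * (LI x. data 0 x)) / sphere_area)"
proof -
 have t: "(0::real) <= 0" by simp
 have it: "linteg (%x. indicator {x. norm x > R} x * dens 0 x)"
  using dens_nonneg by (intro exterior_integrable dens_measurable) auto
 have "tot 0 R <= (LI x. 2 * err \<eta> 0 x + 2 * data 0 x)"
  unfolding tot_def
 proof (rule integral_mono[OF it Bochner_Integration.integrable_add[OF integrable_mult_right[of 2, OF ierr] integrable_mult_right[of 2, OF data_integrable]]])
  fix x :: "real^4"
  have "indicator {x. norm x > R} x * dens 0 x <= 1 * dens 0 x" using dens_nonneg by (intro mult_right_mono) (auto simp: indicator_def)
  then show "indicator {x. norm x > R} x * dens 0 x <= 2 * err \<eta> 0 x + 2 * data 0 x" using dens_le[of 0 x] by simp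
 qed
 also have "... = 2 * (LI x. err \<eta> 0 x) + 2 * (LI x. data 0 x)"
  using ierr data_integrable by simp
 finally have "pot1 0 R <= (2 * (LI x. err \<eta> 0 x) + 2 * (LI x. data 0 x)) / sphere_area"
  using one_dim_energy(4)[OF t R] sphere_area_pos by (meson divide_right_mono less_imp_le order_trans)
 moreover have "0 <= 1 / (2 * R^2) - 1 / (2 * L^2)" using R L by (simp add: frac_le power_mono)
 ultimately show ?thesis using order_trans[OF profile_hoelder[OF t R L] mult_left_mono] by blast
qed

end

section \<open>Calculus of weak gradients\<close>

lemma weak_gradient_restrict:
 assumes g: "has_weak_gradient UNIV f g" shows "has_weak_gradient \<Omega> f g"
proof -
 have l: "locally_integrable \<Omega> f" "locally_integrable \<Omega> g" using g by (auto simp: has_weak_gradient_def locally_integrable_def)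
 have "(LINT x:\<Omega>|lebesgue. f x * pd b \<phi> x) = - (LINT x:\<Omega>|lebesgue. (g x \<bullet> b) * \<phi> x)"
  if \<phi>: "\<phi> \<in> test_functions \<Omega>" and b: "b \<in> Basis" for \<phi> b
 proof -
  have z: "\<psi> x = 0" if "\<psi> \<in> test_functions \<Omega>" "x \<notin> \<Omega>" for \<psi> x
   using that by (auto simp: test_functions_def)
  have e: "(LINT x:\<Omega>|lebesgue. k x * \<psi> x) = (LINT x:UNIV|lebesgue. k x * \<psi> x)" if "\<psi> \<in> test_functions \<Omega>" for k \<psi>
   unfolding set_lebesgue_integral_def
   by (rule Bochner_Integration.integral_cong[OF refl]) (use z[OF that] in \<open>auto simp: indicator_def\<close>)
  have "\<phi> \<in> testfuns" using \<phi> by (rule test_mono) simp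
  then show ?thesis unfolding e[OF \<phi>] e[OF test_partial_deriv[OF \<phi>]] using g b by (simp add: has_weak_gradient_def)
 qed
 then show ?thesis using l by (simp add: has_weak_gradient_def)
qed

lemma weak_gradient_add_scaled:
 fixes f f' :: "'a::euclidean_space => real"
 assumes g: "has_weak_gradient \<Omega> f g" and g': "has_weak_gradient \<Omega> f' g'"
 shows "has_weak_gradient \<Omega> (%x. f x + c * f' x) (%x. g x + c *\<^sub>R g' x)"
proof -
 have l: "locally_integrable \<Omega> f" "locally_integrable \<Omega> f'" "locally_integrable \<Omega> g" "locally_integrable \<Omega> g'"
  using g g' by (auto simp: has_weak_gradient_def)
 have "locally_integrable \<Omega> (%x. f x + c * f' x)" "locally_integrable \<Omega> (%x. g x + c *\<^sub>R g' x)"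
  using l unfolding locally_integrable_def by (auto intro!: set_integral_add(1) set_integrable_mult_right set_integrable_scaleR_right)
 moreover have "(LINT x:\<Omega>|lebesgue. (f x + c * f' x) * pd b \<phi> x) = - (LINT x:\<Omega>|lebesgue. ((g x + c *\<^sub>R g' x) \<bullet> b) * \<phi> x)"
  if \<phi>: "\<phi> \<in> test_functions \<Omega>" and b: "b \<in> Basis" for \<phi> b
 proof -
  note i = locally_integrable_times_test[OF l(1) test_partial_deriv[OF \<phi>, of b]] locally_integrable_times_test[OF l(2) test_partial_deriv[OF \<phi>, of b]]
   and j = locally_integrable_times_test[OF locally_integrable_inner[OF l(3), of b] \<phi>] locally_integrable_times_test[OF locally_integrable_inner[OF l(4), of b] \<phi>]
  have ic: "set_integrable lebesgue \<Omega> (%x. c * (f' x * pd b \<phi> x))" "set_integrable lebesgue \<Omega> (%x. c * ((g' x \<bullet> b) * \<phi> x))"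
   using i(2) j(2) by (auto intro: set_integrable_mult_right)
  have "(LINT x:\<Omega>|lebesgue. (f x + c * f' x) * pd b \<phi> x) = (LINT x:\<Omega>|lebesgue. f x * pd b \<phi> x + c * (f' x * pd b \<phi> x))"
   by (simp add: algebra_simps)
  also have "... = (LINT x:\<Omega>|lebesgue. f x * pd b \<phi> x) + c * (LINT x:\<Omega>|lebesgue. f' x * pd b \<phi> x)"
   unfolding set_integral_add(2)[OF i(1) ic(1)] by simp
  also have "... = - ((LINT x:\<Omega>|lebesgue. (g x \<bullet> b) * \<phi> x) + c * (LINT x:\<Omega>|lebesgue. (g' x \<bullet> b) * \<phi> x))"
   using g g' \<phi> b by (simp add: has_weak_gradient_def)
  also have "(LINT x:\<Omega>|lebesgue. (g x \<bullet> b) * \<phi> x) + c * (LINT x:\<Omega>|lebesgue. (g' x \<bullet> b) * \<phi> x) = (LINT x:\<Omega>|lebesgue. (g x \<bullet> b) * \<phi> x + c * ((g' x \<bullet> b) * \<phi> x))"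
   unfolding set_integral_add(2)[OF j(1) ic(2)] by simp
  also have "... = (LINT x:\<Omega>|lebesgue. ((g x + c *\<^sub>R g' x) \<bullet> b) * \<phi> x)"
   by (simp add: inner_add_left algebra_simps)
  finally show ?thesis .
 qed
 ultimately show ?thesis by (simp add: has_weak_gradient_def)
qed

lemma locally_integrable_continuous:
 fixes f :: "'a::euclidean_space => 'b::euclidean_space"
 assumes "continuous_on \<Omega> f" shows "locally_integrable \<Omega> f"
 unfolding locally_integrable_def set_integrable_def
proof (intro allI impI)
 fix K assume K: "compact K \<and> K \<subseteq> \<Omega>"
 have i: "integrable lborel (%x. indicator K x *\<^sub>R f x)"
  by (rule borel_integrable_compact) (use K assms in \<open>auto intro: continuous_on_subset\<close>)
 show "linteg (%x. indicator K x *\<^sub>R f x)"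
  using integrable_completion[OF borel_measurable_integrable[OF i]] i by simp
qed

lemma line_tendsto: "((%s. x + s *\<^sub>R b) ---> x) (nhds (0::real))" for x b :: "'a::real_normed_vector"
proof -
 have "isCont (%s. x + s *\<^sub>R b) 0" by (intro continuous_intros)
 then have "((%s. x + s *\<^sub>R b) ---> x + 0 *\<^sub>R b) (nhds 0)" unfolding isCont_def by (rule tendsto_at_iff_tendsto_nhds[THEN iffD1])
 then show ?thesis by simp
qed

text \<open>The product of \<open>f\<close> and a test function extends by zero to a compactly supported function, whose derivatives integrate to \<open>0\<close>.\<close>

lemma classical_weak_gradient:
 fixes f :: "'a::euclidean_space => real"
 assumes op: "open \<Omega>" and cf: "continuous_on \<Omega> f" and cg: "continuous_on \<Omega> g"
  and der: "!!x b. x \<in> \<Omega> ==> b \<in> Basis ==> ((%s. f (x + s *\<^sub>R b)) has_deriv g x \<bullet> b) (at 0)"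
 shows "has_weak_gradient \<Omega> f g"
proof -
 have l: "locally_integrable \<Omega> f" "locally_integrable \<Omega> g" using cf cg by (auto intro: locally_integrable_continuous)
 have "(LINT x:\<Omega>|lebesgue. f x * pd b \<phi> x) = - (LINT x:\<Omega>|lebesgue. (g x \<bullet> b) * \<phi> x)"
  if \<phi>: "\<phi> \<in> test_functions \<Omega>" and b: "b \<in> Basis" for \<phi> b
 proof -
  obtain K where K: "compact K" "K \<subseteq> \<Omega>" "!!x. x \<notin> K ==> \<phi> x = 0" using \<phi> by (auto simp: test_functions_def)
  have oK: "open (- K)" using K(1) by (simp add: compact_imp_closed open_Compl)
  have UN: "\<Omega> \<union> - K = UNIV" using K(2) by auto
  have pK: "pd b \<phi> x = 0" if x: "x \<notin> K" for x
  proof -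
   have "\<forall>\<^sub>F s in nhds 0. \<phi> (x + s *\<^sub>R b) = 0"
    using topological_tendstoD[OF line_tendsto oK Compl_iff[THEN iffD2, OF x]] by eventually_elim (use K(3) in simp)
   then have "((%s. \<phi> (x + s *\<^sub>R b)) has_deriv 0) (at 0)"
    using DERIV_cong_ev[OF refl, of "%s. \<phi> (x + s *\<^sub>R b)" "%_. 0" 0 0 0] by simp
   then show ?thesis using test_dir_deriv[OF \<phi>, of x b 0] DERIV_unique by fastforce
  qed
  define F where "F x = indicator \<Omega> x *\<^sub>R (f x * \<phi> x)" for x
  define F' where "F' x = indicator \<Omega> x *\<^sub>R (f x * pd b \<phi> x + (g x \<bullet> b) * \<phi> x)" for x
  have cont: "continuous_on UNIV H" if "continuous_on \<Omega> H0" "!!x. x \<in> \<Omega> ==> H x = H0 x" "!!x. x \<notin> K ==> H x = 0" for H H0 :: "'a => real"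
  proof -
   have "continuous_on \<Omega> H" using that(1) by (rule continuous_on_eq) (simp add: that(2))
   moreover have "continuous_on (- K) H" by (rule continuous_on_eq[of _ "%_. 0"]) (auto simp: that(3))
   ultimately have "continuous_on (\<Omega> \<union> - K) H" using op oK by (intro continuous_on_open_Un) auto
   then show ?thesis unfolding UN .
  qed
  note ct = test_continuous[OF \<phi>] test_continuous[OF test_partial_deriv[OF \<phi>]]
  have cF: "continuous_on UNIV F" by (rule cont[of "%x. f x * \<phi> x"]) (auto intro!: continuous_intros cf ct simp: F_def K(3))
  have cF': "continuous_on UNIV F'"
   by (rule cont[of "%x. f x * pd b \<phi> x + (g x \<bullet> b) * \<phi> x"]) (auto intro!: continuous_intros cf cg ct simp: F'_def K(3) pK)
  obtain M where M: "!!x. x \<in> K ==> norm x <= M" using compact_imp_bounded[OF K(1)] by (auto simp: bounded_iff)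
  have "(LI x. F' x) = 0"
  proof (rule integral_directional_derivative_eq_0[OF cF cF', of M b])
   show "F x = 0" if "norm x > M" for x using M[of x] K(3)[of x] that by (force simp: F_def)
   show "((%s. F (x + s *\<^sub>R b)) has_deriv F' x) (at 0)" for x
   proof -
    note tl = line_tendsto[of x b]
    show ?thesis
    proof (cases "x \<in> \<Omega>")
     case True
     have ev: "\<forall>\<^sub>F s in nhds 0. F (x + s *\<^sub>R b) = f (x + s *\<^sub>R b) * \<phi> (x + s *\<^sub>R b)"
      using topological_tendstoD[OF tl op True] by eventually_elim (simp add: F_def)
     have d1: "((%s. \<phi> (x + s *\<^sub>R b)) has_deriv pd b \<phi> x) (at 0)" using test_dir_deriv[OF \<phi>, of x b 0] by simp
     have "((%s. f (x + s *\<^sub>R b) * \<phi> (x + s *\<^sub>R b)) has_deriv F' x) (at 0)"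
      by (rule DERIV_cong[OF DERIV_mult[OF der[OF True b] d1]]) (use True in \<open>simp add: F'_def algebra_simps\<close>)
     then show ?thesis using DERIV_cong_ev[OF refl ev refl] by simp
    next
     case False
     then have xK: "x \<in> - K" using K(2) by auto
     have ev: "\<forall>\<^sub>F s in nhds 0. F (x + s *\<^sub>R b) = 0"
      using topological_tendstoD[OF tl oK xK] by eventually_elim (use K(3) in \<open>simp add: F_def\<close>)
     then show ?thesis using DERIV_cong_ev[OF refl ev refl] False by (simp add: F'_def)
    qed
   qed
  qed
  moreover have "(LI x. F' x) = (LINT x:\<Omega>|lebesgue. f x * pd b \<phi> x) + (LINT x:\<Omega>|lebesgue. (g x \<bullet> b) * \<phi> x)"
   unfolding F'_def set_lebesgue_integral_def[symmetric]
   by (rule set_integral_add(2)[OF locally_integrable_times_test[OF l(1) test_partial_deriv[OF \<phi>]] locally_integrable_times_test[OF locally_integrable_inner[OF l(2)] \<phi>]])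
  ultimately show ?thesis by simp
 qed
 then show ?thesis using l by (simp add: has_weak_gradient_def)
qed

lemma exterior_open: "open {x::'a::euclidean_space. norm x > R}"
 by (intro open_Collect_less continuous_intros)

lemma inverse_square_weak_gradient:
 assumes R: "R > 0"
 shows "has_weak_gradient {x::'a::euclidean_space. norm x > R} (%x. 1 / (norm x)^2) (%x. (- 2 / (norm x) ^ 4) *\<^sub>R x)"
proof (rule classical_weak_gradient[OF exterior_open])
 show "continuous_on {x::'a. norm x > R} (%x. 1 / (norm x)^2)" "continuous_on {x::'a. norm x > R} (%x. (- 2 / (norm x) ^ 4) *\<^sub>R x)"
  using R by (auto intro!: continuous_intros)
 fix x b :: 'a assume "x \<in> {x. norm x > R}" and b: "b \<in> Basis"
 then have "R < norm x" by simp
 then have n: "norm x > 0" using R by linarith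
 have e: "(%s. 1 / (norm (x + s *\<^sub>R b))^2) = (%s. 1 / (x \<bullet> x + 2 * s * (x \<bullet> b) + s^2 * (b \<bullet> b)))"
  by (rule ext) (simp only: power2_norm_eq_inner, simp add: inner_add_left inner_add_right inner_commute power2_eq_square algebra_simps)
 have d: "((%s. x \<bullet> x + 2 * s * (x \<bullet> b) + s^2 * (b \<bullet> b)) has_deriv 2 * (x \<bullet> b)) (at 0)"
  by (auto intro!: derivative_eq_intros)
 have xx: "x \<bullet> x = (norm x)^2" by (simp add: dot_square_norm)
 have "((%s. 1 / (x \<bullet> x + 2 * s * (x \<bullet> b) + s^2 * (b \<bullet> b))) has_deriv
   (0 * (x \<bullet> x + 2 * 0 * (x \<bullet> b) + 0^2 * (b \<bullet> b)) - 1 * (2 * (x \<bullet> b))) / ((x \<bullet> x + 2 * 0 * (x \<bullet> b) + 0^2 * (b \<bullet> b)) * (x \<bullet> x + 2 * 0 * (x \<bullet> b) + 0^2 * (b \<bullet> b)))) (at 0)"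
  by (rule DERIV_divide[OF DERIV_const d]) (use n in \<open>simp add: xx\<close>)
 then show "((%s. 1 / (norm (x + s *\<^sub>R b))^2) has_deriv ((- 2 / (norm x) ^ 4) *\<^sub>R x) \<bullet> b) (at 0)"
  unfolding e by (rule DERIV_cong) (use n in \<open>simp add: xx eval_nat_numeral\<close>)
qed

lemma coulomb_field_square_integrable:
 assumes R: "R > 0"
 shows "(%x::real^4. indicator {x. norm x > R} x *\<^sub>R ((1 / (norm x) ^ 4) *\<^sub>R x)) \<in> lmeas"
  "linteg (%x::real^4. (norm (indicator {x. norm x > R} x *\<^sub>R ((1 / (norm x) ^ 4) *\<^sub>R x)))^2)"
proof -
 have "{x::real^4. norm x > R} \<in> sets borel" using exterior_open by simp
 then have "(%x::real^4. indicator {x. norm x > R} x *\<^sub>R ((1 / (norm x) ^ 4) *\<^sub>R x)) \<in> borel_measurable lborel" by measurable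
 then show "(%x::real^4. indicator {x. norm x > R} x *\<^sub>R ((1 / (norm x) ^ 4) *\<^sub>R x)) \<in> lmeas" by (rule measurable_completion)
 define F where "F r = (1 / r ^ 3)^2" for r :: real
 have Fm: "F \<in> borel_measurable borel" unfolding F_def[abs_def] by measurable
 have e: "(%x::real^4. (norm (indicator {x. norm x > R} x *\<^sub>R ((1 / (norm x) ^ 4) *\<^sub>R x)))^2) = (%x. indicator {x. norm x > R} x * F (norm x))"
 proof
  fix x :: "real^4"
  have "1 / (norm x) ^ 4 * norm x = 1 / (norm x) ^ 3" by (cases "x = 0") (simp_all add: eval_nat_numeral)
  then show "(norm (indicator {x. norm x > R} x *\<^sub>R ((1 / (norm x) ^ 4) *\<^sub>R x)))^2 = indicator {x. norm x > R} x * F (norm x)"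
   by (auto simp: F_def indicator_def)
 qed
 have cont: "continuous_on {R..} (%r. F r * r ^ 3)" unfolding F_def using R by (intro continuous_intros) auto
 have "set_integrable lborel {R..} (%r. F r * r ^ 3)"
 proof (rule nonneg_half_line(1)[OF cont])
  fix N assume N: "N >= R"
  have "integral {R..N} (%r. F r * r ^ 3) <= integral {R..N} (%r. 1 / R * (1 / (r + 0)^2))"
  proof (rule integral_le)
   show "(%r. F r * r ^ 3) integrable_on {R..N}" by (intro integrable_continuous_real continuous_on_subset[OF cont]) auto
   show "(%r. 1 / R * (1 / (r + 0)^2)) integrable_on {R..N}" using R by (intro integrable_continuous_real continuous_intros) auto
   fix r assume "r \<in> {R..N}"
   then have r: "r >= R" "r > 0" using R by auto
   have "F r * r ^ 3 = 1 / r * (1 / r^2)" using r by (simp add: F_def eval_nat_numeral)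
   also have "... <= 1 / R * (1 / (r + 0)^2)" using r R by (intro mult_mono) (auto simp: frac_le)
   finally show "F r * r ^ 3 <= 1 / R * (1 / (r + 0)^2)" .
  qed
  also have "... = 1 / R * integral {R..N} (%r. 1 / (r + 0)^2)" by (rule integral_mult_right)
  also have "... <= 1 / R * (1 / (R + 0))" using inverse_square_half_line(3)[of R 0 N] R N by (intro mult_left_mono) auto
  finally show "integral {R..N} (%r. F r * r ^ 3) <= 1 / R * (1 / (R + 0))" .
 qed (use R in \<open>simp add: F_def\<close>)
 then show "linteg (%x::real^4. (norm (indicator {x. norm x > R} x *\<^sub>R ((1 / (norm x) ^ 4) *\<^sub>R x)))^2)"
  unfolding e using polar_coordinates(1)[OF Fm, of R] R by simp
qed

lemma integral_lebesgue_AE_cong: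
 fixes f g :: "'a::euclidean_space => real"
 assumes "AE x in lebesgue. f x = g x" "g \<in> lmeas"
 shows "(LI x. f x) = (LI x. g x)"
 by (rule integral_cong_AE[OF borel_measurable_lebesgue_AE_cong[OF assms(2,1)] assms(2,1)])

lemma L2_restricted_distance:
 fixes f g :: "'a::euclidean_space => 'b::euclidean_space"
 assumes m: "f \<in> lmeas" "g \<in> lmeas" and A: "A \<in> sets lebesgue"
  and i: "linteg (%x. (norm (f x))^2)" "linteg (%x. (norm (g x))^2)"
 shows "\<bar>sqrt (LI x. indicator A x * (norm (f x))^2) - sqrt (LI x. indicator A x * (norm (g x))^2)\<bar>
   <= sqrt (LI x. (norm (f x - g x))^2)"
proof -
 have main: "sqrt (LI x. indicator A x * (norm (f x))^2) <= sqrt (LI x. indicator A x * (norm (g x))^2) + sqrt (LI x. (norm (f x - g x))^2)"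
  if m: "f \<in> lmeas" "g \<in> lmeas"
  and i: "linteg (%x. (norm (f x))^2)" "linteg (%x. (norm (g x))^2)" for f g :: "'a => 'b"
 proof -
  define F where "F x = indicator A x *\<^sub>R g x" for x
  define D where "D x = indicator A x *\<^sub>R (f x - g x)" for x
  have dm: "(%x. f x - g x) \<in> lmeas" by (intro borel_measurable_diff m)
  have di: "linteg (%x. (norm (f x - g x))^2)"
   using square_integrable_add[OF m(1) borel_measurable_uminus[OF m(2)] i(1)] i(2) by simp
  have ind: "(norm (indicator A x *\<^sub>R z))^2 = indicator A x * (norm z)^2" for z :: 'b and x
   by (simp add: indicator_def)
  have mm: "F \<in> lmeas" "D \<in> lmeas" unfolding F_def[abs_def] D_def[abs_def]
   by (intro borel_measurable_scaleR borel_measurable_indicator A m dm)+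
  have ii: "linteg (%x. indicator A x * (norm (h x))^2)" if "h \<in> lmeas" "linteg (%x. (norm (h x))^2)" for h :: "'a => 'b"
   by (rule Bochner_Integration.integrable_bound[OF that(2)])
    (intro borel_measurable_times borel_measurable_indicator A borel_measurable_power measurable_compose[OF that(1) borel_measurable_norm], auto simp: indicator_def)
  have Fi: "linteg (%x. (norm (F x))^2)" "linteg (%x. (norm (D x))^2)"
   unfolding F_def D_def ind by (intro ii m i dm di)+
  have "(%x. (norm (F x + D x))^2) = (%x. indicator A x * (norm (f x))^2)"
   by (auto simp: F_def D_def indicator_def)
  then have "sqrt (LI x. indicator A x * (norm (f x))^2) <= sqrt (LI x. (norm (F x))^2) + sqrt (LI x. (norm (D x))^2)"
   using L2_triangle[OF mm Fi] by simp
  then have s1: "sqrt (LI x. indicator A x * (norm (f x))^2) <= sqrt (LI x. (norm (F x))^2) + sqrt (LI x. (norm (D x))^2)" .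
  have "(LI x. (norm (D x))^2) <= (LI x. (norm (f x - g x))^2)"
   by (rule integral_mono[OF Fi(2) di]) (auto simp: D_def indicator_def)
  then have s2: "sqrt (LI x. (norm (D x))^2) <= sqrt (LI x. (norm (f x - g x))^2)" by (rule real_sqrt_le_mono)
  have Fn: "(%x. (norm (F x))^2) = (%x. indicator A x * (norm (g x))^2)" by (rule ext) (simp only: F_def ind)
  show ?thesis using s1 s2 unfolding Fn by linarith
 qed
 have c: "(%x. (norm (g x - f x))^2) = (%x. (norm (f x - g x))^2)" by (rule ext) (simp only: norm_minus_commute)
 show ?thesis using main[OF m i] main[OF m(2,1) i(2,1)] unfolding c by linarith
qed

text \<open>Uniformity in \<open>t\<close> makes the limits \<open>l n\<close> a Cauchy sequence and allows the two limits to be interchanged.\<close>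

lemma uniform_approximation_limit:
 fixes f g :: "real => real" and F G :: "nat => real => real"
 assumes F: "!!n. (F n ---> l n) at_top" and G: "!!n. (G n ---> l n) at_top"
  and fF: "!!n t. t >= 0 ==> \<bar>f t - F n t\<bar> <= d n" and gG: "!!n t. t >= 0 ==> \<bar>g t - G n t\<bar> <= d n"
  and d: "d \<longlonglongrightarrow> 0" and k: "!!n. l n >= k n" and kK: "k \<longlonglongrightarrow> K"
 shows "\<exists>L. (f ---> L) at_top \<and> (g ---> L) at_top \<and> L >= K"
proof -
 have close: "\<bar>l m - l n\<bar> <= d m + d n" for m n
 proof (rule tendsto_upperbound)
  show "((%t. \<bar>F m t - F n t\<bar>) ---> \<bar>l m - l n\<bar>) at_top" by (intro tendsto_intros F)
  show "\<forall>\<^sub>F t in at_top. \<bar>F m t - F n t\<bar> <= d m + d n"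
   using eventually_ge_at_top[of 0]
  proof eventually_elim
   case (elim t)
   then show ?case using fF[of t m] fF[of t n] by linarith
  qed
 qed simp
 have "Cauchy l"
 proof (rule metric_CauchyI)
  fix e :: real assume "e > 0"
  then have "\<forall>\<^sub>F n in sequentially. d n < e / 2" using order_tendstoD(2)[OF d, of "e / 2"] by simp
  then obtain N where N: "!!n. n >= N ==> d n < e / 2" by (auto simp: eventually_sequentially)
  show "\<exists>N. \<forall>m\<ge>N. \<forall>n\<ge>N. dist (l m) (l n) < e"
  proof (intro exI allI impI)
   fix m n assume "m >= N" "n >= N"
   then show "dist (l m) (l n) < e" using close[of m n] N[of m] N[of n] by (simp add: dist_real_def)
  qed
 qed
 then obtain L where L: "l \<longlonglongrightarrow> L" using Cauchy_convergent convergent_def by blast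
 have lim: "(h ---> L) at_top" if H: "!!n. (H n ---> l n) at_top" "!!n t. t >= 0 ==> \<bar>h t - H n t\<bar> <= d n" for h and H :: "nat => real => real"
 proof (rule tendstoI)
  fix e :: real assume e: "e > 0"
  then have e3: "e / 3 > 0" by simp
  have "\<forall>\<^sub>F n in sequentially. d n < e / 3 \<and> dist (l n) L < e / 3"
   using order_tendstoD(2)[OF d, of "e / 3"] tendstoD[OF L, of "e / 3"] e by (simp add: eventually_conj)
  then obtain n where n: "d n < e / 3" "dist (l n) L < e / 3" using eventually_happens'[OF sequentially_bot] by blast
  show "\<forall>\<^sub>F t in at_top. dist (h t) L < e"
   using tendstoD[OF H(1)[of n] e3] eventually_ge_at_top[of 0]
  proof eventually_elim
   case (elim t)
   then show ?case using H(2)[of t n] n unfolding dist_real_def by linarith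
  qed
 qed
 have "L >= K" using L kK k by (intro LIMSEQ_le[OF kK L]) auto
 then show ?thesis using lim[OF F fF] lim[OF G gG] by blast
qed

section \<open>Removing the mollification\<close>

lemma weak_wave_of_solution:
 assumes sol: "free_wave_solution w0 w1 u v"
 obtains g where "weak_wave u v g"
proof -
 have H: "u t \<in> Hdot1" "square_integrable (v t)" for t using sol by (auto simp: free_wave_solution_def)
 have "\<exists>g. has_weak_gradient UNIV (u t) g \<and> square_integrable g" for t using H(1)[of t] by (auto simp: Hdot1_def)
 then obtain g where g: "!!t. has_weak_gradient UNIV (u t) (g t)" "!!t. square_integrable (g t)" by metis
 have gm: "g t \<in> lmeas" and gi: "linteg (%x. (norm (g t x))^2)" for t
  using g(2)[of t] by (auto simp: square_integrable_def)
 have sqL: "(LI x. (norm (f x))^2) = (L2_norm UNIV f)^2" for f :: "real^4 => 'b::euclidean_space"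
 proof -
  have "0 <= (LI x. (norm (f x))^2)" by (rule Bochner_Integration.integral_nonneg) simp
  then show ?thesis by (simp add: L2_norm_def set_lebesgue_integral_def)
 qed
 have sq0: "((%s. (h s)^2) ---> 0) (at t)" if "(h ---> 0) (at t)" for h :: "real => real" and t
  using tendsto_power[OF that, of 2] by simp
 have cg: "((%s. LI x. (norm (g s x - g t x))^2) ---> 0) (at t)" for t
 proof -
  have e: "(LI x. (norm (g s x - g t x))^2) = (LI x. (norm (weak_gradient UNIV (%x. u s x - u t x) x))^2)" for s
  proof -
   have "has_weak_gradient UNIV (%x. u s x + (- 1) * u t x) (%x. g s x + (- 1) *\<^sub>R g t x)"
    by (rule weak_gradient_add_scaled[OF g(1) g(1)])
   then have h: "has_weak_gradient UNIV (%x. u s x - u t x) (%x. g s x - g t x)" by simp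
   have ae: "AE x in lebesgue. (norm (weak_gradient UNIV (%x. u s x - u t x) x))^2 = (norm (g s x - g t x))^2"
    using weak_gradient_AE(1)[OF open_UNIV h] by eventually_elim simp
   show ?thesis
    by (rule integral_lebesgue_AE_cong[OF ae, symmetric])
     (intro borel_measurable_power measurable_compose[OF borel_measurable_diff[OF gm gm] borel_measurable_norm])
  qed
  have "((%s. L2_norm UNIV (weak_gradient UNIV (%x. u s x - u t x))) ---> 0) (at t)"
   using sol by (simp add: free_wave_solution_def)
  then show ?thesis unfolding e sqL by (rule sq0)
 qed
 have cv: "((%s. LI x. (norm (v s x - v t x))^2) ---> 0) (at t)" for t
  unfolding sqL by (rule sq0) (use sol in \<open>simp add: free_wave_solution_def\<close>)
 have D: "((%s. LI x. u s x * \<phi> x) has_deriv (LI x. v t x * \<phi> x)) (at t)"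
  "((%s. LI x. v s x * \<phi> x) has_deriv (LI x. u t x * laplacian \<phi> x)) (at t)"
  if "\<phi> \<in> testfuns" for \<phi> t
  using sol that by (auto simp: free_wave_solution_def)
 have "weak_wave u v g" by unfold_locales (fact g H(2) cg cv D)+
 then show ?thesis by (rule that)
qed

context radial_weak_wave
begin

text \<open>The data are a continuous function of the radius at \<open>x\<close>, and a mollification is an average over a small ball.\<close>

lemma S_pointwise:
 fixes f :: "real => real"
 assumes w: "AE x in lebesgue. norm x > R --> u 0 x = f (norm x)" and cf: "continuous_on {R..} f" and x: "norm x > R" and e: "e > 0"
 shows "\<exists>d>0. \<forall>\<epsilon> \<eta>. \<epsilon> <= d --> mollifier \<epsilon> \<eta> --> \<bar>S \<eta> 0 x - f (norm x)\<bar> <= e"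
proof -
 have "isCont f (norm x)"
  by (rule continuous_on_interior[OF cf]) (use x interior_real_atLeast in auto)
 then obtain d0 where d0: "d0 > 0" "!!s. \<bar>s - norm x\<bar> < d0 ==> \<bar>f s - f (norm x)\<bar> < e"
  using e unfolding continuous_at_eps_delta by (auto simp: dist_real_def)
 define d where "d = min d0 (norm x - R)"
 have d: "d > 0" using d0(1) x by (simp add: d_def)
 have "\<bar>S \<eta> 0 x - f (norm x)\<bar> <= e" if le: "\<epsilon> <= d" and m: "mollifier \<epsilon> \<eta>" for \<epsilon> \<eta>
 proof -
  have \<eta>: "\<eta> \<in> testfuns" "!!y. \<eta> y >= 0" "!!y. norm y >= \<epsilon> ==> \<eta> y = 0" "(LI y. \<eta> y) = 1"
   using m by (auto simp: mollifier_def)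
  note p = lebesgue_preserving_reflection[of x]
  have \<eta>m: "\<eta> \<in> lmeas" using test_borel[OF \<eta>(1)] by (simp add: measurable_completion)
  have i1: "linteg (%y. \<eta> (x - y))" "(LI y. \<eta> (x - y)) = 1"
   using lebesgue_preserving_integral(1,2)[OF p \<eta>m] test_integrable[OF \<eta>(1)] \<eta>(4) by auto
  note i2 = convol_integrable[OF u_li \<eta>(1), of 0 x]
  have ic: "linteg (%y. f (norm x) * \<eta> (x - y))" using i1(1) by (rule integrable_mult_right)
  have ie: "linteg (%y. e * \<eta> (x - y))" using i1(1) by (rule integrable_mult_right)
  have "S \<eta> 0 x - f (norm x) = (LI y. u 0 y * \<eta> (x - y)) - (LI y. f (norm x) * \<eta> (x - y))"
   using i1(2) by (simp add: S_def convol_def)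
  also have "... = (LI y. u 0 y * \<eta> (x - y) - f (norm x) * \<eta> (x - y))"
   by (rule Bochner_Integration.integral_diff[OF i2 ic, symmetric])
  finally have eq: "S \<eta> 0 x - f (norm x) = (LI y. u 0 y * \<eta> (x - y) - f (norm x) * \<eta> (x - y))" .
  have "\<bar>S \<eta> 0 x - f (norm x)\<bar> <= (LI y. \<bar>u 0 y * \<eta> (x - y) - f (norm x) * \<eta> (x - y)\<bar>)"
   unfolding eq by (rule integral_abs_bound)
  also have "... <= (LI y. e * \<eta> (x - y))"
  proof (rule integral_mono_AE[OF integrable_abs[OF Bochner_Integration.integrable_diff[OF i2 ic]] ie])
   show "AE y in lebesgue. \<bar>u 0 y * \<eta> (x - y) - f (norm x) * \<eta> (x - y)\<bar> <= e * \<eta> (x - y)"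
    using w
   proof eventually_elim
    case (elim y)
    show ?case
    proof (cases "norm (x - y) < \<epsilon>")
     case True
     have "\<bar>norm y - norm x\<bar> < d" using True le norm_triangle_ineq3[of y x] by (simp add: norm_minus_commute)
     then have "u 0 y = f (norm y)" "\<bar>f (norm y) - f (norm x)\<bar> < e" using elim d0(2) by (auto simp: d_def)
     then have "\<bar>u 0 y - f (norm x)\<bar> * \<eta> (x - y) <= e * \<eta> (x - y)" using \<eta>(2) by (intro mult_right_mono) auto
     then show ?thesis using \<eta>(2)[of "x - y"] by (simp add: left_diff_distrib[symmetric] abs_mult)
    next
     case False
     then show ?thesis using \<eta>(3)[of "x - y"] by simp
    qed
   qed
  qed
  also have "... = e" using i1(2) by simp
  finally show ?thesis .
 qed
 then show ?thesis using d by blast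
qed

text \<open>On the sphere of radius \<open>R\<close> the averages also see the unknown interior data, so \<open>S_pointwise\<close> is applied slightly outside and combined with Hoelder continuity that is uniform in the mollifier.\<close>

lemma mollified_boundary_value:
 fixes f :: "real => real"
 assumes w: "AE x in lebesgue. norm x > R --> u 0 x = f (norm x)" and cf: "continuous_on {R..} f" and R: "R > 0" and e: "e > 0"
  and ax: "norm (ax::real^4) = 1"
 shows "\<exists>d>0. \<forall>\<epsilon> \<eta>. \<epsilon> <= d --> mollifier \<epsilon> \<eta> -->
   (\<forall>L>R. (S \<eta> 0 (L *\<^sub>R ax) - S \<eta> 0 (R *\<^sub>R ax))^2 <= (1 / (2 * R^2) - 1 / (2 * L^2)) * C) --> \<bar>S \<eta> 0 (R *\<^sub>R ax) - f R\<bar> <= e"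
proof -
 have e3: "e / 3 > 0" using e by simp
 have "((%L. (1 / (2 * R^2) - 1 / (2 * L^2)) * C) ---> (1 / (2 * R^2) - 1 / (2 * R^2)) * C) (at_right R)"
  using R by (intro tendsto_intros) auto
 then have "\<forall>\<^sub>F L in at_right R. (1 / (2 * R^2) - 1 / (2 * L^2)) * C < (e / 3)\<^sup>2"
  using e3 by (intro order_tendstoD(2)) auto
 moreover have "\<forall>\<^sub>F L in at_right R. dist (f L) (f R) < e / 3"
 proof -
  have "(f ---> f R) (at R within {R..})" using cf by (simp add: continuous_on_def)
  then have "(f ---> f R) (at_right R)" by (rule tendsto_within_subset) auto
  then show ?thesis using e3 by (rule tendstoD)
 qed
 moreover have "\<forall>\<^sub>F L in at_right R. R < L" by (rule eventually_at_right_less)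
 ultimately have "\<forall>\<^sub>F L in at_right R. (1 / (2 * R^2) - 1 / (2 * L^2)) * C < (e / 3)\<^sup>2 \<and> dist (f L) (f R) < e / 3 \<and> R < L"
  by (simp add: eventually_conj_iff)
 then obtain L where L: "(1 / (2 * R^2) - 1 / (2 * L^2)) * C < (e / 3)\<^sup>2" "dist (f L) (f R) < e / 3" "R < L"
  using eventually_happens'[OF trivial_limit_at_right_real] by blast
 have nL: "norm (L *\<^sub>R ax) = L" using L(3) R ax by simp
 have "norm (L *\<^sub>R ax) > R" using nL L(3) by simp
 from S_pointwise[OF w cf this e3, unfolded nL] obtain d where d: "d > 0"
  "!!\<epsilon> \<eta>. \<epsilon> <= d ==> mollifier \<epsilon> \<eta> ==> \<bar>S \<eta> 0 (L *\<^sub>R ax) - f L\<bar> <= e / 3" by blast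
 have "\<bar>S \<eta> 0 (R *\<^sub>R ax) - f R\<bar> <= e"
  if "\<epsilon> <= d" "mollifier \<epsilon> \<eta>" "\<forall>L>R. (S \<eta> 0 (L *\<^sub>R ax) - S \<eta> 0 (R *\<^sub>R ax))^2 <= (1 / (2 * R^2) - 1 / (2 * L^2)) * C" for \<epsilon> \<eta>
 proof -
  have "(S \<eta> 0 (L *\<^sub>R ax) - S \<eta> 0 (R *\<^sub>R ax))^2 <= (e / 3)^2" using that(3)[rule_format, OF L(3)] L(1) by linarith
  then have "\<bar>S \<eta> 0 (L *\<^sub>R ax) - S \<eta> 0 (R *\<^sub>R ax)\<bar> <= \<bar>e / 3\<bar>" by (rule abs_le_square_iff[THEN iffD2])
  also have "\<bar>e / 3\<bar> = e / 3" using e by simp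
  finally show ?thesis using d(2)[OF that(1,2)] L(2) unfolding dist_real_def by linarith
 qed
 then show ?thesis using d(1) by blast
qed

definition \<G> :: "(real^4 => real) => real => real^4 => real^4" where
 "\<G> \<eta> t x = (\<Sum>b\<in>Basis. S (pd b \<eta>) t x *\<^sub>R b)"

lemma \<G>_inner: "b \<in> Basis ==> \<G> \<eta> t x \<bullet> b = S (pd b \<eta>) t x"
 by (simp add: \<G>_def inner_sum_left_Basis)

lemma \<G>_norm: "(norm (\<G> \<eta> t x + y))^2 = (\<Sum>b\<in>Basis. (S (pd b \<eta>) t x + y \<bullet> b)^2)"
 unfolding inner_square_sum[symmetric] by (rule sum.cong) (simp_all add: inner_add_left \<G>_inner)

text \<open>The result for one mollification, with all quantities expressed through \<open>u\<close>, \<open>v\<close> and \<open>g\<close>.\<close>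

lemma mollified_approximation:
 assumes R: "R > 0" and e: "0 < e" "e <= 1"
 obtains \<eta> \<epsilon> E where "mollifier \<epsilon> \<eta>" "\<epsilon> <= e" "!!t. t >= 0 ==> linteg (err \<eta> t) \<and> (LI x. err \<eta> t x) <= e"
  "((%t. LI x. indicator {x. norm x > R + t} x * (norm (V \<eta> t x))^2) ---> E) at_top"
  "((%t. LI x. indicator {x. norm x > R + t} x * (norm (\<G> \<eta> t x))^2) ---> E) at_top"
  "E >= 3/20 * (LI x. indicator {x. norm x > R} x * (norm (\<G> \<eta> 0 x + (2 * R^2 * S \<eta> 0 (R *\<^sub>R axis 1 1) / (norm x) ^ 4) *\<^sub>R x))^2)"
  "\<forall>L>R. (S \<eta> 0 (L *\<^sub>R axis 1 1) - S \<eta> 0 (R *\<^sub>R axis 1 1))^2 <= (1 / (2 * R^2) - 1 / (2 * L^2)) *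
   ((2 + 2 * (LI x. (v 0 x)^2 + (\<Sum>b\<in>Basis. (g 0 x \<bullet> b)^2))) / sphere_area)"
proof -
 have e4: "e / 4 > 0" using e by simp
 obtain d where d: "d > 0" "!!\<epsilon> \<eta>. \<epsilon> <= d ==> mollifier \<epsilon> \<eta> ==> linteg (err \<eta> 0) \<and> (LI x. err \<eta> 0 x) <= e / 4"
  using err_small[OF e4, of 0] by blast
 have "min d e > 0" using d(1) e by simp
 then obtain \<eta> :: "real^4 => real" where \<eta>: "mollifier (min d e) \<eta>" and sym: "!!x y. norm x = norm y ==> \<eta> x = \<eta> y"
  using radial_mollifier_exists by blast
 have er: "linteg (err \<eta> 0)" "(LI x. err \<eta> 0 x) <= e / 4" using d(2)[OF _ \<eta>] by auto
 interpret M: radial_profile u v g h \<eta> "min d e" R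
  by unfold_locales (fact \<eta> sym er(1) R)+
 have shift: "(\<Sum>b\<in>Basis. (S (pd b \<eta>) 0 x + 2 * R^2 * S \<eta> 0 (R *\<^sub>R axis 1 1) * (x \<bullet> b) / (norm x) ^ 4)^2) =
   (norm (\<G> \<eta> 0 x + (2 * R^2 * S \<eta> 0 (R *\<^sub>R axis 1 1) / (norm x) ^ 4) *\<^sub>R x))^2" for x
  unfolding \<G>_norm by simp
 have gr: "(\<Sum>b\<in>Basis. (S (pd b \<eta>) t x)^2) = (norm (\<G> \<eta> t x))^2" for t x
  using \<G>_norm[of \<eta> t x 0] by simp
 obtain E where E: "((%t. LI x. indicator {x. norm x > R + t} x * (V \<eta> t x)^2) ---> E) at_top"
  "((%t. LI x. indicator {x. norm x > R + t} x * (norm (\<G> \<eta> t x))^2) ---> E) at_top"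
  "E >= 3/20 * (LI x. indicator {x. norm x > R} x * (norm (\<G> \<eta> 0 x + (2 * R^2 * S \<eta> 0 (R *\<^sub>R axis 1 1) / (norm x) ^ 4) *\<^sub>R x))^2)"
  using M.mollified_limits[unfolded M.kin_def M.pot_def M.U_def M.ray_def shift gr] by blast
 have et: "linteg (err \<eta> t) \<and> (LI x. err \<eta> t x) <= e" if "t >= 0" for t
  using err_uniform[OF \<eta> er(1) that] er(2) by auto
 have hol: "\<forall>L>R. (S \<eta> 0 (L *\<^sub>R axis 1 1) - S \<eta> 0 (R *\<^sub>R axis 1 1))^2 <= (1 / (2 * R^2) - 1 / (2 * L^2)) *
   ((2 + 2 * (LI x. (v 0 x)^2 + (\<Sum>b\<in>Basis. (g 0 x \<bullet> b)^2))) / sphere_area)"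
 proof (intro allI impI)
  fix L assume L: "R < L"
  have nn: "0 <= 1 / (2 * R^2) - 1 / (2 * L^2)" using R L by (simp add: frac_le power_mono)
  have le: "(2 * (LI x. err \<eta> 0 x) + 2 * (LI x. M.data 0 x)) / sphere_area <= (2 + 2 * (LI x. M.data 0 x)) / sphere_area"
   using er(2) e sphere_area_pos by (intro divide_right_mono) auto
  show "(S \<eta> 0 (L *\<^sub>R axis 1 1) - S \<eta> 0 (R *\<^sub>R axis 1 1))^2 <= (1 / (2 * R^2) - 1 / (2 * L^2)) *
   ((2 + 2 * (LI x. (v 0 x)^2 + (\<Sum>b\<in>Basis. (g 0 x \<bullet> b)^2))) / sphere_area)"
   by (rule order_trans[OF M.profile_uniform_hoelder[OF L] mult_left_mono[OF le nn], unfolded M.U_def M.ray_def M.data_def])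
 qed
 have EV: "((%t. LI x. indicator {x. norm x > R + t} x * (norm (V \<eta> t x))^2) ---> E) at_top" using E(1) by simp
 show ?thesis by (rule that[OF \<eta> _ et EV E(2,3) hol]) simp
qed

lemma mollified_vector:
 assumes \<eta>: "\<eta> \<in> testfuns"
 shows "\<G> \<eta> t \<in> lmeas" "V \<eta> t \<in> lmeas"
  and "(V \<eta> t x - v t x)^2 <= err \<eta> t x" "(norm (\<G> \<eta> t x - g t x))^2 <= err \<eta> t x"
proof -
 have m: "V \<eta> t \<in> lmeas" "S (pd b \<eta>) t \<in> lmeas" for b
  using borel_measurable_continuous_onI[OF convol_continuous[OF v_li \<eta>]] borel_measurable_continuous_onI[OF convol_continuous[OF u_li test_partial_deriv[OF \<eta>]]]
  by (simp_all add: V_def[abs_def] S_def[abs_def] measurable_completion)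
 show "V \<eta> t \<in> lmeas" by (rule m)
 show "\<G> \<eta> t \<in> lmeas" unfolding \<G>_def[abs_def] by (intro borel_measurable_sum borel_measurable_scaleR m) simp
 have s: "0 <= (\<Sum>b\<in>Basis. (S (pd b \<eta>) t x - g t x \<bullet> b)^2)" by (intro sum_nonneg) simp
 show "(V \<eta> t x - v t x)^2 <= err \<eta> t x" unfolding err_def using s by simp
 have "(norm (\<G> \<eta> t x - g t x))^2 = (\<Sum>b\<in>Basis. (S (pd b \<eta>) t x - g t x \<bullet> b)^2)"
  using \<G>_norm[of \<eta> t x "- g t x"] by simp
 then show "(norm (\<G> \<eta> t x - g t x))^2 <= err \<eta> t x" unfolding err_def by simp
qed

end

context radial_weak_wave
begin

text \<open>Mollified solutions approximate the energies uniformly in time, and the lower bounds converge because both the gradients at time \<open>0\<close> and the boundary values do.\<close>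

lemma exterior_energy_limits:
 fixes f :: "real => real"
 assumes w: "AE x in lebesgue. norm x > R --> u 0 x = f (norm x)" and cf: "continuous_on {R..} f" and R: "R > 0"
 shows "\<exists>L. ((%t. sqrt (LI x. indicator {x. norm x > R + t} x * (norm (v t x))^2)) ---> L) at_top \<and>
   ((%t. sqrt (LI x. indicator {x. norm x > R + t} x * (norm (g t x))^2)) ---> L) at_top \<and>
   L >= sqrt (3/20) * sqrt (LI x. indicator {x. norm x > R} x * (norm (g 0 x + (2 * R^2 * f R / (norm x) ^ 4) *\<^sub>R x))^2)"
proof -
 define ax :: "real^4" where "ax = axis 1 1"
 have ax: "norm ax = 1" by (simp add: ax_def norm_axis_1)
 define C where "C = (2 + 2 * (LI x. (v 0 x)^2 + (\<Sum>b\<in>Basis. (g 0 x \<bullet> b)^2))) / sphere_area"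
 define X where "X x = indicator {x. norm x > R} x *\<^sub>R ((1 / (norm x) ^ 4) *\<^sub>R x)" for x :: "real^4"
 have X: "X \<in> lmeas" "linteg (%x. (norm (X x))^2)"
  unfolding X_def[abs_def] by (rule coulomb_field_square_integrable[OF R])+
 define c where "c \<eta> = 2 * R^2 * S \<eta> 0 (R *\<^sub>R ax)" for \<eta>
 define c0 where "c0 = 2 * R^2 * f R"
 \<comment> \<open>For each \<open>n\<close> one mollification whose error is at most \<open>1 / (n + 1)\<close>.\<close>
 define good where "good n \<eta> \<epsilon> E \<longleftrightarrow> mollifier \<epsilon> \<eta> \<and> \<epsilon> <= 1 / real (Suc n) \<and>
  (\<forall>t\<ge>0. linteg (err \<eta> t) \<and> (LI x. err \<eta> t x) <= 1 / real (Suc n)) \<and>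
  ((%t. LI x. indicator {x. norm x > R + t} x * (norm (V \<eta> t x))^2) ---> E) at_top \<and>
  ((%t. LI x. indicator {x. norm x > R + t} x * (norm (\<G> \<eta> t x))^2) ---> E) at_top \<and>
  E >= 3/20 * (LI x. indicator {x. norm x > R} x * (norm (\<G> \<eta> 0 x + (c \<eta> / (norm x) ^ 4) *\<^sub>R x))^2) \<and>
  (\<forall>L>R. (S \<eta> 0 (L *\<^sub>R ax) - S \<eta> 0 (R *\<^sub>R ax))^2 <= (1 / (2 * R^2) - 1 / (2 * L^2)) * C)" for n \<eta> \<epsilon> E
 have "\<forall>n. \<exists>p. good n (fst p) (fst (snd p)) (snd (snd p))"
 proof
  fix n :: nat
  have e: "0 < 1 / real (Suc n)" "1 / real (Suc n) <= 1" by simp_all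
  obtain \<eta> \<epsilon> E where "good n \<eta> \<epsilon> E"
   by (rule mollified_approximation[OF R e])
    (rule that, unfold good_def c_def C_def ax_def, intro conjI; (assumption | blast))
  then show "\<exists>p. good n (fst p) (fst (snd p)) (snd (snd p))" by (intro exI[of _ "(\<eta>, \<epsilon>, E)"]) simp
 qed
 from choice[OF this] obtain p where p: "\<forall>n. good n (fst (p n)) (fst (snd (p n))) (snd (snd (p n)))" by (elim exE)
 define \<eta> \<epsilon> E where "\<eta> n = fst (p n)" and "\<epsilon> n = fst (snd (p n))" and "E n = snd (snd (p n))" for n
 have G: "good n (\<eta> n) (\<epsilon> n) (E n)" for n using p[rule_format, of n] by (simp only: \<eta>_def \<epsilon>_def E_def)
 have te: "\<eta> n \<in> testfuns" for n using G[of n] by (simp add: good_def mollifier_def)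
 have ei: "linteg (err (\<eta> n) t)" "(LI x. err (\<eta> n) t x) <= 1 / real (Suc n)" if "t >= 0" for n t
  using G[of n] that by (simp_all add: good_def)
 define d where "d n = sqrt (1 / real (Suc n))" for n
 have inv0: "(%n. 1 / real (Suc n)) \<longlonglongrightarrow> 0" using LIMSEQ_inverse_real_of_nat by (simp add: inverse_eq_divide)
 have d0: "d \<longlonglongrightarrow> 0" unfolding d_def[abs_def] using tendsto_real_sqrt[OF inv0] by simp
 note gm = g2[unfolded square_integrable_def, THEN conjunct1] and gi = g2[unfolded square_integrable_def, THEN conjunct2]
 note vm = v2[unfolded square_integrable_def, THEN conjunct1] and vi = v2[unfolded square_integrable_def, THEN conjunct2]
 have diff: "linteg (%x. (norm (F x - G x))^2) \<and> linteg (%x. (norm (F x))^2) \<and> sqrt (LI x. (norm (F x - G x))^2) <= d n"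
  if t: "t >= 0" and m: "F \<in> lmeas" "G \<in> lmeas" and i: "linteg (%x. (norm (G x))^2)"
   and le: "!!x. (norm (F x - G x))^2 <= err (\<eta> n) t x" for F G :: "real^4 => 'z::euclidean_space" and n t
 proof -
  have dm: "(%x. F x - G x) \<in> lmeas" by (intro borel_measurable_diff m)
  have di: "linteg (%x. (norm (F x - G x))^2)"
  proof (rule Bochner_Integration.integrable_bound[OF ei(1)[OF t]])
   show "(%x. (norm (F x - G x))^2) \<in> lmeas"
    by (intro borel_measurable_power measurable_compose[OF dm borel_measurable_norm])
   show "AE x in lebesgue. norm ((norm (F x - G x))^2) <= norm (err (\<eta> n) t x)"
    by (rule AE_I2) (use order_trans[OF le abs_ge_self] in simp)
  qed
  have "(LI x. (norm (F x - G x))^2) <= (LI x. err (\<eta> n) t x)"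
   by (rule integral_mono[OF di ei(1)[OF t] le])
  then have "sqrt (LI x. (norm (F x - G x))^2) <= d n"
   unfolding d_def using ei(2)[OF t, of n] real_sqrt_le_mono order_trans by blast
  moreover have "linteg (%x. (norm (F x))^2)" using square_integrable_add[OF dm m(2) di i] by simp
  ultimately show ?thesis using di by blast
 qed
 have ext: "{x::real^4. norm x > \<rho>} \<in> sets lebesgue" for \<rho>
 proof -
  have "{x::real^4. norm x > \<rho>} \<in> sets lborel" using exterior_open[of \<rho>] by simp
  then show ?thesis by (rule sets_completionI_sets)
 qed
 define N0 where "N0 = (LI x. indicator {x. norm x > R} x * (norm (g 0 x + c0 *\<^sub>R X x))^2)"
 define N where "N n = (LI x. indicator {x. norm x > R} x * (norm (\<G> (\<eta> n) 0 x + c (\<eta> n) *\<^sub>R X x))^2)" for n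
 have Xe: "indicator {x. norm x > R} x * (norm (y + (a / (norm x) ^ 4) *\<^sub>R x))^2 = indicator {x. norm x > R} x * (norm (y + a *\<^sub>R X x))^2" for x y :: "real^4" and a
  by (simp add: X_def indicator_def)
 have cl: "(%n. c (\<eta> n)) \<longlonglongrightarrow> c0"
 proof -
  have "(%n. S (\<eta> n) 0 (R *\<^sub>R ax)) \<longlonglongrightarrow> f R"
  proof (rule tendstoI)
   fix e :: real assume "e > 0"
   then have e2: "e / 2 > 0" by simp
   obtain \<delta> where \<delta>: "\<delta> > 0" "!!\<epsilon> \<eta>. \<epsilon> <= \<delta> ==> mollifier \<epsilon> \<eta> ==>
    (\<forall>L>R. (S \<eta> 0 (L *\<^sub>R ax) - S \<eta> 0 (R *\<^sub>R ax))^2 <= (1 / (2 * R^2) - 1 / (2 * L^2)) * C) ==> \<bar>S \<eta> 0 (R *\<^sub>R ax) - f R\<bar> <= e / 2"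
    using mollified_boundary_value[OF w cf R e2 ax, of C] by blast
   have "\<forall>\<^sub>F n in sequentially. 1 / real (Suc n) < \<delta>" by (rule order_tendstoD(2)[OF inv0 \<delta>(1)])
   then show "\<forall>\<^sub>F n in sequentially. dist (S (\<eta> n) 0 (R *\<^sub>R ax)) (f R) < e"
   proof eventually_elim
    case (elim n)
    have "\<bar>S (\<eta> n) 0 (R *\<^sub>R ax) - f R\<bar> <= e / 2"
     by (rule \<delta>(2)[of "\<epsilon> n"]) (use G[of n] elim in \<open>auto simp: good_def\<close>)
    then show ?case using \<open>e > 0\<close> by (simp add: dist_real_def)
   qed
  qed
  then show ?thesis unfolding c_def c0_def by (intro tendsto_intros)
 qed
 have NN: "\<bar>sqrt (N n) - sqrt N0\<bar> <= d n + \<bar>c (\<eta> n) - c0\<bar> * sqrt (LI x. (norm (X x))^2)" for n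
 proof -
  have m: "\<G> (\<eta> n) 0 \<in> lmeas" by (rule mollified_vector(1)[OF te])
  have D: "linteg (%x. (norm (\<G> (\<eta> n) 0 x - g 0 x))^2) \<and> linteg (%x. (norm (\<G> (\<eta> n) 0 x))^2)
    \<and> sqrt (LI x. (norm (\<G> (\<eta> n) 0 x - g 0 x))^2) <= d n"
   by (rule diff[OF order_refl m gm gi mollified_vector(4)[OF te]])
  have Xc: "(%x. a *\<^sub>R X x) \<in> lmeas" "linteg (%x. (norm (a *\<^sub>R X x))^2)"
   "(LI x. (norm (a *\<^sub>R X x))^2) = a^2 * (LI x. (norm (X x))^2)" for a
   using X by (simp_all add: power_mult_distrib borel_measurable_scaleR)
  have mm: "(%x. \<G> (\<eta> n) 0 x + c (\<eta> n) *\<^sub>R X x) \<in> lmeas" "(%x. g 0 x + c0 *\<^sub>R X x) \<in> lmeas"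
   by (intro borel_measurable_add m gm Xc(1))+
  have ii: "linteg (%x. (norm (\<G> (\<eta> n) 0 x + c (\<eta> n) *\<^sub>R X x))^2)" "linteg (%x. (norm (g 0 x + c0 *\<^sub>R X x))^2)"
   using square_integrable_add[OF m Xc(1) _ Xc(2)] square_integrable_add[OF gm Xc(1) gi Xc(2)] D by blast+
  have dm: "(%x. \<G> (\<eta> n) 0 x - g 0 x) \<in> lmeas" by (intro borel_measurable_diff m gm)
  have "\<bar>sqrt (N n) - sqrt N0\<bar> <= sqrt (LI x. (norm ((\<G> (\<eta> n) 0 x + c (\<eta> n) *\<^sub>R X x) - (g 0 x + c0 *\<^sub>R X x)))^2)"
   unfolding N_def N0_def by (rule L2_restricted_distance[OF mm ext ii])
  also have "(%x. (\<G> (\<eta> n) 0 x + c (\<eta> n) *\<^sub>R X x) - (g 0 x + c0 *\<^sub>R X x)) = (%x. (\<G> (\<eta> n) 0 x - g 0 x) + (c (\<eta> n) - c0) *\<^sub>R X x)"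
   by (auto simp: algebra_simps)
  then have "sqrt (LI x. (norm ((\<G> (\<eta> n) 0 x + c (\<eta> n) *\<^sub>R X x) - (g 0 x + c0 *\<^sub>R X x)))^2) =
    sqrt (LI x. (norm ((\<G> (\<eta> n) 0 x - g 0 x) + (c (\<eta> n) - c0) *\<^sub>R X x))^2)" by metis
  also have "... <= sqrt (LI x. (norm (\<G> (\<eta> n) 0 x - g 0 x))^2) + sqrt (LI x. (norm ((c (\<eta> n) - c0) *\<^sub>R X x))^2)"
   by (rule L2_triangle[OF dm Xc(1) conjunct1[OF D] Xc(2)])
  also have "... <= d n + \<bar>c (\<eta> n) - c0\<bar> * sqrt (LI x. (norm (X x))^2)"
   unfolding Xc(3) using D by (simp add: real_sqrt_mult)
  finally show ?thesis .
 qed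
 have sN: "(%n. sqrt (N n)) \<longlonglongrightarrow> sqrt N0"
 proof (rule LIM_zero_cancel, rule Lim_null_comparison)
  show "\<forall>\<^sub>F n in sequentially. norm (sqrt (N n) - sqrt N0) <= d n + \<bar>c (\<eta> n) - c0\<bar> * sqrt (LI x. (norm (X x))^2)"
   using NN by simp
  have "(%n. d n + \<bar>c (\<eta> n) - c0\<bar> * sqrt (LI x. (norm (X x))^2)) \<longlonglongrightarrow> 0 + \<bar>c0 - c0\<bar> * sqrt (LI x. (norm (X x))^2)"
   by (intro tendsto_intros d0 cl)
  then show "(%n. d n + \<bar>c (\<eta> n) - c0\<bar> * sqrt (LI x. (norm (X x))^2)) \<longlonglongrightarrow> 0" by simp
 qed
 have "\<exists>L. ((%t. sqrt (LI x. indicator {x. norm x > R + t} x * (norm (v t x))^2)) ---> L) at_top \<and>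
   ((%t. sqrt (LI x. indicator {x. norm x > R + t} x * (norm (g t x))^2)) ---> L) at_top \<and> L >= sqrt (3/20) * sqrt N0"
 proof (rule uniform_approximation_limit[where d = d and l = "%n. sqrt (E n)" and k = "%n. sqrt (3/20) * sqrt (N n)"
   and F = "%n t. sqrt (LI x. indicator {x. norm x > R + t} x * (norm (V (\<eta> n) t x))^2)"
   and G = "%n t. sqrt (LI x. indicator {x. norm x > R + t} x * (norm (\<G> (\<eta> n) t x))^2)"])
  show "d \<longlonglongrightarrow> 0" by (rule d0)
  show "(%n. sqrt (3/20) * sqrt (N n)) \<longlonglongrightarrow> sqrt (3/20) * sqrt N0" by (intro tendsto_intros sN)
  fix n
  show "((%t. sqrt (LI x. indicator {x. norm x > R + t} x * (norm (V (\<eta> n) t x))^2)) ---> sqrt (E n)) at_top"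
   "((%t. sqrt (LI x. indicator {x. norm x > R + t} x * (norm (\<G> (\<eta> n) t x))^2)) ---> sqrt (E n)) at_top"
   using G[of n] unfolding good_def by (intro tendsto_real_sqrt; blast)+
  show "sqrt (3/20) * sqrt (N n) <= sqrt (E n)"
   unfolding real_sqrt_mult[symmetric] N_def using G[of n] unfolding good_def Xe by (intro real_sqrt_le_iff[THEN iffD2]) blast
  fix t :: real assume t: "t >= 0"
  note mV = mollified_vector(2)[OF te[of n], of t] and mG = mollified_vector(1)[OF te[of n], of t]
  have lev: "(norm (V (\<eta> n) t x - v t x))^2 <= err (\<eta> n) t x" for x using mollified_vector(3)[OF te] by simp
  note D = diff[OF t mV vm[of t] vi[of t] lev] and D' = diff[OF t mG gm[of t] gi[of t] mollified_vector(4)[OF te[of n]]]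
  show "\<bar>sqrt (LI x. indicator {x. norm x > R + t} x * (norm (v t x))^2) - sqrt (LI x. indicator {x. norm x > R + t} x * (norm (V (\<eta> n) t x))^2)\<bar> <= d n"
   using L2_restricted_distance[OF mV vm[of t] ext[of "R + t"] conjunct1[OF conjunct2[OF D]] vi[of t]] conjunct2[OF conjunct2[OF D]] by linarith
  show "\<bar>sqrt (LI x. indicator {x. norm x > R + t} x * (norm (g t x))^2) - sqrt (LI x. indicator {x. norm x > R + t} x * (norm (\<G> (\<eta> n) t x))^2)\<bar> <= d n"
   using L2_restricted_distance[OF mG gm[of t] ext[of "R + t"] conjunct1[OF conjunct2[OF D']] gi[of t]] conjunct2[OF conjunct2[OF D']] by linarith
 qed
 then show ?thesis unfolding N0_def c0_def[symmetric] Xe .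
qed

end

lemma L2_norm_square_AE:
 fixes f :: "real^4 => 'b::euclidean_space"
 assumes ae: "AE x in lebesgue. x \<in> \<Omega> --> f x = F x" and m: "F \<in> lmeas" and \<Omega>: "\<Omega> \<in> sets lebesgue"
 shows "L2_norm \<Omega> f = sqrt (LI x. indicator \<Omega> x * (norm (F x))^2)"
proof -
 have "(LI x. indicator \<Omega> x *\<^sub>R (norm (f x))\<^sup>2) = (LI x. indicator \<Omega> x * (norm (F x))^2)"
 proof (rule integral_lebesgue_AE_cong)
  show "AE x in lebesgue. indicator \<Omega> x *\<^sub>R (norm (f x))\<^sup>2 = indicator \<Omega> x * (norm (F x))^2"
   using ae by eventually_elim (simp add: indicator_def)
  show "(%x. indicator \<Omega> x * (norm (F x))^2) \<in> lmeas"
   by (intro borel_measurable_times borel_measurable_indicator \<Omega> borel_measurable_power measurable_compose[OF m borel_measurable_norm])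
 qed
 then show ?thesis by (simp add: L2_norm_def set_lebesgue_integral_def)
qed

theorem proposition3p2:
  fixes R :: real
    and u\<^sub>0 :: "real \<Rightarrow> real"
    and u\<^sub>L dtu\<^sub>L :: "real \<Rightarrow> real^4 \<Rightarrow> real"
  assumes "R > 0"
    and "u\<^sub>0 \<in> Hdot1_ext R"
    and "exterior_wave_solution R u\<^sub>0 u\<^sub>L dtu\<^sub>L"
  shows "\<exists>E. ((\<lambda>t. (L2_norm {x. norm x > t + R} (weak_gradient {x. norm x > t + R} (u\<^sub>L t)))\<^sup>2)
              \<longlongrightarrow> E) at_top
           \<and> ((\<lambda>t. (L2_norm {x. norm x > t + R} (dtu\<^sub>L t))\<^sup>2) \<longlongrightarrow> E) at_top
           \<and> E \<ge> 3 / 20 *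
               (L2_norm {x. norm x > R}
                  (weak_gradient {x :: real^4. norm x > R} (\<lambda>x. proj_perp R u\<^sub>0 (norm x))))\<^sup>2"
proof -
 note R = assms(1)
 obtain w U V where re: "radial_extension R u\<^sub>0 w" and sol: "free_wave_solution w (%_. 0) U V"
  and uL: "!!t. t >= 0 ==> AE x in lebesgue. norm x > R + \<bar>t\<bar> --> u\<^sub>L t x = U t x \<and> dtu\<^sub>L t x = V t x"
  using assms(3) by (auto simp: exterior_wave_solution_def)
 obtain g where g: "weak_wave U V g" using weak_wave_of_solution[OF sol] by blast
 obtain h where h: "AE x in lebesgue. w x = h (norm x)" using re by (auto simp: radial_extension_def radial_def)
 have U0: "AE x in lebesgue. U 0 x = w x" and V0: "AE x in lebesgue. V 0 x = 0" using sol by (auto simp: free_wave_solution_def)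
 have U0h: "AE x in lebesgue. U 0 x = h (norm x)" using U0 h by eventually_elim simp
 have U4: "linteg (%x. (U t x) ^ 4)" for t using sol by (auto simp: free_wave_solution_def Hdot1_def)
 interpret weak_wave U V g by (rule g)
 interpret radial_weak_wave U V g h by unfold_locales (fact U4 U0h V0)+
 have cu: "continuous_on {R..} u\<^sub>0" using assms(2) by (simp add: Hdot1_ext_def)
 have "AE x in lebesgue. norm x > R --> w x = u\<^sub>0 (norm x)" using re by (simp add: radial_extension_def)
 then have wu: "AE x in lebesgue. norm x > R --> U 0 x = u\<^sub>0 (norm x)" using U0 by eventually_elim simp
 have gm: "g t \<in> lmeas" for t using g2[of t] by (simp add: square_integrable_def)
 have sets: "{x::real^4. norm x > \<rho>} \<in> sets lebesgue" for \<rho>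
 proof -
  have "{x::real^4. norm x > \<rho>} \<in> sets lborel" using exterior_open[of \<rho>] by simp
  then show ?thesis by (rule sets_completionI_sets)
 qed
 have e1: "L2_norm {x. norm x > t + R} (dtu\<^sub>L t) = sqrt (LI x. indicator {x. norm x > R + t} x * (norm (V t x))^2)" if t: "t >= 0" for t
  unfolding add.commute[of t R]
  by (rule L2_norm_square_AE[OF _ v_sq(1) sets]) (use uL[OF t] t in \<open>auto elim!: eventually_mono\<close>)
 have e2: "L2_norm {x. norm x > t + R} (weak_gradient {x. norm x > t + R} (u\<^sub>L t)) = sqrt (LI x. indicator {x. norm x > R + t} x * (norm (g t x))^2)" if t: "t >= 0" for t
  unfolding add.commute[of t R]
 proof (rule L2_norm_square_AE[OF _ gm sets], rule weak_gradient_AE(1)[OF exterior_open])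
  show "has_weak_gradient {x. norm x > R + t} (u\<^sub>L t) (g t)"
   by (rule weak_gradient_cong_AE[OF _ weak_gradient_restrict[OF grad]]) (use uL[OF t] t in \<open>auto elim!: eventually_mono\<close>)
 qed
 define c where "c = R^2 * u\<^sub>0 R"
 have e3: "L2_norm {x. norm x > R} (weak_gradient {x :: real^4. norm x > R} (%x. proj_perp R u\<^sub>0 (norm x))) =
   sqrt (LI x. indicator {x. norm x > R} x * (norm (g 0 x + (2 * R^2 * u\<^sub>0 R / (norm x) ^ 4) *\<^sub>R x))^2)"
 proof (rule L2_norm_square_AE[OF _ _ sets], rule weak_gradient_AE(1)[OF exterior_open])
  have "has_weak_gradient {x. norm x > R} (%x. U 0 x + (- c) * (1 / (norm x)^2)) (%x. g 0 x + (- c) *\<^sub>R ((- 2 / (norm x) ^ 4) *\<^sub>R x))"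
   by (rule weak_gradient_add_scaled[OF weak_gradient_restrict[OF grad] inverse_square_weak_gradient[OF R]])
  moreover have "(%x. g 0 x + (- c) *\<^sub>R ((- 2 / (norm x) ^ 4) *\<^sub>R x)) = (%x. g 0 x + (2 * R^2 * u\<^sub>0 R / (norm x) ^ 4) *\<^sub>R x)"
   by (rule ext) (simp add: c_def mult_ac)
  ultimately have hg: "has_weak_gradient {x. norm x > R} (%x. U 0 x + (- c) * (1 / (norm x)^2)) (%x. g 0 x + (2 * R^2 * u\<^sub>0 R / (norm x) ^ 4) *\<^sub>R x)"
   by simp
  show "has_weak_gradient {x. norm x > R} (%x. proj_perp R u\<^sub>0 (norm x)) (%x. g 0 x + (2 * R^2 * u\<^sub>0 R / (norm x) ^ 4) *\<^sub>R x)"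
   by (rule weak_gradient_cong_AE[OF _ hg]) (use wu in \<open>auto elim!: eventually_mono simp: proj_perp_def c_def\<close>)
  have "(%x::real^4. (2 * R^2 * u\<^sub>0 R / (norm x) ^ 4) *\<^sub>R x) \<in> borel_measurable lborel" by measurable
  then show "(%x. g 0 x + (2 * R^2 * u\<^sub>0 R / (norm x) ^ 4) *\<^sub>R x) \<in> lmeas"
   by (intro borel_measurable_add gm measurable_completion)
 qed
 obtain L where L: "((%t. sqrt (LI x. indicator {x. norm x > R + t} x * (norm (V t x))^2)) ---> L) at_top"
   "((%t. sqrt (LI x. indicator {x. norm x > R + t} x * (norm (g t x))^2)) ---> L) at_top"
   "L >= sqrt (3/20) * sqrt (LI x. indicator {x. norm x > R} x * (norm (g 0 x + (2 * R^2 * u\<^sub>0 R / (norm x) ^ 4) *\<^sub>R x))^2)"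
  using exterior_energy_limits[OF wu cu R] by (elim exE conjE)
 have 1: "((%t. (L2_norm {x. norm x > t + R} (dtu\<^sub>L t))^2) ---> L\<^sup>2) at_top"
  by (rule Lim_transform_eventually[OF tendsto_power[OF L(1)]]) (auto intro!: eventually_at_top_linorderI[of 0] simp: e1)
 have 2: "((%t. (L2_norm {x. norm x > t + R} (weak_gradient {x. norm x > t + R} (u\<^sub>L t)))^2) ---> L\<^sup>2) at_top"
  by (rule Lim_transform_eventually[OF tendsto_power[OF L(2)]]) (auto intro!: eventually_at_top_linorderI[of 0] simp: e2)
 define K where "K = L2_norm {x. norm x > R} (weak_gradient {x :: real^4. norm x > R} (%x. proj_perp R u\<^sub>0 (norm x)))"
 have K0: "K >= 0" unfolding K_def e3 by (intro real_sqrt_ge_zero Bochner_Integration.integral_nonneg) simp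
 have "(sqrt (3/20) * K)^2 <= L^2" using L(3) K0 unfolding K_def e3 by (intro power_mono) auto
 then have "3 / 20 * K^2 <= L^2" by (simp add: power_mult_distrib)
 then show ?thesis using 1 2 unfolding K_def by blast
qed

end
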